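(* Let $K$ be (a) a non-archimedean local field of residue characteristic not $2$, or (b) a global field of characteristic not $2$. Assume that $K$ contains $\sqrt{-1}$. Then there exist a $6$-dimensional $K$-torus $T$ and a cohomology class $\xi\in H^1(K,T)$ such that $\mathrm{per}(\xi)=2$, but $4\mid\mathrm{ind}(\xi)$.
   Context: A global field is a number field or a global function field. $H^1(K,T)=H^1(\mathrm{Gal}(K^s/K),T(K^s))$ is the Galois cohomology group of the torus $T$, written multiplicatively. For $\xi\in H^1(K,T)$ with $T$ a torus, the period $\mathrm{per}(\xi)$ is the greatest common divisor of the positive integers $n$ with $\xi^n=1$, i.e. the order of $\xi$ in the abelian group $H^1(K,T)$ (the power operation $\xi^{\Diamond n}$ used in the paper to define the period for general reductive groups coincides with $\xi^n$ for tori). A field extension $L/K$ splits $\xi$ if the restriction of $\xi$ to $H^1(L,T)$ equals $1$; the index $\mathrm{ind}(\xi)$ is the greatest common divisor of the degrees $[L:K]$ over all finite field extensions $L/K$ splitting $\xi$. *)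

theory Defs
  imports
    "HOL-Algebra.Algebraic_Closure_Type"
    "HOL-Algebra.Bij"
    "HOL-Algebra.Coset"
    "HOL-Algebra.QuotRing"
    "HOL-Algebra.Generated_Fields"
    "Jordan_Normal_Form.Matrix"
    "Jordan_Normal_Form.Determinant"
begin

text \<open>
  All fields are subfields of one ambient field, the type \<open>'a\<close>, which in the theorem is an
  algebraic closure of the base field \<open>K\<close>. In particular the finite extensions of \<open>K\<close> are the
  finite subextensions of \<open>'a\<close> over \<open>K\<close>; every finite extension is isomorphic to one of these.
\<close>

abbreviation FF :: "'a::field ring" where
  "FF \<equiv> ring_of_type_algebra"

definition finite_ext :: "'a::field set \<Rightarrow> 'a set \<Rightarrow> bool" where
  "finite_ext K L \<longleftrightarrow>
     subfield K FF \<and> subfield L FF \<and> K \<subseteq> L \<and> ring.finite_dimension FF K L"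


section \<open>Local and global fields\<close>

text \<open>A valuation is a function on the nonzero elements only; its value at \<open>0\<close> is irrelevant
  and should be read as infinity.\<close>

definition discrete_valuation :: "'a::field set \<Rightarrow> ('a \<Rightarrow> int) \<Rightarrow> bool" where
  "discrete_valuation K v \<longleftrightarrow>
     v ` (K - {0}) = UNIV \<and>
     (\<forall>x\<in>K - {0}. \<forall>y\<in>K - {0}. v (x * y) = v x + v y) \<and>
     (\<forall>x\<in>K - {0}. \<forall>y\<in>K - {0}. x + y \<noteq> 0 \<longrightarrow> min (v x) (v y) \<le> v (x + y))"

definition val_ring :: "'a::field set \<Rightarrow> ('a \<Rightarrow> int) \<Rightarrow> 'a ring" where
  "val_ring K v = FF\<lparr>carrier := {x\<in>K. x = 0 \<or> 0 \<le> v x}\<rparr>"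

definition val_ideal :: "'a::field set \<Rightarrow> ('a \<Rightarrow> int) \<Rightarrow> 'a set" where
  "val_ideal K v = {x\<in>K. x = 0 \<or> 0 < v x}"

definition residue_field :: "'a::field set \<Rightarrow> ('a \<Rightarrow> int) \<Rightarrow> 'a set ring" where
  "residue_field K v = val_ring K v Quot val_ideal K v"

definition val_complete :: "'a::field set \<Rightarrow> ('a \<Rightarrow> int) \<Rightarrow> bool" where
  "val_complete K v \<longleftrightarrow>
     (\<forall>s :: nat \<Rightarrow> 'a.
        range s \<subseteq> K \<and>
        (\<forall>m. \<exists>n0. \<forall>i\<ge>n0. \<forall>j\<ge>n0. s i = s j \<or> m \<le> v (s i - s j)) \<longrightarrow>
        (\<exists>l\<in>K. \<forall>m. \<exists>n0. \<forall>i\<ge>n0. s i = l \<or> m \<le> v (s i - l)))"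

definition nonarch_local_field :: "'a::field set \<Rightarrow> ('a \<Rightarrow> int) \<Rightarrow> bool" where
  "nonarch_local_field K v \<longleftrightarrow>
     subfield K FF \<and> discrete_valuation K v \<and> val_complete K v \<and>
     finite (carrier (residue_field K v))"

definition ring_char :: "('b, 'c) ring_scheme \<Rightarrow> nat" where
  "ring_char R = (THE p. \<forall>n::nat. [n] \<cdot>\<^bsub>R\<^esub> \<one>\<^bsub>R\<^esub> = \<zero>\<^bsub>R\<^esub> \<longleftrightarrow> p dvd n)"

definition number_field :: "'a::field set \<Rightarrow> bool" where
  "number_field K \<longleftrightarrow> CHAR('a) = 0 \<and> finite_ext (generate_field FF {}) K"

text \<open>\<open>generate_field FF {}\<close> is the prime field, so \<open>generate_field FF {t}\<close> is the field of
  rational functions in \<open>t\<close> over the prime field.\<close>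

definition global_function_field :: "'a::field set \<Rightarrow> bool" where
  "global_function_field K \<longleftrightarrow>
     CHAR('a) > 0 \<and>
     (\<exists>t. ring.transcendental FF (generate_field FF {}) t \<and>
          finite_ext (generate_field FF {t}) K)"

definition global_field :: "'a::field set \<Rightarrow> bool" where
  "global_field K \<longleftrightarrow> number_field K \<or> global_function_field K"


section \<open>Separable closure and absolute Galois group\<close>

definition sep_closure :: "'a::field set \<Rightarrow> 'a set" where
  "sep_closure K = {x. \<exists>p. (\<forall>i. Polynomial.coeff p i \<in> K) \<and> rsquarefree p \<and> poly p x = 0}"

text \<open>As everywhere in \<open>HOL-Algebra.Bij\<close>, automorphisms are extensional, that is, equal to
  \<open>undefined\<close> outside the separable closure; composition is \<open>compose (sep_closure K)\<close>.\<close>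

definition abs_Gal :: "'a::field set \<Rightarrow> ('a \<Rightarrow> 'a) set" where
  "abs_Gal K =
     {\<sigma> \<in> Bij (sep_closure K).
        (\<forall>x\<in>sep_closure K. \<forall>y\<in>sep_closure K.
           \<sigma> (x + y) = \<sigma> x + \<sigma> y \<and> \<sigma> (x * y) = \<sigma> x * \<sigma> y) \<and>
        (\<forall>x\<in>K. \<sigma> x = x)}"


section \<open>Linear algebraic groups and tori\<close>

text \<open>
  Algebraic groups over \<open>K\<close> are taken in the classical sense: Zariski closed subgroups of the
  general linear group over the algebraically closed field \<open>'a\<close> that are defined over \<open>K\<close>.
\<close>

definition GL :: "nat \<Rightarrow> 'a::field mat monoid" where
  "GL N = units_of (ring_mat TYPE('a) N ())"

text \<open>Polynomials in the matrix entries with coefficients in \<open>K\<close>. They may be identified with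
  polynomial functions since \<open>'a\<close> is infinite.\<close>

inductive_set entry_polys :: "'a::field set \<Rightarrow> nat \<Rightarrow> ('a mat \<Rightarrow> 'a) set"
  for K :: "'a set" and N :: nat where
  const: "c \<in> K \<Longrightarrow> (\<lambda>_. c) \<in> entry_polys K N"
| entry: "i < N \<Longrightarrow> j < N \<Longrightarrow> (\<lambda>A. A $$ (i, j)) \<in> entry_polys K N"
| add: "f \<in> entry_polys K N \<Longrightarrow> g \<in> entry_polys K N \<Longrightarrow> (\<lambda>A. f A + g A) \<in> entry_polys K N"
| mult: "f \<in> entry_polys K N \<Longrightarrow> g \<in> entry_polys K N \<Longrightarrow> (\<lambda>A. f A * g A) \<in> entry_polys K N"

definition vanishing :: "'a::field set \<Rightarrow> nat \<Rightarrow> 'a mat set \<Rightarrow> ('a mat \<Rightarrow> 'a) set" where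
  "vanishing K N T = {f \<in> entry_polys K N. \<forall>A\<in>T. f A = 0}"

definition zariski_closed :: "nat \<Rightarrow> 'a::field mat set \<Rightarrow> bool" where
  "zariski_closed N T \<longleftrightarrow> T = {A \<in> carrier (GL N). \<forall>f\<in>vanishing UNIV N T. f A = 0}"

text \<open>The vanishing ideal over \<open>'a\<close> is generated by polynomials with coefficients in \<open>K\<close>.
  Over an imperfect field this is stronger than being the zero set of such polynomials.\<close>

definition defined_over :: "'a::field set \<Rightarrow> nat \<Rightarrow> 'a mat set \<Rightarrow> bool" where
  "defined_over K N T \<longleftrightarrow>
     (\<forall>f\<in>vanishing UNIV N T.
        \<exists>n g h. (\<forall>i<n. g i \<in> entry_polys UNIV N \<and> h i \<in> vanishing K N T) \<and>
                f = (\<lambda>A. \<Sum>i<n::nat. g i A * h i A))"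

definition linear_algebraic_group :: "'a::field set \<Rightarrow> nat \<Rightarrow> 'a mat set \<Rightarrow> bool" where
  "linear_algebraic_group K N T \<longleftrightarrow>
     subgroup T (GL N) \<and> zariski_closed N T \<and> defined_over K N T"

definition regular_on :: "nat \<Rightarrow> 'a::field mat set \<Rightarrow> ('a mat \<Rightarrow> 'a) \<Rightarrow> bool" where
  "regular_on N T f \<longleftrightarrow> (\<exists>p\<in>entry_polys UNIV N. \<exists>k::nat. \<forall>A\<in>T. f A = p A / det A ^ k)"

definition alg_group_hom ::
  "nat \<Rightarrow> 'a::field mat set \<Rightarrow> nat \<Rightarrow> 'a mat set \<Rightarrow> ('a mat \<Rightarrow> 'a mat) \<Rightarrow> bool" where
  "alg_group_hom N T M S \<phi> \<longleftrightarrow>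
     \<phi> \<in> hom ((GL N)\<lparr>carrier := T\<rparr>) ((GL M)\<lparr>carrier := S\<rparr>) \<and>
     (\<forall>i<M. \<forall>j<M. regular_on N T (\<lambda>A. \<phi> A $$ (i, j)))"

definition alg_group_isomorphic ::
  "nat \<Rightarrow> 'a::field mat set \<Rightarrow> nat \<Rightarrow> 'a mat set \<Rightarrow> bool" where
  "alg_group_isomorphic N T M S \<longleftrightarrow>
     (\<exists>\<phi> \<psi>. alg_group_hom N T M S \<phi> \<and> alg_group_hom M S N T \<psi> \<and>
            (\<forall>A\<in>T. \<psi> (\<phi> A) = A) \<and> (\<forall>B\<in>S. \<phi> (\<psi> B) = B))"

text \<open>The group of invertible diagonal matrices is the \<open>d\<close>-th power of the multiplicative group.\<close>

definition diag_group :: "nat \<Rightarrow> 'a::field mat set" where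
  "diag_group d = {A \<in> carrier (GL d). diagonal_mat A}"

definition torus :: "'a::field set \<Rightarrow> nat \<Rightarrow> nat \<Rightarrow> 'a mat set \<Rightarrow> bool" where
  "torus K d N T \<longleftrightarrow> linear_algebraic_group K N T \<and> alg_group_isomorphic N T d (diag_group d)"

definition points :: "'a mat set \<Rightarrow> 'a set \<Rightarrow> 'a mat set" where
  "points T L = {A \<in> T. \<forall>i<dim_row A. \<forall>j<dim_col A. A $$ (i, j) \<in> L}"


section \<open>Galois cohomology of a torus\<close>

text \<open>In this section \<open>T\<close> is a torus in \<open>GL N\<close> defined over \<open>K\<close>. It will also be considered over
  the extensions \<open>L\<close> of \<open>K\<close>.\<close>

text \<open>Continuity for the Krull topology on the Galois group and the discrete topology on the
  coefficients.\<close>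

definition krull_continuous :: "'a::field set \<Rightarrow> (('a \<Rightarrow> 'a) \<Rightarrow> 'b) \<Rightarrow> bool" where
  "krull_continuous K c \<longleftrightarrow>
     (\<forall>\<sigma>\<in>abs_Gal K. \<exists>M. finite_ext K M \<and> M \<subseteq> sep_closure K \<and>
        (\<forall>\<tau>\<in>abs_Gal K. (\<forall>x\<in>M. \<tau> x = \<sigma> x) \<longrightarrow> c \<tau> = c \<sigma>))"

definition Z1 :: "'a::field set \<Rightarrow> nat \<Rightarrow> 'a mat set \<Rightarrow> (('a \<Rightarrow> 'a) \<Rightarrow> 'a mat) monoid" where
  "Z1 K N T =
     \<lparr>carrier = {c \<in> abs_Gal K \<rightarrow>\<^sub>E points T (sep_closure K).
         krull_continuous K c \<and>
         (\<forall>\<sigma>\<in>abs_Gal K. \<forall>\<tau>\<in>abs_Gal K.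
            c (compose (sep_closure K) \<sigma> \<tau>) = c \<sigma> * map_mat \<sigma> (c \<tau>))},
      monoid.mult = \<lambda>c d. \<lambda>\<sigma>\<in>abs_Gal K. c \<sigma> * d \<sigma>,
      monoid.one = \<lambda>\<sigma>\<in>abs_Gal K. 1\<^sub>m N\<rparr>"

definition B1 :: "'a::field set \<Rightarrow> nat \<Rightarrow> 'a mat set \<Rightarrow> (('a \<Rightarrow> 'a) \<Rightarrow> 'a mat) set" where
  "B1 K N T =
     {(\<lambda>\<sigma>\<in>abs_Gal K. inv\<^bsub>GL N\<^esub> a * map_mat \<sigma> a) | a. a \<in> points T (sep_closure K)}"

definition H1 :: "'a::field set \<Rightarrow> nat \<Rightarrow> 'a mat set \<Rightarrow> (('a \<Rightarrow> 'a) \<Rightarrow> 'a mat) set monoid" where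
  "H1 K N T = Z1 K N T Mod B1 K N T"

text \<open>On cocycles, restriction is composition with the map of absolute Galois groups that
  restricts automorphisms to \<open>sep_closure K\<close>. The union below is over the representatives of \<open>\<xi>\<close>,
  which all give the same coset.\<close>

definition res_cocycle ::
  "'a::field set \<Rightarrow> 'a set \<Rightarrow> (('a \<Rightarrow> 'a) \<Rightarrow> 'a mat) \<Rightarrow> (('a \<Rightarrow> 'a) \<Rightarrow> 'a mat)" where
  "res_cocycle K L c = (\<lambda>\<sigma>\<in>abs_Gal L. c (restrict \<sigma> (sep_closure K)))"

definition res_H1 ::
  "'a::field set \<Rightarrow> 'a set \<Rightarrow> nat \<Rightarrow> 'a mat set \<Rightarrow>
     (('a \<Rightarrow> 'a) \<Rightarrow> 'a mat) set \<Rightarrow> (('a \<Rightarrow> 'a) \<Rightarrow> 'a mat) set" where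
  "res_H1 K L N T \<xi> = (\<Union>c\<in>\<xi>. B1 L N T #>\<^bsub>Z1 L N T\<^esub> res_cocycle K L c)"

definition splits ::
  "'a::field set \<Rightarrow> 'a set \<Rightarrow> nat \<Rightarrow> 'a mat set \<Rightarrow> (('a \<Rightarrow> 'a) \<Rightarrow> 'a mat) set \<Rightarrow> bool" where
  "splits K L N T \<xi> \<longleftrightarrow> res_H1 K L N T \<xi> = \<one>\<^bsub>H1 L N T\<^esub>"

definition period ::
  "'a::field set \<Rightarrow> nat \<Rightarrow> 'a mat set \<Rightarrow> (('a \<Rightarrow> 'a) \<Rightarrow> 'a mat) set \<Rightarrow> nat" where
  "period K N T \<xi> = Gcd {n. 0 < n \<and> \<xi> [^]\<^bsub>H1 K N T\<^esub> n = \<one>\<^bsub>H1 K N T\<^esub>}"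

definition cohom_index ::
  "'a::field set \<Rightarrow> nat \<Rightarrow> 'a mat set \<Rightarrow> (('a \<Rightarrow> 'a) \<Rightarrow> 'a mat) set \<Rightarrow> nat" where
  "cohom_index K N T \<xi> = Gcd {ring.dim FF K L | L. finite_ext K L \<and> splits K L N T \<xi>}"

end

theory Submission
  imports Defs
begin

text \<open>
  Let `v` be a discrete valuation of `K` with finite residue field of odd characteristic. It is given
  for a local field; for a global field it extends the 3-adic valuation of the rational numbers, or
  the `t`-adic one of the rational functions over the prime field (`local_field_valuation`,
  `number_field_valuation`, `function_field_valuation`). Let `a` be an integer of `K` that is not a
  square modulo `v`, let `\<pi>` be a uniformizer, and let `\<alpha>`, `\<beta>` be square roots of `a`, `\<pi>`.

  The torus is a product of three tori of dimension 2, one for each of the pairs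
  `(r, s) = (\<alpha>, \<beta>), (\<beta>, \<alpha>), (\<alpha> \<beta>, \<alpha>)`: the elements of norm 1 of the biquadratic algebra
  `K(r, s)` over `K(r)`, which act on that algebra by multiplication (locale `biquad`,
  theorem `TT_torus`). The class `\<xi>` is that of the torsor of the elements of norm `r`. Since `r` lies
  in `K(r)`, its norm is `r^2`, so that `\<xi>` has order dividing 2 (`zz_square`). If a finite extension `L`
  splits `\<xi>`, then the torsor has a point over `L`, which means that for each of the three pairs
  `r = P^2 - s^2 Q^2` with `P, Q \<in> L + L r` (`split_norm_equation`).

  It remains to deduce from these three equations that 4 divides `n = [L : K]` (`splitting_degree`).
  As `n` is the sum of `e j` over the valuations `w` of `L` above `v`, with `e` the ramification index
  and `j` the residue degree, otherwise some `w` has `e j` not divisible by 4. If `a` is not a square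
  modulo `w`, then the values of the form `x^2 - a y^2` have even valuation; this contradicts the
  first equation if `e` is odd, and if `e` is twice an odd number it contradicts the second or the
  third one, because `\<beta>` or `\<alpha> \<beta>` is then close to an element of odd valuation. If `a` is
  congruent to a square `c^2`, then `j` is even, hence `e` is odd and 4 does not divide `j`; because
  `-1` is a square, `c` is not a square modulo `w`, whereas the first equation, in which `\<alpha>` is close
  to `c`, makes it one. In particular `K` does not split `\<xi>`, and the period is exactly 2.

  The identity `n = \<Sum> e j` is used in the following form. The elements of `L` that map some lattice into itself form a ring `ic` (the integral
  closure of the valuation ring). The index of `x A` in `A` does not depend on the lattice `A` stable
  under `x`, is multiplicative in `x`, and equals `q ^ n` for `x = \<pi>`, where `q` is the number of
  residue classes. Since `ic` is a principal ideal domain, `\<pi>` is a product of prime elements of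
  index `q ^ j`, each of which gives a valuation.
\<close>

section \<open>Subfields of an algebraically closed field and their automorphisms\<close>

definition subf :: "'a::field set \<Rightarrow> bool" where
  "subf F \<longleftrightarrow> 0 \<in> F & 1 \<in> F & (\<forall>x\<in>F. \<forall>y\<in>F. x + y \<in> F & x * y \<in> F) &
   (\<forall>x\<in>F. - x \<in> F & inverse x \<in> F)"

lemma FF_simps [simp]:
  "carrier FF = UNIV" "x \<otimes>\<^bsub>FF\<^esub> y = x * y" "\<one>\<^bsub>FF\<^esub> = 1" "\<zero>\<^bsub>FF\<^esub> = 0" "x \<oplus>\<^bsub>FF\<^esub> y = x + y"
  by (simp_all add: ring_of_type_algebra_def)

interpretation FF: ring "FF :: 'a::field ring"
  by (rule ring_from_type_algebra)

lemma FF_domain: "domain (FF :: 'a::field ring)"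
  using field_from_type_algebra field.axioms(1) by blast

lemma FF_a_inv [simp]: "\<ominus>\<^bsub>FF\<^esub> x = - (x :: 'a::field)"
  using abelian_group.minus_equality[OF ring.is_abelian_group[OF ring_from_type_algebra], of "- x" x] by simp

lemma FF_m_inv [simp]: "x ~= 0 ==> inv\<^bsub>FF\<^esub> x = inverse (x :: 'a::field)"
  using monoid.inv_char[OF ring.is_monoid[OF ring_from_type_algebra], of x "inverse x"] by simp

lemma subfield_FF_iff: "subfield F FF \<longleftrightarrow> subf (F :: 'a::field set)"
proof
  assume F: "subfield F FF"
  note r = subringE[OF subfieldE(1)[OF F]]
  have "inverse x \<in> F" if "x \<in> F" for x
  proof (cases "x = 0")
   case False
   with that FF.subfield_m_inv(1)[OF F, of x] show ?thesis by simp
  qed (use that in simp)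
  with r show "subf F" by (auto simp: subf_def)
next
  assume F: "subf F"
  show "subfield F FF"
  proof (rule field.subfieldI'[OF field_from_type_algebra])
   show "subring F FF" using F by (intro FF.subringI) (auto simp: subf_def)
  qed (use F in \<open>auto simp: subf_def\<close>)
qed

context
  fixes F :: "'a::field set"
  assumes F: "subf F"
begin

lemma subf_basic:
  "0 \<in> F" "1 \<in> F" "x \<in> F ==> y \<in> F ==> x + y \<in> F" "x \<in> F ==> y \<in> F ==> x * y \<in> F"
  "x \<in> F ==> - x \<in> F" "x \<in> F ==> inverse x \<in> F" "x \<in> F ==> y \<in> F ==> x - y \<in> F"
  "x \<in> F ==> y \<in> F ==> x / y \<in> F"
proof -
  show "0 \<in> F" "1 \<in> F" and a: "x \<in> F ==> y \<in> F ==> x + y \<in> F"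
   and m: "x \<in> F ==> y \<in> F ==> x * y \<in> F"
   and "x \<in> F ==> - x \<in> F" "x \<in> F ==> inverse x \<in> F" for x y
   using F by (auto simp: subf_def)
  show "x \<in> F ==> y \<in> F ==> x - y \<in> F"
   using a[of x "- y"] F by (simp add: subf_def)
  show "x \<in> F ==> y \<in> F ==> x / y \<in> F"
   using m[of x "inverse y"] F by (simp add: subf_def divide_inverse)
qed

lemma subf_power: "x \<in> F ==> x ^ n \<in> F"
  by (induction n) (auto intro: subf_basic)

lemma subf_of_nat: "of_nat n \<in> F"
  by (induction n) (auto intro: subf_basic)

lemma subf_numeral: "numeral n \<in> F"
  using subf_of_nat[of "numeral n"] by simp

lemma subf_sum: "(!!i. i \<in> A ==> f i \<in> F) ==> sum f A \<in> F"
  by (induction A rule: infinite_finite_induct) (auto intro: subf_basic)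

lemma subf_prod: "(!!i. i \<in> A ==> f i \<in> F) ==> prod f A \<in> F"
  by (induction A rule: infinite_finite_induct) (auto intro: subf_basic)

lemmas subf_closed = subf_basic subf_power subf_of_nat subf_numeral subf_sum subf_prod

end

definition polys :: "'a::field set \<Rightarrow> 'a poly set" where
  "polys F = {p. \<forall>i. Polynomial.coeff p i \<in> F}"

context
  fixes F :: "'a::field set"
  assumes F: "subf F"
begin

lemma polys_closed:
  "0 \<in> polys F" "1 \<in> polys F" "p \<in> polys F ==> q \<in> polys F ==> p + q \<in> polys F"
  "p \<in> polys F ==> q \<in> polys F ==> p - q \<in> polys F"
  "p \<in> polys F ==> - p \<in> polys F"
  "p \<in> polys F ==> q \<in> polys F ==> p * q \<in> polys F" "c \<in> F ==> p \<in> polys F ==> smult c p \<in> polys F"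
  "c \<in> F ==> p \<in> polys F ==> pCons c p \<in> polys F" "c \<in> F ==> Polynomial.monom c n \<in> polys F"
  using F by (auto simp: polys_def coeff_pCons coeff_mult Polynomial.coeff_monom intro!: subf_closed split: nat.split)
  
lemma polys_prod: "(!!i. i \<in> A ==> f i \<in> polys F) ==> prod f A \<in> polys F"
  by (induction A rule: infinite_finite_induct) (auto intro: polys_closed)

lemma poly_in_subf: "p \<in> polys F ==> x \<in> F ==> poly p x \<in> F"
  unfolding poly_altdef polys_def using F by (auto intro!: subf_closed)

end

lemma polys_mono: "F \<subseteq> F' ==> polys F \<subseteq> polys F'"
  by (auto simp: polys_def)

lemma polys_pCons_iff: "pCons c p \<in> polys F \<longleftrightarrow> c \<in> F & p \<in> polys F"
  by (auto simp: polys_def coeff_pCons split: nat.splits)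

definition alg_over :: "'a::field set \<Rightarrow> 'a \<Rightarrow> bool" where
  "alg_over F x \<longleftrightarrow> (\<exists>p\<in>polys F. p ~= 0 & poly p x = 0)"

lemma FF_pow [simp]: "x [^]\<^bsub>FF\<^esub> (n::nat) = (x::'a::field) ^ n"
  by (induction n) (simp_all add: mult.commute)

text \<open>
  Polynomials in the algebra library are lists of coefficients with the leading one first.
\<close>
lemma FF_eval: "ring.eval FF p x = poly (Poly (rev p)) (x::'a::field)"
  by (induction p) (auto simp: Poly_append poly_monom algebra_simps)

lemma algebraic_FF_iff:
  assumes "subf (F :: 'a::field set)"
  shows "(ring.algebraic FF over F) x \<longleftrightarrow> alg_over F x"
proof
  assume "(ring.algebraic FF over F) x"
  moreover have "subring F FF" using assms subfieldE(1) subfield_FF_iff by blast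
  ultimately obtain p where p: "p \<in> carrier (F [X]\<^bsub>FF\<^esub>)" "p ~= []" "ring.eval FF p x = \<zero>\<^bsub>FF\<^esub>"
   using domain.algebraicE[OF FF_domain, of F x] by auto
  then have h: "hd p ~= 0" "set p \<subseteq> F" by (auto simp: univ_poly_def polynomial_def)
  have "Poly (rev p) ~= 0"
  proof
   assume "Poly (rev p) = 0"
   then obtain n where "rev p = replicate n 0" by (auto simp: Poly_eq_0)
   then have "set p \<subseteq> {0}" using set_rev[of p] by auto
   with h(1) p(2) show False using hd_in_set by blast
  qed
  moreover have "Poly (rev p) \<in> polys F"
   using h(2) subf_closed(1)[OF assms] nth_mem[of _ "rev p"] by (auto simp: polys_def nth_default_def)
  ultimately show "alg_over F x" using p(3) unfolding alg_over_def by (auto simp: FF_eval)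
next
  assume "alg_over F x"
  then obtain p where p: "p \<in> polys F" "p ~= 0" "poly p x = 0" by (auto simp: alg_over_def)
  show "(ring.algebraic FF over F) x"
   unfolding over_def
  proof (rule FF.algebraicI[unfolded over_def])
   show "rev (Polynomial.coeffs p) \<in> carrier (F [X]\<^bsub>FF\<^esub>)"
    using p by (auto simp: univ_poly_def polynomial_def hd_rev last_coeffs_eq_coeff_degree polys_def coeffs_def)
  qed (use p in \<open>auto simp: FF_eval\<close>)
qed

definition rhom :: "'a::field set \<Rightarrow> ('a \<Rightarrow> 'b::field) \<Rightarrow> bool" where
  "rhom F f \<longleftrightarrow> f 0 = 0 & f 1 = 1 & (\<forall>x\<in>F. \<forall>y\<in>F. f (x + y) = f x + f y & f (x * y) = f x * f y)"

context
  fixes F :: "'a::field set" and f :: "'a \<Rightarrow> 'b::field"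
  assumes F: "subf F" and f: "rhom F f"
begin

lemma rhom_simps:
  "f 0 = 0" "f 1 = 1" "x \<in> F ==> y \<in> F ==> f (x + y) = f x + f y"
  "x \<in> F ==> y \<in> F ==> f (x * y) = f x * f y"
  using f by (auto simp: rhom_def)

lemma rhom_minus: "x \<in> F ==> f (- x) = - f x"
  using rhom_simps(1) rhom_simps(3)[of x "- x"] subf_closed(5)[OF F, of x]
  by (simp add: add_eq_0_iff)

lemma rhom_diff: "x \<in> F ==> y \<in> F ==> f (x - y) = f x - f y"
  using rhom_simps(3)[of x "- y"] rhom_minus[of y] subf_closed(5)[OF F, of y] by simp

lemma rhom_inverse: "x \<in> F ==> f (inverse x) = inverse (f x)"
proof (cases "x = 0")
  case False
  assume "x \<in> F"
  with False rhom_simps(4)[of x "inverse x"] subf_closed(6)[OF F, of x]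
  have "f x * f (inverse x) = 1" by (simp add: rhom_simps)
  then show ?thesis by (metis inverse_unique)
qed (simp add: rhom_simps)

lemma rhom_divide: "x \<in> F ==> y \<in> F ==> f (x / y) = f x / f y"
  unfolding divide_inverse using rhom_simps(4)[of x "inverse y"] rhom_inverse[of y] subf_closed(6)[OF F, of y] by simp

lemma rhom_eq_0_iff: "x \<in> F ==> f x = 0 \<longleftrightarrow> x = 0"
proof
  assume "x \<in> F" "f x = 0"
  then show "x = 0"
   using rhom_simps(2) rhom_simps(4)[of x "inverse x"] subf_closed(6)[OF F, of x]
   by (metis mult_zero_left right_inverse zero_neq_one)
qed (simp add: rhom_simps)

lemma rhom_inj: "x \<in> F ==> y \<in> F ==> f x = f y ==> x = y"
  using rhom_diff[of x y] rhom_eq_0_iff[of "x - y"] subf_closed(7)[OF F, of x y] by auto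

lemma rhom_sum: "(!!i. i \<in> A ==> g i \<in> F) ==> f (sum g A) = (\<Sum>i\<in>A. f (g i))"
proof (induction A rule: infinite_finite_induct)
  case (insert x A)
  then have "sum g A \<in> F" "g x \<in> F" using subf_sum[OF F, of A g] by auto
  with insert show ?case by (simp add: rhom_simps)
qed (simp_all add: rhom_simps)

lemma rhom_power: "x \<in> F ==> f (x ^ n) = f x ^ n"
  by (induction n) (auto simp: rhom_simps subf_power[OF F])

lemma map_poly_on:
  assumes "p \<in> polys F" "q \<in> polys F"
  shows "map_poly f (p + q) = map_poly f p + map_poly f q"
   and "map_poly f (p * q) = map_poly f p * map_poly f q"
proof -
  show "map_poly f (p + q) = map_poly f p + map_poly f q"
   using assms by (intro poly_eqI) (auto simp: coeff_map_poly rhom_simps polys_def)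
  show "map_poly f (p * q) = map_poly f p * map_poly f q"
  proof (intro poly_eqI)
   fix n
   have "f (\<Sum>i\<le>n. Polynomial.coeff p i * Polynomial.coeff q (n - i))
     = (\<Sum>i\<le>n. f (Polynomial.coeff p i * Polynomial.coeff q (n - i)))"
    using assms by (intro rhom_sum) (auto simp: polys_def intro: subf_closed[OF F])
   also have "... = (\<Sum>i\<le>n. f (Polynomial.coeff p i) * f (Polynomial.coeff q (n - i)))"
    using assms by (intro sum.cong) (auto simp: polys_def rhom_simps)
   finally show "Polynomial.coeff (map_poly f (p * q)) n = Polynomial.coeff (map_poly f p * map_poly f q) n"
    by (simp add: coeff_map_poly rhom_simps coeff_mult)
  qed
qed

lemma poly_map_poly_on: "p \<in> polys F ==> x \<in> F ==> poly (map_poly f p) (f x) = f (poly p x)"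
proof (induction p)
  case (pCons c p)
  then have c: "c \<in> F" and p: "p \<in> polys F"
   by (auto simp: polys_pCons_iff)
  then show ?case using pCons poly_in_subf[OF F p, of x]
   by (simp add: map_poly_pCons rhom_simps subf_closed[OF F])
qed (simp add: rhom_simps)

end

text \<open>
  Divide an annihilating polynomial by a power of the variable so that its constant term is
  nonzero, and solve for that term.
\<close>
lemma alg_over_inverse_poly:
  assumes F: "subf F" and x: "alg_over F x" "x ~= 0"
  shows "\<exists>h\<in>polys F. inverse x = poly h x"
proof -
  obtain p where p: "p \<in> polys F" "p ~= 0" "poly p x = 0" using x by (auto simp: alg_over_def)
  have "\<exists>h\<in>polys F. inverse x = poly h x"
   using p
  proof (induction p)
   case (pCons c p)
   show ?case
   proof (cases "c = 0")
    case True
    then show ?thesis using pCons x by (auto simp: polys_pCons_iff)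
   next
    case False
    have "inverse x = poly (smult (- inverse c) p) x"
     using pCons.prems(3) x(2) False by (simp add: field_simps add_eq_0_iff)
    moreover have "smult (- inverse c) p \<in> polys F"
     using pCons.prems by (auto simp: polys_pCons_iff intro!: polys_closed[OF F] subf_closed[OF F])
    ultimately show ?thesis by blast
   qed
  qed simp
  then show ?thesis .
qed

lemma alg_over_mono: "F \<subseteq> F' ==> alg_over F x ==> alg_over F' x"
  using polys_mono unfolding alg_over_def by blast

lemma subf_of_subring:
  assumes F: "subf F" and alg: "\<forall>x\<in>R. alg_over F x" and "F \<subseteq> R"
   and closed: "!!x y. x \<in> R ==> y \<in> R ==> x + y \<in> R & x * y \<in> R"
  shows "subf R"
proof -
  have pR: "poly h x \<in> R" if "h \<in> polys F" "x \<in> R" for h x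
   using that
  proof (induction h)
   case 0
   then show ?case using subf_closed(1)[OF F] assms(3) by auto
  next
   case (pCons c h)
   then show ?case using assms(3) by (auto simp: polys_pCons_iff intro!: closed[THEN conjunct1] closed[THEN conjunct2])
  qed
  have "inverse x \<in> R" if "x \<in> R" for x
   using alg_over_inverse_poly[OF F, of x] that alg pR[of _ x] subf_closed(1)[OF F] assms(3)
   by (cases "x = 0") auto
  moreover have "- x \<in> R" if "x \<in> R" for x
   using closed[of "- 1" x] subf_closed(2,5)[OF F] assms(3) that by auto
  ultimately show ?thesis unfolding subf_def using closed assms(3) subf_closed(1,2)[OF F] by auto
qed

lemma subf_UNIV: "subf UNIV" by (simp add: subf_def)

text \<open>
  The graph of a homomorphism over `K` from a subring. Graphs, unlike functions, have unions along
  chains, as needed for the lemma of Zorn.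
\<close>
definition partial_hom :: "'a::field set \<Rightarrow> ('a \<times> 'a) set \<Rightarrow> bool" where
  "partial_hom K G \<longleftrightarrow> (\<forall>c\<in>K. (c, c) \<in> G) &
   (\<forall>x x' y y'. (x, x') \<in> G --> (y, y') \<in> G --> (x + y, x' + y') \<in> G & (x * y, x' * y') \<in> G) &
   (\<forall>z. (0, z) \<in> G --> z = 0)"

text \<open>
  A homomorphism extends to the ring generated by a root `x` by sending `x` to `y`, as soon as all
  relations that `x` satisfies hold for `y`.
\<close>
lemma partial_hom_adjoin:
  assumes F: "subf F" and f: "rhom F f" and K: "K \<subseteq> F" "!!c. c \<in> K ==> f c = c"
   and root: "!!h. h \<in> polys F ==> poly h x = 0 ==> poly (map_poly f h) y = 0"
  shows "partial_hom K {(poly h x, poly (map_poly f h) y) | h. h \<in> polys F}"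
  unfolding partial_hom_def
proof (intro conjI allI ballI impI)
  let ?G = "{(poly h x, poly (map_poly f h) y) | h. h \<in> polys F}"
  note f0 = rhom_simps[OF F f]
  fix c assume "c \<in> K"
  then show "(c, c) \<in> ?G"
   using K f0 by (intro CollectI exI[of _ "[:c:]"]) (auto simp: map_poly_pCons polys_pCons_iff polys_closed[OF F])
next
  let ?G = "{(poly h x, poly (map_poly f h) y) | h. h \<in> polys F}"
  fix u u' v v' assume "(u, u') \<in> ?G" "(v, v') \<in> ?G"
  then obtain h k where "h \<in> polys F" "k \<in> polys F"
   "u = poly h x" "u' = poly (map_poly f h) y" "v = poly k x" "v' = poly (map_poly f k) y" by blast
  note hk = this
  from hk show "(u + v, u' + v') \<in> ?G"
   by (auto intro!: exI[of _ "h + k"] simp: map_poly_on[OF F f] polys_closed[OF F])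
  from hk show "(u * v, u' * v') \<in> ?G"
   by (auto intro!: exI[of _ "h * k"] simp: map_poly_on[OF F f] polys_closed[OF F])
next
  fix z assume "(0, z) \<in> {(poly h x, poly (map_poly f h) y) | h. h \<in> polys F}"
  with root show "z = 0" by auto
qed

lemma min_poly_exists:
  assumes F: "subf F" and x: "alg_over F x"
  obtains m where "m \<in> polys F" "Polynomial.lead_coeff m = 1" "poly m x = 0"
   "!!h. h \<in> polys F ==> poly h x = 0 ==> \<exists>k\<in>polys F. h = m * k"
   "!!h. h \<in> polys F ==> \<exists>k\<in>polys F. \<exists>r\<in>polys F. h = m * k + r & (r = 0 \<or> Polynomial.degree r < Polynomial.degree m)"
proof -
  define P where "P p \<longleftrightarrow> p \<in> polys F & p ~= 0 & poly p x = 0" for p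
  obtain p where p: "P p" and min: "!!q. P q ==> Polynomial.degree p \<le> Polynomial.degree q"
   using x ex_has_least_nat[of P _ Polynomial.degree] unfolding alg_over_def P_def by blast
  define m where "m = smult (inverse (Polynomial.lead_coeff p)) p"
  have lc: "Polynomial.lead_coeff p \<in> F" "Polynomial.lead_coeff p ~= 0"
   using p by (auto simp: P_def polys_def)
  have m: "m \<in> polys F" "Polynomial.lead_coeff m = 1" "poly m x = 0" "Polynomial.degree m = Polynomial.degree p"
   using p lc by (auto simp: m_def P_def intro!: polys_closed[OF F] subf_closed[OF F])
  have div: "\<exists>k\<in>polys F. \<exists>r\<in>polys F. h = m * k + r & (r = 0 \<or> Polynomial.degree r < Polynomial.degree m)"
   if "h \<in> polys F" for h
   using that
  proof (induction "Polynomial.degree h" arbitrary: h rule: less_induct)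
   case less
   show ?case
   proof (cases "h = 0 \<or> Polynomial.degree h < Polynomial.degree m")
    case True
    then show ?thesis using less.prems
     by (intro bexI[of _ 0] bexI[of _ h]) (auto simp: polys_closed[OF F])
   next
    case False
    define t where "t = Polynomial.monom (Polynomial.lead_coeff h) (Polynomial.degree h - Polynomial.degree m)"
    have t: "t \<in> polys F" using less.prems by (auto simp: t_def polys_def intro!: polys_closed[OF F, unfolded polys_def, simplified])
    have t0: "t ~= 0" "Polynomial.lead_coeff t = Polynomial.lead_coeff h"
     "Polynomial.degree t = Polynomial.degree h - Polynomial.degree m"
     using False by (auto simp: t_def Polynomial.degree_monom_eq)
    have m0: "m ~= 0" using m(2) by auto
    have tm: "t ~= 0" "Polynomial.degree (m * t) = Polynomial.degree h"
     "Polynomial.lead_coeff (m * t) = Polynomial.lead_coeff h"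
     using False t0 m0 m(2) degree_mult_eq[of m t] lead_coeff_mult[of m t] by auto
    have h': "h - m * t \<in> polys F" using less.prems m t by (auto intro!: polys_closed[OF F])
    show ?thesis
    proof (cases "h - m * t = 0")
     case True
     then show ?thesis using t by (intro bexI[of _ t] bexI[of _ 0]) (auto simp: polys_closed[OF F])
    next
     case nz: False
     have "Polynomial.degree h ~= 0 \<or> h - m * t = 0"
     proof (rule ccontr)
      assume "\<not> ?thesis"
      then have "Polynomial.degree h = 0" "Polynomial.degree m = 0" using False by auto
      then obtain c d where "h = [:c:]" "m = [:d:]" by (metis degree_eq_zeroE)
      then have "h - m * t = 0" using m(2) by (simp add: t_def Polynomial.monom_0 one_pCons)
      with \<open>\<not> ?thesis\<close> show False by simp
     qed
     with nz have "Polynomial.degree (h - m * t) < Polynomial.degree h"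
      using tm by (intro degree_lessI) (auto, metis coeff_diff degree_diff_le eq_iff_diff_eq_0 le_degree order_refl le_neq_implies_less leD)
     then obtain k r where "k \<in> polys F" "r \<in> polys F" "h - m * t = m * k + r"
      "r = 0 \<or> Polynomial.degree r < Polynomial.degree m" using less.hyps[OF _ h'] by blast
     then show ?thesis using t by (intro bexI[of _ "k + t"] bexI[of _ r])
      (auto simp: algebra_simps intro!: polys_closed[OF F])
    qed
   qed
  qed
  show ?thesis
  proof (rule that[OF m(1-3) _ div])
   fix h assume h: "h \<in> polys F" "poly h x = 0"
   then obtain k r where kr: "k \<in> polys F" "r \<in> polys F" "h = m * k + r"
      "r = 0 \<or> Polynomial.degree r < Polynomial.degree m" using div by blast
   then have "poly r x = 0" using h m by simp
   then have "r = 0" using kr min[of r] m by (cases "r = 0") (auto simp: P_def)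
   with kr show "\<exists>k\<in>polys F. h = m * k" by auto
  qed
qed

lemma alg_closed_root: "Polynomial.degree (p :: 'a::alg_closed_field poly) > 0 ==> \<exists>x. poly p x = 0"
  using alg_closed_imp_poly_has_root by blast

text \<open>
  A maximal homomorphism that sends `x` to `y` is defined everywhere: otherwise the minimal
  polynomial of a missing element would give an extension, its image having a root in the
  algebraically closed field.
\<close>
theorem embedding_extends:
  fixes F :: "'a::alg_closed_field set"
  assumes F: "subf F" and alg: "!!x. alg_over F x"
   and root: "!!h. h \<in> polys F ==> poly h x = 0 ==> poly h y = 0"
  obtains \<sigma> where "rhom UNIV \<sigma>" "!!c. c \<in> F ==> \<sigma> c = c" "\<sigma> x = y"
proof -
  define G0 where "G0 = {(poly h x, poly (map_poly (\<lambda>c. c) h) y) | h. h \<in> polys F}"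
  have G0: "partial_hom F G0" unfolding G0_def
   by (rule partial_hom_adjoin[OF F]) (use root in \<open>auto simp: rhom_def\<close>)
  define S where "S = {G. partial_hom F G & G0 \<subseteq> G}"
  have "\<exists>G\<in>S. \<forall>G'\<in>S. G \<subseteq> G' --> G' = G"
  proof (rule subset_Zorn_nonempty)
   show "S ~= {}" using G0 by (auto simp: S_def)
   fix C assume C: "C ~= {}" "subset.chain S C"
   then have sub: "!!G. G \<in> C ==> partial_hom F G & G0 \<subseteq> G" and ch: "!!A B. A \<in> C ==> B \<in> C ==> A \<subseteq> B \<or> B \<subseteq> A"
    unfolding subset_chain_def S_def by auto
   have "partial_hom F (\<Union>C)"
    unfolding partial_hom_def
   proof (intro conjI allI ballI impI)
    fix c assume "c \<in> F" then show "(c, c) \<in> \<Union>C" using C(1) sub unfolding partial_hom_def by blast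
   next
    fix u u' v v' assume "(u, u') \<in> \<Union>C" "(v, v') \<in> \<Union>C"
    then obtain G where "G \<in> C" "(u, u') \<in> G" "(v, v') \<in> G" using ch by blast
    then show "(u + v, u' + v') \<in> \<Union>C" "(u * v, u' * v') \<in> \<Union>C"
     using sub[of G] unfolding partial_hom_def by blast+
   next
    fix z assume "(0, z) \<in> \<Union>C" then show "z = 0" using sub unfolding partial_hom_def by blast
   qed
   then show "\<Union>C \<in> S" using C(1) sub by (auto simp: S_def)
  qed
  then obtain G where G: "partial_hom F G" "G0 \<subseteq> G" and max: "!!G'. partial_hom F G' ==> G0 \<subseteq> G' ==> G \<subseteq> G' ==> G' = G"
   unfolding S_def by auto
  have GF: "!!c. c \<in> F ==> (c, c) \<in> G" and Gadd: "!!x x' y y'. (x, x') \<in> G ==> (y, y') \<in> G ==> (x + y, x' + y') \<in> G"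
   and Gmul: "!!x x' y y'. (x, x') \<in> G ==> (y, y') \<in> G ==> (x * y, x' * y') \<in> G"
   and G0z: "!!z. (0, z) \<in> G ==> z = 0"
   using G(1) unfolding partial_hom_def by blast+
  have uniq: "z = w" if "(u, z) \<in> G" "(u, w) \<in> G" for u z w
  proof -
   have "(- u, - w) \<in> G" using Gmul[OF GF[of "- 1"] that(2)] subf_closed(2,5)[OF F] by simp
   from Gadd[OF that(1) this] G0z[of "z - w"] show ?thesis by simp
  qed
  define \<sigma> where "\<sigma> u = (SOME z. (u, z) \<in> G)" for u
  have \<sigma>: "(u, \<sigma> u) \<in> G" if "u \<in> Domain G" for u
   using that unfolding \<sigma>_def by (meson DomainE someI_ex)
  have \<sigma>_eq: "\<sigma> u = z" if "(u, z) \<in> G" for u z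
   using \<sigma>[of u] uniq that by blast
  have FD: "F \<subseteq> Domain G" using GF by auto
  have D: "subf (Domain G)"
  proof (rule subf_of_subring[OF F _ FD])
   show "\<forall>x\<in>Domain G. alg_over F x" using alg by blast
   fix u v assume "u \<in> Domain G" "v \<in> Domain G"
   then show "u + v \<in> Domain G & u * v \<in> Domain G" using Gadd Gmul by blast
  qed
  have hom: "rhom (Domain G) \<sigma>"
   unfolding rhom_def using \<sigma>_eq[OF GF] subf_closed(1,2)[OF F] \<sigma>_eq[OF Gadd[OF \<sigma> \<sigma>]] \<sigma>_eq[OF Gmul[OF \<sigma> \<sigma>]] by auto
  have "u \<in> Domain G" for u
  proof -
   obtain m where m: "m \<in> polys (Domain G)" "Polynomial.lead_coeff m = 1" "poly m u = 0"
    and div: "!!h. h \<in> polys (Domain G) ==> poly h u = 0 ==> \<exists>k\<in>polys (Domain G). h = m * k"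
    using min_poly_exists[OF D alg_over_mono[OF FD alg[of u]]] by metis
   have md: "Polynomial.degree m > 0"
   proof (rule ccontr)
    assume "\<not> Polynomial.degree m > 0"
    then obtain c where "m = [:c:]" by (metis degree_eq_zeroE gr0I)
    with m show False by simp
   qed
   have "Polynomial.degree (map_poly \<sigma> m) = Polynomial.degree m"
    using m(2) rhom_simps(1,2)[OF D hom]
    by (intro antisym map_poly_degree_leq le_degree) (auto simp: coeff_map_poly)
   then obtain w where w: "poly (map_poly \<sigma> m) w = 0" using md alg_closed_root by metis
   define G' where "G' = {(poly h u, poly (map_poly \<sigma> h) w) | h. h \<in> polys (Domain G)}"
   have G': "partial_hom F G'" unfolding G'_def
   proof (rule partial_hom_adjoin[OF D hom FD])
    show "\<sigma> c = c" if "c \<in> F" for c using \<sigma>_eq[OF GF[OF that]] .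
    fix h assume h: "h \<in> polys (Domain G)" "poly h u = 0"
    with div obtain k where "k \<in> polys (Domain G)" "h = m * k" by blast
    then show "poly (map_poly \<sigma> h) w = 0" using w map_poly_on(2)[OF D hom m(1)] by simp
   qed
   have "G \<subseteq> G'"
   proof
    fix p assume "p \<in> G"
    then obtain c d where p: "p = (c, d)" "(c, d) \<in> G" by (cases p) auto
    then have "c \<in> Domain G" "\<sigma> c = d" using \<sigma>_eq by auto
    then show "p \<in> G'" using p rhom_simps[OF D hom] unfolding G'_def
     by (auto simp: polys_pCons_iff polys_closed[OF D] map_poly_pCons intro!: exI[of _ "[:c:]"])
   qed
   with G' G(2) have "G' = G" by (intro max) auto
   moreover have "(u, w) \<in> G'" unfolding G'_def using rhom_simps[OF D hom]
    by (auto simp: polys_pCons_iff polys_closed[OF D] subf_closed[OF D] map_poly_pCons intro!: exI[of _ "[:0, 1:]"])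
   ultimately show ?thesis by blast
  qed
  then have UN: "Domain G = UNIV" by blast
  show ?thesis
  proof (rule that[of \<sigma>])
   show "rhom UNIV \<sigma>" using hom UN by simp
   show "\<sigma> c = c" if "c \<in> F" for c using \<sigma>_eq[OF GF[OF that]] .
   have "(x, y) \<in> G0" unfolding G0_def
    by (auto simp: polys_pCons_iff polys_closed[OF F] subf_closed[OF F] map_poly_pCons intro!: exI[of _ "[:0, 1:]"])
   then show "\<sigma> x = y" using G(2) \<sigma>_eq by blast
  qed
qed

definition adj :: "'a::field set \<Rightarrow> 'a \<Rightarrow> 'a set" where
  "adj F x = {poly h x | h. h \<in> polys F}"

definition acl :: "'a::field set \<Rightarrow> bool" where
  "acl F \<longleftrightarrow> subf F & (\<forall>x. alg_over F x)"

definition auts :: "'a::field set \<Rightarrow> ('a \<Rightarrow> 'a) set" where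
  "auts F = {\<sigma>. rhom UNIV \<sigma> & (\<forall>c\<in>F. \<sigma> c = c)}"

lemma acl_mono: "acl F ==> F \<subseteq> F' ==> subf F' ==> acl F'"
  unfolding acl_def using alg_over_mono by blast

lemma adj_incl: assumes "subf F" shows "F \<subseteq> adj F x" "x \<in> adj F x"
proof -
  show "F \<subseteq> adj F x"
  proof
   fix c assume "c \<in> F"
   then show "c \<in> adj F x" unfolding adj_def using assms
    by (intro CollectI exI[of _ "[:c:]"]) (auto simp: polys_pCons_iff polys_closed)
  qed
  show "x \<in> adj F x" unfolding adj_def using assms
    by (intro CollectI exI[of _ "[:0, 1:]"]) (auto simp: polys_pCons_iff polys_closed subf_closed)
qed

lemma adj_acl: assumes F: "acl F" shows "acl (adj F x)"
proof -
  have sF: "subf F" using F by (simp add: acl_def)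
  have "subf (adj F x)"
  proof (rule subf_of_subring[OF sF])
   fix u v assume "u \<in> adj F x" "v \<in> adj F x"
   then obtain h k where "h \<in> polys F" "k \<in> polys F" "u = poly h x" "v = poly k x"
    by (auto simp: adj_def)
   then have "u + v = poly (h + k) x" "u * v = poly (h * k) x" "h + k \<in> polys F" "h * k \<in> polys F"
    using polys_closed[OF sF] by auto
   then show "u + v \<in> adj F x & u * v \<in> adj F x" unfolding adj_def by blast
  qed (use F adj_incl(1)[OF sF, of x] in \<open>auto simp: acl_def\<close>)
  with acl_mono[OF F adj_incl(1)[OF sF]] show ?thesis by blast
qed

lemma adj_min: "subf E ==> F \<subseteq> E ==> x \<in> E ==> adj F x \<subseteq> E"
  unfolding adj_def using poly_in_subf polys_mono by blast

fun adjs :: "'a::field set \<Rightarrow> 'a list \<Rightarrow> 'a set" where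
  "adjs F [] = F" | "adjs F (x # xs) = adjs (adj F x) xs"

lemma adjs_acl: "acl F ==> acl (adjs F xs)"
  by (induction xs arbitrary: F) (auto intro: adj_acl)

lemma adjs_incl: "acl F ==> F \<subseteq> adjs F xs & set xs \<subseteq> adjs F xs"
proof (induction xs arbitrary: F)
  case (Cons x xs)
  then have "subf F" by (simp add: acl_def)
  from Cons.IH[OF adj_acl[OF Cons.prems], of x] adj_incl[OF this, of x] show ?case by auto
qed simp

lemma adjs_min: "subf E ==> F \<subseteq> E ==> set xs \<subseteq> E ==> adjs F xs \<subseteq> E"
  by (induction xs arbitrary: F) (auto dest: adj_min)

lemma card_roots_rsquarefree:
  fixes p :: "'a::alg_closed_field poly"
  assumes "rsquarefree p"
  shows "card {x. poly p x = 0} = Polynomial.degree p"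
  using assms
proof (induction "Polynomial.degree p" arbitrary: p)
  case 0
  then obtain c where "p = [:c:]" by (metis degree_eq_zeroE)
  with 0 show ?case by (simp add: rsquarefree_def)
next
  case (Suc n)
  then obtain x where x: "poly p x = 0" using alg_closed_root[of p] by auto
  then obtain q where q: "p = [:- x, 1:] * q" by (auto simp: poly_eq_0_iff_dvd)
  have p0: "p ~= 0" and o: "!!a. order a p = 0 \<or> order a p = 1" using Suc.prems by (auto simp: rsquarefree_def)
  have q0: "q ~= 0" using p0 q by auto
  have ord: "order a p = order a [:- x, 1:] + order a q" for a
   using order_mult[of "[:- x, 1:]" q a] p0 unfolding q by auto
  have ox: "order x [:- x, 1:] ~= 0" using order_root[of "[:- x, 1:]" x] by simp
  have xq: "poly q x ~= 0" using o[of x] ord[of x] ox order_root[of q x] q0 by auto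
  have "order a q = 0 \<or> order a q = 1" for a using ord[of a] o[of a] by linarith
  then have "rsquarefree q" unfolding rsquarefree_def using q0 by blast
  moreover have d: "Polynomial.degree p = Suc (Polynomial.degree q)" unfolding q using q0 by (subst degree_mult_eq) auto
  ultimately have "card {x. poly q x = 0} = n" using Suc by auto
  moreover have "{x. poly p x = 0} = insert x {x. poly q x = 0}" unfolding q by auto
  ultimately show ?case using xq poly_roots_finite[OF q0] Suc.hyps(2) by simp
qed

lemma rsquarefree_prod_roots:
  fixes S :: "'a::field set"
  assumes "finite S"
  shows "rsquarefree (\<Prod>v\<in>S. [:- v, 1:])"
  using assms
proof (induction S)
  case empty
  then show ?case by (simp add: rsquarefree_def order_0I)
next
  case (insert u S)
  let ?p = "\<Prod>v\<in>S. [:- v, 1:]"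
  have nz: "?p ~= 0" using insert by (simp add: prod_zero_iff)
  have ou: "order a [:- u, 1:] = (if a = u then 1 else 0)" for a
   using order_power_n_n[of u 1] by (auto intro: order_0I)
  have "order u ?p = 0" using insert by (intro order_0I) (auto simp: poly_prod)
  moreover have "order a ([:- u, 1:] * ?p) = order a [:- u, 1:] + order a ?p" for a
   using nz by (intro order_mult) (metis mult_eq_0_iff pCons_eq_0_iff one_neq_zero)
  moreover have "order a ?p = 0 \<or> order a ?p = 1" for a using insert by (simp add: rsquarefree_def)
  moreover have "[:- u, 1:] * ?p ~= 0" using nz by (metis mult_eq_0_iff pCons_eq_0_iff one_neq_zero)
  ultimately show ?case using ou unfolding rsquarefree_def prod.insert[OF insert.hyps] by simp
qed

lemma rsquarefree_factor: "rsquarefree (m * k) ==> rsquarefree (m :: 'a::field poly)"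
proof -
  assume mk: "rsquarefree (m * k)"
  have "order a m = 0 \<or> order a m = 1" for a
   using mk[unfolded rsquarefree_def, THEN conjunct2, rule_format, of a]
    order_mult[of m k a, OF mk[unfolded rsquarefree_def, THEN conjunct1]] by linarith
  with mk show ?thesis by (auto simp: rsquarefree_def)
qed

lemma sep_closure_mono: "F \<subseteq> F' ==> sep_closure F \<subseteq> sep_closure F'"
  unfolding sep_closure_def by blast

lemma sep_closure_iff: "x \<in> sep_closure F \<longleftrightarrow> (\<exists>p\<in>polys F. rsquarefree p & poly p x = 0)"
  unfolding sep_closure_def polys_def by auto

lemma aut_poly_root:
  assumes "\<sigma> \<in> auts F" "p \<in> polys F"
  shows "poly p (\<sigma> x) = \<sigma> (poly p x)"
proof -
  have "rhom UNIV \<sigma>" using assms by (simp add: auts_def)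
  from poly_map_poly_on[OF subf_UNIV this, of p x]
  have "poly (map_poly \<sigma> p) (\<sigma> x) = \<sigma> (poly p x)" by (simp add: polys_def)
  moreover have "map_poly \<sigma> p = p" using assms \<open>rhom UNIV \<sigma>\<close>
   by (intro poly_eqI) (auto simp: coeff_map_poly rhom_def auts_def polys_def)
  ultimately show ?thesis by simp
qed

text \<open>
  An element of `F(x)` is a polynomial in `x` of degree below that of the minimal polynomial `m`.
  If all automorphisms fix it, then that polynomial takes the same value at all roots of `m`,
  which are as many as the degree by separability; so it is constant.
\<close>
lemma fixed_adj:
  fixes F :: "'a::alg_closed_field set"
  assumes F: "acl F" and x: "x \<in> sep_closure F" and z: "z \<in> adj F x" "!!\<sigma>. \<sigma> \<in> auts F ==> \<sigma> z = z"
  shows "z \<in> F"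
proof -
  have sF: "subf F" and alg: "!!x. alg_over F x" using F by (auto simp: acl_def)
  obtain p where p: "p \<in> polys F" "rsquarefree p" "poly p x = 0" using x by (auto simp: sep_closure_iff)
  obtain m where m: "m \<in> polys F" "Polynomial.lead_coeff m = 1" "poly m x = 0"
   and dvd: "!!h. h \<in> polys F ==> poly h x = 0 ==> \<exists>k\<in>polys F. h = m * k"
   and div: "!!h. h \<in> polys F ==> \<exists>k\<in>polys F. \<exists>r\<in>polys F. h = m * k + r & (r = 0 \<or> Polynomial.degree r < Polynomial.degree m)"
   using min_poly_exists[OF sF alg] by metis
  have "rsquarefree m" using dvd[OF p(1,3)] p(2) rsquarefree_factor by blast
  then have card: "card {y. poly m y = 0} = Polynomial.degree m" by (rule card_roots_rsquarefree)
  obtain h where h: "h \<in> polys F" "z = poly h x" using z by (auto simp: adj_def)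
  from div[OF h(1)] obtain k r where kr: "k \<in> polys F" "r \<in> polys F" "h = m * k + r"
   "r = 0 \<or> Polynomial.degree r < Polynomial.degree m" by blast
  have zr: "z = poly r x" using h kr m by simp
  have root: "poly (r - [:z:]) y = 0" if y: "poly m y = 0" for y
  proof -
   have "poly g y = 0" if "g \<in> polys F" "poly g x = 0" for g
    using dvd[OF that] y by auto
   from embedding_extends[OF sF alg this] obtain \<sigma> where \<sigma>: "rhom UNIV \<sigma>" "!!c. c \<in> F ==> \<sigma> c = c" "\<sigma> x = y"
    by blast
   then have "\<sigma> \<in> auts F" by (auto simp: auts_def)
   with z(2) aut_poly_root[OF this kr(2), of x] zr \<sigma>(3) show ?thesis by simp
  qed
  have "r - [:z:] = 0"
  proof (rule ccontr)
   assume nz: "r - [:z:] ~= 0"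
   have "Polynomial.degree m > 0"
   proof (rule ccontr)
    assume "\<not> Polynomial.degree m > 0"
    then obtain c where "m = [:c:]" by (metis degree_eq_zeroE gr0I)
    with m show False by simp
   qed
   then have "Polynomial.degree (r - [:z:]) < Polynomial.degree m"
    using kr(4) by (intro degree_diff_less) auto
   moreover have "card {y. poly m y = 0} \<le> card {y. poly (r - [:z:]) y = 0}"
    using root poly_roots_finite[OF nz] by (intro card_mono) auto
   ultimately show False using card_poly_roots_bound[OF nz] card by linarith
  qed
  then have "z = Polynomial.coeff r 0" by simp
  with kr(2) show ?thesis by (simp add: polys_def)
qed

lemma fixed_adjs:
  fixes F :: "'a::alg_closed_field set"
  assumes "acl F" "set xs \<subseteq> sep_closure F" "z \<in> adjs F xs" "!!\<sigma>. \<sigma> \<in> auts F ==> \<sigma> z = z"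
  shows "z \<in> F"
  using assms
proof (induction xs arbitrary: F)
  case (Cons x xs)
  have sub: "F \<subseteq> adj F x" using adj_incl Cons.prems(1) unfolding acl_def by blast
  have "z \<in> adj F x"
  proof (rule Cons.IH[OF adj_acl[OF Cons.prems(1)]])
   show "set xs \<subseteq> sep_closure (adj F x)" using Cons.prems(2) sep_closure_mono[OF sub] by auto
   show "z \<in> adjs (adj F x) xs" using Cons.prems by simp
   show "\<sigma> z = z" if "\<sigma> \<in> auts (adj F x)" for \<sigma> using that Cons.prems(4) sub unfolding auts_def by blast
  qed
  with Cons.prems show ?case by (intro fixed_adj[OF Cons.prems(1), of x]) auto
qed simp

lemma aut_inj: "\<sigma> \<in> auts F ==> inj \<sigma>"
  using rhom_inj[OF subf_UNIV] by (auto simp: auts_def inj_def)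

text \<open>
  The conjugates of `z` are finitely many; the product of the corresponding linear factors is
  invariant under all automorphisms, so that its coefficients lie in `F`.
\<close>
lemma sep_closure_adjs:
  fixes F :: "'a::alg_closed_field set"
  assumes F: "acl F" and xs: "set xs \<subseteq> sep_closure F" and z: "z \<in> adjs F xs"
  shows "z \<in> sep_closure F"
proof -
  have sF: "subf F" and alg: "!!x. alg_over F x" using F by (auto simp: acl_def)
  have "\<forall>x\<in>set xs. \<exists>p. p \<in> polys F & rsquarefree p & poly p x = 0"
   using xs unfolding subset_iff sep_closure_iff by blast
  then obtain P where P: "!!x. x \<in> set xs ==> P x \<in> polys F & rsquarefree (P x) & poly (P x) x = 0" by metis
  define Y where "Y = (\<Union>x\<in>set xs. {y. poly (P x) y = 0})"
  have "finite Y" using P unfolding Y_def rsquarefree_def by (auto intro!: poly_roots_finite)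
  then obtain ys where ys: "set ys = Y" using finite_list by blast
  have Ysep: "set ys \<subseteq> sep_closure F"
  proof
   fix y assume "y \<in> set ys"
   then obtain x where "x \<in> set xs" "poly (P x) y = 0" unfolding ys Y_def by blast
   with P show "y \<in> sep_closure F" unfolding sep_closure_iff by blast
  qed
  let ?E = "adjs F ys"
  have E: "acl ?E" "F \<subseteq> ?E" "Y \<subseteq> ?E" using adjs_acl[OF F, of ys] adjs_incl[OF F, of ys] ys by auto
  have sE: "subf ?E" using E by (simp add: acl_def)
  have zE: "z \<in> ?E" using adjs_min[OF sE E(2), of xs] E(3) P z unfolding Y_def by auto
  have stable: "\<sigma> w \<in> ?E" if \<sigma>: "\<sigma> \<in> auts F" and w: "w \<in> ?E" for \<sigma> w
  proof -
   have hom: "rhom UNIV \<sigma>" using \<sigma> by (simp add: auts_def)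
   note hs = rhom_simps[OF subf_UNIV hom] rhom_minus[OF subf_UNIV hom] rhom_inverse[OF subf_UNIV hom]
   have "subf {w. \<sigma> w \<in> ?E}" using sE unfolding subf_def by (auto simp: hs)
   moreover have "F \<subseteq> {w. \<sigma> w \<in> ?E}" using E(2) \<sigma> by (auto simp: auts_def)
   moreover have "set ys \<subseteq> {w. \<sigma> w \<in> ?E}"
   proof
    fix y assume "y \<in> set ys"
    then obtain x where "x \<in> set xs" "poly (P x) y = 0" unfolding ys Y_def by blast
    then have "poly (P x) (\<sigma> y) = 0" using aut_poly_root[OF \<sigma>, of "P x" y] P hs by auto
    with \<open>x \<in> set xs\<close> show "y \<in> {w. \<sigma> w \<in> ?E}" using E(3) unfolding Y_def by blast
   qed
   ultimately show ?thesis using adjs_min w by blast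
  qed
  define orb where "orb = {\<sigma> z | \<sigma>. \<sigma> \<in> auts F}"
  obtain q where q: "q \<in> polys F" "q ~= 0" "poly q z = 0" using alg[of z] by (auto simp: alg_over_def)
  have "orb \<subseteq> {y. poly q y = 0}"
   unfolding orb_def using aut_poly_root[OF _ q(1), of _ z] q(3) rhom_simps(1)[OF subf_UNIV] by (auto simp: auts_def)
  then have finO: "finite orb" using poly_roots_finite[OF q(2)] finite_subset by blast
  have OE: "orb \<subseteq> ?E" unfolding orb_def using stable zE by auto
  have Oinv: "\<sigma> ` orb = orb" if \<sigma>: "\<sigma> \<in> auts F" for \<sigma>
  proof -
   have "\<sigma> ` orb \<subseteq> orb"
   proof
    fix w assume "w \<in> \<sigma> ` orb"
    then obtain \<tau> where "\<tau> \<in> auts F" "w = \<sigma> (\<tau> z)" unfolding orb_def by auto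
    moreover from this \<sigma> have "\<sigma> \<circ> \<tau> \<in> auts F" by (auto simp: auts_def rhom_def)
    ultimately show "w \<in> orb" unfolding orb_def by (metis (mono_tags, lifting) comp_apply mem_Collect_eq)
   qed
   then show ?thesis using finO aut_inj[OF \<sigma>] by (metis card_image card_subset_eq inj_on_subset subset_UNIV)
  qed
  define R where "R = (\<Prod>v\<in>orb. [:- v, 1:])"
  have RE: "R \<in> polys ?E" unfolding R_def using OE
   by (intro polys_prod[OF sE]) (auto simp: polys_pCons_iff intro!: polys_closed[OF sE] subf_closed[OF sE])
  have "R \<in> polys F"
   unfolding polys_def
  proof (intro CollectI allI)
   fix i
   show "Polynomial.coeff R i \<in> F"
   proof (rule fixed_adjs[OF F Ysep])
    show "Polynomial.coeff R i \<in> adjs F ys" using RE by (simp add: polys_def)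
    fix \<sigma> assume \<sigma>: "\<sigma> \<in> auts F"
    then have hom: "rhom UNIV \<sigma>" by (simp add: auts_def)
    note hs = rhom_simps[OF subf_UNIV hom] rhom_minus[OF subf_UNIV hom]
    have U: "p \<in> polys UNIV" for p :: "'a poly" by (simp add: polys_def)
    have "map_poly \<sigma> (\<Prod>v\<in>A. [:- v, 1:]) = (\<Prod>v\<in>A. [:- \<sigma> v, 1:])" if "finite A" for A
     using that
    proof (induction A)
     case empty
     then show ?case by (simp add: one_pCons map_poly_pCons hs del: pCons_one)
    next
     case (insert u A)
     have "map_poly \<sigma> [:- u, 1:] = [:- \<sigma> u, 1:]" by (simp add: map_poly_pCons hs)
     then show ?case using insert map_poly_on(2)[OF subf_UNIV hom U U, of "[:- u, 1:]" "\<Prod>v\<in>A. [:- v, 1:]"]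
      by (simp only: prod.insert insert.hyps)
    qed
    from this[OF finO] have "map_poly \<sigma> R = (\<Prod>v\<in>orb. [:- \<sigma> v, 1:])" unfolding R_def .
    also have "... = (\<Prod>v\<in>\<sigma> ` orb. [:- v, 1:])"
     using prod.reindex[of \<sigma> orb "\<lambda>v. [:- v, 1:]"] inj_on_subset[OF aut_inj[OF \<sigma>], of orb]
     by (simp add: o_def)
    finally have "map_poly \<sigma> R = R" using Oinv[OF \<sigma>] unfolding R_def by simp
    then show "\<sigma> (Polynomial.coeff R i) = Polynomial.coeff R i"
     using coeff_map_poly[of \<sigma> R i] hs by simp
   qed
  qed
  moreover have "rsquarefree R" unfolding R_def using finO by (rule rsquarefree_prod_roots)
  moreover have "poly R z = 0"
  proof -
   have "id \<in> auts F" by (auto simp: auts_def rhom_def)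
   then have "z \<in> orb" unfolding orb_def by (metis (mono_tags, lifting) id_apply mem_Collect_eq)
   then show ?thesis unfolding R_def poly_prod using finO by (auto intro!: bexI[of _ z])
  qed
  ultimately show ?thesis by (auto simp: sep_closure_iff)
qed

lemma sep_closure_incl: assumes "subf F" shows "F \<subseteq> sep_closure F"
proof
  fix c assume c: "c \<in> F"
  have "rsquarefree [:- c, 1:]" using rsquarefree_prod_roots[of "{c}"] by simp
  moreover have "[:- c, 1:] \<in> polys F" using c assms by (auto simp: polys_pCons_iff polys_closed subf_closed)
  ultimately show "c \<in> sep_closure F" unfolding sep_closure_iff by force
qed

text \<open>
  Sums and products of separable elements lie in a finitely generated extension, all of whose
  elements are separable by `sep_closure_adjs`.
\<close>
theorem sep_closure_subf:
  fixes F :: "'a::alg_closed_field set"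
  assumes F: "acl F"
  shows "subf (sep_closure F)"
proof -
  have *: "w \<in> sep_closure F" if "x \<in> sep_closure F" "y \<in> sep_closure F" "w \<in> adjs F [x, y]" for x y w
   using sep_closure_adjs[OF F, of "[x, y]" w] that by simp
  have i: "x \<in> adjs F [x, y]" "y \<in> adjs F [x, y]" "subf (adjs F [x, y])" for x y
   using adjs_incl[OF F, of "[x, y]"] adjs_acl[OF F, of "[x, y]"] by (auto simp: acl_def)
  show ?thesis unfolding subf_def
  proof (intro conjI ballI)
   show "0 \<in> sep_closure F" "1 \<in> sep_closure F" using sep_closure_incl[of F] F subf_closed(1,2)[of F] by (auto simp: acl_def)
   fix x assume x: "x \<in> sep_closure F"
   show "- x \<in> sep_closure F" "inverse x \<in> sep_closure F"
    using *[OF x x] i(1)[of x x] subf_closed(5,6)[OF i(3)[of x x], of x] by auto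
   fix y assume y: "y \<in> sep_closure F"
   show "x + y \<in> sep_closure F" "x * y \<in> sep_closure F"
    using *[OF x y] i(1,2) subf_closed(3,4)[OF i(3)[of x y], of x y] by auto
  qed
qed

theorem fixed_sep_closure:
  fixes F :: "'a::alg_closed_field set"
  assumes "acl F" "z \<in> sep_closure F" "!!\<sigma>. \<sigma> \<in> auts F ==> \<sigma> z = z"
  shows "z \<in> F"
  using fixed_adjs[OF assms(1), of "[z]" z] assms(2,3) adjs_incl[OF assms(1), of "[z]"] by auto

section \<open>Discrete valuations and lattices\<close>

definition asg :: "'a::field set \<Rightarrow> bool" where
  "asg A \<longleftrightarrow> 0 \<in> A & (\<forall>x\<in>A. \<forall>y\<in>A. x + y \<in> A & x - y \<in> A)"

text \<open>
  The index of `B` in `A`, through a system of representatives; a relation, because the index may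
  be infinite.
\<close>
definition idx :: "'a::field set \<Rightarrow> 'a set \<Rightarrow> nat \<Rightarrow> bool" where
  "idx A B k \<longleftrightarrow> (\<exists>T\<subseteq>A. finite T & card T = k & (\<forall>a\<in>A. \<exists>!t\<in>T. a - t \<in> B))"

lemma asgD:
  assumes "asg A"
  shows "0 \<in> A" "x \<in> A ==> y \<in> A ==> x + y \<in> A" "x \<in> A ==> y \<in> A ==> x - y \<in> A" "x \<in> A ==> - x \<in> A"
proof -
  show "0 \<in> A" "x \<in> A ==> y \<in> A ==> x + y \<in> A" and m: "x \<in> A ==> y \<in> A ==> x - y \<in> A" for x y
   using assms by (auto simp: asg_def)
  from m[of 0 x] show "x \<in> A ==> - x \<in> A" using assms by (auto simp: asg_def)
qed

lemma asg_diff_trans: "asg B ==> a - b \<in> B ==> b - c \<in> B ==> a - c \<in> B"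
  using asgD(2)[of B "a - b" "b - c"] by simp

lemma asg_diff_sym: "asg B ==> a - b \<in> B ==> b - a \<in> B"
  using asgD(4)[of B "a - b"] by simp

lemma idx_le:
  assumes B: "asg B" and T: "T \<subseteq> A" "\<forall>a\<in>A. \<exists>!t\<in>T. a - t \<in> B" and
   T': "T' \<subseteq> A" "finite T'" "\<forall>a\<in>A. \<exists>t\<in>T'. a - t \<in> B"
  shows "card T \<le> card T'"
proof -
  obtain f where f: "!!a. a \<in> A ==> f a \<in> T' & a - f a \<in> B" using T'(3) by metis
  have "inj_on f T"
  proof
   fix s t assume st: "s \<in> T" "t \<in> T" "f s = f t"
   then have "s - f t \<in> B" "f t - t \<in> B" using f[of s] f[of t] T(1) asg_diff_sym[OF B] by auto
   from asg_diff_trans[OF B this] have "s - t \<in> B" "s - s \<in> B" using asgD(1)[OF B] by auto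
   with T st show "s = t" by blast
  qed
  moreover have "f ` T \<subseteq> T'" using f T(1) by blast
  ultimately show ?thesis using card_inj_on_le T'(2) by blast
qed

lemma idx_unique: "asg B ==> idx A B k ==> idx A B l ==> k = l"
  unfolding idx_def using idx_le[of B _ A] by (metis (no_types, lifting) le_antisym)

lemma idx_exists:
  assumes B: "asg B" and Y: "Y \<subseteq> A" "finite Y" "\<forall>a\<in>A. \<exists>t\<in>Y. a - t \<in> B"
  shows "\<exists>k. idx A B k"
proof -
  define f where "f a = (SOME t. t \<in> Y & a - t \<in> B)" for a
  have f: "f a \<in> Y & a - f a \<in> B" if "a \<in> A" for a
   unfolding f_def using Y(3) that by (metis (mono_tags, lifting) someI_ex)
  have feq: "f a = f b" if "a \<in> A" "b \<in> A" "a - b \<in> B" for a b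
  proof -
   have "a - t \<in> B \<longleftrightarrow> b - t \<in> B" for t
    using that asg_diff_trans[OF B] asg_diff_sym[OF B] by blast
   then show ?thesis unfolding f_def by simp
  qed
  have "\<forall>a\<in>A. \<exists>!t\<in>f ` Y. a - t \<in> B"
  proof (intro ballI ex1I conjI)
   fix a assume a: "a \<in> A"
   have "f (f a) = f a" using feq[of a "f a"] f[OF a] a Y(1) by auto
   then show "f a \<in> f ` Y" "a - f a \<in> B" using f[OF a] by (metis image_eqI, auto)
   fix t assume t: "t \<in> f ` Y & a - t \<in> B"
   then obtain y where y: "y \<in> Y" "t = f y" by auto
   then have "y - t \<in> B" "t \<in> A" using f[of y] Y(1) by auto
   then have "f y = f t" "f a = f t" using feq[of y t] feq[of a t] t a y Y(1) by auto
   then show "t = f a" using y by simp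
  qed
  moreover have "f ` Y \<subseteq> A" using f Y(1) by blast
  ultimately show ?thesis unfolding idx_def using Y(2) by (metis finite_imageI)
qed

lemma idx_tower:
  assumes C: "asg C" and B: "asg B" and A: "asg A" and sub: "C \<subseteq> B" "B \<subseteq> A" and k: "idx A B k" and l: "idx B C l"
  shows "idx A C (k * l)"
proof -
  obtain S T where S: "S \<subseteq> A" "finite S" "card S = k" "\<forall>a\<in>A. \<exists>!t\<in>S. a - t \<in> B"
   and T: "T \<subseteq> B" "finite T" "card T = l" "\<forall>a\<in>B. \<exists>!t\<in>T. a - t \<in> C"
   using k l unfolding idx_def by blast
  let ?f = "\<lambda>(s, t). s + t"
  have uniq: "s = s' & t = t'" if "s \<in> S" "s' \<in> S" "t \<in> T" "t' \<in> T" "(s + t) - (s' + t') \<in> C" for s t s' t'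
  proof -
   have "(s + t) - (s' + t') \<in> B" "t - t' \<in> B" using that sub T(1) asgD(3)[OF B, of t t'] by blast+
   from asgD(3)[OF B this] have "s - s' \<in> B" "s' - s' \<in> B" using asgD(1)[OF B] by (auto simp: algebra_simps)
   have "s \<in> A" using that(1) S(1) by auto
   from S(4)[rule_format, OF this] that(1,2) \<open>s - s' \<in> B\<close> have ss: "s = s'" using asgD(1)[OF B] by auto
   have tB: "t \<in> B" using that(3) T(1) by auto
   have "t - t' \<in> C" using that(5) ss by simp
   with T(4)[rule_format, OF tB] that(3,4) have "t = t'" using asgD(1)[OF C] by auto
   with ss show ?thesis by simp
  qed
  have inj: "inj_on ?f (S \<times> T)"
   using uniq asgD(1)[OF C] by (auto simp: inj_on_def)
  have "\<forall>a\<in>A. \<exists>!r\<in>?f ` (S \<times> T). a - r \<in> C"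
  proof (intro ballI ex_ex1I)
   fix a assume a: "a \<in> A"
   then obtain s where s: "s \<in> S" "a - s \<in> B" using S(4) by blast
   then obtain t where t: "t \<in> T" "(a - s) - t \<in> C" using T(4) by blast
   then show "\<exists>r. r \<in> ?f ` (S \<times> T) & a - r \<in> C"
    using s by (intro exI[of _ "s + t"]) (auto simp: algebra_simps)
  next
   fix a r r' assume "a \<in> A" and r: "r \<in> ?f ` (S \<times> T) & a - r \<in> C" "r' \<in> ?f ` (S \<times> T) & a - r' \<in> C"
   then have "r - r' \<in> C" using asg_diff_trans[OF C] asg_diff_sym[OF C] by blast
   with r show "r = r'" using uniq by auto
  qed
  moreover have "?f ` (S \<times> T) \<subseteq> A"
  proof -
   have "s + t \<in> A" if "s \<in> S" "t \<in> T" for s t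
    using that S(1) T(1) sub asgD(2)[OF A, of s t] by blast
   then show ?thesis by auto
  qed
  moreover have "card (?f ` (S \<times> T)) = k * l" using card_image[OF inj] S T by (simp add: card_cartesian_product)
  ultimately show ?thesis unfolding idx_def using S(2) T(2) by blast
qed

lemma idx_scale:
  assumes x: "x ~= (0::'a::field)" and "idx A B k"
  shows "idx ((*) x ` A) ((*) x ` B) k"
proof -
  obtain T where T: "T \<subseteq> A" "finite T" "card T = k" "\<forall>a\<in>A. \<exists>!t\<in>T. a - t \<in> B"
   using assms(2) unfolding idx_def by blast
  have eq: "x * a - x * t \<in> (*) x ` B \<longleftrightarrow> a - t \<in> B" for a t
   using x by (auto simp: right_diff_distrib[symmetric])
  have "\<forall>a\<in>(*) x ` A. \<exists>!t\<in>(*) x ` T. a - t \<in> (*) x ` B"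
  proof
   fix a assume "a \<in> (*) x ` A"
   then obtain a' where a': "a' \<in> A" "a = x * a'" by auto
   then obtain t where t: "t \<in> T" "a' - t \<in> B" "!!s. s \<in> T ==> a' - s \<in> B ==> s = t" using T(4) by blast
   show "\<exists>!t\<in>(*) x ` T. a - t \<in> (*) x ` B"
   proof (rule ex1I[of _ "x * t"])
    show "x * t \<in> (*) x ` T & a - x * t \<in> (*) x ` B" using t(1,2) eq a' by blast
    fix s assume s: "s \<in> (*) x ` T & a - s \<in> (*) x ` B"
    then obtain s' where "s' \<in> T" "s = x * s'" by blast
    with s eq[of a' s'] a' t(3)[of s'] show "s = x * t" by simp
   qed
  qed
  moreover have "card ((*) x ` T) = k" using x T(3) by (subst card_image) (auto simp: inj_on_def)
  moreover have "(*) x ` T \<subseteq> (*) x ` A" "finite ((*) x ` T)" using T by auto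
  ultimately show ?thesis unfolding idx_def by (intro exI[of _ "(*) x ` T"] conjI)
qed

lemma idx_between:
  assumes B: "asg B" and C: "asg C" and sub: "C \<subseteq> B" "B \<subseteq> A" and k: "idx A C k"
  shows "\<exists>l. idx A B l" "\<exists>l. idx B C l"
proof -
  obtain T where T: "T \<subseteq> A" "finite T" "\<forall>a\<in>A. \<exists>!t\<in>T. a - t \<in> C"
   using k unfolding idx_def by blast
  then show "\<exists>l. idx A B l" using sub by (intro idx_exists[OF B, of T]) blast+
  define g where "g t = (SOME b. b \<in> B & b - t \<in> C)" for t
  have g: "g t \<in> B & g t - t \<in> C" if "b \<in> B" "b - t \<in> C" for b t
   unfolding g_def using that by (metis (mono_tags, lifting) someI_ex)
  show "\<exists>l. idx B C l"
  proof (rule idx_exists[OF C])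
   show "g ` {t \<in> T. \<exists>b\<in>B. b - t \<in> C} \<subseteq> B" using g by auto
   show "\<forall>a\<in>B. \<exists>t\<in>g ` {t \<in> T. \<exists>b\<in>B. b - t \<in> C}. a - t \<in> C"
   proof
    fix a assume a: "a \<in> B"
    with sub obtain t where t: "t \<in> T" "a - t \<in> C" using T(3) by blast
    with g[OF a] have "a - g t \<in> C" using asg_diff_trans[OF C] asg_diff_sym[OF C] by blast
    with t a show "\<exists>t\<in>g ` {t \<in> T. \<exists>b\<in>B. b - t \<in> C}. a - t \<in> C" by blast
   qed
  qed (use T in auto)
qed

lemma idx_pos: "asg A ==> idx A B k ==> k > 0"
  unfolding idx_def using asgD(1) by (metis card_gt_0_iff empty_iff)

lemma idx_1:
  assumes "asg A" "asg B" "idx A B 1"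
  shows "A \<subseteq> B"
proof
  fix a assume a: "a \<in> A"
  obtain t where t: "\<forall>a\<in>A. a - t \<in> B" using assms(3) unfolding idx_def by (auto simp: card_Suc_eq)
  then have "a - t \<in> B" "0 - t \<in> B" using a asgD(1)[OF assms(1)] by auto
  from asgD(3)[OF assms(2) this] show "a \<in> B" by simp
qed

lemma idx_refl: "asg A ==> idx A A 1"
  unfolding idx_def using asgD(1)[of A] by (intro exI[of _ "{0}"]) auto

text \<open>
  A discrete valuation with finite residue field. The representatives `R` of the residue classes
  take the place of the residue field.
\<close>
locale dvf =
  fixes K :: "'a::field set" and v :: "'a \<Rightarrow> int" and \<pi> :: 'a and R :: "'a set"
  assumes K: "subf K"
   and v_mult: "x \<in> K ==> y \<in> K ==> x ~= 0 ==> y ~= 0 ==> v (x * y) = v x + v y"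
   and v_add: "x \<in> K ==> y \<in> K ==> x ~= 0 ==> y ~= 0 ==> x + y ~= 0 ==> min (v x) (v y) \<le> v (x + y)"
   and unif: "\<pi> \<in> K" "\<pi> ~= 0" "v \<pi> = 1"
   and R_fin: "finite R" and R_sub: "r \<in> R ==> r \<in> K & (r = 0 \<or> 0 \<le> v r)"
   and R_rep: "x \<in> K ==> x = 0 \<or> 0 \<le> v x ==> \<exists>!r\<in>R. x - r = 0 \<or> 1 \<le> v (x - r)"
begin

definition vr :: "'a set" where "vr = {x\<in>K. x = 0 \<or> 0 \<le> v x}"
definition mi :: "'a set" where "mi = {x\<in>K. x = 0 \<or> 1 \<le> v x}"

lemma v_1: "v 1 = 0" using v_mult[of 1 1] subf_closed[OF K] by simp

lemma v_minus: "x \<in> K ==> v (- x) = v x"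
proof (cases "x = 0")
  case False
  assume x: "x \<in> K"
  have "v (- 1) = 0" using v_mult[of "- 1" "- 1"] v_1 subf_closed[OF K] by simp
  with v_mult[of "- 1" x] False x subf_closed[OF K] show ?thesis by simp
qed simp

lemma v_inverse: "x \<in> K ==> x ~= 0 ==> v (inverse x) = - v x"
  using v_mult[of x "inverse x"] v_1 subf_closed(6)[OF K, of x] by simp

lemma v_divide: "x \<in> K ==> x ~= 0 ==> y \<in> K ==> y ~= 0 ==> v (x / y) = v x - v y"
  using v_mult[of x "inverse y"] v_inverse[of y] subf_closed(6)[OF K, of y] by (simp add: divide_inverse)

lemma v_power: "x \<in> K ==> x ~= 0 ==> v (x ^ m) = int m * v x"
  by (induction m) (auto simp: v_1 v_mult subf_power[OF K] algebra_simps)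

lemma vr_closed:
  "0 \<in> vr" "1 \<in> vr" "x \<in> vr ==> y \<in> vr ==> x + y \<in> vr" "x \<in> vr ==> y \<in> vr ==> x * y \<in> vr"
  "x \<in> vr ==> - x \<in> vr" "x \<in> vr ==> y \<in> vr ==> x - y \<in> vr"
proof -
  show "0 \<in> vr" "1 \<in> vr" using v_1 subf_closed[OF K] by (auto simp: vr_def)
  show a: "x \<in> vr ==> y \<in> vr ==> x + y \<in> vr" for x y
   using v_add[of x y] subf_closed(3)[OF K, of x y] by (cases "x + y = 0"; cases "x = 0"; cases "y = 0") (auto simp: vr_def)
  show "x \<in> vr ==> y \<in> vr ==> x * y \<in> vr"
   using v_mult[of x y] subf_closed(4)[OF K, of x y] by (cases "x = 0"; cases "y = 0") (auto simp: vr_def)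
  show n: "x \<in> vr ==> - x \<in> vr" for x using v_minus[of x] subf_closed(5)[OF K, of x] by (auto simp: vr_def)
  show "x \<in> vr ==> y \<in> vr ==> x - y \<in> vr" using a[of x "- y"] n[of y] by simp
qed

lemma vr_power: "x \<in> vr ==> x ^ m \<in> vr"
  by (induction m) (auto intro: vr_closed)

lemma vr_K: "vr \<subseteq> K" by (auto simp: vr_def)

lemma unif_vr: "\<pi> \<in> vr" using unif by (auto simp: vr_def)

lemma mi_iff: "x \<in> mi \<longleftrightarrow> x / \<pi> \<in> vr"
proof
  assume "x \<in> mi"
  then show "x / \<pi> \<in> vr" using v_divide[of x \<pi>] unif subf_closed(8)[OF K, of x \<pi>] by (cases "x = 0") (auto simp: mi_def vr_def)
next
  assume a: "x / \<pi> \<in> vr"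
  then have "x \<in> K" using subf_closed(4)[OF K, of "x / \<pi>" \<pi>] unif by (auto simp: vr_def)
  then show "x \<in> mi" using a v_divide[of x \<pi>] unif by (cases "x = 0") (auto simp: mi_def vr_def)
qed

lemma vr_bound: "x \<in> K ==> \<exists>m. \<pi> ^ m * x \<in> vr"
proof (cases "x = 0")
  case False
  assume x: "x \<in> K"
  have "v (\<pi> ^ nat (- v x) * x) \<ge> 0"
   using v_mult[of "\<pi> ^ nat (- v x)" x] v_power[of \<pi> "nat (- v x)"] unif x False subf_power[OF K] by auto
  then show ?thesis using x unif subf_closed[OF K] by (auto simp: vr_def intro!: exI[of _ "nat (- v x)"])
qed (auto simp: vr_closed)

lemma R_vr: "R \<subseteq> vr" using R_sub by (auto simp: vr_def)

lemma R_rep': "x \<in> vr ==> \<exists>!r\<in>R. x - r \<in> mi"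
proof -
  assume x: "x \<in> vr"
  have "x - r \<in> mi \<longleftrightarrow> (x - r = 0 \<or> 1 \<le> v (x - r))" if "r \<in> R" for r
   using that x R_sub[OF that] subf_closed(7)[OF K, of x r] by (auto simp: mi_def vr_def)
  with R_rep[of x] x show ?thesis by (auto simp: vr_def)
qed

lemma R_card: "card R \<ge> 2"
proof -
  obtain r s where r: "r \<in> R" "0 - r \<in> mi" and s: "s \<in> R" "1 - s \<in> mi"
   using R_rep'[OF vr_closed(1)] R_rep'[OF vr_closed(2)] by blast
  have "r ~= s"
  proof
   assume "r = s"
   with r s have "(1 - r) / \<pi> - (0 - r) / \<pi> \<in> vr" using mi_iff vr_closed(6) by blast
   then have "1 / \<pi> \<in> vr" by (simp add: diff_divide_distrib)
   then show False using v_divide[of 1 \<pi>] v_1 unif subf_closed(2)[OF K] by (auto simp: vr_def)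
  qed
  then have "card {r, s} = 2" by simp
  with r s R_fin show ?thesis by (metis card_mono empty_subsetI insert_subset)
qed

end

lemma finite_bound_ex:
  fixes P :: "'b \<Rightarrow> nat \<Rightarrow> bool"
  assumes "finite A" "!!x. x \<in> A ==> \<exists>m. \<forall>k\<ge>m. P x k"
  shows "\<exists>m. \<forall>x\<in>A. \<forall>k\<ge>m. P x k"
  using assms
proof (induction A)
  case (insert x A)
  then obtain m1 m2 where "\<forall>x\<in>A. \<forall>k\<ge>m1. P x k" "\<forall>k\<ge>m2. P x k" by blast
  then show ?case by (intro exI[of _ "max m1 m2"]) auto
qed simp

text \<open>
  A finite extension `L` with a basis, from which the lattices are built.
\<close>
locale dvf_ext = dvf K v \<pi> R for K :: "'a::field set" and v \<pi> R +
  fixes L :: "'a set" and n :: nat and u :: "nat \<Rightarrow> 'a"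
  assumes L: "subf L" and KL: "K \<subseteq> L" and alg: "x \<in> L ==> alg_over K x"
   and u: "i < n ==> u i \<in> L" and span: "x \<in> L ==> \<exists>c. (\<forall>i<n. c i \<in> K) & x = (\<Sum>i<n. c i * u i)"
   and indep: "(!!i. i < n ==> c i \<in> K) ==> (\<Sum>i<n. c i * u i) = 0 ==> i < n ==> c i = 0"
begin

lemma vrL: "vr \<subseteq> L" using KL vr_K by blast

lemma piL: "\<pi> ^ m \<in> L" "\<pi> \<in> L" using subf_power[OF L] KL unif by auto

text \<open>
  The valuation ring span of the basis.
\<close>
definition lat0 :: "'a set" where "lat0 = {\<Sum>i<n. c i * u i | c. \<forall>i<n. c i \<in> vr}"

definition submod :: "'a set \<Rightarrow> bool" where
  "submod A \<longleftrightarrow> A \<subseteq> L & 0 \<in> A & (\<forall>x\<in>A. \<forall>y\<in>A. x + y \<in> A) & (\<forall>c\<in>vr. \<forall>x\<in>A. c * x \<in> A)"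

definition lattice :: "'a set \<Rightarrow> bool" where
  "lattice A \<longleftrightarrow> submod A & (\<exists>m. \<forall>y\<in>lat0. \<pi> ^ m * y \<in> A) & (\<exists>m. \<forall>y\<in>A. \<pi> ^ m * y \<in> lat0)"

definition stab :: "'a \<Rightarrow> 'a set \<Rightarrow> bool" where "stab x A \<longleftrightarrow> (\<forall>y\<in>A. x * y \<in> A)"

text \<open>
  The integral closure of the valuation ring in `L`: integral elements are those that map some
  lattice into itself.
\<close>
definition ic :: "'a set" where "ic = {x\<in>L. \<exists>A. lattice A & stab x A}"

lemma submodD:
  assumes "submod A"
  shows "A \<subseteq> L" "0 \<in> A" "x \<in> A ==> y \<in> A ==> x + y \<in> A" "c \<in> vr ==> x \<in> A ==> c * x \<in> A"
   "x \<in> A ==> - x \<in> A" "x \<in> A ==> y \<in> A ==> x - y \<in> A" "x \<in> A ==> \<pi> ^ m * x \<in> A" "asg A"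
proof -
  show "A \<subseteq> L" "0 \<in> A" and a: "x \<in> A ==> y \<in> A ==> x + y \<in> A" and m: "c \<in> vr ==> x \<in> A ==> c * x \<in> A" for x y c
   using assms by (auto simp: submod_def)
  show n: "x \<in> A ==> - x \<in> A" for x using m[of "- 1" x] vr_closed by auto
  show d: "x \<in> A ==> y \<in> A ==> x - y \<in> A" for x y using a[of x "- y"] n[of y] by simp
  show "x \<in> A ==> \<pi> ^ m * x \<in> A" using m vr_power[OF unif_vr] by blast
  show "asg A" using a d assms by (auto simp: asg_def submod_def)
qed

lemma submod_sum: "submod A ==> (!!i. i \<in> I ==> f i \<in> A) ==> sum f I \<in> A"
  by (induction I rule: infinite_finite_induct) (auto dest: submodD)

lemma stabD: "stab x A ==> y \<in> A ==> x * y \<in> A" by (simp add: stab_def)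

lemma stab_power: "stab x A ==> y \<in> A ==> x ^ m * y \<in> A"
  by (induction m) (auto simp: stab_def mult.assoc)

lemma lat0_submod: "submod lat0"
  unfolding submod_def
proof (intro conjI ballI)
  show "lat0 \<subseteq> L" using u vrL by (auto simp: lat0_def intro!: subf_sum[OF L] subf_closed(4)[OF L])
  show "0 \<in> lat0" unfolding lat0_def using vr_closed(1) by (auto intro!: exI[of _ "\<lambda>_. 0"])
next
  fix x y assume "x \<in> lat0" "y \<in> lat0"
  then obtain c d where "\<forall>i<n. c i \<in> vr" "\<forall>i<n. d i \<in> vr" "x = (\<Sum>i<n. c i * u i)" "y = (\<Sum>i<n. d i * u i)"
   unfolding lat0_def by blast
  then show "x + y \<in> lat0" unfolding lat0_def
   by (auto intro!: exI[of _ "\<lambda>i. c i + d i"] simp: vr_closed sum.distrib algebra_simps)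
next
  fix a x assume "a \<in> vr" "x \<in> lat0"
  moreover from this obtain c where "\<forall>i<n. c i \<in> vr" "x = (\<Sum>i<n. c i * u i)" unfolding lat0_def by blast
  ultimately show "a * x \<in> lat0" unfolding lat0_def
   by (auto intro!: exI[of _ "\<lambda>i. a * c i"] simp: vr_closed sum_distrib_left algebra_simps)
qed

lemma lat0_lattice: "lattice lat0"
  unfolding lattice_def using lat0_submod submodD(7)[OF lat0_submod] by blast

lemma pi_mult_mono: "submod A ==> \<pi> ^ m * y \<in> A ==> m \<le> k ==> \<pi> ^ k * y \<in> A"
  using submodD(7)[of A "\<pi> ^ m * y" "k - m"] by (simp add: mult.assoc[symmetric] power_add[symmetric])

lemma lat0_absorb: "x \<in> L ==> \<exists>m. \<pi> ^ m * x \<in> lat0"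
proof -
  assume "x \<in> L"
  with span obtain c where c: "\<forall>i<n. c i \<in> K" "x = (\<Sum>i<n. c i * u i)" by blast
  have "\<exists>m. \<forall>i\<in>{..<n}. \<forall>k\<ge>m. \<pi> ^ k * c i \<in> vr"
  proof (rule finite_bound_ex)
   fix i assume "i \<in> {..<n}"
   then obtain m where m: "\<pi> ^ m * c i \<in> vr" using vr_bound c by blast
   have "\<pi> ^ k * c i \<in> vr" if "k \<ge> m" for k
    using vr_closed(4)[OF vr_power[OF unif_vr, of "k - m"] m] that
    by (simp add: mult.assoc[symmetric] power_add[symmetric])
   then show "\<exists>m. \<forall>k\<ge>m. \<pi> ^ k * c i \<in> vr" by blast
  qed simp
  then obtain m where "\<forall>i<n. \<pi> ^ m * c i \<in> vr" by auto
  then have "\<pi> ^ m * x \<in> lat0" unfolding lat0_def c(2)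
   by (auto intro!: exI[of _ "\<lambda>i. \<pi> ^ m * c i"] simp: sum_distrib_left mult.assoc)
  then show ?thesis by blast
qed

lemma lattice_comm:
  assumes "lattice A" "lattice B"
  shows "\<exists>m. \<forall>k\<ge>m. \<forall>y\<in>A. \<pi> ^ k * y \<in> B"
proof -
  from assms obtain i j where i: "!!y. y \<in> A ==> \<pi> ^ i * y \<in> lat0" and j: "!!y. y \<in> lat0 ==> \<pi> ^ j * y \<in> B"
   and B: "submod B"
   unfolding lattice_def by blast
  have "\<pi> ^ (j + i) * y \<in> B" if "y \<in> A" for y using j[OF i[OF that]] by (simp add: power_add mult.assoc)
  then show ?thesis using pi_mult_mono[OF B] by blast
qed

lemma lattice_absorb: "lattice A ==> x \<in> L ==> \<exists>m. \<pi> ^ m * x \<in> A"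
proof -
  assume A: "lattice A" and "x \<in> L"
  then obtain i where "\<pi> ^ i * x \<in> lat0" using lat0_absorb by blast
  moreover obtain j where "!!y. y \<in> lat0 ==> \<pi> ^ j * y \<in> A" using A unfolding lattice_def by blast
  ultimately have "\<pi> ^ (j + i) * x \<in> A" by (simp add: power_add mult.assoc)
  then show ?thesis by blast
qed

lemma lattice_mult_bound:
  assumes A: "lattice A" and x: "x \<in> L"
  shows "\<exists>m. \<forall>k\<ge>m. \<forall>y\<in>A. \<pi> ^ k * (x * y) \<in> A"
proof -
  have sA: "submod A" using A by (simp add: lattice_def)
  have "\<exists>m. \<forall>i\<in>{..<n}. \<forall>k\<ge>m. \<pi> ^ k * (x * u i) \<in> A"
  proof (rule finite_bound_ex)
   fix i assume "i \<in> {..<n}"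
   then have "x * u i \<in> L" using x u subf_closed(4)[OF L] by auto
   then show "\<exists>m. \<forall>k\<ge>m. \<pi> ^ k * (x * u i) \<in> A" using lattice_absorb[OF A] pi_mult_mono[OF sA] by blast
  qed simp
  then obtain m where m: "!!i. i < n ==> \<pi> ^ m * (x * u i) \<in> A" by auto
  have 0: "\<pi> ^ m * (x * y) \<in> A" if "y \<in> lat0" for y
  proof -
   from that obtain c where c: "\<forall>i<n. c i \<in> vr" "y = (\<Sum>i<n. c i * u i)" unfolding lat0_def by blast
   have "(\<Sum>i<n. c i * (\<pi> ^ m * (x * u i))) \<in> A" using m c(1) submodD(4)[OF sA] by (intro submod_sum[OF sA]) auto
   then show ?thesis unfolding c(2) by (simp add: sum_distrib_left algebra_simps)
  qed
  obtain j where j: "!!y. y \<in> A ==> \<pi> ^ j * y \<in> lat0" using A unfolding lattice_def by blast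
  have "\<pi> ^ (m + j) * (x * y) \<in> A" if "y \<in> A" for y
   using 0[OF j[OF that]] by (simp add: power_add algebra_simps)
  then show ?thesis using pi_mult_mono[OF sA] by blast
qed

text \<open>
  Integrality bounds the powers of `x`, so that the elements that all powers of `x` send into `A`
  still form a lattice.
\<close>
lemma lattice_colon:
  assumes A: "lattice A" and x: "x \<in> ic"
  defines "B \<equiv> {y\<in>L. \<forall>i. x ^ i * y \<in> A}"
  shows "lattice B" "stab x B" "!!z. z \<in> L ==> stab z A ==> stab z B"
proof -
  have sA: "submod A" using A by (simp add: lattice_def)
  have xL: "x \<in> L" using x by (simp add: ic_def)
  obtain D where D: "lattice D" "stab x D" using x by (auto simp: ic_def)
  obtain i where i: "!!y. y \<in> A ==> \<pi> ^ i * y \<in> D" using lattice_comm[OF A D(1)] by blast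
  obtain j where j: "!!y. y \<in> D ==> \<pi> ^ j * y \<in> A" using lattice_comm[OF D(1) A] by blast
  have sB: "submod B" unfolding submod_def B_def
   using submodD[OF sA] subf_closed[OF L] vrL by (auto simp: distrib_left mult.left_commute[of "x ^ _"])
  have BA: "B \<subseteq> A" using power_0[of x] unfolding B_def by (metis (no_types, lifting) mem_Collect_eq mult_1 subsetI)
  have "\<pi> ^ (j + i) * y \<in> B" if "y \<in> A" for y
  proof -
   have "x ^ l * (\<pi> ^ (j + i) * y) \<in> A" for l
    using j[OF stab_power[OF D(2) i[OF that], of l]] by (simp add: power_add algebra_simps)
   then show ?thesis unfolding B_def using that submodD(1)[OF sA] subf_closed(4)[OF L] piL by auto
  qed
  moreover obtain m where "!!y. y \<in> lat0 ==> \<pi> ^ m * y \<in> A" using A unfolding lattice_def by blast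
  ultimately have "\<pi> ^ ((j + i) + m) * y \<in> B" if "y \<in> lat0" for y
   using that by (simp add: power_add mult.assoc)
  then show "lattice B" using sB A BA unfolding lattice_def by blast
  show "stab x B" unfolding stab_def B_def
   using subf_closed(4)[OF L xL] by (auto simp: mult.assoc[symmetric] power_Suc2[symmetric] simp del: power_Suc)
  show "stab z B" if "z \<in> L" "stab z A" for z unfolding stab_def B_def
   using subf_closed(4)[OF L that(1)] stabD[OF that(2)] by (auto simp: mult.left_commute[of "x ^ _"])
qed

text \<open>
  Repeating the preceding construction makes one lattice stable under finitely many elements. This
  yields at once that integral elements form a ring.
\<close>
lemma common_lattice:
  assumes "finite S" "S \<subseteq> ic"
  shows "\<exists>A. lattice A & (\<forall>x\<in>S. stab x A)"
  using assms
proof (induction S)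
  case empty
  then show ?case using lat0_lattice by blast
next
  case (insert x S)
  then obtain A where A: "lattice A" "\<forall>x\<in>S. stab x A" by auto
  have "!!y. y \<in> S ==> y \<in> L" using insert.prems by (auto simp: ic_def)
  with lattice_colon[OF A(1), of x] A(2) insert.prems show ?case
   by (intro exI[of _ "{y\<in>L. \<forall>i. x ^ i * y \<in> A}"]) auto
qed

lemma icI: "x \<in> L ==> lattice A ==> stab x A ==> x \<in> ic" by (auto simp: ic_def)

lemma ic_L: "ic \<subseteq> L" by (auto simp: ic_def)

lemma ic_closed:
  "0 \<in> ic" "1 \<in> ic" "x \<in> vr ==> x \<in> ic" "x \<in> ic ==> y \<in> ic ==> x + y \<in> ic" "x \<in> ic ==> y \<in> ic ==> x * y \<in> ic"
  "x \<in> ic ==> - x \<in> ic" "x \<in> ic ==> y \<in> ic ==> x - y \<in> ic"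
proof -
  show vr: "x \<in> vr ==> x \<in> ic" for x
   using icI[OF _ lat0_lattice, of x] vrL submodD(4)[OF lat0_submod] by (auto simp: stab_def)
  show "0 \<in> ic" "1 \<in> ic" using vr vr_closed(1,2) by auto
  show a: "x \<in> ic ==> y \<in> ic ==> x + y \<in> ic" for x y
  proof -
   assume "x \<in> ic" "y \<in> ic"
   then obtain A where "lattice A" "stab x A" "stab y A" using common_lattice[of "{x, y}"] by auto
   moreover have "x + y \<in> L" using \<open>x \<in> ic\<close> \<open>y \<in> ic\<close> subf_closed(3)[OF L] by (auto simp: ic_def)
   moreover have "stab (x + y) A" using calculation submodD(3)[of A]
    unfolding stab_def lattice_def distrib_right by blast
   ultimately show "x + y \<in> ic" using icI by blast
  qed
  show m: "x \<in> ic ==> y \<in> ic ==> x * y \<in> ic" for x y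
  proof -
   assume "x \<in> ic" "y \<in> ic"
   then obtain A where "lattice A" "stab x A" "stab y A" using common_lattice[of "{x, y}"] by auto
   moreover have "x * y \<in> L" using \<open>x \<in> ic\<close> \<open>y \<in> ic\<close> subf_closed(4)[OF L] by (auto simp: ic_def)
   moreover have "stab (x * y) A" using calculation unfolding stab_def mult.assoc by blast
   ultimately show "x * y \<in> ic" using icI by blast
  qed
  show n: "x \<in> ic ==> - x \<in> ic" for x using m[of "- 1" x] vr[of "- 1"] vr_closed by auto
  show "x \<in> ic ==> y \<in> ic ==> x - y \<in> ic" using a[of x "- y"] n[of y] by simp
qed

lemma ic_power: "x \<in> ic ==> x ^ m \<in> ic"
  by (induction m) (auto intro: ic_closed)

lemma ic_sum: "(!!i. i \<in> I ==> f i \<in> ic) ==> sum f I \<in> ic"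
  by (induction I rule: infinite_finite_induct) (auto intro: ic_closed)

lemma ic_frac: "x \<in> L ==> \<exists>m. \<pi> ^ m * x \<in> ic"
proof -
  assume x: "x \<in> L"
  with lattice_mult_bound[OF lat0_lattice] obtain m where "\<forall>y\<in>lat0. \<pi> ^ m * (x * y) \<in> lat0" by blast
  then have "\<pi> ^ m * x \<in> ic" using x piL subf_closed(4)[OF L]
   by (intro icI[OF _ lat0_lattice]) (auto simp: stab_def mult.assoc)
  then show ?thesis by blast
qed

end

section \<open>The index of an integral element\<close>

context dvf_ext
begin

text \<open>
  Clear denominators in an algebraic relation, dividing by a coefficient of least valuation.
\<close>
lemma primitive_relation:
  assumes \<theta>: "\<theta> \<in> L"
  obtains N a j where "j \<le> N" "a j = 1" "!!i. a i \<in> vr" "(\<Sum>i\<le>N. a i * \<theta> ^ i) = 0" "N > 0"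
proof -
  from alg[OF \<theta>] obtain p where p: "p \<in> polys K" "p ~= 0" "poly p \<theta> = 0" by (auto simp: alg_over_def)
  let ?c = "Polynomial.coeff p"
  have cK: "?c i \<in> K" for i using p(1) by (simp add: polys_def)
  define I where "I = {i. i \<le> Polynomial.degree p & ?c i ~= 0}"
  have "finite I" "I ~= {}" using p(2) unfolding I_def by auto
  then obtain j where j: "j \<in> I" "!!i. i \<in> I ==> v (?c j) \<le> v (?c i)"
   using ex_is_arg_min_if_finite[of I "\<lambda>i. v (?c i)"] by (auto simp: is_arg_min_linorder)
  define a where "a i = ?c i / ?c j" for i
  have a: "a i \<in> vr" for i
  proof (cases "?c i = 0")
   case False
   then have "i \<in> I" unfolding I_def by (simp add: le_degree)
   with j cK[of i] cK[of j] False v_divide[of "?c i" "?c j"] show ?thesis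
    unfolding a_def vr_def I_def by (auto intro: subf_closed[OF K])
  qed (simp add: a_def vr_closed)
  have s: "(\<Sum>i\<le>Polynomial.degree p. a i * \<theta> ^ i) = 0"
   using p(3) unfolding poly_altdef a_def by (simp add: sum_divide_distrib[symmetric] divide_inverse mult.assoc mult.left_commute[of _ "inverse _"] sum_distrib_left[symmetric])
  have aj: "a j = 1" using j(1) unfolding a_def I_def by simp
  have "Polynomial.degree p > 0"
  proof (rule ccontr)
   assume "\<not> Polynomial.degree p > 0"
   with s j(1) aj show False unfolding I_def by auto
  qed
  with that[of j "Polynomial.degree p" a] j(1) aj a s show ?thesis unfolding I_def by auto
qed

text \<open>
  Seidenberg: from a relation with coefficients `a i`, one of which is 1, form the Horner partial
  sums. They and their multiples by `\<theta>` are integral, and those around the coefficient 1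
  give the identity. It says that the fractional ideal generated by 1 and `\<theta>` is
  invertible.
\<close>
lemma prufer:
  assumes \<theta>: "\<theta> \<in> L"
  obtains p r where "p \<in> ic" "r \<in> ic" "\<theta> * p \<in> ic" "\<theta> * r \<in> ic" "p - \<theta> * r = 1"
proof -
  obtain N a j0 where j0: "j0 \<le> N" "a j0 = 1" and a: "!!i. a i \<in> vr" and rel: "(\<Sum>i\<le>N. a i * \<theta> ^ i) = 0"
   and N: "N > 0" using primitive_relation[OF \<theta>] by metis
  define A where "A = {y\<in>L. \<forall>i<N. \<theta> ^ i * y \<in> lat0}"
  define z where "z j = (\<Sum>l\<le>j. a (N - j + l) * \<theta> ^ l)" for j
  have sA: "submod A" unfolding submod_def A_def
   using submodD[OF lat0_submod] subf_closed[OF L] vrL by (auto simp: distrib_left mult.left_commute[of "\<theta> ^ _"])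
  have A0: "A \<subseteq> lat0" using N unfolding A_def by (auto dest!: spec[of _ 0])
  have "\<exists>m. \<forall>i\<in>{..<N}. \<forall>k\<ge>m. \<forall>y\<in>lat0. \<pi> ^ k * (\<theta> ^ i * y) \<in> lat0"
   using lattice_mult_bound[OF lat0_lattice subf_power[OF L \<theta>]] by (intro finite_bound_ex) auto
  then obtain m where m: "!!i y. i < N ==> y \<in> lat0 ==> \<pi> ^ m * (\<theta> ^ i * y) \<in> lat0" by auto
  have "\<pi> ^ m * y \<in> A" if y: "y \<in> lat0" for y unfolding A_def
   using m[OF _ y] y submodD(1)[OF lat0_submod] piL(1)[of m] subf_closed(4)[OF L]
   by (auto simp: mult.left_commute[of "\<theta> ^ _"])
  then have lA: "lattice A" using sA A0 submodD(7)[OF lat0_submod] unfolding lattice_def by blast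
  have zL: "z j \<in> L" for j unfolding z_def using a vrL \<theta>
   by (auto intro!: subf_sum[OF L] subf_closed(4)[OF L] subf_power[OF L])
  have zN: "z N = 0" unfolding z_def using rel by simp
  have zic: "z j \<in> ic" if j: "j \<le> N" for j
  proof (rule icI[OF zL lA])
   have split: "\<theta> ^ (N - j) * z j + (\<Sum>l<N - j. a l * \<theta> ^ l) = 0"
   proof -
    have "(\<Sum>i\<le>N. a i * \<theta> ^ i) = (\<Sum>l<N - j. a l * \<theta> ^ l) + (\<Sum>l\<in>{N - j..N}. a l * \<theta> ^ l)"
     using j by (subst sum.union_disjoint[symmetric]) (auto intro!: sum.cong)
    also have "(\<Sum>l\<in>{N - j..N}. a l * \<theta> ^ l) = (\<Sum>l\<le>j. a (N - j + l) * \<theta> ^ (N - j + l))"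
     by (rule sum.reindex_bij_witness[of _ "\<lambda>l. N - j + l" "\<lambda>l. l - (N - j)"]) (use j in auto)
    also have "... = \<theta> ^ (N - j) * z j" unfolding z_def sum_distrib_left by (simp add: power_add algebra_simps)
    finally show ?thesis using rel by (simp add: algebra_simps)
   qed
   show "stab (z j) A" unfolding stab_def
   proof
    fix y assume y: "y \<in> A"
    have *: "a k * (\<theta> ^ l * y) \<in> lat0" if "l < N" for k l
     using y that a submodD(4)[OF lat0_submod] unfolding A_def by auto
    have "\<theta> ^ i * (z j * y) \<in> lat0" if i: "i < N" for i
    proof (cases "i + j < N")
     case True
     have "(\<Sum>l\<le>j. a (N - j + l) * (\<theta> ^ (i + l) * y)) \<in> lat0"
      using True by (intro submod_sum[OF lat0_submod] *) auto
     then show ?thesis unfolding z_def by (simp add: sum_distrib_left sum_distrib_right power_add algebra_simps)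
    next
     case False
     have "\<theta> ^ i * z j = \<theta> ^ (i - (N - j)) * (\<theta> ^ (N - j) * z j)"
      using False by (simp add: mult.assoc[symmetric] power_add[symmetric])
     also have "... = \<theta> ^ (i - (N - j)) * - (\<Sum>l<N - j. a l * \<theta> ^ l)"
      using split unfolding eq_neg_iff_add_eq_0[symmetric] by simp
     finally have "\<theta> ^ i * (z j * y) = - (\<Sum>l<N - j. a l * (\<theta> ^ (i - (N - j) + l) * y))"
      by (simp add: sum_distrib_left sum_distrib_right power_add algebra_simps)
     moreover have "(\<Sum>l<N - j. a l * (\<theta> ^ (i - (N - j) + l) * y)) \<in> lat0"
      using False i by (intro submod_sum[OF lat0_submod] *) auto
     ultimately show ?thesis using submodD(5)[OF lat0_submod] by simp
    qed
    then show "z j * y \<in> A" using y zL[of j] subf_closed(4)[OF L] unfolding A_def by auto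
   qed
  qed
  have step: "\<theta> * z j = z (Suc j) - a (N - Suc j)" if "j < N" for j
  proof -
   have "z (Suc j) = a (N - Suc j) + (\<Sum>l\<le>j. a (N - Suc j + Suc l) * \<theta> ^ Suc l)"
    unfolding z_def by (simp add: sum.atMost_Suc_shift del: power_Suc sum.atMost_Suc)
   also have "(\<Sum>l\<le>j. a (N - Suc j + Suc l) * \<theta> ^ Suc l) = \<theta> * z j"
    unfolding z_def sum_distrib_left using that by (intro sum.cong) (auto simp: Suc_diff_Suc algebra_simps)
   finally show ?thesis by simp
  qed
  have zt: "\<theta> * z j \<in> ic" if "j \<le> N" for j
  proof (cases "j = N")
   case False
   then show ?thesis using step[of j] that zic[of "Suc j"] ic_closed(3)[OF a] ic_closed(7) by auto
  qed (use zN ic_closed in simp)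
  show ?thesis
  proof (cases "N - j0")
   case 0
   then have "z 0 = 1" using j0 unfolding z_def by simp
   then show ?thesis using that[of 1 0] zt[of 0] ic_closed by auto
  next
   case (Suc k)
   then have "\<theta> * z k = z (Suc k) - 1" using step[of k] j0 by (metis Suc_le_lessD diff_diff_cancel diff_le_self)
   then show ?thesis using that[of "z (Suc k)" "z k"] zic[of "Suc k"] zic[of k] zt[of k] zt[of "Suc k"] Suc
    by auto
  qed
qed

lemma lattice_submod: "lattice A ==> submod A" by (simp add: lattice_def)

lemma lattice_asg: "lattice A ==> asg A" using submodD(8) lattice_submod by blast

lemma submod_scale: "submod A ==> x \<in> L ==> submod ((*) x ` A)"
  unfolding submod_def
proof (intro conjI ballI)
  assume A: "A \<subseteq> L & 0 \<in> A & (\<forall>x\<in>A. \<forall>y\<in>A. x + y \<in> A) & (\<forall>c\<in>vr. \<forall>x\<in>A. c * x \<in> A)" and x: "x \<in> L"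
  show "(*) x ` A \<subseteq> L" using A x subf_closed(4)[OF L] by auto
  show "0 \<in> (*) x ` A" using A by (auto intro: image_eqI[of _ _ 0])
  fix y assume y: "y \<in> (*) x ` A"
  then obtain y' where y': "y' \<in> A" "y = x * y'" by auto
  show "y + w \<in> (*) x ` A" if w: "w \<in> (*) x ` A" for w
  proof -
   obtain w' where "w' \<in> A" "w = x * w'" using w by auto
   with y' A show ?thesis by (intro image_eqI[of _ _ "y' + w'"]) (auto simp: distrib_left)
  qed
  show "c * y \<in> (*) x ` A" if "c \<in> vr" for c
   using y' A that by (intro image_eqI[of _ _ "c * y'"]) auto
qed

lemma lattice_scale:
  assumes A: "lattice A" and x: "x \<in> L" "x ~= 0"
  shows "lattice ((*) x ` A)"
proof -
  have ix: "inverse x \<in> L" using x subf_closed(6)[OF L] by auto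
  obtain m k where m: "!!y. y \<in> A ==> \<pi> ^ m * (inverse x * y) \<in> A" and k: "!!y. y \<in> A ==> \<pi> ^ k * (x * y) \<in> A"
   using lattice_mult_bound[OF A ix] lattice_mult_bound[OF A x(1)] by blast
  obtain i j where i: "!!y. y \<in> lat0 ==> \<pi> ^ i * y \<in> A" and j: "!!y. y \<in> A ==> \<pi> ^ j * y \<in> lat0"
   using A unfolding lattice_def by blast
  have "\<pi> ^ (m + i) * y \<in> (*) x ` A" if "y \<in> lat0" for y
   using m[OF i[OF that]] x by (intro image_eqI[of _ _ "\<pi> ^ m * (inverse x * (\<pi> ^ i * y))"]) (auto simp: power_add field_simps)
  moreover have "\<pi> ^ (j + k) * y \<in> lat0" if "y \<in> (*) x ` A" for y
   using that j[OF k] by (auto simp: power_add mult.assoc)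
  ultimately show ?thesis unfolding lattice_def using submod_scale[OF lattice_submod[OF A] x(1)] by blast
qed

lemma lattice_inter:
  assumes A: "lattice A" and B: "lattice B"
  shows "lattice (A \<inter> B)"
proof -
  have sA: "submod A" and sB: "submod B" using A B by (auto simp: lattice_def)
  obtain m where m: "\<forall>k\<ge>m. \<forall>y\<in>lat0. \<pi> ^ k * y \<in> A" using lattice_comm[OF lat0_lattice A] by blast
  obtain l where l: "\<forall>k\<ge>l. \<forall>y\<in>lat0. \<pi> ^ k * y \<in> B" using lattice_comm[OF lat0_lattice B] by blast
  have "\<forall>y\<in>lat0. \<pi> ^ (max m l) * y \<in> A \<inter> B" using m l by simp
  moreover have "submod (A \<inter> B)" using sA sB unfolding submod_def by auto
  ultimately show ?thesis using A unfolding lattice_def by blast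
qed

text \<open>
  Coordinates with respect to the basis reduce the count to residue classes of the valuation ring,
  one for each basis vector.
\<close>
lemma idx_lat0: "idx lat0 ((*) \<pi> ` lat0) (card R ^ n)"
proof -
  let ?F = "{..<n} \<rightarrow>\<^sub>E R"
  define g where "g c = (\<Sum>i<n. c i * u i)" for c
  have gz: "g c - g d = (\<Sum>i<n. (c i - d i) * u i)" for c d unfolding g_def by (simp add: left_diff_distrib sum_subtractf)
  have mem: "g c - g d \<in> (*) \<pi> ` lat0 \<longleftrightarrow> (\<forall>i<n. c i - d i \<in> mi)" if cd: "\<forall>i<n. c i \<in> vr" "\<forall>i<n. d i \<in> vr" for c d
  proof
   assume "g c - g d \<in> (*) \<pi> ` lat0"
   then obtain e where e: "\<forall>i<n. e i \<in> vr" "g c - g d = \<pi> * (\<Sum>i<n. e i * u i)" unfolding lat0_def by auto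
   have "c i - d i - \<pi> * e i = 0" if "i < n" for i
   proof (rule indep[of "\<lambda>i. c i - d i - \<pi> * e i"])
    show "c i - d i - \<pi> * e i \<in> K" if "i < n" for i using that cd e(1) vr_K unif_vr
     by (auto intro!: subf_closed[OF K])
    show "(\<Sum>i<n. (c i - d i - \<pi> * e i) * u i) = 0"
     using e(2) unfolding gz by (simp add: algebra_simps sum_subtractf sum_distrib_left sum.distrib)
   qed (use that in auto)
   then have "(c i - d i) / \<pi> = e i" if "i < n" for i using that unif by (auto simp: field_simps)
   with e(1) show "\<forall>i<n. c i - d i \<in> mi" unfolding mi_iff by auto
  next
   assume "\<forall>i<n. c i - d i \<in> mi"
   then have "(\<Sum>i<n. ((c i - d i) / \<pi>) * u i) \<in> lat0" unfolding mi_iff lat0_def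
    by (intro CollectI exI[of _ "\<lambda>i. (c i - d i) / \<pi>"]) auto
   then show "g c - g d \<in> (*) \<pi> ` lat0" unfolding gz
    using unif by (intro image_eqI[of _ _ "\<Sum>i<n. ((c i - d i) / \<pi>) * u i"]) (auto simp: sum_distrib_left)
  qed
  have RF: "\<forall>i<n. c i \<in> vr" if "c \<in> ?F" for c using that R_vr by (auto simp: PiE_iff)
  have uniq: "c = d" if "c \<in> ?F" "d \<in> ?F" "g c - g d \<in> (*) \<pi> ` lat0" for c d
  proof (rule PiE_ext[OF that(1,2)])
   fix i assume "i \<in> {..<n}"
   then have "c i - d i \<in> mi" "c i \<in> R" "d i \<in> R" "c i - c i \<in> mi" using that mem[OF RF[OF that(1)] RF[OF that(2)]]
    by (auto simp: mi_iff vr_closed)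
   then show "c i = d i" using R_rep'[of "c i"] R_vr by blast
  qed
  have inj: "inj_on g ?F"
  proof
   fix c d assume "c \<in> ?F" "d \<in> ?F" "g c = g d"
   then show "c = d" using uniq[of c d] submodD(2)[OF lat0_submod] by (metis diff_self image_eqI mult_zero_right)
  qed
  have sp: "asg ((*) \<pi> ` lat0)" using submodD(8) submod_scale[OF lat0_submod piL(2)] by blast
  have "\<forall>a\<in>lat0. \<exists>!t\<in>g ` ?F. a - t \<in> (*) \<pi> ` lat0"
  proof (intro ballI ex_ex1I)
   fix a assume "a \<in> lat0"
   then obtain c where c: "\<forall>i<n. c i \<in> vr" "a = g c" unfolding lat0_def g_def by blast
   then have "\<forall>i<n. \<exists>r. r \<in> R & c i - r \<in> mi" using R_rep' by blast
   then obtain d where d: "!!i. i < n ==> d i \<in> R & c i - d i \<in> mi" by metis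
   define d' where "d' = restrict d {..<n}"
   have d': "d' \<in> ?F" "\<forall>i<n. c i - d' i \<in> mi" using d unfolding d'_def by auto
   with mem[OF c(1) RF[OF d'(1)]] show "\<exists>t. t \<in> g ` ?F & a - t \<in> (*) \<pi> ` lat0" unfolding c(2) by blast
  next
   fix a t t' assume t: "t \<in> g ` ?F & a - t \<in> (*) \<pi> ` lat0" "t' \<in> g ` ?F & a - t' \<in> (*) \<pi> ` lat0"
   then have "t - t' \<in> (*) \<pi> ` lat0"
    using asg_diff_trans[OF sp asg_diff_sym[OF sp, of a t], of t'] by simp
   moreover obtain c where "c \<in> ?F" "t = g c" using t(1) by (elim conjE imageE)
   moreover obtain d where "d \<in> ?F" "t' = g d" using t(2) by (elim conjE imageE)
   ultimately show "t = t'" using uniq[of c d] by simp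
  qed
  moreover have "g ` ?F \<subseteq> lat0" using RF unfolding g_def lat0_def by blast
  moreover have "card (g ` ?F) = card R ^ n" using card_image[OF inj] by (simp add: card_PiE)
  moreover have "finite (g ` ?F)" using R_fin by (simp add: finite_PiE)
  ultimately show ?thesis unfolding idx_def by (intro exI[of _ "g ` ?F"] conjI)
qed

lemma lat0_chain: "\<exists>k. idx lat0 ((*) (\<pi> ^ m) ` lat0) k"
proof (induction m)
  case 0
  then show ?case using idx_refl[OF lattice_asg[OF lat0_lattice]] by (auto simp: image_def)
next
  case (Suc m)
  then obtain k where k: "idx lat0 ((*) (\<pi> ^ m) ` lat0) k" by blast
  have lm: "lattice ((*) (\<pi> ^ m) ` lat0)" for m using lattice_scale[OF lat0_lattice] piL unif by auto
  have "idx ((*) (\<pi> ^ m) ` lat0) ((*) (\<pi> ^ m) ` (*) \<pi> ` lat0) (card R ^ n)"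
   using idx_scale[OF _ idx_lat0, of "\<pi> ^ m"] unif by simp
  moreover have "(*) (\<pi> ^ m) ` (*) \<pi> ` lat0 = (*) (\<pi> ^ Suc m) ` lat0" by (auto simp: image_image mult_ac)
  ultimately have "idx ((*) (\<pi> ^ m) ` lat0) ((*) (\<pi> ^ Suc m) ` lat0) (card R ^ n)" by simp
  moreover have "(*) (\<pi> ^ Suc m) ` lat0 \<subseteq> (*) (\<pi> ^ m) ` lat0"
   using submodD(4)[OF lat0_submod unif_vr] by (auto simp: mult.assoc mult.left_commute)
  moreover have "(*) (\<pi> ^ m) ` lat0 \<subseteq> lat0" using submodD(7)[OF lat0_submod] by auto
  ultimately show ?case using idx_tower[OF lattice_asg[OF lm] lattice_asg[OF lm] lattice_asg[OF lat0_lattice]] k by blast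
qed

lemma idx_lattice_exists:
  assumes A: "lattice A" and B: "lattice B" and sub: "B \<subseteq> A"
  shows "\<exists>k. idx A B k"
proof -
  obtain i where i: "!!y. y \<in> lat0 ==> \<pi> ^ i * y \<in> B" using B unfolding lattice_def by blast
  obtain j where j: "!!y. y \<in> A ==> \<pi> ^ j * y \<in> lat0" using A unfolding lattice_def by blast
  have nz: "\<pi> ^ j ~= 0" using unif by simp
  have lm: "lattice ((*) (\<pi> ^ m) ` lat0)" for m using lattice_scale[OF lat0_lattice] piL unif by auto
  have lA: "lattice ((*) (\<pi> ^ m) ` A)" for m using lattice_scale[OF A] piL unif by auto
  have lB: "lattice ((*) (\<pi> ^ m) ` B)" for m using lattice_scale[OF B] piL unif by auto
  obtain k where k: "idx lat0 ((*) (\<pi> ^ (j + i)) ` lat0) k" using lat0_chain by blast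
  have s1: "(*) (\<pi> ^ (j + i)) ` lat0 \<subseteq> (*) (\<pi> ^ j) ` B" using i by (auto simp: power_add mult.assoc)
  have s2: "(*) (\<pi> ^ j) ` B \<subseteq> (*) (\<pi> ^ j) ` A" using sub by auto
  have s3: "(*) (\<pi> ^ j) ` A \<subseteq> lat0" using j by auto
  obtain l where "idx lat0 ((*) (\<pi> ^ j) ` B) l"
   using idx_between(1)[OF lattice_asg[OF lB] lattice_asg[OF lm] s1 _ k] s2 s3 by blast
  then obtain l' where "idx ((*) (\<pi> ^ j) ` A) ((*) (\<pi> ^ j) ` B) l'"
   using idx_between(2)[OF lattice_asg[OF lA] lattice_asg[OF lB] s2 s3] by blast
  from idx_scale[OF _ this, of "inverse (\<pi> ^ j)"] nz show ?thesis
   by (auto simp: image_image mult.assoc[symmetric])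
qed

text \<open>
  Compare the two lattices with a common sublattice `C`: the index of `x C` in `A` can be computed
  through `C` or through `x A`, and multiplication by `x` preserves indices.
\<close>
lemma idx_independent:
  assumes x: "x \<in> L" "x ~= 0" and A: "lattice A" "stab x A" and B: "lattice B" "stab x B"
   and k: "idx A ((*) x ` A) k" and l: "idx B ((*) x ` B) l"
  shows "k = l"
proof -
  have *: "k = l" if A: "lattice A" "stab x A" and B: "lattice B" "stab x B"
   and k: "idx A ((*) x ` A) k" and l: "idx B ((*) x ` B) l" and sub: "B \<subseteq> A" for A B k l
  proof -
   obtain i where i: "idx A B i" using idx_lattice_exists[OF A(1) B(1) sub] by blast
   have sA: "(*) x ` A \<subseteq> A" and sB: "(*) x ` B \<subseteq> B" using A(2) B(2) by (auto simp: stab_def)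
   have sAB: "(*) x ` B \<subseteq> (*) x ` A" using sub by auto
   note as = lattice_asg[OF A(1)] lattice_asg[OF B(1)] lattice_asg[OF lattice_scale[OF A(1) x]] lattice_asg[OF lattice_scale[OF B(1) x]]
   have "idx A ((*) x ` B) (i * l)" by (rule idx_tower[OF as(4,2,1) sB sub i l])
   moreover have "idx A ((*) x ` B) (k * i)" by (rule idx_tower[OF as(4,3,1) sAB sA k idx_scale[OF x(2) i]])
   ultimately have "i * l = k * i" using idx_unique[OF as(4)] by blast
   then show ?thesis using idx_pos[OF as(1) i] by simp
  qed
  have I: "lattice (A \<inter> B)" "stab x (A \<inter> B)" using lattice_inter A B by (auto simp: stab_def)
  have "(*) x ` (A \<inter> B) \<subseteq> A \<inter> B" using I(2) by (auto simp: stab_def)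
  then obtain m where "idx (A \<inter> B) ((*) x ` (A \<inter> B)) m" using idx_lattice_exists[OF I(1) lattice_scale[OF I(1) x]] by blast
  with *[OF A I k] *[OF B I l] show ?thesis by auto
qed

text \<open>
  By `idx_independent` the choice of the lattice does not matter; the index plays the role of the
  absolute norm of `x`.
\<close>
definition ind :: "'a \<Rightarrow> nat" where
  "ind x = (SOME k. \<exists>A. lattice A & stab x A & idx A ((*) x ` A) k)"

lemma ind:
  assumes x: "x \<in> L" "x ~= 0" and A: "lattice A" "stab x A"
  shows "idx A ((*) x ` A) (ind x)"
proof -
  have "(*) x ` A \<subseteq> A" using A(2) by (auto simp: stab_def)
  then obtain k where k: "idx A ((*) x ` A) k" using idx_lattice_exists[OF A(1) lattice_scale[OF A(1) x]] by blast
  then have "\<exists>k A. lattice A & stab x A & idx A ((*) x ` A) k" using A by blast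
  then have "\<exists>A. lattice A & stab x A & idx A ((*) x ` A) (ind x)" unfolding ind_def by (rule someI_ex)
  then obtain B where "lattice B" "stab x B" "idx B ((*) x ` B) (ind x)" by blast
  with idx_independent[OF x A this(1,2) k this(3)] k show ?thesis by simp
qed

lemma ind_mult:
  assumes "x \<in> ic" "y \<in> ic" "x ~= 0" "y ~= 0"
  shows "ind (x * y) = ind x * ind y"
proof -
  obtain A where A: "lattice A" "stab x A" "stab y A" using common_lattice[of "{x, y}"] assms by auto
  have L': "x \<in> L" "y \<in> L" using assms ic_L by auto
  have sxy: "stab (x * y) A" using A by (auto simp: stab_def mult.assoc)
  have "idx A ((*) x ` A) (ind x)" "idx ((*) x ` A) ((*) x ` (*) y ` A) (ind y)"
   using ind[OF L'(1) assms(3) A(1,2)] idx_scale[OF assms(3) ind[OF L'(2) assms(4) A(1,3)]] by auto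
  moreover have "(*) x ` (*) y ` A = (*) (x * y) ` A" by (auto simp: image_image mult.assoc)
  moreover have "(*) (x * y) ` A \<subseteq> (*) x ` A" "(*) x ` A \<subseteq> A" using A by (auto simp: stab_def mult.assoc)
  ultimately have "idx A ((*) (x * y) ` A) (ind x * ind y)"
   using idx_tower[OF lattice_asg[OF lattice_scale[OF A(1), of "x * y"]] lattice_asg[OF lattice_scale[OF A(1) L'(1) assms(3)]] lattice_asg[OF A(1)]]
    L' assms subf_closed(4)[OF L] by auto
  moreover have "idx A ((*) (x * y) ` A) (ind (x * y))" using ind[OF _ _ A(1) sxy] L' assms subf_closed(4)[OF L] by auto
  ultimately show ?thesis using idx_unique[OF lattice_asg[OF lattice_scale[OF A(1), of "x * y"]]] L' assms subf_closed(4)[OF L] by auto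
qed

lemma ind_pos: "x \<in> ic ==> x ~= 0 ==> ind x > 0"
  using ind[of x] idx_pos lattice_asg unfolding ic_def by blast

lemma ind_1: assumes "x \<in> ic" "x ~= 0" "ind x = 1" shows "1 / x \<in> ic"
proof -
  obtain A where A: "lattice A" "stab x A" and x: "x \<in> L" using assms by (auto simp: ic_def)
  have "A \<subseteq> (*) x ` A" using idx_1[OF lattice_asg[OF A(1)] lattice_asg[OF lattice_scale[OF A(1) x assms(2)]]]
    ind[OF x assms(2) A] assms(3) by simp
  then have "stab (1 / x) A" using assms(2) unfolding stab_def by auto
  then show ?thesis using A x subf_closed(2,8)[OF L] by (intro icI) auto
qed

lemma ind_pi: "ind \<pi> = card R ^ n"
proof -
  have "stab \<pi> lat0" using submodD(4)[OF lat0_submod unif_vr] by (simp add: stab_def)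
  from idx_unique[OF lattice_asg[OF lattice_scale[OF lat0_lattice piL(2) unif(2)]] ind[OF piL(2) unif(2) lat0_lattice this] idx_lat0]
  show ?thesis .
qed

lemma n_pos: "n > 0"
  using span[OF subf_closed(2)[OF L]] by (cases n) auto

lemma pi_not_unit: "1 / \<pi> ~: ic"
proof
  assume "1 / \<pi> \<in> ic"
  then have "ind (\<pi> * (1 / \<pi>)) = ind \<pi> * ind (1 / \<pi>)" using unif ic_closed(3)[OF unif_vr] by (intro ind_mult) auto
  moreover have "ind 1 = 1"
   using ind_mult[of 1 1] ind_pos[of 1] ic_closed(2) by simp
  ultimately have "card R ^ n = 1" using unif ind_pi by auto
  then show False using R_card n_pos one_less_power[of "card R" n] by simp
qed

lemma ind_unit: "x \<in> ic ==> x ~= 0 ==> 1 / x \<in> ic ==> ind x = 1"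
  using ind_mult[of x "1 / x"] ind_mult[of 1 1] ind_pos[of 1] ic_closed(2) by simp

end

section \<open>Integral elements form a principal ideal domain\<close>

context dvf_ext
begin

lemmas ic_ring = ic_closed(1,2,4-7)

text \<open>
  The ring of integral elements modulo `\<pi>` acts on a finite quotient of a lattice; by the
  pigeonhole principle the powers of `x` become periodic, and some power is idempotent modulo
  `\<pi>`.
\<close>
lemma idempotent_power:
  assumes x: "x \<in> ic"
  shows "\<exists>N>0. x ^ N * (x ^ N - 1) / \<pi> \<in> ic"
proof -
  obtain A where A: "lattice A" "stab x A" and xL: "x \<in> L" using x by (auto simp: ic_def)
  have sA: "submod A" using A by (simp add: lattice_def)
  let ?B = "(*) \<pi> ` A"
  have lB: "lattice ?B" using lattice_scale[OF A(1) piL(2) unif(2)] .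
  note aB = lattice_asg[OF lB]
  have "stab \<pi> A" using submodD(4)[OF sA unif_vr] by (simp add: stab_def)
  from ind[OF piL(2) unif(2) A(1) this] obtain T where T: "T \<subseteq> A" "finite T" "\<forall>a\<in>A. \<exists>!t\<in>T. a - t \<in> ?B"
   unfolding idx_def by blast
  then obtain cls where cls: "!!a. a \<in> A ==> cls a \<in> T & a - cls a \<in> ?B" by metis
  define h where "h k = restrict (\<lambda>t. cls (x ^ k * t)) T" for k :: nat
  have "range h \<subseteq> T \<rightarrow>\<^sub>E T" using cls stab_power[OF A(2)] T(1) unfolding h_def by (auto simp: PiE_iff)
  then have "finite (range h)" using T(2) finite_PiE[of T "\<lambda>_. T"] finite_subset by blast
  then have "\<not> inj h" using finite_imageD infinite_UNIV_nat by blast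
  then obtain k' l' where kl': "k' ~= l'" "h k' = h l'" by (auto simp: inj_def)
  obtain k l where kl: "k < l" "h k = h l"
   using kl' by (cases "k' < l'") (metis, metis linorder_neqE_nat)
  have Bx: "x ^ m * w \<in> ?B" if "w \<in> ?B" for w m using that stab_power[OF A(2)] by (auto simp: mult.left_commute[of "x ^ _"])
  have base: "x ^ k * y - x ^ l * y \<in> ?B" if y: "y \<in> A" for y
  proof -
   obtain t where t: "t \<in> T" "y - t \<in> ?B" using T(3) y by blast
   have "cls (x ^ k * t) = cls (x ^ l * t)" using kl(2) t(1) unfolding h_def by (metis restrict_apply')
   moreover have "x ^ m * t \<in> A" for m using t(1) T(1) stab_power[OF A(2)] by blast
   ultimately have "x ^ k * t - x ^ l * t \<in> ?B" using cls asg_diff_trans[OF aB] asg_diff_sym[OF aB] by metis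
   from asgD(2)[OF aB this asgD(3)[OF aB Bx[OF t(2), of k] Bx[OF t(2), of l]]] show ?thesis by (simp add: algebra_simps)
  qed
  define d where "d = l - k"
  have step: "x ^ m * y - x ^ (m + d) * y \<in> ?B" if "y \<in> A" "m \<ge> k" for y m
  proof -
   have "x ^ k * (x ^ (m - k) * y) - x ^ l * (x ^ (m - k) * y) \<in> ?B" using base stab_power[OF A(2) that(1)] by blast
   moreover have "x ^ k * (x ^ (m - k) * y) = x ^ m * y" "x ^ l * (x ^ (m - k) * y) = x ^ (m + d) * y"
   proof -
    have "k + (m - k) = m" "l + (m - k) = m + d" using that(2) kl(1) unfolding d_def by auto
    then show "x ^ k * (x ^ (m - k) * y) = x ^ m * y" "x ^ l * (x ^ (m - k) * y) = x ^ (m + d) * y"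
     unfolding mult.assoc[symmetric] power_add[symmetric] by simp_all
   qed
   ultimately show ?thesis by simp
  qed
  have steps: "x ^ m * y - x ^ (m + j * d) * y \<in> ?B" if "y \<in> A" "m \<ge> k" for y m j
  proof (induction j)
   case 0
   then show ?case using asgD(1)[OF aB] by simp
  next
   case (Suc j)
   from asg_diff_trans[OF aB Suc step[OF that(1), of "m + j * d"]] that(2) show ?case by (simp add: algebra_simps)
  qed
  define N where "N = d * Suc k"
  have "d \<ge> 1" using kl(1) unfolding d_def by simp
  then have N: "N > 0" "N \<ge> k" using mult_le_mono1[of 1 d "Suc k"] unfolding N_def by auto
  have "x ^ N * (x ^ N - 1) / \<pi> * y \<in> A" if y: "y \<in> A" for y
  proof -
   have "x ^ N * y - x ^ (N + N) * y \<in> ?B" using steps[OF y N(2), of "Suc k"] unfolding N_def by (simp add: algebra_simps)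
   then have "x ^ (N + N) * y - x ^ N * y \<in> ?B" by (rule asg_diff_sym[OF aB])
   then obtain w where "w \<in> A" "x ^ (N + N) * y - x ^ N * y = \<pi> * w" by blast
   moreover from this have "x ^ N * (x ^ N - 1) / \<pi> * y = w" using unif(2) by (simp add: field_simps power_add)
   ultimately show ?thesis by simp
  qed
  then have "x ^ N * (x ^ N - 1) / \<pi> \<in> ic" using xL piL(2)
   by (intro icI[OF _ A(1)]) (auto simp: stab_def intro!: subf_closed[OF L])
  with N show ?thesis by blast
qed

lemma one_plus_pi_unit:
  assumes s: "s \<in> ic"
  shows "1 + \<pi> * s ~= 0" "1 / (1 + \<pi> * s) \<in> ic"
proof -
  let ?x = "1 + \<pi> * s"
  show nz: "?x ~= 0"
  proof
   assume "?x = 0"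
   then have "1 / \<pi> = - s" using unif(2) by (simp add: field_simps add_eq_0_iff)
   with ic_closed(6)[OF s] pi_not_unit show False by simp
  qed
  obtain A where A: "lattice A" "stab s A" and sL: "s \<in> L" using s by (auto simp: ic_def)
  have sA: "submod A" using A by (simp add: lattice_def)
  have xL: "?x \<in> L" using sL piL by (auto intro!: subf_closed[OF L])
  have lx: "lattice ((*) ?x ` A)" using lattice_scale[OF A(1) xL nz] .
  have mx: "submod ((*) ?x ` A)" using lx by (simp add: lattice_def)
  obtain N where N: "!!y. y \<in> A ==> \<pi> ^ N * y \<in> (*) ?x ` A" using lattice_comm[OF A(1) lx] by blast
  have iter: "\<exists>y'\<in>A. \<exists>w\<in>A. y = ?x * y' + \<pi> ^ m * w" if "y \<in> A" for y m
  proof (induction m)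
   case 0
   then show ?case using that submodD(2)[OF sA] by (intro bexI[of _ 0] bexI[of _ y]) auto
  next
   case (Suc m)
   then obtain y' w where yw: "y' \<in> A" "w \<in> A" "y = ?x * y' + \<pi> ^ m * w" by blast
   then have "y = ?x * (y' + \<pi> ^ m * w) + \<pi> ^ Suc m * - (s * w)" by (simp add: algebra_simps)
   moreover have "y' + \<pi> ^ m * w \<in> A" "- (s * w) \<in> A" using yw A(2) submodD[OF sA] by (auto simp: stab_def)
   ultimately show ?case by blast
  qed
  have "1 / ?x * y \<in> A" if y: "y \<in> A" for y
  proof -
   obtain y' w where yw: "y' \<in> A" "w \<in> A" "y = ?x * y' + \<pi> ^ N * w" using iter[OF y] by blast
   then obtain w' where "w' \<in> A" "\<pi> ^ N * w = ?x * w'" using N by blast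
   with yw nz have "1 / ?x * y = y' + w'" by (simp add: field_simps)
   with yw(1) \<open>w' \<in> A\<close> submodD(3)[OF sA] show ?thesis by simp
  qed
  then show "1 / ?x \<in> ic" using xL subf_closed(2,8)[OF L]
   by (intro icI[OF _ A(1)]) (auto simp: stab_def)
qed

text \<open>
  The ideal generated by 1 and `\<theta>` is invertible by `prufer`, hence locally generated by 1
  or by `\<theta>`. An idempotent modulo `\<pi>` separates the two kinds of places and glues the
  local generators to a global one.
\<close>
lemma bezout:
  assumes \<theta>: "\<theta> \<in> L"
  obtains \<gamma> a b where "\<gamma> ~= 0" "a \<in> ic" "b \<in> ic" "\<gamma> = a + b * \<theta>" "1 / \<gamma> \<in> ic" "\<theta> / \<gamma> \<in> ic"
proof (cases "\<theta> = 0")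
  case True
  then show ?thesis using that[of 1 1 0] ic_closed(1,2) by auto
next
  case False
  obtain p r where pr: "p \<in> ic" "r \<in> ic" "\<theta> * p \<in> ic" "\<theta> * r \<in> ic" "p - \<theta> * r = 1"
   using prufer[OF \<theta>] by metis
  obtain N where N: "N > 0" "p ^ N * (p ^ N - 1) / \<pi> \<in> ic" using idempotent_power[OF pr(1)] by blast
  define e where "e = p ^ N"
  define t where "t = e * (e - 1) / \<pi>"
  define E where "E = e\<^sup>2 * (3 - 2 * e)"
  define g1 where "g1 = e * \<theta>"
  define g2 where "g2 = (1 - e) / \<theta>"
  have e: "e \<in> ic" unfolding e_def using ic_power[OF pr(1)] .
  have t: "t \<in> ic" "e * (e - 1) = \<pi> * t" using N(2) unif(2) unfolding t_def e_def by auto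
  have num: "(numeral k :: 'a) \<in> ic" for k
  proof -
   have "(of_nat m :: 'a) \<in> ic" for m by (induction m) (auto intro: ic_ring)
   from this[of "numeral k"] show ?thesis by simp
  qed
  have g1: "g1 \<in> ic"
  proof -
   obtain M where "N = Suc M" using N(1) by (cases N) auto
   then have "g1 = p ^ M * (\<theta> * p)" unfolding g1_def e_def by simp
   then show ?thesis using ic_closed(5)[OF ic_power[OF pr(1)] pr(3)] by simp
  qed
  have g2: "g2 \<in> ic"
  proof -
   have "1 - p = - (\<theta> * r)" using pr(5) by (simp add: algebra_simps)
   moreover have "1 - e = (1 - p) * (\<Sum>i<N. p ^ i)" unfolding e_def by (rule one_diff_power_eq)
   ultimately have "g2 = - r * (\<Sum>i<N. p ^ i)" unfolding g2_def using False by simp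
   then show ?thesis using ic_closed(5)[OF ic_closed(6)[OF pr(2)] ic_sum[of "{..<N}" "\<lambda>i. p ^ i"]] ic_power[OF pr(1)] by simp
  qed
  have e1: "1 - e \<in> ic" "3 - 2 * e \<in> ic" "1 + 2 * e \<in> ic" using e num ic_closed by auto
  have oE: "1 - E = (1 - e)\<^sup>2 * (1 + 2 * e)" unfolding E_def by (simp add: algebra_simps power2_eq_square)
  have E: "E \<in> ic" "1 - E \<in> ic" unfolding oE unfolding E_def power2_eq_square using e e1 by (auto intro!: ic_ring)
  define \<gamma> where "\<gamma> = E + (1 - E) * \<theta>"
  define \<delta> where "\<delta> = E + (1 - e) * (1 + 2 * e) * g2"
  have \<delta>ic: "\<delta> \<in> ic" unfolding \<delta>_def using E e1 g2 by (auto intro!: ic_ring)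
  have \<delta>: "\<delta> * \<theta> = E * \<theta> + (1 - E)" unfolding \<delta>_def oE g2_def using False by (simp add: field_simps power2_eq_square)
  define w where "w = (3 - 2 * e) * (1 + 2 * e)"
  have w: "w \<in> ic" unfolding w_def using e1 by (auto intro!: ic_ring)
  define s where "s = - t * w * (- 2 * (e * (1 - e)) + (1 - e) * g1 + e * g2)"
  have s: "s \<in> ic" unfolding s_def using t(1) e w g1 g2 by (auto intro!: ic_ring num)
  have "\<pi> * s = E * (1 - E) * (\<theta> + 1 / \<theta> - 2)"
  proof -
   have EE: "E * (1 - E) = - (\<pi> * t) * w * (e * (1 - e))"
    unfolding oE unfolding E_def w_def t(2)[symmetric] by (simp add: algebra_simps power2_eq_square)
   have g12: "(1 - e) * g1 = (e * (1 - e)) * \<theta>" "e * g2 = (e * (1 - e)) * (1 / \<theta>)"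
    unfolding g1_def g2_def using False by (simp_all add: field_simps)
   have "\<pi> * (- t * w * (- 2 * W + W * \<theta> + W * i)) = - (\<pi> * t) * w * W * (\<theta> + i - 2)" for W i
    by (simp add: algebra_simps)
   then show ?thesis unfolding s_def EE g12 by blast
  qed
  moreover have "\<gamma> * \<delta> * \<theta> = (1 + E * (1 - E) * (\<theta> + 1 / \<theta> - 2)) * \<theta>"
  proof -
   have "\<gamma> * \<delta> * \<theta> = (E + (1 - E) * \<theta>) * (E * \<theta> + (1 - E))" using \<delta> unfolding \<gamma>_def by (simp add: mult.assoc)
   also have "... = \<theta> + E * (1 - E) * (\<theta> * \<theta> + 1 - 2 * \<theta>)" by (simp add: algebra_simps)
   also have "... = (1 + E * (1 - E) * (\<theta> + 1 / \<theta> - 2)) * \<theta>" using False by (simp add: field_simps)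
   finally show ?thesis .
  qed
  ultimately have gd: "\<gamma> * \<delta> = 1 + \<pi> * s" using False by simp
  note un = one_plus_pi_unit[OF s]
  have \<gamma>0: "\<gamma> ~= 0" "\<delta> ~= 0" using gd un(1) by auto
  have "1 / \<gamma> = \<delta> * (1 / (1 + \<pi> * s))" unfolding gd[symmetric] using \<gamma>0 by simp
  moreover have "\<theta> / \<gamma> = (\<delta> * \<theta>) * (1 / (1 + \<pi> * s))" unfolding gd[symmetric] using \<gamma>0 by simp
  moreover have "\<delta> * \<theta> \<in> ic"
  proof -
   have "E * \<theta> = e * (3 - 2 * e) * g1" unfolding E_def g1_def by (simp add: power2_eq_square algebra_simps)
   then show ?thesis unfolding \<delta> using E e e1 g1 by (auto intro!: ic_ring)
  qed
  ultimately have "1 / \<gamma> \<in> ic" "\<theta> / \<gamma> \<in> ic" using ic_closed(5)[OF _ un(2)] \<delta>ic by metis+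
  with that[OF \<gamma>0(1) E \<gamma>_def] show ?thesis by blast
qed

text \<open>
  Membership of quotients in `ic` expresses divisibility: `x / z \<in> ic` says that `z` divides
  `x`, and `1 / z ~: ic` that `z` is not a unit.
\<close>
definition prime_ic :: "'a \<Rightarrow> bool" where
  "prime_ic z \<longleftrightarrow> z \<in> ic & z ~= 0 & 1 / z ~: ic & (\<forall>x\<in>ic. \<forall>y\<in>ic. x * y / z \<in> ic --> x / z \<in> ic \<or> y / z \<in> ic)"

lemma ic_gcd:
  assumes "x \<in> ic" "y \<in> ic" "y ~= 0"
  obtains g a b where "g \<in> ic" "g ~= 0" "x / g \<in> ic" "y / g \<in> ic" "a \<in> ic" "b \<in> ic" "g = a * y + b * x"
proof -
  have "x / y \<in> L" using assms ic_L subf_closed(8)[OF L] by auto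
  from bezout[OF this] obtain \<gamma> a b where g: "\<gamma> ~= 0" "a \<in> ic" "b \<in> ic" "\<gamma> = a + b * (x / y)" "1 / \<gamma> \<in> ic" "x / y / \<gamma> \<in> ic"
   by metis
  have e: "y * \<gamma> = a * y + b * x" using g(4) assms(3) by (simp add: field_simps)
  have m: "y * \<gamma> \<in> ic" unfolding e using g assms by (auto intro!: ic_ring)
  have d: "x / (y * \<gamma>) = x / y / \<gamma>" "y / (y * \<gamma>) = 1 / \<gamma>" using assms(3) g(1) by auto
  show ?thesis
   by (rule that[OF m _ _ _ g(2,3) e]) (use g d assms in simp_all)
qed

text \<open>
  A nonunit divisor of least index is prime, since greatest common divisors are linear
  combinations.
\<close>
lemma prime_divisor:
  assumes x: "x \<in> ic" "x ~= 0" "1 / x ~: ic"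
  shows "\<exists>z. prime_ic z & x / z \<in> ic"
proof -
  define P where "P z \<longleftrightarrow> z \<in> ic & z ~= 0 & 1 / z ~: ic & x / z \<in> ic" for z
  have "P x" using x ic_closed(2) unfolding P_def by simp
  then obtain z where z: "P z" and min: "!!y. P y ==> ind z \<le> ind y"
   using ex_has_least_nat[of P x ind] by blast
  have z': "z \<in> ic" "z ~= 0" "1 / z ~: ic" "x / z \<in> ic" using z unfolding P_def by auto
  have "y1 / z \<in> ic \<or> y2 / z \<in> ic" if y: "y1 \<in> ic" "y2 \<in> ic" "y1 * y2 / z \<in> ic" for y1 y2
  proof -
   obtain g a b where g: "g \<in> ic" "g ~= 0" "y1 / g \<in> ic" "z / g \<in> ic" "a \<in> ic" "b \<in> ic" "g = a * z + b * y1"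
    using ic_gcd[OF y(1) z'(1,2)] by metis
   show ?thesis
   proof (cases "1 / g \<in> ic")
    case True
    have "y2 / z = 1 / g * (g * y2 / z)" using g(2) by simp
    also have "g * y2 / z = a * y2 + b * (y1 * y2 / z)" unfolding g(7) using z'(2) by (simp add: field_simps)
    finally have "y2 / z = 1 / g * (a * y2 + b * (y1 * y2 / z))" .
    moreover have "1 / g * (a * y2 + b * (y1 * y2 / z)) \<in> ic" by (intro ic_ring True g y)
    ultimately show ?thesis by metis
   next
    case False
    have "x / g = x / z * (z / g)" using z'(2) by simp
    then have "x / g \<in> ic" using ic_closed(5)[OF z'(4) g(4)] by metis
    then have "P g" using False g(1,2) unfolding P_def by blast
    moreover have "ind z = ind g * ind (z / g)" using ind_mult[OF g(1) g(4) g(2)] g(2) z'(2) by simp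
    ultimately have "ind g * ind (z / g) \<le> ind g * 1" using min[of g] by simp
    then have "ind (z / g) \<le> 1" using ind_pos[OF g(1,2)] by simp
    moreover have "ind (z / g) > 0" using ind_pos[OF g(4)] g(2) z'(2) by simp
    ultimately have "ind (z / g) = 1" by simp
    then have "g / z \<in> ic" using ind_1[OF g(4)] g(2) z'(2) by simp
    moreover have "y1 / z = y1 / g * (g / z)" using g(2) by simp
    ultimately show ?thesis using ic_closed(5)[OF g(3)] by metis
   qed
  qed
  then have "prime_ic z" using z' unfolding prime_ic_def by blast
  with z' show ?thesis by blast
qed

lemma prime_power_divides: "prime_ic z ==> x \<in> ic ==> x ^ m / z \<in> ic ==> x / z \<in> ic"
proof (induction m)
  case 0
  then show ?case by (simp add: prime_ic_def)
next
  case (Suc m)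
  have "x * x ^ m / z \<in> ic" using Suc.prems(3) by simp
  with Suc.prems(1,2) ic_power[OF Suc.prems(2), of m] have "x / z \<in> ic \<or> x ^ m / z \<in> ic"
   unfolding prime_ic_def by blast
  with Suc show ?case by blast
qed

lemma prime_ind: "prime_ic z ==> ind z \<ge> 2"
  using ind_pos[of z] ind_1[of z] unfolding prime_ic_def by force

lemma ind_power: "z \<in> ic ==> z ~= 0 ==> ind (z ^ m) = ind z ^ m"
  by (induction m) (auto simp: ind_mult ic_power ind_unit ic_closed)

lemma multiplicity_ex:
  assumes z: "prime_ic z" and x: "x \<in> ic" "x ~= 0"
  obtains m where "x / z ^ m \<in> ic" "x / z ^ Suc m ~: ic"
proof -
  have z': "z \<in> ic" "z ~= 0" using z by (auto simp: prime_ic_def)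
  have bound: "m \<le> ind x" if "x / z ^ m \<in> ic" for m
  proof -
   have "ind x = ind z ^ m * ind (x / z ^ m)"
    using ind_mult[of "z ^ m" "x / z ^ m"] ind_power[OF z', of m] that x z' ic_power[OF z'(1)] by simp
   then have "ind x \<ge> ind z ^ m" using ind_pos[of "x / z ^ m"] that x z' by simp
   moreover have "2 ^ m \<le> ind z ^ m" using prime_ind[OF z] by (intro power_mono) auto
   ultimately show ?thesis using less_exp[of m] by linarith
  qed
  define M where "M = Max {m. x / z ^ m \<in> ic}"
  have fin: "finite {m. x / z ^ m \<in> ic}"
   by (rule finite_subset[of _ "{..ind x}"]) (use bound in auto)
  have "0 \<in> {m. x / z ^ m \<in> ic}" using x by simp
  then have "M \<in> {m. x / z ^ m \<in> ic}" unfolding M_def using fin Max_in by blast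
  moreover have "Suc M ~: {m. x / z ^ m \<in> ic}" using Max_ge[OF fin, of "Suc M"] unfolding M_def by force
  ultimately show ?thesis using that by blast
qed

end

section \<open>Indices are powers of the residue cardinality\<close>

text \<open>
  `F` represents the classes of the field `S / I`, without forming the quotient.
\<close>
definition residue_system :: "'a::field set \<Rightarrow> 'a set \<Rightarrow> 'a set \<Rightarrow> bool" where
  "residue_system S I F \<longleftrightarrow> 1 \<in> S & (\<forall>x\<in>S. \<forall>y\<in>S. x + y \<in> S & x - y \<in> S & x * y \<in> S) &
   I \<subseteq> S & asg I & 1 ~: I & (\<forall>x\<in>S. \<forall>y\<in>I. x * y \<in> I) &
   finite F & F \<subseteq> S & (\<forall>x\<in>S. \<exists>!f\<in>F. x - f \<in> I) & (\<forall>x\<in>S. x ~: I --> (\<exists>w\<in>S. x * w - 1 \<in> I))"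

lemma residue_systemD:
  assumes "residue_system S I F"
  shows "1 \<in> S" "x \<in> S ==> y \<in> S ==> x + y \<in> S" "x \<in> S ==> y \<in> S ==> x - y \<in> S"
   "x \<in> S ==> y \<in> S ==> x * y \<in> S" "I \<subseteq> S" "asg I" "1 ~: I" "x \<in> S ==> y \<in> I ==> x * y \<in> I"
   "finite F" "F \<subseteq> S" "x \<in> S ==> \<exists>!f\<in>F. x - f \<in> I" "x \<in> S ==> x ~: I ==> \<exists>w\<in>S. x * w - 1 \<in> I" "0 \<in> S" "x \<in> S ==> - x \<in> S"
proof -
  show "1 \<in> S" "x \<in> S ==> y \<in> S ==> x + y \<in> S" and d: "x \<in> S ==> y \<in> S ==> x - y \<in> S" and
   "x \<in> S ==> y \<in> S ==> x * y \<in> S" "I \<subseteq> S" "asg I" "1 ~: I" "x \<in> S ==> y \<in> I ==> x * y \<in> I"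
   "finite F" "F \<subseteq> S" "x \<in> S ==> \<exists>!f\<in>F. x - f \<in> I" "x \<in> S ==> x ~: I ==> \<exists>w\<in>S. x * w - 1 \<in> I" for x y
   using assms unfolding residue_system_def by simp_all
  show z: "0 \<in> S" using d[of 1 1] \<open>1 \<in> S\<close> by simp
  show "x \<in> S ==> - x \<in> S" using d[of 0 x] z by simp
qed

lemma residue_system_unique:
  assumes r: "residue_system S I F" and "f \<in> F" "g \<in> F" "f - g \<in> I"
  shows "f = g"
proof -
  have "f - f \<in> I" "f \<in> S" using asgD(1) residue_systemD[OF r] assms by auto
  with residue_systemD(11)[OF r, of f] assms show ?thesis by blast
qed

lemma residue_system_card: assumes r: "residue_system S I F" shows "card F \<ge> 2"
proof -
  note D = residue_systemD[OF r]
  obtain f g where fg: "f \<in> F" "0 - f \<in> I" "g \<in> F" "1 - g \<in> I" using D(11)[OF D(13)] D(11)[OF D(1)] by blast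
  have "f ~= g" using asgD(3)[OF D(6) fg(4) fg(2)] D(7) by auto
  then have "card {f, g} = 2" by simp
  with fg D(9) show ?thesis by (metis card_mono empty_subsetI insert_subset)
qed

text \<open>
  The quotient `A / B` is a vector space over the finite field `S / I`; the induction on the index
  splits off one line at a time.
\<close>
lemma module_index_power:
  assumes r: "residue_system S I F" and aA: "asg A" and SA: "!!x y. x \<in> S ==> y \<in> A ==> x * y \<in> A"
   and "asg B" "B \<subseteq> A" "idx A B k"
   "!!x y. x \<in> S ==> y \<in> B ==> x * y \<in> B" "!!x y. x \<in> I ==> y \<in> A ==> x * y \<in> B"
  shows "\<exists>j. k = card F ^ j"
  using assms(4-)
proof (induction k arbitrary: B rule: less_induct)
  case (less k B)
  note D = residue_systemD[OF r] and aB = less.prems(1)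
  note SB = less.prems(4) and IB = less.prems(5)
  show ?case
  proof (cases "A \<subseteq> B")
   case True
   then have "A = B" using less.prems(2) by blast
   then have "k = 1" using idx_unique[OF aB less.prems(3)] idx_refl[OF aA] by blast
   then show ?thesis by (intro exI[of _ 0]) simp
  next
   case False
   then obtain x where x: "x \<in> A" "x ~: B" by blast
   define B' where "B' = {b + a * x | a b. a \<in> S & b \<in> B}"
   have mem: "b + a * x \<in> B'" if "a \<in> S" "b \<in> B" for a b unfolding B'_def using that by blast
   have elim: "\<exists>a\<in>S. \<exists>b\<in>B. y = b + a * x" if "y \<in> B'" for y using that unfolding B'_def by blast
   have aB': "asg B'" unfolding asg_def
   proof (intro conjI ballI)
    show "0 \<in> B'" using mem[OF D(13) asgD(1)[OF aB]] by simp
    fix y y' assume "y \<in> B'" "y' \<in> B'"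
    then obtain a b a' b' where e: "a \<in> S" "b \<in> B" "y = b + a * x" "a' \<in> S" "b' \<in> B" "y' = b' + a' * x"
     using elim[OF \<open>y \<in> B'\<close>] elim[OF \<open>y' \<in> B'\<close>] by blast
    from mem[OF D(2)[OF e(1,4)] asgD(2)[OF aB e(2,5)]] show "y + y' \<in> B'" unfolding e by (simp add: algebra_simps)
    from mem[OF D(3)[OF e(1,4)] asgD(3)[OF aB e(2,5)]] show "y - y' \<in> B'" unfolding e by (simp add: algebra_simps)
   qed
   have BB': "B \<subseteq> B'" using mem[OF D(13)] by auto
   have B'A: "B' \<subseteq> A"
   proof
    fix y assume "y \<in> B'"
    then obtain a b where "a \<in> S" "b \<in> B" "y = b + a * x" using elim by blast
    then show "y \<in> A" using asgD(2)[OF aA _ SA[OF _ x(1)]] less.prems(2) by blast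
   qed
   have SB': "s * y \<in> B'" if s: "s \<in> S" and y: "y \<in> B'" for s y
   proof -
    obtain a b where e: "a \<in> S" "b \<in> B" "y = b + a * x" using elim[OF y] by blast
    from mem[OF D(4)[OF s e(1)] SB[OF s e(2)]] show ?thesis unfolding e by (simp add: algebra_simps)
   qed
   have key: "f = g" if "f \<in> F" "g \<in> F" "f * x - g * x \<in> B" for f g
   proof (rule residue_system_unique[OF r that(1,2)], rule ccontr)
    assume "f - g ~: I"
    moreover have "f - g \<in> S" using that D(3,10) by blast
    ultimately obtain w where w: "w \<in> S" "(f - g) * w - 1 \<in> I" using D(12) by blast
    have "w * (f * x - g * x) - ((f - g) * w - 1) * x \<in> B"
     using asgD(3)[OF aB SB[OF w(1) that(3)] IB[OF w(2) x(1)]] .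
    with x(2) show False by (simp add: algebra_simps)
   qed
   have idxB': "idx B' B (card F)"
   proof -
    let ?T = "(\<lambda>f. f * x) ` F"
    have inj: "inj_on (\<lambda>f. f * x) F" using key asgD(1)[OF aB] by (auto simp: inj_on_def)
    have "\<forall>y\<in>B'. \<exists>!t\<in>?T. y - t \<in> B"
    proof (intro ballI ex_ex1I)
     fix y assume "y \<in> B'"
     then obtain a b where e: "a \<in> S" "b \<in> B" "y = b + a * x" using elim by blast
     obtain f where f: "f \<in> F" "a - f \<in> I" using D(11)[OF e(1)] by blast
     from asgD(2)[OF aB e(2) IB[OF f(2) x(1)]] have "y - f * x \<in> B" unfolding e by (simp add: algebra_simps)
     with f show "\<exists>t. t \<in> ?T & y - t \<in> B" by blast
    next
     fix y t t' assume t: "t \<in> ?T & y - t \<in> B" "t' \<in> ?T & y - t' \<in> B"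
     then obtain f g where fg: "f \<in> F" "t = f * x" "g \<in> F" "t' = g * x" by blast
     have "t - t' \<in> B" using t asg_diff_trans[OF aB asg_diff_sym[OF aB, of y t], of t'] by simp
     with key[OF fg(1,3)] fg show "t = t'" by simp
    qed
    moreover have "?T \<subseteq> B'" using mem[OF _ asgD(1)[OF aB]] D(10) by fastforce
    moreover have "finite ?T" "card ?T = card F" using D(9) card_image[OF inj] by auto
    ultimately show ?thesis unfolding idx_def by (intro exI[of _ ?T] conjI)
   qed
   obtain l where l: "idx A B' l" using idx_between(1)[OF aB' aB BB' B'A less.prems(3)] by blast
   have k: "k = l * card F"
    using idx_unique[OF aB less.prems(3) idx_tower[OF aB aB' aA BB' B'A l idxB']] .
   have "l < k" using k idx_pos[OF aA l] residue_system_card[OF r] by simp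
   moreover have "s * y \<in> B'" if "s \<in> I" "y \<in> A" for s y using IB[OF that] BB' by blast
   ultimately obtain j where "l = card F ^ j" using less.IH[OF _ aB' B'A l SB'] by blast
   then show ?thesis using k by (intro exI[of _ "Suc j"]) (simp add: mult.commute)
  qed
qed

text \<open>
  Adjoining a root `c` of a nonsquare gives a quadratic extension of the residue field.
\<close>
lemma residue_system_quadratic:
  assumes r: "residue_system S I F" and cI': "\<forall>y\<in>I. c * y \<in> I" and a: "a \<in> S" "c\<^sup>2 - a \<in> I"
   and nsq: "\<forall>x\<in>S. x\<^sup>2 - a ~: I"
  shows "residue_system {x + y * c | x y. x \<in> S & y \<in> S} I {x + y * c | x y. x \<in> F & y \<in> F}" (is "residue_system ?S I ?F")
   and "card {x + y * c | x y. x \<in> F & y \<in> F} = (card F)\<^sup>2"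
   and "!!x y. x \<in> S ==> y \<in> S ==> x + y * c \<in> I ==> x \<in> I & y \<in> I"
proof -
  note D = residue_systemD[OF r]
  note aI = asgD[OF D(6)]
  have cI: "c * y \<in> I" if "y \<in> I" for y using cI' that by blast
  have mem: "x + y * c \<in> ?S" if "x \<in> S" "y \<in> S" for x y using that by blast
  have elim: "\<exists>x\<in>S. \<exists>y\<in>S. w = x + y * c" if "w \<in> ?S" for w using that by blast
  have SI: "w * t \<in> I" if w: "w \<in> ?S" and t: "t \<in> I" for w t
  proof -
   obtain x y where e: "x \<in> S" "y \<in> S" "w = x + y * c" using elim[OF w] by blast
   from aI(2)[OF D(8)[OF e(1) t] D(8)[OF e(2) cI[OF t]]] show ?thesis unfolding e by (simp add: algebra_simps)
  qed
  show ind: "x \<in> I & y \<in> I" if xy: "x \<in> S" "y \<in> S" "x + y * c \<in> I" for x y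
  proof -
   have "y \<in> I"
   proof (rule ccontr)
    assume "y ~: I"
    then obtain w where w: "w \<in> S" "y * w - 1 \<in> I" using D(12) xy by blast
    have i: "x * w + c \<in> I" using aI(3)[OF D(8)[OF w(1) xy(3)] cI[OF w(2)]] by (simp add: algebra_simps)
    have "- (x * w) + 1 * c \<in> ?S" using mem[OF D(14)[OF D(4)[OF xy(1) w(1)]] D(1)] .
    from SI[OF this i] have "c\<^sup>2 - (x * w)\<^sup>2 \<in> I" by (simp add: algebra_simps power2_eq_square)
    from aI(3)[OF a(2) this] have "(x * w)\<^sup>2 - a \<in> I" by simp
    with nsq D(4)[OF xy(1) w(1)] show False by blast
   qed
   moreover from this have "x \<in> I" using aI(3)[OF xy(3) cI[of y]] by (simp add: algebra_simps)
   ultimately show ?thesis by blast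
  qed
  have inv: "\<exists>w\<in>?S. t * w - 1 \<in> I" if t: "t \<in> ?S" "t ~: I" for t
  proof -
   obtain x y where e: "x \<in> S" "y \<in> S" "t = x + y * c" using elim[OF t(1)] by blast
   define N where "N = x\<^sup>2 - a * y\<^sup>2"
   have NS: "N \<in> S" unfolding N_def power2_eq_square
    using D(3)[OF D(4)[OF e(1,1)] D(4)[OF a(1) D(4)[OF e(2,2)]]] .
   have "N ~: I"
   proof
    assume N: "N \<in> I"
    show False
    proof (cases "y \<in> I")
     case True
     then have "x ~: I" using t(2) aI(2)[OF _ cI[of y], of x] e by (auto simp: mult.commute)
     then obtain w where w: "w \<in> S" "x * w - 1 \<in> I" using D(12) e by blast
     have "x\<^sup>2 \<in> I" using aI(2)[OF N D(8)[OF D(4)[OF a(1) e(2)] True]] unfolding N_def by (simp add: power2_eq_square)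
     then have "w * w * x\<^sup>2 \<in> I" using D(8)[OF D(4)[OF w(1) w(1)]] by blast
     moreover have "(x * w + 1) * (x * w - 1) \<in> I" using D(8)[OF D(2)[OF D(4)[OF e(1) w(1)] D(1)] w(2)] .
     ultimately have "w * w * x\<^sup>2 - (x * w + 1) * (x * w - 1) \<in> I" using aI(3) by blast
     then show False using D(7) by (simp add: algebra_simps power2_eq_square)
    next
     case False
     then obtain w where w: "w \<in> S" "y * w - 1 \<in> I" using D(12) e by blast
     have "w * w * N + a * ((y * w + 1) * (y * w - 1)) \<in> I"
      by (intro aI(2) D(8)[OF D(4)[OF w(1) w(1)] N] D(8)[OF a(1)] D(8)[OF D(2)[OF D(4)[OF e(2) w(1)] D(1)] w(2)])
     then have "(x * w)\<^sup>2 - a \<in> I" unfolding N_def by (simp add: algebra_simps power2_eq_square)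
     with nsq D(4)[OF e(1) w(1)] show False by blast
    qed
   qed
   then obtain w where w: "w \<in> S" "N * w - 1 \<in> I" using D(12)[OF NS] by blast
   have 1: "x * w + (- (y * w)) * c \<in> ?S"
    using mem[OF D(4)[OF e(1) w(1)] D(14)[OF D(4)[OF e(2) w(1)]]] .
   have 2: "t * (x * w + (- (y * w)) * c) - 1 = (N * w - 1) - (y * y * w) * (c\<^sup>2 - a)"
    unfolding e N_def by (simp add: algebra_simps power2_eq_square)
   have 3: "(N * w - 1) - (y * y * w) * (c\<^sup>2 - a) \<in> I"
    using aI(3)[OF w(2) D(8)[OF D(4)[OF D(4)[OF e(2) e(2)] w(1)] a(2)]] .
   show ?thesis by (rule bexI[OF _ 1]) (simp only: 2 3)
  qed
  have uniq: "x = x' & y = y'" if "x \<in> F" "x' \<in> F" "y \<in> F" "y' \<in> F" "(x + y * c) - (x' + y' * c) \<in> I" for x y x' y'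
  proof -
   have "(x - x') + (y - y') * c \<in> I" using that(5) by (simp add: algebra_simps)
   moreover have "x - x' \<in> S" "y - y' \<in> S" using D(3) that(1-4) D(10) by auto
   ultimately have "x - x' \<in> I" "y - y' \<in> I" using ind by blast+
   with residue_system_unique[OF r] that show ?thesis by blast
  qed
  have Feq: "?F = (\<lambda>(x, y). x + y * c) ` (F \<times> F)" by auto
  have inj: "inj_on (\<lambda>(x, y). x + y * c) (F \<times> F)"
   using uniq aI(1) by (auto simp: inj_on_def)
  show "card ?F = (card F)\<^sup>2" unfolding Feq card_image[OF inj] by (simp add: card_cartesian_product power2_eq_square)
  show "residue_system ?S I ?F" unfolding residue_system_def
  proof (intro conjI ballI impI)
   show "1 \<in> ?S" using mem[OF D(1) D(13)] by simp
   show "I \<subseteq> ?S" using mem[OF _ D(13)] D(5) by fastforce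
   show "asg I" "1 ~: I" using D by auto
   show "finite ?F" unfolding Feq using D(9) by simp
   show "?F \<subseteq> ?S" using D(10) by blast
   show "w * t \<in> I" if "w \<in> ?S" "t \<in> I" for w t using SI[OF that] .
   show "\<exists>w\<in>?S. t * w - 1 \<in> I" if "t \<in> ?S" "t ~: I" for t using inv[OF that] .
   fix w assume w: "w \<in> ?S"
   then obtain x y where e: "x \<in> S" "y \<in> S" "w = x + y * c" using elim by blast
   show "\<exists>!f\<in>?F. w - f \<in> I"
   proof (rule ex_ex1I)
    obtain f g where fg: "f \<in> F" "x - f \<in> I" "g \<in> F" "y - g \<in> I"
     using D(11)[OF e(1)] D(11)[OF e(2)] by blast
    from aI(2)[OF fg(2) cI[OF fg(4)]] have "w - (f + g * c) \<in> I" unfolding e by (simp add: algebra_simps)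
    with fg show "\<exists>f. f \<in> ?F & w - f \<in> I" by blast
   next
    fix f f' assume f: "f \<in> ?F & w - f \<in> I" "f' \<in> ?F & w - f' \<in> I"
    then obtain x1 y1 x2 y2 where xy: "x1 \<in> F" "y1 \<in> F" "f = x1 + y1 * c" "x2 \<in> F" "y2 \<in> F" "f' = x2 + y2 * c" by blast
    have "f - f' \<in> I" using f asg_diff_trans[OF D(6) asg_diff_sym[OF D(6), of w f], of f'] by simp
    with uniq[OF xy(1,4,2,5)] xy show "f = f'" by simp
   qed
   fix t assume t: "t \<in> ?S"
   then obtain x' y' where e': "x' \<in> S" "y' \<in> S" "t = x' + y' * c" using elim by blast
   from mem[OF D(2)[OF e(1) e'(1)] D(2)[OF e(2) e'(2)]] show "w + t \<in> ?S" unfolding e e' by (simp add: algebra_simps)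
   from mem[OF D(3)[OF e(1) e'(1)] D(3)[OF e(2) e'(2)]] show "w - t \<in> ?S" unfolding e e' by (simp add: algebra_simps)
   have "c\<^sup>2 - a \<in> S" using a(2) D(5) by blast
   then have c2: "c\<^sup>2 \<in> S" using D(2)[OF _ a(1), of "c\<^sup>2 - a"] by simp
   from mem[OF D(2)[OF D(4)[OF e(1) e'(1)] D(4)[OF D(4)[OF e(2) e'(2)] c2]] D(2)[OF D(4)[OF e(1) e'(2)] D(4)[OF e(2) e'(1)]]] show "w * t \<in> ?S" unfolding e e' by (simp add: algebra_simps power2_eq_square)
  qed
qed

context dvf_ext
begin

lemma affine_combination:
  "s \<in> {x + y * c | x y. x \<in> X' & y \<in> Y'} ==> \<exists>x\<in>X'. \<exists>y\<in>Y'. s = x + y * c"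
  by blast

text \<open>
  The integers of `K`, together with the elements that act as 0 on `A / z A`, represent the
  residue field of `v` inside the endomorphisms of that quotient.
\<close>
lemma residue_system_base:
  assumes A: "lattice A" and z: "z \<in> L" "z ~= 0" "stab z A" "stab (\<pi> / z) A" and nu: "1 / z ~: ic"
  shows "residue_system {x + w | x w. x \<in> vr & w \<in> {w\<in>L. \<forall>y\<in>A. w * y \<in> (*) z ` A}} {w\<in>L. \<forall>y\<in>A. w * y \<in> (*) z ` A} R"
   and "!!x. x \<in> vr ==> x \<in> {w\<in>L. \<forall>y\<in>A. w * y \<in> (*) z ` A} ==> x \<in> mi"
   and "!!c y. c \<in> L ==> stab c A ==> y \<in> {w\<in>L. \<forall>y\<in>A. w * y \<in> (*) z ` A} ==> c * y \<in> {w\<in>L. \<forall>y\<in>A. w * y \<in> (*) z ` A}"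
proof -
  let ?B = "(*) z ` A" and ?I = "{w\<in>L. \<forall>y\<in>A. w * y \<in> (*) z ` A}"
  let ?S = "{x + w | x w. x \<in> vr & w \<in> ?I}"
  have sA: "submod A" using A by (simp add: lattice_def)
  have lB: "lattice ?B" using lattice_scale[OF A z(1,2)] .
  have sB: "submod ?B" using lB by (simp add: lattice_def)
  have BA: "?B \<subseteq> A" using z(3) by (auto simp: stab_def)
  have cB: "c * y \<in> ?B" if "stab c A" "y \<in> ?B" for c y
   using that by (auto simp: stab_def mult.left_commute[of c])
  show cI: "c * y \<in> ?I" if "c \<in> L" "stab c A" "y \<in> ?I" for c y
   using that cB[OF that(2)] subf_closed(4)[OF L] by (auto simp: mult.assoc)
  have vrI: "x * y \<in> ?I" if "x \<in> vr" "y \<in> ?I" for x y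
  proof -
   have "stab x A" using that(1) submodD(4)[OF sA] unfolding stab_def by blast
   with cI[of x y] that vrL show ?thesis by blast
  qed
  have II: "x * y \<in> ?I" if "x \<in> ?I" "y \<in> ?I" for x y
  proof -
   have "stab x A" using that(1) BA unfolding stab_def by blast
   with cI[of x y] that show ?thesis by blast
  qed
  have aI: "asg ?I" unfolding asg_def
   using subf_closed[OF L] submodD[OF sB] by (auto simp: distrib_right left_diff_distrib)
  note aI' = asgD[OF aI]
  have one: "1 ~: ?I"
  proof
   assume "1 \<in> ?I"
   then have "A \<subseteq> ?B" by auto
   then have "stab (1 / z) A" using z(2) unfolding stab_def by auto
   then show False using nu icI[OF _ A] z(1) subf_closed(2,8)[OF L] by auto
  qed
  have piI: "\<pi> \<in> ?I"
  proof -
   have "\<pi> * y \<in> ?B" if "y \<in> A" for y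
    by (rule image_eqI[of _ _ "\<pi> / z * y"]) (use z(2,4) that in \<open>auto simp: stab_def\<close>)
   then show ?thesis using piL(2) by blast
  qed
  have miI: "x \<in> ?I" if "x \<in> mi" for x
   using vrI[of "x / \<pi>" \<pi>] that piI unif(2) unfolding mi_iff by simp
  show Imi: "x \<in> mi" if "x \<in> vr" "x \<in> ?I" for x
  proof (rule ccontr)
   assume "x ~: mi"
   then have "x \<in> K" "x ~= 0" "v x = 0" using that(1) by (auto simp: vr_def mi_def)
   then have "inverse x \<in> vr" using v_inverse[of x] subf_closed(6)[OF K] by (auto simp: vr_def)
   from vrI[OF this that(2)] \<open>x ~= 0\<close> one show False by simp
  qed
  have mem: "x + w \<in> ?S" if "x \<in> vr" "w \<in> ?I" for x w using that by blast
  have elim: "\<exists>x\<in>vr. \<exists>w\<in>?I. s = x + w" if "s \<in> ?S" for s using that by blast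
  show "residue_system ?S ?I R" unfolding residue_system_def
  proof (intro conjI ballI impI)
   show "1 \<in> ?S" using mem[OF vr_closed(2) aI'(1)] by simp
   show "?I \<subseteq> ?S" using mem[OF vr_closed(1)] by fastforce
   show "R \<subseteq> ?S" using mem[OF _ aI'(1)] R_vr by fastforce
   show "asg ?I" "1 ~: ?I" "finite R" using aI one R_fin by auto
   fix s assume "s \<in> ?S"
   then obtain x w where e: "x \<in> vr" "w \<in> ?I" "s = x + w" using elim by blast
   show "s * t \<in> ?I" if "t \<in> ?I" for t
    using aI'(2)[OF vrI[OF e(1) that] II[OF e(2) that]] unfolding e by (simp only: distrib_right)
   show "\<exists>!f\<in>R. s - f \<in> ?I"
   proof (rule ex_ex1I)
    obtain f where f: "f \<in> R" "x - f \<in> mi" using R_rep'[OF e(1)] by blast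
    from aI'(2)[OF miI[OF f(2)] e(2)] have "s - f \<in> ?I" unfolding e by (simp only: diff_add_eq)
    with f show "\<exists>f. f \<in> R & s - f \<in> ?I" by blast
   next
    fix f g assume fg: "f \<in> R & s - f \<in> ?I" "g \<in> R & s - g \<in> ?I"
    then have "f - g \<in> ?I" using asg_diff_trans[OF aI asg_diff_sym[OF aI, of s f], of g] by blast
    moreover have f: "f \<in> vr" "g \<in> vr" using fg R_vr by auto
    ultimately have "f - g \<in> mi" using Imi vr_closed(6)[OF f] by blast
    moreover have "f - f \<in> mi" using mi_iff[of 0] vr_closed(1) by simp
    moreover note f
    ultimately have "f - g \<in> mi" "f - f \<in> mi" "f \<in> vr" by simp_all
    with R_rep'[of f] fg show "f = g" by blast
   qed
   show "\<exists>w\<in>?S. s * w - 1 \<in> ?I" if "s ~: ?I"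
   proof -
    have "x ~: mi" using that aI'(2)[OF miI[of x] e(2)] e(3) by blast
    then have x: "x \<in> K" "x ~= 0" "v x = 0" using e(1) by (auto simp: vr_def mi_def)
    then have i: "inverse x \<in> vr" using v_inverse[of x] subf_closed(6)[OF K] by (auto simp: vr_def)
    have 1: "s * (inverse x + 0) - 1 = inverse x * w" using x(2) unfolding e by (simp add: field_simps)
    have "s * (inverse x + 0) - 1 \<in> ?I" unfolding 1 using vrI[OF i e(2)] .
    then show ?thesis using mem[OF i aI'(1)] by blast
   qed
   fix t assume "t \<in> ?S"
   then obtain x' w' where e': "x' \<in> vr" "w' \<in> ?I" "t = x' + w'" using elim by blast
   have "s + t = (x + x') + (w + w')" unfolding e e' by simp
   then show "s + t \<in> ?S" using mem[OF vr_closed(3)[OF e(1) e'(1)] aI'(2)[OF e(2) e'(2)]] by simp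
   have "s - t = (x - x') + (w - w')" unfolding e e' by simp
   then show "s - t \<in> ?S" using mem[OF vr_closed(6)[OF e(1) e'(1)] aI'(3)[OF e(2) e'(2)]] by simp
   have "s * t = x * x' + ((x * w' + x' * w) + w * w')" unfolding e e' by (simp add: algebra_simps)
   then show "s * t \<in> ?S"
    using mem[OF vr_closed(4)[OF e(1) e'(1)] aI'(2)[OF aI'(2)[OF vrI[OF e(1) e'(2)] vrI[OF e'(1) e(2)]] II[OF e(2) e'(2)]]] by simp
  qed
qed

lemma lattice_residue_stab:
  assumes A: "lattice A" and z: "z \<in> L" "z ~= 0" "stab z A"
   and s: "s \<in> {x + w | x w. x \<in> vr & w \<in> {w\<in>L. \<forall>y\<in>A. w * y \<in> (*) z ` A}}"
  shows "stab s A" "stab s ((*) z ` A)"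
proof -
  have sA: "submod A" using A by (simp add: lattice_def)
  obtain x w where e: "x \<in> vr" "!!y. y \<in> A ==> w * y \<in> (*) z ` A" "s = x + w" using s by blast
  have "w * y \<in> A" if "y \<in> A" for y using e(2)[OF that] z(3) by (auto simp: stab_def)
  then show 1: "stab s A" using submodD(3,4)[OF sA] e(1) unfolding e(3) stab_def by (auto simp: distrib_right)
  show "stab s ((*) z ` A)" using 1 by (auto simp: stab_def mult.left_commute[of s])
qed

text \<open>
  The quotient of a lattice by its multiple by `z` is a vector space over the residue field, and
  over its extension by a square root or a fourth root of `a` if `a` becomes a square or a fourth
  power modulo `z`. The square root `i` of `-1` ensures that the fourth root generates an
  extension of degree 4.
\<close>
lemma index_of_pi_divisor:
  assumes z: "z \<in> ic" "z ~= 0" "1 / z ~: ic" "\<pi> / z \<in> ic"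
  shows "\<exists>j. ind z = card R ^ j"
   and "c \<in> ic ==> a \<in> vr ==> (c\<^sup>2 - a) / z \<in> ic ==> (\<forall>x\<in>vr. x\<^sup>2 - a ~: mi) ==> \<exists>j. ind z = card R ^ (2 * j)"
   and "c \<in> ic ==> a \<in> vr ==> (c ^ 4 - a) / z \<in> ic ==> (\<forall>x\<in>vr. x\<^sup>2 - a ~: mi) ==> i \<in> K ==> i\<^sup>2 = - 1
    ==> \<exists>j. ind z = card R ^ (4 * j)"
proof -
  define I where "I A = {w\<in>L. \<forall>y\<in>A. w * y \<in> (*) z ` A}" for A
  define S where "S A = {x + w | x w. x \<in> vr & w \<in> I A}" for A
  have zL: "z \<in> L" using z ic_L by auto
  have base: "residue_system (S A) (I A) R" "!!x. x \<in> vr ==> x \<in> I A ==> x \<in> mi"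
    "!!c y. c \<in> L ==> stab c A ==> y \<in> I A ==> c * y \<in> I A"
    "!!s. s \<in> S A ==> stab s A" "!!s. s \<in> S A ==> stab s ((*) z ` A)" "asg A" "asg ((*) z ` A)" "(*) z ` A \<subseteq> A" "idx A ((*) z ` A) (ind z)"
   if "lattice A" "stab z A" "stab (\<pi> / z) A" for A
   using residue_system_base[OF that(1) zL z(2) that(2,3) z(3)] lattice_residue_stab[OF that(1) zL z(2) that(2)]
    lattice_asg[OF that(1)] lattice_asg[OF lattice_scale[OF that(1) zL z(2)]] that(2) ind[OF zL z(2) that(1,2)]
   unfolding S_def I_def by (auto simp: stab_def)
  have pow: "\<exists>j. ind z = card F ^ j" if A: "lattice A" "stab z A" "stab (\<pi> / z) A" and F: "residue_system S' (I A) F"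
   and st: "\<forall>s\<in>S'. stab s A" "\<forall>s\<in>S'. stab s ((*) z ` A)" for A S' F
   by (rule module_index_power[OF F base(6)[OF A] _ base(7,8,9)[OF A]])
    (use st in \<open>auto simp: stab_def I_def\<close>)
  show "\<exists>j. ind z = card R ^ j"
  proof -
   obtain A where A: "lattice A" "stab z A" "stab (\<pi> / z) A" using common_lattice[of "{z, \<pi> / z}"] z by auto
   from pow[OF A base(1)[OF A]] base(4,5)[OF A] show ?thesis by blast
  qed
  have first: "residue_system {x + y * c | x y. x \<in> S A & y \<in> S A} (I A) {x + y * c | x y. x \<in> R & y \<in> R}"
   "card {x + y * c | x y. x \<in> R & y \<in> R} = (card R)\<^sup>2"
   "!!x y. x \<in> S A ==> y \<in> S A ==> x + y * c \<in> I A ==> x \<in> I A & y \<in> I A"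
   "\<forall>s\<in>{x + y * c | x y. x \<in> S A & y \<in> S A}. stab s A"
   "\<forall>s\<in>{x + y * c | x y. x \<in> S A & y \<in> S A}. stab s ((*) z ` A)"
   "a \<in> S A" "\<forall>x\<in>S A. x\<^sup>2 - a ~: I A"
   if A: "lattice A" "stab z A" "stab (\<pi> / z) A" and c: "c \<in> L" "stab c A" "stab ((c\<^sup>2 - a) / z) A"
   and a: "a \<in> vr" "\<forall>x\<in>vr. x\<^sup>2 - a ~: mi" for A c a
  proof -
   note D = residue_systemD[OF base(1)[OF A]]
   have sA: "submod A" using A by (simp add: lattice_def)
   show aS: "a \<in> S A" unfolding S_def using a(1) asgD(1)[OF D(6)] by (intro CollectI exI[of _ a] exI[of _ 0]) simp
   have nsq': "x\<^sup>2 - a ~: I A" if x: "x \<in> S A" for x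
   proof
    assume xa: "x\<^sup>2 - a \<in> I A"
    obtain y w where yw: "y \<in> vr" "w \<in> I A" "x = y + w" using x unfolding S_def by blast
    have yS: "y \<in> S A" unfolding S_def using yw(1) asgD(1)[OF D(6)] by (intro CollectI exI[of _ y] exI[of _ 0]) simp
    have "(x + y) * w \<in> I A" using D(8)[OF D(2)[OF x yS] yw(2)] .
    from asgD(3)[OF D(6) xa this] have "y\<^sup>2 - a \<in> I A" unfolding yw(3) by (simp add: algebra_simps power2_eq_square)
    moreover have "y\<^sup>2 - a \<in> vr" using yw(1) a(1) vr_closed(6) vr_power by blast
    ultimately show False using base(2)[OF A] a(2) yw(1) by blast
   qed
   then show nsq: "\<forall>x\<in>S A. x\<^sup>2 - a ~: I A" by blast
   have c2: "c\<^sup>2 - a \<in> I A"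
   proof -
    have "(c\<^sup>2 - a) * y \<in> (*) z ` A" if "y \<in> A" for y
     by (rule image_eqI[of _ _ "(c\<^sup>2 - a) / z * y"]) (use z(2) c(3) that in \<open>auto simp: stab_def\<close>)
    moreover have "c\<^sup>2 - a \<in> L" using subf_closed(7)[OF L subf_power[OF L c(1)]] a(1) vrL by blast
    ultimately show ?thesis unfolding I_def by blast
   qed
   have cI: "\<forall>y\<in>I A. c * y \<in> I A" using base(3)[OF A c(1,2)] by blast
   note q = residue_system_quadratic[OF base(1)[OF A] cI aS c2 nsq]
   show "residue_system {x + y * c | x y. x \<in> S A & y \<in> S A} (I A) {x + y * c | x y. x \<in> R & y \<in> R}"
    "card {x + y * c | x y. x \<in> R & y \<in> R} = (card R)\<^sup>2" using q(1,2) by simp_all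
   show "x \<in> S A ==> y \<in> S A ==> x + y * c \<in> I A ==> x \<in> I A & y \<in> I A" for x y using q(3) .
   have st: "stab s A" if s: "s \<in> {x + y * c | x y. x \<in> S A & y \<in> S A}" for s
   proof -
   from s obtain x y where e: "x \<in> S A" "y \<in> S A" "s = x + y * c" by blast
   have "x * t + y * (c * t) \<in> A" if "t \<in> A" for t
    using base(4)[OF A e(1)] base(4)[OF A e(2)] c(2) that submodD(3)[OF sA] unfolding stab_def by blast
   then show ?thesis unfolding e stab_def by (simp add: algebra_simps)
   qed
   then show 1: "\<forall>s\<in>{x + y * c | x y. x \<in> S A & y \<in> S A}. stab s A" by blast
   have "stab s ((*) z ` A)" if "stab s A" for s using that by (auto simp: stab_def mult.left_commute[of s])
   with 1 show "\<forall>s\<in>{x + y * c | x y. x \<in> S A & y \<in> S A}. stab s ((*) z ` A)" by blast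
  qed
  show "\<exists>j. ind z = card R ^ (2 * j)" if c: "c \<in> ic" "a \<in> vr" "(c\<^sup>2 - a) / z \<in> ic" "\<forall>x\<in>vr. x\<^sup>2 - a ~: mi"
  proof -
   obtain A where A: "lattice A" "stab z A" "stab (\<pi> / z) A" "stab c A" "stab ((c\<^sup>2 - a) / z) A"
    using common_lattice[of "{z, \<pi> / z, c, (c\<^sup>2 - a) / z}"] z c by auto
   have cL: "c \<in> L" using c ic_L by auto
   note f = first[OF A(1-3) cL A(4,5) c(2,4)]
   from pow[OF A(1-3) f(1) f(4,5)] obtain j where "ind z = card {x + y * c | x y. x \<in> R & y \<in> R} ^ j" by blast
   then have "ind z = ((card R)\<^sup>2) ^ j" using f(2) by simp
   then show ?thesis by (intro exI[of _ j]) (simp add: power_mult)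
  qed
  show "\<exists>j. ind z = card R ^ (4 * j)" if c: "c \<in> ic" "a \<in> vr" "(c ^ 4 - a) / z \<in> ic" "\<forall>x\<in>vr. x\<^sup>2 - a ~: mi"
   and i: "i \<in> K" "i\<^sup>2 = - 1"
  proof -
   obtain A where A: "lattice A" "stab z A" "stab (\<pi> / z) A" "stab c A" "stab ((c ^ 4 - a) / z) A"
    using common_lattice[of "{z, \<pi> / z, c, (c ^ 4 - a) / z}"] z c by auto
   have c4: "(c\<^sup>2)\<^sup>2 = c ^ 4" by (simp add: power_mult[symmetric])
   have cL: "c \<in> L" "c\<^sup>2 \<in> L" using c ic_L subf_power[OF L] by auto
   have c2A: "stab (c\<^sup>2) A" using A(4) by (auto simp: stab_def power2_eq_square mult.assoc)
   have A5: "stab (((c\<^sup>2)\<^sup>2 - a) / z) A" unfolding c4 by (rule A(5))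
   note f = first[OF A(1-3) cL(2) c2A A5 c(2,4)]
   let ?S = "{x + y * c\<^sup>2 | x y. x \<in> S A & y \<in> S A}" and ?F = "{x + y * c\<^sup>2 | x y. x \<in> R & y \<in> R}"
   note D = residue_systemD[OF base(1)[OF A(1-3)]]
   note D' = residue_systemD[OF f(1)]
   have iS: "i \<in> S A"
   proof -
    have "i ~= 0" using i(2) by auto
    then have "v (i * i) = v i + v i" using v_mult[OF i(1) i(1)] by simp
    moreover have "v (i * i) = 0" using i(2) v_minus[of 1] v_1 subf_closed[OF K] by (simp add: power2_eq_square)
    ultimately have "i \<in> vr" using i(1) unfolding vr_def by simp
    then show ?thesis unfolding S_def using asgD(1)[OF D(6)] by (intro CollectI exI[of _ i] exI[of _ 0]) simp
   qed
   have c2S: "c\<^sup>2 \<in> ?S" using D(1,13) by (intro CollectI exI[of _ 0] exI[of _ 1]) simp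
   have c2I: "(c\<^sup>2)\<^sup>2 - a \<in> I A"
   proof -
    have "((c\<^sup>2)\<^sup>2 - a) * y \<in> (*) z ` A" if "y \<in> A" for y
     by (rule image_eqI[of _ _ "((c\<^sup>2)\<^sup>2 - a) / z * y"]) (use z(2) A5 that in \<open>auto simp: stab_def\<close>)
    moreover have "(c\<^sup>2)\<^sup>2 - a \<in> L" using subf_closed(7)[OF L subf_power[OF L cL(2)]] c(2) vrL by blast
    ultimately show ?thesis unfolding I_def by blast
   qed
   have nsq': "t\<^sup>2 - c\<^sup>2 ~: I A" if "t \<in> ?S" for t
   proof
    assume h: "t\<^sup>2 - c\<^sup>2 \<in> I A"
    from that obtain x y where e: "x \<in> S A" "y \<in> S A" "t = x + y * c\<^sup>2" by blast
    have xx: "x * x + a * (y * y) \<in> S A" "(x * y + x * y) - 1 \<in> S A"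
     using D(2)[OF D(4)[OF e(1,1)] D(4)[OF f(6) D(4)[OF e(2,2)]]]
      D(3)[OF D(2)[OF D(4)[OF e(1,2)] D(4)[OF e(1,2)]] D(1)] by simp_all
    have "t\<^sup>2 - c\<^sup>2 - (y * y) * ((c\<^sup>2)\<^sup>2 - a) \<in> I A"
     using asgD(3)[OF D(6) h D(8)[OF D(4)[OF e(2,2)] c2I]] .
    moreover have "t\<^sup>2 - c\<^sup>2 - (y * y) * ((c\<^sup>2)\<^sup>2 - a) = (x * x + a * (y * y)) + ((x * y + x * y) - 1) * c\<^sup>2"
     unfolding e(3) by (simp add: algebra_simps power2_eq_square)
    ultimately have I: "x * x + a * (y * y) \<in> I A" "(x * y + x * y) - 1 \<in> I A" using f(3)[OF xx] by simp_all
    define u where "u = x * x + x * x"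
    have uS: "u \<in> S A" unfolding u_def using D(2)[OF D(4)[OF e(1,1)] D(4)[OF e(1,1)]] .
    have iu: "i * u \<in> S A" using D(4)[OF iS uS] .
    have p: "(4 * x * x) * (x * x + a * (y * y)) \<in> I A"
    proof -
     have "4 * x * x = u + u" unfolding u_def by simp
     then show ?thesis using D(8)[OF D(2)[OF uS uS] I(1)] by simp
    qed
    have q: "(a * ((x * y + x * y) + 1)) * ((x * y + x * y) - 1) \<in> I A"
     using D(8)[OF D(4)[OF f(6) D(2)[OF D(2)[OF D(4)[OF e(1,2)] D(4)[OF e(1,2)]] D(1)]] I(2)] .
    have "(a * ((x * y + x * y) + 1)) * ((x * y + x * y) - 1) - (4 * x * x) * (x * x + a * (y * y)) \<in> I A"
     using asgD(3)[OF D(6) q p] .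
    moreover have "(a * ((x * y + x * y) + 1)) * ((x * y + x * y) - 1) - (4 * x * x) * (x * x + a * (y * y)) = (i * u)\<^sup>2 - a"
    proof -
     have "(i * u)\<^sup>2 = - (u * u)" by (simp only: power_mult_distrib i(2)) (simp add: power2_eq_square)
     then show ?thesis unfolding u_def by (simp add: algebra_simps)
    qed
    ultimately show False using f(7) iu by simp
   qed
   then have nsq: "\<forall>t\<in>?S. t\<^sup>2 - c\<^sup>2 ~: I A" by blast
   have c0: "c\<^sup>2 - c\<^sup>2 \<in> I A" using asgD(1)[OF D(6)] by simp
   have cI: "\<forall>y\<in>I A. c * y \<in> I A" using base(3)[OF A(1-3) cL(1) A(4)] by blast
   note g = residue_system_quadratic[OF f(1) cI c2S c0 nsq]
   let ?S' = "{x + y * c | x y. x \<in> ?S & y \<in> ?S}" and ?F' = "{x + y * c | x y. x \<in> ?F & y \<in> ?F}"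
   have sA: "submod A" using A by (simp add: lattice_def)
   have st: "stab s A" if "s \<in> ?S'" for s
   proof -
    from affine_combination[OF that] obtain x y where e: "x \<in> ?S" "y \<in> ?S" "s = x + y * c" by (elim bexE)
    have "x * t + y * (c * t) \<in> A" if "t \<in> A" for t
     using bspec[OF f(4) e(1)] bspec[OF f(4) e(2)] A(4) that submodD(3)[OF sA] unfolding stab_def by blast
    then show "stab s A" unfolding e stab_def by (simp add: algebra_simps)
   qed
   have st': "stab s ((*) z ` A)" if "s \<in> ?S'" for s using st[OF that] by (auto simp: stab_def mult.left_commute[of s])
   have "card ?F' = card R ^ 4" unfolding g(2) f(2) by (simp add: power_mult[symmetric])
   moreover obtain j where "ind z = card ?F' ^ j" using pow[OF A(1-3) g(1) ballI[OF st] ballI[OF st']] by blast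
   ultimately show ?thesis by (intro exI[of _ j]) (simp add: power_mult)
  qed
qed

end

section \<open>Valuations given by prime elements\<close>

context dvf_ext
begin

lemma prime_not_self_div:
  assumes p: "prime_ic z" "prime_ic y" and d: "y / z \<in> ic"
  shows "z / y \<in> ic"
proof -
  have z: "z \<in> ic" "z ~= 0" "1 / z ~: ic" and y: "y \<in> ic" "y ~= 0" using p by (auto simp: prime_ic_def)
  have "z * (y / z) / y \<in> ic" using z y ic_closed(2) by simp
  with p(2) z(1) d have "z / y \<in> ic \<or> y / z / y \<in> ic" unfolding prime_ic_def by blast
  moreover have e: "y / z / y = 1 / z" using y by simp
  ultimately show ?thesis using z(3) unfolding e by blast
qed

text \<open>
  For `x = \<pi>` and `d = 4` this is what is used of the identity `n = \<Sum> e j`. The induction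
  removes all factors `z` of `x` at once, the index being multiplicative.
\<close>
lemma odd_prime_exists:
  assumes "x \<in> ic" "x ~= 0" "\<pi> / x \<in> ic" "ind x = card R ^ k" "\<not> d dvd k"
  shows "\<exists>z m j. prime_ic z & \<pi> / z \<in> ic & x / z ^ m \<in> ic & x / z ^ Suc m ~: ic & ind z = card R ^ j & \<not> d dvd m * j"
  using assms
proof (induction "ind x" arbitrary: x k rule: less_induct)
  case (less x k)
  have q2: "card R \<ge> 2" by (rule R_card)
  have "1 / x ~: ic"
  proof
   assume "1 / x \<in> ic"
   then have "card R ^ k = card R ^ 0" using ind_unit less.prems by simp
   then have "k = 0" using q2 power_inject_exp[of "card R" k 0] by simp
   with less.prems(5) show False by simp
  qed
  then obtain z where z: "prime_ic z" "x / z \<in> ic" using prime_divisor less.prems by blast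
  have z': "z \<in> ic" "z ~= 0" "1 / z ~: ic" using z by (auto simp: prime_ic_def)
  obtain m where m: "x / z ^ m \<in> ic" "x / z ^ Suc m ~: ic" using multiplicity_ex[OF z(1) less.prems(1,2)] by blast
  have "m ~= 0" using m(2) z(2) by (cases m) auto
  have pz: "\<pi> / z \<in> ic"
  proof -
   have e: "\<pi> / z = \<pi> / x * (x / z)" using less.prems(2) by simp
   show ?thesis unfolding e by (rule ic_closed(5)[OF less.prems(3) z(2)])
  qed
  obtain j where j: "ind z = card R ^ j" using index_of_pi_divisor(1)[OF z' pz] by blast
  show ?case
  proof (cases "d dvd m * j")
   case False
   with z m j pz show ?thesis by blast
  next
   case True
   define x' where "x' = x / z ^ m"
   have x': "x' \<in> ic" "x' ~= 0" "x = z ^ m * x'" using m less.prems z' unfolding x'_def by auto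
   have px': "\<pi> / x' \<in> ic"
   proof -
    have "\<pi> / x' = \<pi> / x * z ^ m" using x' z' by simp
    then show ?thesis using ic_closed(5)[OF less.prems(3) ic_power[OF z'(1)]] by simp
   qed
   have ix: "ind x = ind z ^ m * ind x'"
    using ind_mult[of "z ^ m" x'] ind_power[OF z'(1,2)] x' z' ic_power[OF z'(1)] by simp
   obtain k' where k': "ind x' = card R ^ k'"
   proof (cases "1 / x' \<in> ic")
    case True
    then show ?thesis using that[of 0] ind_unit x' by simp
   next
    case False
    then show ?thesis using index_of_pi_divisor(1)[OF x'(1,2) _ px'] that by blast
   qed
   have "card R ^ k = card R ^ (m * j + k')" using ix less.prems(4) k' j by (simp add: power_add power_mult mult.commute)
   then have k: "k = m * j + k'" using q2 power_inject_exp[of "card R" k "m * j + k'"] by simp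
   have "\<not> d dvd k'" using less.prems(5) True unfolding k by (metis dvd_add)
   moreover have "ind x' < ind x"
   proof -
    have "2 ^ m \<le> ind z ^ m" using prime_ind[OF z(1)] by (intro power_mono) auto
    moreover have "(2::nat) ^ m \<ge> 2 ^ 1" using \<open>m ~= 0\<close> by (intro power_increasing) auto
    ultimately have "ind z ^ m \<ge> 2" by simp
    then show ?thesis using ix ind_pos[OF x'(1,2)] by simp
   qed
   ultimately obtain y m' j' where y: "prime_ic y" "\<pi> / y \<in> ic" "x' / y ^ m' \<in> ic" "x' / y ^ Suc m' ~: ic"
    "ind y = card R ^ j'" "\<not> d dvd m' * j'"
    using less.hyps[OF _ x'(1,2) px' k'] by blast
   have y': "y \<in> ic" "y ~= 0" using y by (auto simp: prime_ic_def)
   have e: "x / y ^ m' = z ^ m * (x' / y ^ m')" using x'(3) by simp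
   have 1: "x / y ^ m' \<in> ic" unfolding e by (rule ic_closed(5)[OF ic_power[OF z'(1), of m] y(3)])
   have 2: "x / y ^ Suc m' ~: ic"
   proof
    assume a: "x / y ^ Suc m' \<in> ic"
    have "x / y ^ Suc m' = z ^ m * (x' / y ^ m') / y" using x'(3) y'(2) by (simp add: field_simps)
    with a have "z ^ m * (x' / y ^ m') / y \<in> ic" by simp
    then have "z ^ m / y \<in> ic \<or> x' / y ^ m' / y \<in> ic"
     using y(1,3) ic_power[OF z'(1), of m] unfolding prime_ic_def by blast
    moreover have e2: "x' / y ^ m' / y = x' / y ^ Suc m'" by (simp add: field_simps)
    ultimately have "z ^ m / y \<in> ic" using y(4) unfolding e2 by blast
    then have "z / y \<in> ic" by (rule prime_power_divides[OF y(1) z'(1)])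
    then have yz: "y / z \<in> ic" by (rule prime_not_self_div[OF y(1) z(1)])
    have "m' ~= 0" using y(6) by (cases m') auto
    then obtain l where l: "m' = Suc l" by (cases m') auto
    have "x' / z = x' / y ^ m' * (y ^ l * (y / z))" using y'(2) unfolding l by (simp add: field_simps)
    then have "x' / z \<in> ic" using ic_closed(5)[OF y(3) ic_closed(5)[OF ic_power[OF y'(1), of l] yz]] by simp
    moreover have "x' / z = x / z ^ Suc m" unfolding x'_def by (simp add: field_simps)
    ultimately show False using m(2) by simp
   qed
   from y 1 2 show ?thesis by blast
  qed
qed

lemma prime_coprime:
  assumes z: "prime_ic z" and t: "t \<in> ic" "t / z ~: ic"
  shows "\<exists>w\<in>ic. \<exists>b\<in>ic. 1 = w * t + b * z"
proof -
  have z': "z \<in> ic" "z ~= 0" "1 / z ~: ic" using z by (auto simp: prime_ic_def)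
  obtain g a b where g: "g \<in> ic" "g ~= 0" "t / g \<in> ic" "z / g \<in> ic" "a \<in> ic" "b \<in> ic" "g = a * z + b * t"
   by (rule ic_gcd[OF t(1) z'(1,2)])
  have "g * (z / g) / z \<in> ic" using g(2) z'(2) ic_closed(2) by simp
  then have "g / z \<in> ic \<or> z / g / z \<in> ic" using z g(1,4) unfolding prime_ic_def by blast
  moreover have "g / z ~: ic"
  proof
   assume "g / z \<in> ic"
   from ic_closed(5)[OF g(3) this] have "t / z \<in> ic" using g(2) by simp
   with t(2) show False ..
  qed
  moreover have "z / g / z = 1 / g" using z'(2) by simp
  ultimately have ug: "1 / g \<in> ic" by simp
  have "1 = 1 / g * (a * z + b * t)" using g(2) by (simp only: g(7)[symmetric]) simp
  then have "1 = (1 / g * b) * t + (1 / g * a) * z" by (simp add: algebra_simps)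
  then show ?thesis using ic_closed(5)[OF ug g(5)] ic_closed(5)[OF ug g(6)] by blast
qed

text \<open>
  Elements distinct modulo `z` map a vector of a lattice that is not divisible by `z` to distinct
  classes.
\<close>
lemma residue_bound:
  assumes z: "prime_ic z" and S: "finite S" "S \<subseteq> ic" "!!s t. s \<in> S ==> t \<in> S ==> s ~= t ==> (s - t) / z ~: ic"
  shows "card S \<le> ind z"
proof -
  have z': "z \<in> ic" "z ~= 0" "z \<in> L" using z ic_L by (auto simp: prime_ic_def)
  have "\<exists>w b. w \<in> ic & b \<in> ic & 1 = w * (s - t) + b * z" if "s \<in> S" "t \<in> S" "s ~= t" for s t
   using prime_coprime[OF z ic_closed(7)[of s t] S(3)[OF that]] S(2) that by blast
  then obtain w b where wb: "!!s t. s \<in> S ==> t \<in> S ==> s ~= t ==> w s t \<in> ic & b s t \<in> ic & 1 = w s t * (s - t) + b s t * z"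
   by metis
  define P where "P = {(s, t). s \<in> S & t \<in> S & s ~= t}"
  have "P \<subseteq> S \<times> S" unfolding P_def by auto
  then have finP: "finite P" using S(1) finite_subset by blast
  define Y where "Y = insert z (S \<union> (\<lambda>(s, t). w s t) ` P \<union> (\<lambda>(s, t). b s t) ` P)"
  have "finite Y" "Y \<subseteq> ic" using S finP z' wb unfolding Y_def P_def by auto
  from common_lattice[OF this] obtain A where A: "lattice A" "\<forall>y\<in>Y. stab y A" by blast
  have sA: "submod A" using A by (simp add: lattice_def)
  have st: "stab z A" "!!s. s \<in> S ==> stab s A" using A(2) unfolding Y_def by auto
  have wbA: "stab (w s t) A & stab (b s t) A" if "s \<in> S" "t \<in> S" "s ~= t" for s t
   using A(2) that unfolding Y_def P_def by auto
  let ?B = "(*) z ` A"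
  have lB: "lattice ?B" using lattice_scale[OF A(1) z'(3,2)] .
  note aB = lattice_asg[OF lB]
  have id: "idx A ?B (ind z)" using ind[OF z'(3,2) A(1) st(1)] .
  have "\<not> A \<subseteq> ?B"
  proof
   assume AB: "A \<subseteq> ?B"
   have "?B \<subseteq> A" using st(1) by (auto simp: stab_def)
   with AB have "?B = A" by blast
   then have "ind z = 1" using idx_unique[OF lattice_asg[OF A(1)]] id idx_refl[OF lattice_asg[OF A(1)]] by metis
   then show False using prime_ind[OF z] by simp
  qed
  then obtain x where x: "x \<in> A" "x ~: ?B" by blast
  obtain T where T: "T \<subseteq> A" "finite T" "card T = ind z" "\<forall>a\<in>A. \<exists>!t\<in>T. a - t \<in> ?B" using id unfolding idx_def by blast
  then obtain f where f: "!!a. a \<in> A ==> f a \<in> T & a - f a \<in> ?B" by metis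
  have sx: "s * x \<in> A" if "s \<in> S" for s using st(2)[OF that] x(1) by (simp add: stab_def)
  have "inj_on (\<lambda>s. f (s * x)) S"
  proof (rule inj_onI, rule ccontr)
   fix s t assume h: "s \<in> S" "t \<in> S" "f (s * x) = f (t * x)" "s ~= t"
   have "s * x - t * x \<in> ?B"
    using f[OF sx[OF h(1)]] f[OF sx[OF h(2)]] h(3) asg_diff_trans[OF aB, of "s * x" "f (t * x)" "t * x"]
     asg_diff_sym[OF aB, of "t * x" "f (t * x)"] by simp
   then obtain c where c: "c \<in> A" "s * x - t * x = z * c" by blast
   have e: "1 = w s t * (s - t) + b s t * z" using wb[OF h(1,2,4)] by blast
   have "x = (w s t * (s - t) + b s t * z) * x" using e by simp
   also have "... = w s t * (s * x - t * x) + z * (b s t * x)" by (simp add: algebra_simps)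
   also have "... = z * (w s t * c + b s t * x)" unfolding c(2) by (simp add: algebra_simps)
   finally have "x = z * (w s t * c + b s t * x)" .
   moreover have "w s t * c + b s t * x \<in> A"
    using wbA[OF h(1,2,4)] c(1) x(1) submodD(3)[OF sA] unfolding stab_def by blast
   ultimately show False using x(2) by blast
  qed
  moreover have "(\<lambda>s. f (s * x)) ` S \<subseteq> T" using f sx by blast
  ultimately show ?thesis using card_inj_on_le T(2,3) by metis
qed

lemma residue_representatives:
  assumes z: "prime_ic z"
  shows "\<exists>S. finite S & S \<subseteq> ic & (\<forall>x\<in>ic. \<exists>!s\<in>S. (x - s) / z \<in> ic)"
proof -
  define P where "P S \<longleftrightarrow> finite S & S \<subseteq> ic & (\<forall>s\<in>S. \<forall>t\<in>S. s ~= t --> (s - t) / z ~: ic)" for S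
  have b: "card S \<le> ind z" if "P S" for S using residue_bound[OF z, of S] that unfolding P_def by blast
  have "P {}" unfolding P_def by simp
  obtain S where S: "P S" and max: "!!T. P T ==> card T \<le> card S"
   using ex_has_greatest_nat[of P "{}" card "Suc (ind z)"] b \<open>P {}\<close> by (metis le_imp_less_Suc)
  have add: "(x - t) / z \<in> ic" if "(x - s) / z \<in> ic" "(s - t) / z \<in> ic" for x s t
   using ic_closed(4)[OF that] by (simp add: diff_divide_distrib)
  have sym: "(s - x) / z \<in> ic" if "(x - s) / z \<in> ic" for x s
   using ic_closed(6)[OF that] by (simp add: diff_divide_distrib)
  have "\<forall>x\<in>ic. \<exists>!s\<in>S. (x - s) / z \<in> ic"
  proof (intro ballI ex_ex1I)
   fix x assume x: "x \<in> ic"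
   show "\<exists>s. s \<in> S & (x - s) / z \<in> ic"
   proof (rule ccontr)
    assume n: "\<not> ?thesis"
    have "x ~: S" using n ic_closed(1) by auto
    have "P (insert x S)" using S x n sym unfolding P_def by auto
    from max[OF this] \<open>x ~: S\<close> S show False unfolding P_def by simp
   qed
  next
   fix x s t assume "s \<in> S & (x - s) / z \<in> ic" "t \<in> S & (x - t) / z \<in> ic"
   then have "s \<in> S" "t \<in> S" "(s - t) / z \<in> ic" using add sym by blast+
   with S show "s = t" unfolding P_def by blast
  qed
  with S show ?thesis unfolding P_def by blast
qed

definition zrep :: "'a \<Rightarrow> 'a \<Rightarrow> int \<Rightarrow> 'a \<Rightarrow> 'a \<Rightarrow> bool" where
  "zrep z x m s t \<longleftrightarrow> s \<in> ic & t \<in> ic & s / z ~: ic & t / z ~: ic & x = z powi m * s / t"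

text \<open>
  The order of divisibility by `z`, an integer since `L` is the fraction field of `ic`.
\<close>
definition zval :: "'a \<Rightarrow> 'a \<Rightarrow> int" where
  "zval z x = (SOME m. \<exists>s t. zrep z x m s t)"

lemma nondiv_nonzero: "s / z ~: ic ==> s ~= 0" using ic_closed(1) by auto

lemma zrep_ex:
  assumes z: "prime_ic z" and x: "x \<in> L" "x ~= 0"
  shows "\<exists>m s t. zrep z x m s t"
proof -
  have z': "z ~= 0" using z by (auto simp: prime_ic_def)
  obtain k where k: "\<pi> ^ k * x \<in> ic" using ic_frac[OF x(1)] by blast
  have p: "\<pi> ^ k \<in> ic" "\<pi> ^ k ~= 0" using unif unif_vr ic_closed(3) ic_power by auto
  have nz: "\<pi> ^ k * x ~= 0" using p x by simp
  obtain a where a: "\<pi> ^ k * x / z ^ a \<in> ic" "\<pi> ^ k * x / z ^ Suc a ~: ic" by (rule multiplicity_ex[OF z k nz])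
  obtain b where b: "\<pi> ^ k / z ^ b \<in> ic" "\<pi> ^ k / z ^ Suc b ~: ic" by (rule multiplicity_ex[OF z p])
  have "x = z powi (int a - int b) * (\<pi> ^ k * x / z ^ a) / (\<pi> ^ k / z ^ b)"
   using z' p by (simp add: power_int_diff field_simps)
  moreover have "\<pi> ^ k * x / z ^ a / z ~: ic" "\<pi> ^ k / z ^ b / z ~: ic" using a(2) b(2) by (simp_all add: mult.commute)
  ultimately show ?thesis using a(1) b(1) unfolding zrep_def by blast
qed

lemma zrep_mono:
  assumes z: "prime_ic z" and r: "zrep z x m s t" "zrep z x m' s' t'"
  shows "m \<le> m'"
proof (rule ccontr)
  assume "\<not> m \<le> m'"
  then obtain k where k: "m = m' + int (Suc k)" by (metis add.commute linorder_not_le zless_iff_Suc_zadd)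
  have z': "z \<in> ic" "z ~= 0" using z by (auto simp: prime_ic_def)
  have nz: "t ~= 0" "t' ~= 0" using r nondiv_nonzero unfolding zrep_def by blast+
  have "z powi m' * (z ^ Suc k * s) / t = z powi m' * s' / t'"
   using r z'(2) unfolding zrep_def k by (simp add: power_int_add algebra_simps)
  then have "z ^ Suc k * s * t' = s' * t" using nz z'(2) by (simp add: field_simps)
  then have e: "s' * t / z = z ^ k * (s * t')" using z'(2) by (simp add: field_simps)
  have "s' * t / z \<in> ic" unfolding e using r ic_power[OF z'(1)] unfolding zrep_def by (auto intro!: ic_ring)
  then show False using z r unfolding prime_ic_def zrep_def by blast
qed

lemma zval_eq: "prime_ic z ==> zrep z x m s t ==> zval z x = m"
proof -
  assume z: "prime_ic z" and r: "zrep z x m s t"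
  then have "\<exists>s t. zrep z x (zval z x) s t" unfolding zval_def using someI_ex[of "\<lambda>m. \<exists>s t. zrep z x m s t"] by blast
  with r show ?thesis using zrep_mono[OF z] by (meson antisym)
qed

lemma zval:
  assumes z: "prime_ic z"
  shows "x \<in> L ==> x ~= 0 ==> \<exists>s t. zrep z x (zval z x) s t"
   and "x \<in> L ==> x ~= 0 ==> y \<in> L ==> y ~= 0 ==> zval z (x * y) = zval z x + zval z y"
   and "x \<in> L ==> x ~= 0 ==> y \<in> L ==> y ~= 0 ==> x + y ~= 0 ==> min (zval z x) (zval z y) \<le> zval z (x + y)"
   and "x \<in> ic ==> x ~= 0 ==> x / z ^ m \<in> ic ==> x / z ^ Suc m ~: ic ==> zval z x = int m"
   and "x \<in> ic ==> x ~= 0 ==> 0 \<le> zval z x" and "x \<in> ic ==> x ~= 0 ==> 1 \<le> zval z x \<longleftrightarrow> x / z \<in> ic"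
   and "zval z z = 1"
proof -
  have z': "z \<in> ic" "z ~= 0" "1 / z ~: ic" using z by (auto simp: prime_ic_def)
  have ic1: "1 \<in> ic" using ic_closed(2) .
  show ex: "\<exists>s t. zrep z x (zval z x) s t" if "x \<in> L" "x ~= 0" for x
   using zrep_ex[OF z that] unfolding zval_def by (rule someI_ex)
  have nd: "s * t / z ~: ic" if "s \<in> ic" "t \<in> ic" "s / z ~: ic" "t / z ~: ic" for s t
   using z that unfolding prime_ic_def by blast
  show mlt: "zval z (x * y) = zval z x + zval z y" if xy: "x \<in> L" "x ~= 0" "y \<in> L" "y ~= 0" for x y
  proof -
   obtain s t s' t' where r: "zrep z x (zval z x) s t" "zrep z y (zval z y) s' t'" using ex[OF xy(1,2)] ex[OF xy(3,4)] by blast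
   have "x = z powi zval z x * s / t" "y = z powi zval z y * s' / t'" using r unfolding zrep_def by blast+
   then have "x * y = (z powi zval z x * s / t) * (z powi zval z y * s' / t')" by (rule arg_cong2[where f = "(*)"])
   then have "x * y = z powi (zval z x + zval z y) * (s * s') / (t * t')"
    using z'(2) by (simp add: power_int_add)
   then have "zrep z (x * y) (zval z x + zval z y) (s * s') (t * t')"
    using r nd ic_closed(5) unfolding zrep_def by blast
   then show ?thesis by (rule zval_eq[OF z])
  qed
  show mul: "zval z x = int m" if "x \<in> ic" "x ~= 0" "x / z ^ m \<in> ic" "x / z ^ Suc m ~: ic" for x m
  proof (rule zval_eq[OF z])
   show "zrep z x (int m) (x / z ^ m) 1" unfolding zrep_def using that z' ic1 by (simp add: mult.commute)
  qed
  show pos: "0 \<le> zval z x" if "x \<in> ic" "x ~= 0" for x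
   using multiplicity_ex[OF z that] mul[OF that] by (metis of_nat_0_le_iff)
  show "1 \<le> zval z x \<longleftrightarrow> x / z \<in> ic" if x: "x \<in> ic" "x ~= 0"
  proof -
   obtain m where m: "x / z ^ m \<in> ic" "x / z ^ Suc m ~: ic" by (rule multiplicity_ex[OF z x])
   show ?thesis
   proof (cases m)
    case 0
    then show ?thesis using mul[OF x m] m by simp
   next
    case (Suc k)
    have "x / z = z ^ k * (x / z ^ m)" using z'(2) unfolding Suc by (simp add: field_simps)
    then have "x / z \<in> ic" using ic_closed(5)[OF ic_power[OF z'(1)] m(1)] by simp
    with mul[OF x m] Suc show ?thesis by simp
   qed
  qed
  show "zval z z = 1" using mul[of z 1] z' ic1 by simp
  show "min (zval z x) (zval z y) \<le> zval z (x + y)" if xy: "x \<in> L" "x ~= 0" "y \<in> L" "y ~= 0" "x + y ~= 0" for x y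
  proof -
   have le: "zval z x \<le> zval z (x + y)"
    if xy: "x \<in> L" "x ~= 0" "y \<in> L" "y ~= 0" "x + y ~= 0" and le: "zval z x \<le> zval z y" for x y
   proof -
    obtain s t s' t' where r: "zrep z x (zval z x) s t" "zrep z y (zval z y) s' t'" using ex[OF xy(1,2)] ex[OF xy(3,4)] by blast
    define k where "k = nat (zval z y - zval z x)"
    have k: "zval z y = zval z x + int k" using le unfolding k_def by simp
    have nz: "t ~= 0" "t' ~= 0" using r nondiv_nonzero unfolding zrep_def by blast+
    have tL: "t \<in> L" "t' \<in> L" "t \<in> ic" "t' \<in> ic" using r ic_L unfolding zrep_def by blast+
    define N where "N = s * t' + z ^ k * s' * t"
    have N: "N \<in> ic" unfolding N_def using r ic_power[OF z'(1)] unfolding zrep_def by (auto intro!: ic_ring)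
    have y: "y = z powi (zval z x) * (z ^ k * s') / t'" using r(2) z'(2) unfolding zrep_def k by (simp add: power_int_add)
    have x: "x = z powi (zval z x) * s / t" using r(1) unfolding zrep_def by blast
    have e: "(x + y) * (t * t') = z powi (zval z x) * N"
    proof -
     have "(z powi i * s / t + z powi i * (z ^ k * s') / t') * (t * t') = z powi i * N" for i
      unfolding N_def using nz by (simp add: field_simps)
     then show ?thesis using x y by metis
    qed
    have N0: "N ~= 0" using e xy(5) nz by auto
    have zi: "z powi i \<in> L & z powi i ~= 0" for i
     using z' ic_L subf_power[OF L] subf_closed(6)[OF L] by (auto simp: power_int_def)
    have zv: "zval z (z powi i) = i" for i
     by (rule zval_eq[OF z, of _ _ 1 1]) (use z' ic1 in \<open>simp add: zrep_def\<close>)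
    have tv: "zval z t = 0" "zval z t' = 0" using mul[of t 0] mul[of t' 0] r tL nz unfolding zrep_def by auto
    have "zval z ((x + y) * (t * t')) = zval z (x + y)"
     using mlt[OF subf_closed(3)[OF L xy(1,3)] xy(5), of "t * t'"] mlt[OF tL(1) nz(1) tL(2) nz(2)] tv nz subf_closed(4)[OF L tL(1,2)] by simp
    moreover have "zval z (z powi (zval z x) * N) = zval z x + zval z N"
     using mlt[of "z powi (zval z x)" N] zi zv N0 N ic_L by auto
    ultimately show ?thesis using e pos[OF N N0] by simp
   qed
   show ?thesis
   proof (cases "zval z x \<le> zval z y")
    case True
    with le[OF xy] show ?thesis by simp
   next
    case False
    with le[of y x] xy show ?thesis by (simp add: add.commute)
   qed
  qed
qed

text \<open>
  The last conclusion says that `ic` is dense in the valuation ring: a denominator prime to `z` is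
  invertible modulo `z`.
\<close>
theorem prime_valuation:
  assumes z: "prime_ic z" "\<pi> / z \<in> ic"
  obtains S where "dvf L (zval z) z S"
   "zval z \<pi> \<ge> 1" "!!x. x \<in> K ==> x ~= 0 ==> zval z x = zval z \<pi> * v x"
   "!!x. x \<in> L ==> x ~= 0 ==> zval z x \<ge> 0 ==> \<exists>c\<in>ic. x = c \<or> zval z (x - c) \<ge> 1"
proof -
  have z': "z \<in> ic" "z ~= 0" "z \<in> L" using z ic_L by (auto simp: prime_ic_def)
  obtain S where S: "finite S" "S \<subseteq> ic" "\<forall>x\<in>ic. \<exists>!s\<in>S. (x - s) / z \<in> ic" using residue_representatives[OF z(1)] by blast
  note V = zval[OF z(1)]
  have inL: "x \<in> L" if "x \<in> ic" for x using that ic_L by blast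
  have z1: "zval z 1 = 0" using V(4)[of 1 0] z ic_closed(2) unfolding prime_ic_def by simp
  have inv: "zval z (inverse x) = - zval z x" if "x \<in> L" "x ~= 0" for x
   using V(2)[OF that subf_closed(6)[OF L that(1)]] that(2) z1 by simp
  have approx: "\<exists>c\<in>ic. x = c \<or> zval z (x - c) \<ge> 1" if x: "x \<in> L" "x ~= 0" "zval z x \<ge> 0" for x
  proof -
   obtain s t where r: "zrep z x (zval z x) s t" using V(1)[OF x(1,2)] by blast
   define s' where "s' = z ^ nat (zval z x) * s"
   have s': "s' \<in> ic" "x = s' / t" "t \<in> ic" "t / z ~: ic" "t ~= 0" using r x(3) ic_power[OF z'(1)] nondiv_nonzero ic_closed(5)
    unfolding zrep_def s'_def by (auto simp: power_int_def)
   obtain w b where wb: "w \<in> ic" "b \<in> ic" "1 = w * t + b * z" using prime_coprime[OF z(1) s'(3,4)] by blast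
   have e: "x - s' * w = z * (s' * b) / t"
   proof -
    have "(x - s' * w) * t = s' * (1 - w * t)" using s'(2,5) by (simp add: algebra_simps)
    also have "1 - w * t = b * z" using wb(3) by (simp add: algebra_simps)
    finally show ?thesis using s'(5) by (simp add: field_simps)
   qed
   show ?thesis
   proof (rule bexI[of _ "s' * w"], rule disjCI)
    assume "\<not> 1 \<le> zval z (x - s' * w)"
    show "x = s' * w"
    proof (rule ccontr)
     assume "x ~= s' * w"
     then have sb: "s' * b ~= 0" using e by auto
     have sbi: "s' * b \<in> ic" using ic_closed(5)[OF s'(1) wb(2)] .
     have "x - s' * w = z * ((s' * b) * inverse t)" unfolding e by (simp add: divide_inverse)
     then have "zval z (x - s' * w) = zval z z + (zval z (s' * b) + zval z (inverse t))"
      using V(2)[OF z'(3,2), of "(s' * b) * inverse t"] V(2)[OF inL[OF sbi] sb, of "inverse t"] sb s'(5) inL[OF s'(3)] inL[OF sbi]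
       subf_closed(6)[OF L] subf_closed(4)[OF L] by simp
     moreover have "zval z t = 0" using V(4)[of t 0] s' by simp
     ultimately have "zval z (x - s' * w) = 1 + zval z (s' * b)" using V(7) inv[OF inL[OF s'(3)] s'(5)] by simp
     with V(5)[OF sbi sb] \<open>\<not> 1 \<le> zval z (x - s' * w)\<close> show False by simp
    qed
   qed (rule ic_closed(5)[OF s'(1) wb(1)])
  qed
  have "dvf L (zval z) z S"
  proof
   show "subf L" "z \<in> L" "z ~= 0" "zval z z = 1" "finite S" using L z' V(7) S(1) by auto
   show "zval z (x * y) = zval z x + zval z y" if "x \<in> L" "y \<in> L" "x ~= 0" "y ~= 0" for x y using V(2) that by blast
   show "min (zval z x) (zval z y) \<le> zval z (x + y)" if "x \<in> L" "y \<in> L" "x ~= 0" "y ~= 0" "x + y ~= 0" for x y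
    using V(3) that by blast
   show "r \<in> L & (r = 0 \<or> 0 \<le> zval z r)" if "r \<in> S" for r using that S(2) inL V(5) by blast
   fix x assume x: "x \<in> L" "x = 0 \<or> 0 \<le> zval z x"
   have "\<exists>c\<in>ic. x = c \<or> zval z (x - c) \<ge> 1" using approx x ic_closed(1) by blast
   then obtain c where c: "c \<in> ic" "x - c = 0 \<or> zval z (x - c) \<ge> 1" unfolding right_minus_eq by blast
   have cong: "(x - s = 0 \<or> 1 \<le> zval z (x - s)) \<longleftrightarrow> (c - s) / z \<in> ic" if s: "s \<in> S" for s
   proof -
    have si: "s \<in> ic" using s S(2) by blast
    have cs: "(c - s) / z \<in> ic \<longleftrightarrow> c - s = 0 \<or> 1 \<le> zval z (c - s)"
     using V(6)[OF ic_closed(7)[OF c(1) si]] ic_closed(1) by (cases "c - s = 0") auto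
    have tr: "u + w = 0 \<or> 1 \<le> zval z (u + w)" if "u \<in> L" "w \<in> L" "u = 0 \<or> 1 \<le> zval z u" "w = 0 \<or> 1 \<le> zval z w" for u w
     using V(3)[of u w] that by (cases "u = 0"; cases "w = 0"; cases "u + w = 0") auto
    have mn: "zval z (- u) = zval z u" if "u \<in> L" "u ~= 0" for u
    proof -
     have m1L: "- 1 \<in> L" using subf_closed(2,5)[OF L] by blast
     have "zval z (- 1) + zval z (- 1) = zval z 1" using V(2)[OF m1L _ m1L] by simp
     then have "zval z (- 1) = 0" using z1 by simp
     then show ?thesis using V(2)[OF m1L _ that] by simp
    qed
    have L': "x - c \<in> L" "c - s \<in> L" "x - s \<in> L" "- (x - c) \<in> L" using x(1) inL c(1) si subf_closed(5,7)[OF L] by auto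
    have neg: "- (x - c) = 0 \<or> 1 \<le> zval z (- (x - c))"
    proof (cases "x - c = 0")
     case False
     with c(2) have "1 \<le> zval z (- (x - c))" by (simp only: mn[OF L'(1) False] simp_thms)
     then show ?thesis ..
    qed simp
    show ?thesis unfolding cs using tr[OF L'(1,2) c(2)] tr[OF L'(4,3) neg] by auto
   qed
   show "\<exists>!r\<in>S. x - r = 0 \<or> 1 \<le> zval z (x - r)"
    using S(3)[rule_format, OF c(1)] cong by (metis (no_types, lifting))
  qed
  moreover have p: "zval z \<pi> \<ge> 1" using V(6)[OF ic_closed(3)[OF unif_vr] unif(2)] z(2) by simp
  moreover have "zval z x = zval z \<pi> * v x" if x: "x \<in> K" "x ~= 0" for x
  proof -
   have piv: "zval z (\<pi> ^ k) = int k * zval z \<pi>" for k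
   proof (induction k)
    case (Suc k)
    then show ?case using V(2)[OF piL(2) unif(2) piL(1)[of k]] unif(2) by (simp add: algebra_simps)
   qed (simp add: z1)
   have unit: "zval z y = 0" if y: "y \<in> K" "y ~= 0" "v y = 0" for y
   proof -
    have "y \<in> vr" "inverse y \<in> vr" using y v_inverse[of y] subf_closed(6)[OF K] by (auto simp: vr_def)
    then have "y \<in> ic" "inverse y \<in> ic" using ic_closed(3) by auto
    then have "0 \<le> zval z y" "0 \<le> zval z (inverse y)" using V(5) y(2) by auto
    with inv[OF _ y(2)] \<open>y \<in> ic\<close> inL show ?thesis by auto
   qed
   have xL: "x \<in> L" using x KL by blast
   show ?thesis
   proof (cases "v x \<ge> 0")
    case True
    define k where "k = nat (v x)"
    have pk: "\<pi> ^ k \<in> K" "\<pi> ^ k ~= 0" "v (\<pi> ^ k) = v x" using unif v_power[of \<pi> k] subf_power[OF K] True unfolding k_def by auto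
    have y: "x / \<pi> ^ k \<in> K" "x / \<pi> ^ k ~= 0" "v (x / \<pi> ^ k) = 0" using v_divide[OF x pk(1,2)] pk x subf_closed(8)[OF K] by auto
    have "zval z x = zval z (\<pi> ^ k * (x / \<pi> ^ k))" using pk by simp
    also have "... = zval z (\<pi> ^ k)" using V(2)[OF piL(1) pk(2), of "x / \<pi> ^ k"] y unit[OF y] KL by auto
    finally show ?thesis unfolding piv using True unfolding k_def by simp
   next
    case False
    define k where "k = nat (- v x)"
    have pk: "\<pi> ^ k \<in> K" "\<pi> ^ k ~= 0" "v (\<pi> ^ k) = - v x" using unif v_power[of \<pi> k] subf_power[OF K] False unfolding k_def by auto
    have y: "x * \<pi> ^ k \<in> K" "x * \<pi> ^ k ~= 0" "v (x * \<pi> ^ k) = 0" using v_mult[OF x(1) pk(1) x(2) pk(2)] pk x subf_closed(4)[OF K] by auto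
    have "zval z (x * \<pi> ^ k) = zval z x + zval z (\<pi> ^ k)" using V(2)[OF xL x(2) piL(1) pk(2)] .
    then show ?thesis unfolding piv unit[OF y] using False unfolding k_def by simp
   qed
  qed
  ultimately show ?thesis using that approx by blast
qed

end

section \<open>Norm equations over a discretely valued field\<close>

context dvf
begin

text \<open>
  A nonsquare of the residue field.
\<close>
definition nonsq :: "'a \<Rightarrow> bool" where
  "nonsq a \<longleftrightarrow> a \<in> vr & (\<forall>x\<in>vr. x\<^sup>2 - a ~: mi)"

lemma mi_closed: "0 \<in> mi" "x \<in> mi ==> y \<in> mi ==> x + y \<in> mi" "x \<in> vr ==> y \<in> mi ==> x * y \<in> mi"
  "x \<in> mi ==> - x \<in> mi" "x \<in> mi ==> y \<in> mi ==> x - y \<in> mi" "x \<in> mi ==> x \<in> vr" "1 ~: mi"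
proof -
  show "0 \<in> mi" using vr_closed by (simp add: mi_iff)
  show "x \<in> mi ==> y \<in> mi ==> x + y \<in> mi" using vr_closed(3)[of "x / \<pi>" "y / \<pi>"] by (simp add: mi_iff add_divide_distrib)
  show "x \<in> vr ==> y \<in> mi ==> x * y \<in> mi" using vr_closed(4)[of x "y / \<pi>"] by (simp add: mi_iff)
  show "x \<in> mi ==> - x \<in> mi" using vr_closed(5)[of "x / \<pi>"] by (simp add: mi_iff)
  show "x \<in> mi ==> y \<in> mi ==> x - y \<in> mi" using vr_closed(6)[of "x / \<pi>" "y / \<pi>"] by (simp add: mi_iff diff_divide_distrib)
  show "x \<in> mi ==> x \<in> vr" by (auto simp: mi_def vr_def)
  show "1 ~: mi" using v_1 by (simp add: mi_def)
qed

lemma unit_iff: "x \<in> vr ==> x ~: mi \<longleftrightarrow> x ~= 0 & v x = 0"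
  by (auto simp: vr_def mi_def)

lemma unit_mult: "x \<in> vr ==> y \<in> vr ==> x ~: mi ==> y ~: mi ==> x * y ~: mi"
  using v_mult[of x y] by (auto simp: vr_def mi_def)

lemma v_add_eq:
  assumes "x \<in> K" "y \<in> K" "x ~= 0" "y ~= 0" "v x < v y"
  shows "x + y ~= 0" "v (x + y) = v x"
proof -
  have yK: "- y \<in> K" using assms subf_closed(5)[OF K] by blast
  show nz: "x + y ~= 0"
  proof
   assume "x + y = 0"
   then have "x = - y" by (simp add: eq_neg_iff_add_eq_0)
   with v_minus[OF assms(2)] assms(5) show False by simp
  qed
  have "min (v (x + y)) (v (- y)) \<le> v ((x + y) + - y)"
   using v_add[OF subf_closed(3)[OF K assms(1,2)] yK nz] assms by simp
  then have "min (v (x + y)) (v y) \<le> v x" using v_minus[OF assms(2)] by simp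
  moreover have "min (v x) (v y) \<le> v (x + y)" using v_add[OF assms(1-4) nz] .
  ultimately show "v (x + y) = v x" using assms(5) by linarith
qed

lemma nonsq_unit: "nonsq a ==> a \<in> K & a ~= 0 & v a = 0"
proof -
  assume a: "nonsq a"
  then have av: "a \<in> vr" by (simp add: nonsq_def)
  have "0\<^sup>2 - a ~: mi" using a vr_closed(1) unfolding nonsq_def by blast
  then have "a ~: mi" using mi_closed(4)[of a] by auto
  with unit_iff[OF av] vr_K av show ?thesis by auto
qed

text \<open>
  After scaling one of `x`, `y` is a unit and both are integral; then `x^2 - a y^2` is a unit,
  since `a` is not a square modulo `v`.
\<close>
lemma norm_form_even:
  assumes a: "nonsq a" and xy: "x \<in> K" "y \<in> K" "x ~= 0 \<or> y ~= 0"
  shows "x\<^sup>2 - a * y\<^sup>2 ~= 0 & even (v (x\<^sup>2 - a * y\<^sup>2))"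
proof -
  note u = nonsq_unit[OF a]
  have v2: "v (t\<^sup>2) = 2 * v t" if "t \<in> K" "t ~= 0" for t using v_power[OF that, of 2] by simp
  have K2: "t\<^sup>2 \<in> K" if "t \<in> K" for t using subf_power[OF K that] .
  have ay: "- (a * y\<^sup>2) \<in> K" "y ~= 0 ==> v (- (a * y\<^sup>2)) = 2 * v y"
   using u K2[OF xy(2)] subf_closed(4,5)[OF K] v_minus v_mult[of a "y\<^sup>2"] v2[OF xy(2)] by auto
  consider "y = 0" | "x = 0" "y ~= 0" | "x ~= 0" "y ~= 0" "v x < v y" | "x ~= 0" "y ~= 0" "v y < v x"
   | "x ~= 0" "y ~= 0" "v x = v y" by linarith
  then show ?thesis
  proof cases
   case 1 then show ?thesis using xy v2 by simp
  next
   case 2 then show ?thesis using u ay(2) by simp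
  next
   case 3
   then show ?thesis using v_add_eq[OF K2[OF xy(1)] ay(1)] u ay(2) v2[OF xy(1)] by simp
  next
   case 4
   then show ?thesis using v_add_eq[OF ay(1) K2[OF xy(1)]] u ay(2) v2[OF xy(1)] by (simp add: add.commute)
  next
   case 5
   define t where "t = x / y"
   have t: "t \<in> vr" using v_divide[OF xy(1) 5(1) xy(2) 5(2)] 5 subf_closed(8)[OF K xy(1,2)] unfolding t_def vr_def by simp
   have e: "x\<^sup>2 - a * y\<^sup>2 = y\<^sup>2 * (t\<^sup>2 - a)" unfolding t_def using 5(2) by (simp add: field_simps power2_eq_square)
   have "t\<^sup>2 - a \<in> vr" "t\<^sup>2 - a ~: mi" using a t vr_power vr_closed(6) unfolding nonsq_def by blast+
   then have "t\<^sup>2 - a ~= 0" "v (t\<^sup>2 - a) = 0" "t\<^sup>2 - a \<in> K" using unit_iff vr_K by blast+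
   then show ?thesis unfolding e using v_mult[OF K2[OF xy(2)], of "t\<^sup>2 - a"] v2[OF xy(2)] 5(2) by simp
  qed
qed

text \<open>
  Newton approximations of a square root of `d` replace the completion.
\<close>
lemma newton:
  assumes two: "(2::'a) ~= 0" "v 2 = 0" and d: "d \<in> K" and g: "g \<in> K" "g ~= 0" and close: "g\<^sup>2 = d \<or> v (g\<^sup>2 - d) > 2 * v g"
  shows "\<exists>c\<in>K. (c = g \<or> v (c - g) > v g) & c ~= 0 & (c\<^sup>2 = d \<or> v (c\<^sup>2 - d) > 2 * v g + int k)"
proof (induction k)
  case 0
  then show ?case using g close by (intro bexI[of _ g]) auto
next
  case (Suc k)
  then obtain c where c: "c \<in> K" "c = g \<or> v (c - g) > v g" "c ~= 0" "c\<^sup>2 = d \<or> v (c\<^sup>2 - d) > 2 * v g + int k" by blast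
  show ?case
  proof (cases "c\<^sup>2 = d")
   case True
   with c show ?thesis by blast
  next
   case False
   then have nz: "c\<^sup>2 - d ~= 0" by simp
   have dK: "c\<^sup>2 - d \<in> K" using subf_closed(7)[OF K subf_power[OF K c(1)] d] .
   have twoK: "2 \<in> K" using subf_numeral[OF K] .
   have vc: "v c = v g"
    using c(2)
   proof
    assume h: "v (c - g) > v g"
    show ?thesis
    proof (cases "c - g = 0")
     case False
     then show ?thesis using v_add_eq(2)[OF g(1) subf_closed(7)[OF K c(1) g(1)] g(2) False h] by simp
    qed simp
   qed simp
   define h where "h = (c\<^sup>2 - d) / (2 * c)"
   have h: "h \<in> K" "h ~= 0" using dK twoK c nz two subf_closed(4,8)[OF K] unfolding h_def by auto
   have v2c: "v (2 * c) = v g" using v_mult[OF twoK c(1) two(1) c(3)] two vc by simp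
   have vh: "v h = v (c\<^sup>2 - d) - v g" unfolding h_def
    using v_divide[OF dK nz subf_closed(4)[OF K twoK c(1)]] two c(3) v2c by simp
   with c(4) False have vh': "v h > v g + int k" by simp
   define c' where "c' = c - h"
   have e: "c'\<^sup>2 - d = h\<^sup>2"
   proof -
    have "2 * c * h = c\<^sup>2 - d" unfolding h_def using two c(3) by simp
    then show ?thesis unfolding c'_def by (simp add: power2_eq_square algebra_simps)
   qed
   have c'K: "c' \<in> K" unfolding c'_def using subf_closed(7)[OF K c(1) h(1)] .
   have "v (c'\<^sup>2 - d) = 2 * v h" unfolding e using v_power[OF h, of 2] by simp
   with vh' have 1: "v (c'\<^sup>2 - d) > 2 * v g + int (Suc k)"
   proof -
    have "2 * v h \<ge> 2 * (v g + int k + 1)" using vh' by simp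
    then show ?thesis using \<open>v (c'\<^sup>2 - d) = 2 * v h\<close> by simp
   qed
   have 2: "c' = g \<or> v (c' - g) > v g"
   proof (cases "c' = g")
    case False
    show ?thesis
    proof (cases "c = g")
     case True
     then have "c' - g = - h" unfolding c'_def by simp
     then show ?thesis using v_minus[OF h(1)] vh' by simp
    next
     case cg: False
     have e: "c' - g = (c - g) + - h" unfolding c'_def by simp
     have "(c - g) + - h ~= 0" "c - g ~= 0" "- h ~= 0" using False e cg h(2) by auto
     then have "min (v (c - g)) (v (- h)) \<le> v (c' - g)"
      unfolding e using v_add[OF subf_closed(7)[OF K c(1) g(1)] subf_closed(5)[OF K h(1)]] by blast
     moreover have "v (- h) > v g" using v_minus[OF h(1)] vh' by simp
     ultimately show ?thesis using c(2) cg by (auto simp: min_def split: if_splits)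
    qed
   qed simp
   have 3: "c' ~= 0"
   proof
    assume "c' = 0"
    with 2 g(2) v_minus[OF g(1)] show False by auto
   qed
   from c'K 1 2 3 show ?thesis by blast
  qed
qed

text \<open>
  If `d` has a square root in the completion, then `\<rho>` can be replaced by an element `h` of
  `K` close to `g`: in the equation, `\<rho>` may be read as an approximate root of `d`. For
  `\<rho> \<in> K` it is `g` or `-g` that is close to `\<rho>`, and `i` takes care of the sign.
\<close>
lemma split_case:
  assumes two: "(2::'a) ~= 0" "v 2 = 0" and i: "i \<in> K" "i\<^sup>2 = - 1"
   and d: "d \<in> K" "\<rho>\<^sup>2 = d" and m: "m \<in> K" and g: "g \<in> K" "g ~= 0" "g\<^sup>2 = d \<or> v (g\<^sup>2 - d) > 2 * v g"
   and no: "!!h P Q. h \<in> K ==> h ~= 0 ==> h = g \<or> v (h - g) > v g ==> P \<in> K ==> Q \<in> K ==> h = P\<^sup>2 - m * Q\<^sup>2 ==> False"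
   and p: "p0 \<in> K" "p1 \<in> K" "q0 \<in> K" "q1 \<in> K" and eq: "\<rho> = (p0 + p1 * \<rho>)\<^sup>2 - m * (q0 + q1 * \<rho>)\<^sup>2"
  shows False
proof (cases "\<rho> \<in> K")
  case True
  have d0: "d ~= 0"
  proof
   assume "d = 0"
   with g have "v (g\<^sup>2) > 2 * v g" by simp
   with v_power[OF g(1,2), of 2] show False by simp
  qed
  then have \<rho>0: "\<rho> ~= 0" using d by auto
  have PQ: "p0 + p1 * \<rho> \<in> K" "q0 + q1 * \<rho> \<in> K" using p True subf_closed(3,4)[OF K] by auto
  have neg: "- \<rho> = (i * (p0 + p1 * \<rho>))\<^sup>2 - m * (i * (q0 + q1 * \<rho>))\<^sup>2"
  proof -
   have "(i * X1)\<^sup>2 - m * (i * Y1)\<^sup>2 = - (X1\<^sup>2 - m * Y1\<^sup>2)" for X1 Y1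
    unfolding power_mult_distrib i(2) by simp
   then show ?thesis using arg_cong[OF eq, of uminus] by simp
  qed
  have c1: "\<rho> ~= g & \<not> v (\<rho> - g) > v g" using no[OF True \<rho>0 _ PQ eq] by blast
  have c2: "- \<rho> ~= g & \<not> v (- \<rho> - g) > v g"
   using no[OF subf_closed(5)[OF K True] _ _ subf_closed(4)[OF K i(1) PQ(1)] subf_closed(4)[OF K i(1) PQ(2)] neg] \<rho>0 by auto
  have nz: "\<rho> - g ~= 0" "- \<rho> - g ~= 0" using c1 c2 by auto
  have k: "\<rho> - g \<in> K" "- \<rho> - g \<in> K" using True g(1) subf_closed(5,7)[OF K] by auto
  have "(\<rho> - g) * (- \<rho> - g) = g\<^sup>2 - d" using d(2) by (simp add: power2_eq_square algebra_simps)
  then have "v (g\<^sup>2 - d) = v (\<rho> - g) + v (- \<rho> - g)" using v_mult[OF k nz] by simp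
  moreover have "g\<^sup>2 ~= d" using nz \<open>(\<rho> - g) * (- \<rho> - g) = g\<^sup>2 - d\<close> by auto
  ultimately show False using g(3) c1 c2 by linarith
next
  case False
  have ind: "Y1 = 0 & X1 = 0" if "X1 \<in> K" "Y1 \<in> K" "X1 + Y1 * \<rho> = 0" for X1 Y1
  proof (cases "Y1 = 0")
   case nY: False
   have "\<rho> = - X1 / Y1" using that(3) nY by (simp add: field_simps add_eq_0_iff)
   then show ?thesis using False that subf_closed(5,8)[OF K] by auto
  qed (use that in simp)
  define X1 where "X1 = p0\<^sup>2 + d * p1\<^sup>2 - m * (q0\<^sup>2 + d * q1\<^sup>2)"
  define Y1 where "Y1 = 2 * p0 * p1 - 2 * m * q0 * q1 - 1"
  have sq: "x\<^sup>2 \<in> K" if "x \<in> K" for x using that subf_power[OF K] by blast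
  have X1Y1: "X1 \<in> K" "Y1 \<in> K" unfolding X1_def Y1_def using p d m sq subf_numeral[OF K]
   by (auto intro!: subf_closed[OF K])
  have "X1 + Y1 * \<rho> = ((p0 + p1 * \<rho>)\<^sup>2 - m * (q0 + q1 * \<rho>)\<^sup>2) - \<rho>"
   unfolding X1_def Y1_def d(2)[symmetric] by (simp add: power2_eq_square algebra_simps)
  then have "X1 + Y1 * \<rho> = 0" using eq by simp
  with ind[OF X1Y1] have X1z: "X1 = 0" and Y1z: "Y1 = 0" by auto
  define E where "E = p1\<^sup>2 - m * q1\<^sup>2"
  have EK: "E \<in> K" unfolding E_def using p m sq by (auto intro!: subf_closed[OF K])
  define k where "k = nat (- v g - v E)"
  obtain c where c: "c \<in> K" "c = g \<or> v (c - g) > v g" "c ~= 0" "c\<^sup>2 = d \<or> v (c\<^sup>2 - d) > 2 * v g + int k"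
   using newton[OF two d(1) g] by blast
  have cd: "c\<^sup>2 ~= d"
  proof
   assume "c\<^sup>2 = d"
   then have "(\<rho> - c) * (\<rho> + c) = 0" using d(2) by (simp add: power2_eq_square algebra_simps)
   then have "\<rho> = c \<or> \<rho> = - c" by (simp add: eq_neg_iff_add_eq_0)
   with False c(1) subf_closed(5)[OF K] show False by auto
  qed
  define P where "P = p0 + p1 * c"
  define Q where "Q = q0 + q1 * c"
  have PQ: "P \<in> K" "Q \<in> K" unfolding P_def Q_def using p c subf_closed(3,4)[OF K] by auto
  have e: "P\<^sup>2 - m * Q\<^sup>2 = c + (c\<^sup>2 - d) * E"
  proof -
   have "P\<^sup>2 - m * Q\<^sup>2 = X1 + (Y1 + 1) * c + (c\<^sup>2 - d) * E"
    unfolding P_def Q_def X1_def Y1_def E_def by (simp add: power2_eq_square algebra_simps)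
   then show ?thesis using X1z Y1z by simp
  qed
  define h where "h = c + (c\<^sup>2 - d) * E"
  have cdK: "c\<^sup>2 - d \<in> K" using sq[OF c(1)] d subf_closed(7)[OF K] by blast
  have hK: "h \<in> K" unfolding h_def using c cdK EK subf_closed(3,4)[OF K] by auto
  have close: "h = g \<or> v (h - g) > v g"
  proof (cases "E = 0")
   case True
   then show ?thesis using c(2) unfolding h_def by simp
  next
   case E: False
   have t: "v ((c\<^sup>2 - d) * E) > v g"
   proof -
    have "int k \<ge> - v g - v E" unfolding k_def by simp
    moreover have "v ((c\<^sup>2 - d) * E) = v (c\<^sup>2 - d) + v E" using v_mult[OF cdK EK _ E] cd by simp
    ultimately show ?thesis using c(4) cd by linarith
   qed
   have tK: "(c\<^sup>2 - d) * E \<in> K" "(c\<^sup>2 - d) * E ~= 0" using cdK EK subf_closed(4)[OF K] E cd by auto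
   show ?thesis
   proof (cases "c = g \<or> h = g")
    case True
    then show ?thesis using t unfolding h_def by auto
   next
    case f: False
    have hg: "h - g = (c - g) + (c\<^sup>2 - d) * E" unfolding h_def by simp
    have "c - g ~= 0" "(c - g) + (c\<^sup>2 - d) * E ~= 0" using f unfolding hg[symmetric] by auto
    then have "min (v (c - g)) (v ((c\<^sup>2 - d) * E)) \<le> v (h - g)"
     unfolding hg using v_add[OF subf_closed(7)[OF K c(1) g(1)] tK(1) _ tK(2)] by blast
    with t c(2) f show ?thesis by linarith
   qed
  qed
  have "h ~= 0"
  proof
   assume "h = 0"
   with close g(2) v_minus[OF g(1)] show False by auto
  qed
  from no[OF hK this close PQ] e show False unfolding h_def by simp
qed

text \<open>
  Comparing coefficients of 1 and `\<alpha>` gives `p0^2 + a p1^2 = b (q0^2 + a q1^2)`, whose two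
  sides have valuations of different parity unless all vanish; but `2 p0 p1 - 2 b q0 q1 = 1`.
\<close>
lemma case_unramified:
  assumes i: "i \<in> K" "i\<^sup>2 = - 1" and a: "nonsq a" "\<alpha>\<^sup>2 = a" and b: "b \<in> K" "b ~= 0" "odd (v b)"
   and p: "p0 \<in> K" "p1 \<in> K" "q0 \<in> K" "q1 \<in> K" and eq: "\<alpha> = (p0 + p1 * \<alpha>)\<^sup>2 - b * (q0 + q1 * \<alpha>)\<^sup>2"
  shows False
proof -
  note u = nonsq_unit[OF a(1)]
  have \<alpha>: "\<alpha> ~: K"
  proof
   assume aK: "\<alpha> \<in> K"
   moreover have "\<alpha> ~= 0" using a u by auto
   ultimately have "2 * v \<alpha> = 0" using v_power[of \<alpha> 2] a(2) u by simp
   then have "\<alpha> \<in> vr" using aK by (simp add: vr_def)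
   then have "\<alpha>\<^sup>2 - a ~: mi" using a(1) unfolding nonsq_def by blast
   with a(2) mi_closed(1) show False by simp
  qed
  have ind: "Y1 = 0 & X1 = 0" if "X1 \<in> K" "Y1 \<in> K" "X1 + Y1 * \<alpha> = 0" for X1 Y1
  proof (cases "Y1 = 0")
   case nY: False
   have "\<alpha> = - X1 / Y1" using that(3) nY by (simp add: field_simps add_eq_0_iff)
   then show ?thesis using \<alpha> that subf_closed(5,8)[OF K] by auto
  qed (use that in simp)
  define X1 where "X1 = (p0\<^sup>2 + a * p1\<^sup>2) - b * (q0\<^sup>2 + a * q1\<^sup>2)"
  define Y1 where "Y1 = 2 * p0 * p1 - 2 * b * q0 * q1 - 1"
  have sq: "x\<^sup>2 \<in> K" if "x \<in> K" for x using that subf_power[OF K] by blast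
  have X1Y1: "X1 \<in> K" "Y1 \<in> K" unfolding X1_def Y1_def using p u b sq subf_numeral[OF K]
   by (auto intro!: subf_closed[OF K])
  have "X1 + Y1 * \<alpha> = ((p0 + p1 * \<alpha>)\<^sup>2 - b * (q0 + q1 * \<alpha>)\<^sup>2) - \<alpha>"
   unfolding X1_def Y1_def a(2)[symmetric] by (simp add: power2_eq_square algebra_simps)
  then have "X1 + Y1 * \<alpha> = 0" using eq by simp
  with ind[OF X1Y1] have X1z: "X1 = 0" and Y1z: "Y1 = 0" by auto
  have tw: "x\<^sup>2 + a * y\<^sup>2 = x\<^sup>2 - a * (i * y)\<^sup>2" for x y unfolding power_mult_distrib i(2) by simp
  have i0: "i ~= 0" using i by auto
  have ev: "x\<^sup>2 + a * y\<^sup>2 ~= 0 & even (v (x\<^sup>2 + a * y\<^sup>2))" if "x \<in> K" "y \<in> K" "x ~= 0 \<or> y ~= 0" for x y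
   unfolding tw using norm_form_even[OF a(1) that(1) subf_closed(4)[OF K i(1) that(2)]] that(3) i0 by auto
  have e: "p0\<^sup>2 + a * p1\<^sup>2 = b * (q0\<^sup>2 + a * q1\<^sup>2)" using X1z unfolding X1_def by simp
  have nq: "q0\<^sup>2 + a * q1\<^sup>2 \<in> K" using p u sq by (auto intro!: subf_closed[OF K])
  show False
  proof (cases "q0 = 0 & q1 = 0")
   case True
   then have "p0 = 0 & p1 = 0" using ev[OF p(1,2)] e by auto
   with True Y1z show False unfolding Y1_def by simp
  next
   case False
   then have q: "q0\<^sup>2 + a * q1\<^sup>2 ~= 0" "even (v (q0\<^sup>2 + a * q1\<^sup>2))" using ev[OF p(3,4)] by blast+
   then have "b * (q0\<^sup>2 + a * q1\<^sup>2) ~= 0" "odd (v (b * (q0\<^sup>2 + a * q1\<^sup>2)))" using b v_mult[OF b(1) nq b(2) q(1)] by auto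
   moreover from this have "p0 ~= 0 \<or> p1 ~= 0" using e by auto
   ultimately show False using ev[OF p(1,2)] e by simp
  qed
qed

text \<open>
  As `v b` is odd, the valuations of the two terms differ, and `h` being a unit the first one
  dominates; so `h` is a square modulo `v`, like `c`.
\<close>
lemma ramified_no:
  assumes c: "nonsq c" and b: "b \<in> K" "b ~= 0" "odd (v b)" and h: "h = c \<or> v (h - c) > v c" "h \<in> K" "h ~= 0"
   and PQ: "P \<in> K" "Q \<in> K" "h = P\<^sup>2 - b * Q\<^sup>2"
  shows False
proof -
  note u = nonsq_unit[OF c]
  have vh: "v h = 0"
   using h(1)
  proof
   assume "v (h - c) > v c"
   then show ?thesis using v_add_eq(2)[of c "h - c"] u h subf_closed(7)[OF K] by (cases "h - c = 0") auto
  qed (use u in simp)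
  have v2: "v (t\<^sup>2) = 2 * v t" if "t \<in> K" "t ~= 0" for t using v_power[OF that, of 2] by simp
  have K2: "t\<^sup>2 \<in> K" if "t \<in> K" for t using subf_power[OF K that] .
  have bQ: "- (b * Q\<^sup>2) \<in> K" "Q ~= 0 ==> odd (v (- (b * Q\<^sup>2)))"
   using b K2[OF PQ(2)] subf_closed(4,5)[OF K] v_minus v_mult[of b "Q\<^sup>2"] v2[OF PQ(2)] by auto
  have e: "h = P\<^sup>2 + - (b * Q\<^sup>2)" using PQ(3) by simp
  have P0: "P ~= 0"
  proof
   assume "P = 0"
   then have "h = - (b * Q\<^sup>2)" using PQ(3) by simp
   with bQ(2) vh h(3) show False by (cases "Q = 0") auto
  qed
  have "P\<^sup>2 - h \<in> mi & P \<in> vr"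
  proof (cases "Q = 0")
   case True
   then have "h = P\<^sup>2" using PQ(3) by simp
   with v2[OF PQ(1) P0] vh PQ(1) mi_closed(1) show ?thesis by (simp add: vr_def)
  next
   case False
   have nb: "- (b * Q\<^sup>2) ~= 0" "P\<^sup>2 ~= 0" using False b P0 by auto
   have ne: "v (P\<^sup>2) ~= v (- (b * Q\<^sup>2))"
   proof
    assume "v (P\<^sup>2) = v (- (b * Q\<^sup>2))"
    with bQ(2)[OF False] v2[OF PQ(1) P0] have "odd (2 * v P)" by simp
    then show False by simp
   qed
   show ?thesis
   proof (cases "v (P\<^sup>2) < v (- (b * Q\<^sup>2))")
    case True
    then have "v (P\<^sup>2) = 0" using v_add_eq(2)[OF K2[OF PQ(1)] bQ(1) nb(2,1)] vh e by simp
    then have "P \<in> vr" using v2[OF PQ(1) P0] PQ(1) by (simp add: vr_def)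
    moreover have "- (b * Q\<^sup>2) \<in> mi" using True \<open>v (P\<^sup>2) = 0\<close> bQ(1) by (simp add: mi_def)
    then have "- (- (b * Q\<^sup>2)) \<in> mi" by (rule mi_closed(4))
    moreover have "P\<^sup>2 - h = - (- (b * Q\<^sup>2))" using PQ(3) by simp
    ultimately show ?thesis by simp
   next
    case ge: False
    then have "v (- (b * Q\<^sup>2)) = 0" using v_add_eq(2)[OF bQ(1) K2[OF PQ(1)] nb] ne vh e by (simp add: add.commute)
    with bQ(2)[OF False] show ?thesis by simp
   qed
  qed
  moreover have "h - c \<in> mi" using h(1,2) u mi_closed(1) subf_closed(7)[OF K] by (auto simp: mi_def)
  ultimately have "P \<in> vr" "(P\<^sup>2 - h) + (h - c) \<in> mi" using mi_closed(2) by blast+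
  with c show False unfolding nonsq_def by simp
qed

definition rep :: "'a \<Rightarrow> 'a" where "rep x = (THE r. r \<in> R & x - r \<in> mi)"

lemma rep: "x \<in> vr ==> rep x \<in> R & x - rep x \<in> mi"
  unfolding rep_def using theI'[OF R_rep'[of x]] by blast

lemma rep_eq: assumes "x \<in> vr" "y \<in> vr" shows "rep x = rep y \<longleftrightarrow> x - y \<in> mi"
proof
  assume "rep x = rep y"
  with mi_closed(5)[of "x - rep x" "y - rep y"] rep[OF assms(1)] rep[OF assms(2)] show "x - y \<in> mi" by simp
next
  assume "x - y \<in> mi"
  with mi_closed(2)[of "x - y" "y - rep y"] rep[OF assms(2)] have "rep y \<in> R" "x - rep y \<in> mi" by auto
  with R_rep'[OF assms(1)] rep[OF assms(1)] show "rep x = rep y" by blast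
qed

lemma card_image_fibres:
  assumes "finite A" "!!y. y \<in> f ` A ==> card {x\<in>A. f x = y} \<le> k"
  shows "card A \<le> k * card (f ` A)"
proof -
  have "card A = (\<Sum>y\<in>f ` A. card {x\<in>A. f x = y})"
   using sum.image_gen[OF assms(1), of "\<lambda>_. 1::nat" f] by simp
  also have "... \<le> (\<Sum>y\<in>f ` A. k)" using assms(2) by (intro sum_mono)
  finally show ?thesis by (simp add: mult.commute)
qed

text \<open>
  The squares have index 2 among the nonzero residue classes, by counting the fibres of the
  squaring map.
\<close>
lemma square_classes:
  assumes a: "nonsq a" and u: "u \<in> vr" "u ~: mi"
  shows "\<exists>t\<in>vr. t\<^sup>2 - u \<in> mi \<or> t\<^sup>2 - a * u \<in> mi"
proof -
  define U where "U = {r\<in>R. r ~: mi}"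
  have fU: "finite U" using R_fin unfolding U_def by simp
  have Uvr: "r \<in> vr" "r ~: mi" if "r \<in> U" for r using that R_vr unfolding U_def by auto
  have av: "a \<in> vr" "a ~: mi" using a nonsq_unit[OF a] unit_iff unfolding nonsq_def by auto
  have repU: "rep x \<in> U" if "x \<in> vr" "x ~: mi" for x
   using rep[OF that(1)] mi_closed(2)[of "x - rep x" "rep x"] that(2) unfolding U_def by auto
  have sqv: "r\<^sup>2 \<in> vr" "r\<^sup>2 ~: mi" if "r \<in> U" for r
   using vr_closed(4)[OF Uvr(1)[OF that] Uvr(1)[OF that]]
    unit_mult[OF Uvr(1)[OF that] Uvr(1)[OF that] Uvr(2)[OF that] Uvr(2)[OF that]]
   by (simp_all add: power2_eq_square)
  have asqv: "a * r\<^sup>2 \<in> vr" "a * r\<^sup>2 ~: mi" if "r \<in> U" for r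
   using vr_closed(4)[OF av(1) sqv(1)[OF that]] unit_mult[OF av(1) sqv(1)[OF that] av(2) sqv(2)[OF that]] by auto
  define f where "f r = rep (r\<^sup>2)" for r
  define g where "g r = rep (a * r\<^sup>2)" for r
  have pm: "r = s \<or> r = rep (- s)" if rs: "r \<in> U" "s \<in> U" "r\<^sup>2 - s\<^sup>2 \<in> mi" for r s
  proof -
   have "(r - s) * (r - (- s)) \<in> mi" using rs(3) by (simp add: power2_eq_square algebra_simps)
   moreover have "r - s \<in> vr" "r - (- s) \<in> vr" "- s \<in> vr" using Uvr rs vr_closed by auto
   ultimately have "r - s \<in> mi \<or> r - (- s) \<in> mi" using unit_mult by blast
   then have "rep r = rep s \<or> rep r = rep (- s)" using rep_eq[OF Uvr(1) Uvr(1)] rep_eq[OF Uvr(1) \<open>- s \<in> vr\<close>] rs by blast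
   moreover have "rep t = t" if "t \<in> U" for t
    using R_rep'[OF Uvr(1)[OF that]] rep[OF Uvr(1)[OF that]] that mi_closed(1) unfolding U_def by auto
   ultimately show ?thesis using rs by metis
  qed
  have "card U \<le> 2 * card (f ` U)"
  proof (rule card_image_fibres[OF fU])
   fix y assume "y \<in> f ` U"
   then obtain s where s: "s \<in> U" "y = f s" by blast
   have "{x\<in>U. f x = y} \<subseteq> {s, rep (- s)}"
   proof
    fix x assume "x \<in> {x\<in>U. f x = y}"
    then have x: "x \<in> U" "f x = f s" using s by auto
    then have "x\<^sup>2 - s\<^sup>2 \<in> mi" unfolding f_def using rep_eq sqv(1) s by blast
    with pm x s show "x \<in> {s, rep (- s)}" by blast
   qed
   then have "card {x\<in>U. f x = y} \<le> card {s, rep (- s)}" by (intro card_mono) auto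
   also have "... \<le> 2" by (simp add: card_insert_if)
   finally show "card {x\<in>U. f x = y} \<le> 2" .
  qed
  moreover have "card (g ` U) = card (f ` U)"
  proof -
   have "bij_betw (\<lambda>y. rep (a * y)) (f ` U) (g ` U)"
    unfolding bij_betw_def
   proof
    have fv: "y \<in> vr" if "y \<in> f ` U" for y using that rep sqv R_vr unfolding f_def by blast
    show "inj_on (\<lambda>y. rep (a * y)) (f ` U)"
    proof (rule inj_onI)
     fix y w assume y: "y \<in> f ` U" "w \<in> f ` U" "rep (a * y) = rep (a * w)"
     then have "a * y - a * w \<in> mi" using rep_eq vr_closed(4)[OF av(1) fv] by blast
     then have "a * (y - w) \<in> mi" by (simp add: right_diff_distrib)
     then have "y - w \<in> mi" using unit_mult[OF av(1) vr_closed(6)[OF fv fv] av(2)] y by blast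
     moreover have "y \<in> R" "w \<in> R" using y rep sqv(1) unfolding f_def by auto
     ultimately show "y = w" using R_rep'[OF fv[OF y(1)]] mi_closed(1) by auto
    qed
    have "rep (a * f r) = g r" if r: "r \<in> U" for r
    proof -
     have "a * (f r - r\<^sup>2) \<in> mi" using mi_closed(3)[OF av(1) mi_closed(4)] rep[OF sqv(1)[OF r]] unfolding f_def by fastforce
     then show ?thesis unfolding g_def using rep_eq[OF vr_closed(4)[OF av(1) fv[of "f r"]] asqv(1)[OF r]] r
      by (simp add: right_diff_distrib)
    qed
    then show "(\<lambda>y. rep (a * y)) ` f ` U = g ` U" by (simp add: image_image)
   qed
   from bij_betw_same_card[OF this] show ?thesis by simp
  qed
  moreover have "f ` U \<inter> g ` U = {}"
  proof -
   have "f r ~= g s" if rs: "r \<in> U" "s \<in> U" for r s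
   proof
    assume "f r = g s"
    then have m: "r\<^sup>2 - a * s\<^sup>2 \<in> mi" unfolding f_def g_def using rep_eq[OF sqv(1) asqv(1)] rs by blast
    have s: "s \<in> K" "s ~= 0" "v s = 0" using unit_iff[OF Uvr(1)] Uvr(2) rs vr_K Uvr(1) by auto
    have isv: "inverse s \<in> vr" using v_inverse[of s] s subf_closed(6)[OF K] by (auto simp: vr_def)
    have "(inverse s)\<^sup>2 * (r\<^sup>2 - a * s\<^sup>2) \<in> mi" using mi_closed(3)[OF vr_power[OF isv] m] .
    moreover have "(inverse s)\<^sup>2 * (r\<^sup>2 - a * s\<^sup>2) = (inverse s * r)\<^sup>2 - a" using s(2) by (simp add: field_simps power2_eq_square)
    moreover have "inverse s * r \<in> vr" using isv Uvr(1) rs vr_closed(4) by blast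
    ultimately show False using a unfolding nonsq_def by auto
   qed
   then show ?thesis by auto
  qed
  moreover have sub: "f ` U \<union> g ` U \<subseteq> U" unfolding f_def g_def using repU sqv asqv by auto
  ultimately have "card U \<le> card (f ` U \<union> g ` U)" using card_Un_disjoint[of "f ` U" "g ` U"] fU by simp
  then have "f ` U \<union> g ` U = U" using sub fU by (simp add: card_seteq)
  with repU[OF u] have "rep u \<in> f ` U \<or> rep u \<in> g ` U" by blast
  then show ?thesis
  proof
   assume "rep u \<in> f ` U"
   then obtain r where r: "r \<in> U" "rep u = rep (r\<^sup>2)" unfolding f_def by blast
   then have "r\<^sup>2 - u \<in> mi" using rep_eq[OF sqv(1)[OF r(1)] u(1)] by simp
   with Uvr(1)[OF r(1)] show ?thesis by blast
  next
   assume "rep u \<in> g ` U"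
   then obtain r where r: "r \<in> U" "rep u = rep (a * r\<^sup>2)" unfolding g_def by blast
   then have "a * r\<^sup>2 - u \<in> mi" using rep_eq[OF asqv(1)[OF r(1)] u(1)] by simp
   then have "a * (a * r\<^sup>2 - u) \<in> mi" by (rule mi_closed(3)[OF av(1)])
   moreover have "a * (a * r\<^sup>2 - u) = (a * r)\<^sup>2 - a * u" by (simp add: power2_eq_square algebra_simps)
   ultimately show ?thesis using vr_closed(4)[OF av(1) Uvr(1)[OF r(1)]] by auto
  qed
qed

text \<open>
  Squaring is not injective on the finite residue field, since 1 and `-1` have the same square; so
  it is not surjective.
\<close>
lemma nonsq_exists:
  assumes two: "2 ~: mi"
  shows "\<exists>a. nonsq a"
proof (rule ccontr)
  assume n: "\<nexists>a. nonsq a"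
  have sq: "\<exists>x\<in>vr. x\<^sup>2 - a \<in> mi" if "a \<in> vr" for a using n that unfolding nonsq_def by blast
  define f where "f r = rep (r\<^sup>2)" for r
  have fR: "f ` R \<subseteq> R" unfolding f_def using rep vr_power R_vr by blast
  have "R \<subseteq> f ` R"
  proof
   fix r assume r: "r \<in> R"
   then have rv: "r \<in> vr" using R_vr by blast
   from sq[OF this] obtain x where x: "x \<in> vr" "x\<^sup>2 - r \<in> mi" by blast
   have rx: "rep x \<in> R" "rep x \<in> vr" "x - rep x \<in> mi" using rep[OF x(1)] R_vr by auto
   have "(x + rep x) * (x - rep x) \<in> mi" using mi_closed(3)[OF vr_closed(3)[OF x(1) rx(2)] rx(3)] .
   then have "(x\<^sup>2 - r) - (x + rep x) * (x - rep x) \<in> mi" using mi_closed(5)[OF x(2)] by blast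
   then have "(rep x)\<^sup>2 - r \<in> mi" by (simp add: power2_eq_square algebra_simps)
   then have "f (rep x) = rep r" unfolding f_def using rep_eq[OF vr_power[OF rx(2)] rv] by blast
   moreover have "rep r = r" using R_rep'[OF rv] rep[OF rv] r mi_closed(1) by auto
   ultimately show "r \<in> f ` R" using rx(1) by (metis image_eqI)
  qed
  with fR have "inj_on f R" using R_fin by (simp add: eq_card_imp_inj_on card_mono antisym)
  moreover have v1: "1 \<in> vr" "- 1 \<in> vr" using vr_closed by blast+
  have fe: "f (rep x) = rep 1" if x: "x \<in> vr" "x\<^sup>2 = 1" for x
  proof -
   have rx: "rep x \<in> vr" "x - rep x \<in> mi" using rep[OF x(1)] R_vr by auto
   have "(x + rep x) * (x - rep x) \<in> mi" using mi_closed(3)[OF vr_closed(3)[OF x(1) rx(1)] rx(2)] .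
   then have "- ((x + rep x) * (x - rep x)) \<in> mi" by (rule mi_closed(4))
   moreover have "- ((x + rep x) * (x - rep x)) = (rep x)\<^sup>2 - 1" using x(2) by (simp add: power2_eq_square algebra_simps)
   ultimately show ?thesis unfolding f_def using rep_eq[OF vr_power[OF rx(1)] v1(1)] by simp
  qed
  have "f (rep 1) = f (rep (- 1))" using fe[OF v1(1)] fe[OF v1(2)] by simp
  ultimately have "rep 1 = rep (- 1)" using rep[OF v1(1)] rep[OF v1(2)] by (auto dest: inj_onD)
  then have "1 - (- 1) \<in> mi" using rep_eq[OF v1] by simp
  with two show False by simp
qed

end

section \<open>Degrees of splitting fields\<close>

context dvf_ext
begin

text \<open>
  The exponent `j` in the index of a prime element `z` of `ic` plays the part of the residue
  degree, and `z` is chosen with `e j` not divisible by 4.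
\<close>
theorem splitting_degree:
  assumes two: "2 ~: mi" and i: "i \<in> K" "i\<^sup>2 = - 1" and a: "nonsq a" "\<alpha>\<^sup>2 = a" and b: "\<beta>\<^sup>2 = \<pi>"
   and C1: "\<exists>p0\<in>L. \<exists>p1\<in>L. \<exists>q0\<in>L. \<exists>q1\<in>L. \<alpha> = (p0 + p1 * \<alpha>)\<^sup>2 - \<beta>\<^sup>2 * (q0 + q1 * \<alpha>)\<^sup>2"
   and C2: "\<exists>p0\<in>L. \<exists>p1\<in>L. \<exists>q0\<in>L. \<exists>q1\<in>L. \<beta> = (p0 + p1 * \<beta>)\<^sup>2 - \<alpha>\<^sup>2 * (q0 + q1 * \<beta>)\<^sup>2"
   and C3: "\<exists>p0\<in>L. \<exists>p1\<in>L. \<exists>q0\<in>L. \<exists>q1\<in>L. \<alpha> * \<beta> = (p0 + p1 * (\<alpha> * \<beta>))\<^sup>2 - \<alpha>\<^sup>2 * (q0 + q1 * (\<alpha> * \<beta>))\<^sup>2"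
  shows "4 dvd n"
proof (rule ccontr)
  assume n4: "\<not> 4 dvd n"
  have pic: "\<pi> \<in> ic" "\<pi> / \<pi> \<in> ic" using ic_closed(2,3) unif unif_vr by auto
  obtain z e j where z: "prime_ic z" "\<pi> / z \<in> ic" "\<pi> / z ^ e \<in> ic" "\<pi> / z ^ Suc e ~: ic"
   "ind z = card R ^ j" "\<not> 4 dvd e * j"
   using odd_prime_exists[OF pic(1) unif(2) pic(2) ind_pi n4] by blast
  have z': "z \<in> ic" "z ~= 0" "1 / z ~: ic" using z(1) by (auto simp: prime_ic_def)
  obtain S where D: "dvf L (zval z) z S" and epos: "zval z \<pi> \<ge> 1"
   and ext: "!!x. x \<in> K ==> x ~= 0 ==> zval z x = zval z \<pi> * v x"
   and approx: "!!x. x \<in> L ==> x ~= 0 ==> zval z x \<ge> 0 ==> \<exists>c\<in>ic. x = c \<or> zval z (x - c) \<ge> 1"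
   using prime_valuation[OF z(1,2)] by blast
  note V = zval[OF z(1)]
  have e: "zval z \<pi> = int e" using V(4)[OF pic(1) unif(2) z(3,4)] .
  interpret W: dvf L "zval z" z S by (rule D)
  have twoK: "(2::'a) \<in> vr" using vr_closed(3)[OF vr_closed(2,2)] by simp
  have two': "(2::'a) ~= 0" "zval z 2 = 0" using unit_iff[OF twoK] two ext[of 2] vr_K twoK by auto
  have iL: "i \<in> L" using i KL by blast
  have aK: "a \<in> K" "a ~= 0" "v a = 0" "a \<in> vr" using nonsq_unit[OF a(1)] a(1) by (auto simp: nonsq_def)
  have aL: "a \<in> L" "zval z a = 0" "a \<in> W.vr" "a \<in> ic" using aK KL ext[of a] ic_closed(3) by (auto simp: W.vr_def)
  have piL: "\<pi> \<in> L" using unif KL by blast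
  have j_eq: "l = j" if "ind z = card R ^ l" for l
   using that z(5) R_card power_inject_exp[of "card R" l j] by simp
  have approx': "\<exists>c'\<in>ic. c - c' \<in> W.mi" if c: "c \<in> W.vr" for c
  proof (cases "c = 0")
   case True
   then show ?thesis using ic_closed(1) W.mi_closed(1) by force
  next
   case False
   with c approx[of c] obtain c' where c': "c' \<in> ic" "c = c' \<or> zval z (c - c') \<ge> 1" by (auto simp: W.vr_def)
   have "c - c' \<in> L" using c c'(1) ic_L subf_closed(7)[OF L] by (auto simp: W.vr_def)
   with c' show ?thesis by (auto simp: W.mi_def)
  qed
  have ic_vr: "c \<in> W.vr" if "c \<in> ic" for c using that V(5) ic_L by (auto simp: W.vr_def)
  have ic_mi: "c / z \<in> ic" if "c \<in> ic" "c \<in> W.mi" for c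
   using that V(6)[of c] ic_closed(1) by (cases "c = 0") (auto simp: W.mi_def)
  have na: "\<forall>x\<in>vr. x\<^sup>2 - a ~: mi" using a(1) by (simp add: nonsq_def)
  have F2: "even j" if c: "c \<in> W.vr" "c\<^sup>2 - a \<in> W.mi" for c
  proof -
   obtain c' where c': "c' \<in> ic" "c - c' \<in> W.mi" using approx'[OF c(1)] by blast
   have "(c + c') * (c - c') \<in> W.mi" using W.mi_closed(3)[OF W.vr_closed(3)[OF c(1) ic_vr[OF c'(1)]] c'(2)] .
   from W.mi_closed(5)[OF c(2) this] have "c'\<^sup>2 - a \<in> W.mi" by (simp add: power2_eq_square algebra_simps)
   moreover have "c'\<^sup>2 - a \<in> ic" using ic_closed(7)[OF ic_power[OF c'(1)] aL(4)] .
   ultimately have "(c'\<^sup>2 - a) / z \<in> ic" using ic_mi by blast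
   from index_of_pi_divisor(2)[OF z' z(2) c'(1) aK(4) this na] obtain l where "ind z = card R ^ (2 * l)" by blast
   from j_eq[OF this] show ?thesis by auto
  qed
  have F4: "4 dvd j" if c: "c \<in> W.vr" "c ^ 4 - a \<in> W.mi" for c
  proof -
   obtain c' where c': "c' \<in> ic" "c - c' \<in> W.mi" using approx'[OF c(1)] by blast
   have cv: "c' \<in> W.vr" using ic_vr[OF c'(1)] .
   have "(c + c') * (c\<^sup>2 + c'\<^sup>2) \<in> W.vr"
    by (intro W.vr_closed(4) W.vr_closed(3) W.vr_power c(1) cv)
   then have "((c + c') * (c\<^sup>2 + c'\<^sup>2)) * (c - c') \<in> W.mi" using W.mi_closed(3) c'(2) by blast
   from W.mi_closed(5)[OF c(2) this] have "c' ^ 4 - a \<in> W.mi" by (simp add: power2_eq_square power4_eq_xxxx algebra_simps)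
   moreover have "c' ^ 4 - a \<in> ic" using ic_closed(7)[OF ic_power[OF c'(1)] aL(4)] .
   ultimately have "(c' ^ 4 - a) / z \<in> ic" using ic_mi by blast
   from index_of_pi_divisor(3)[OF z' z(2) c'(1) aK(4) this na i] obtain l where "ind z = card R ^ (4 * l)" by blast
   from j_eq[OF this] show ?thesis by auto
  qed
  show False
  proof (cases "W.nonsq a")
   case True
   show False
   proof (cases "even e")
    case False
    then have odd: "odd (zval z \<pi>)" unfolding e by simp
    from C1 obtain p0 p1 q0 q1 where "p0 \<in> L" "p1 \<in> L" "q0 \<in> L" "q1 \<in> L"
     "\<alpha> = (p0 + p1 * \<alpha>)\<^sup>2 - \<beta>\<^sup>2 * (q0 + q1 * \<alpha>)\<^sup>2" by blast
    then show False using W.case_unramified[OF iL i(2) True a(2) piL unif(2) odd] unfolding b by blast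
   next
    case ev: True
    then obtain e' where e': "e = 2 * e'" by (elim evenE)
    have odd: "odd e'"
    proof
     assume "even e'"
     then have "4 dvd e" unfolding e' by auto
     with z(6) show False by simp
    qed
    define u where "u = \<pi> / z ^ e"
    have zp: "z ^ l \<in> L" "z ^ l ~= 0" "zval z (z ^ l) = int l" for l
     using z' ic_L subf_power[OF L] W.v_power[of z l] V(7) by auto
    have u: "u \<in> L" "u ~= 0" "zval z u = 0" "\<pi> = z ^ e * u"
     using W.v_divide[OF piL unif(2) zp(1,2)] zp(3) e subf_closed(8)[OF L piL zp(1)] zp(2) unif(2) unfolding u_def by auto
    have uv: "u \<in> W.vr" "u ~: W.mi" using u(1-3) by (simp_all add: W.vr_def W.mi_def)
    from W.square_classes[OF True uv] obtain t where t: "t \<in> W.vr" "t\<^sup>2 - u \<in> W.mi \<or> t\<^sup>2 - a * u \<in> W.mi" by blast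
    have tL: "t \<in> L" using t(1) by (simp add: W.vr_def)
    have au: "a * u \<in> W.vr" "a * u ~: W.mi"
     using W.vr_closed(4)[OF aL(3) uv(1)] W.unit_mult[OF aL(3) uv(1) _ uv(2)] aL aK(2) by (auto simp: W.mi_def)
    have ram: "False" if w: "w \<in> W.vr" "w ~: W.mi" "t\<^sup>2 - w \<in> W.mi" and \<rho>: "\<rho>\<^sup>2 = z ^ e * w"
     and ex: "\<exists>p0\<in>L. \<exists>p1\<in>L. \<exists>q0\<in>L. \<exists>q1\<in>L. \<rho> = (p0 + p1 * \<rho>)\<^sup>2 - a * (q0 + q1 * \<rho>)\<^sup>2" for \<rho> w
    proof -
     have wL: "w \<in> L" using w(1) by (simp add: W.vr_def)
     have tu: "t ~: W.mi"
     proof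
      assume "t \<in> W.mi"
      then have "t * t \<in> W.mi" by (rule W.mi_closed(3)[OF t(1)])
      from W.mi_closed(5)[OF this w(3)] w(2) show False by (simp add: power2_eq_square)
     qed
     then have t0: "t ~= 0" "zval z t = 0" using W.unit_iff[OF t(1)] by blast+
     define g where "g = z ^ e' * t"
     have g: "g \<in> L" "g ~= 0" "zval z g = int e'"
      unfolding g_def using subf_closed(4)[OF L zp(1) tL] zp t0 W.v_mult[OF zp(1) tL zp(2) t0(1)] by auto
     have "g\<^sup>2 - z ^ e * w = z ^ e * (t\<^sup>2 - w)" unfolding g_def e' by (simp add: power_mult_distrib power_mult[symmetric] algebra_simps)
     moreover have "t\<^sup>2 - w ~= 0 ==> zval z (t\<^sup>2 - w) \<ge> 1" "t\<^sup>2 - w \<in> L" using w(3) by (auto simp: W.mi_def)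
     ultimately have close: "g\<^sup>2 = z ^ e * w \<or> zval z (g\<^sup>2 - z ^ e * w) > 2 * zval z g"
      using W.v_mult[OF zp(1) _ zp(2), of "t\<^sup>2 - w" e] zp(3) g(3) e' by (cases "t\<^sup>2 - w = 0") auto
     from ex obtain p0 p1 q0 q1 where p: "p0 \<in> L" "p1 \<in> L" "q0 \<in> L" "q1 \<in> L"
      "\<rho> = (p0 + p1 * \<rho>)\<^sup>2 - a * (q0 + q1 * \<rho>)\<^sup>2" by blast
     show False
     proof (rule W.split_case[OF two' iL i(2) subf_closed(4)[OF L zp(1) wL] \<rho> aL(1) g(1,2) close _ p])
      fix h P Q assume h: "h \<in> L" "h ~= 0" "h = g \<or> zval z (h - g) > zval z g" "P \<in> L" "Q \<in> L" "h = P\<^sup>2 - a * Q\<^sup>2"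
      have "zval z h = int e'"
       using h(3)
      proof
       assume c: "zval z (h - g) > zval z g"
       show ?thesis
       proof (cases "h - g = 0")
        case False
        then show ?thesis using W.v_add_eq(2)[OF g(1) subf_closed(7)[OF L h(1) g(1)] g(2) False c] g(3) by simp
       qed (use g in simp)
      qed (use g in simp)
      moreover have "P ~= 0 \<or> Q ~= 0" using h(2,6) by auto
      ultimately show False using W.norm_form_even[OF True h(4,5)] h(6) odd by auto
     qed
    qed
    from t(2) show False
    proof
     assume 1: "t\<^sup>2 - u \<in> W.mi"
     show False using ram[OF uv 1, of \<beta>] C2 u(4) unfolding b a(2) by blast
    next
     assume 1: "t\<^sup>2 - a * u \<in> W.mi"
     have "(\<alpha> * \<beta>)\<^sup>2 = z ^ e * (a * u)" unfolding power_mult_distrib a(2) b by (subst u(4)) simp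
     then show False using ram[OF au 1, of "\<alpha> * \<beta>"] C3 unfolding a(2) by blast
    qed
   qed
  next
   case False
   then obtain c where c: "c \<in> W.vr" "c\<^sup>2 - a \<in> W.mi" using aL(3) by (auto simp: W.nonsq_def)
   have "even j" using F2[OF c] .
   have odd: "odd e"
   proof
    assume "even e"
    with \<open>even j\<close> have "4 dvd e * j" using mult_dvd_mono[of 2 e 2 j] by simp
    with z(6) show False by simp
   qed
   have ns: "W.nonsq c" unfolding W.nonsq_def
   proof (intro conjI ballI notI)
    fix x assume x: "x \<in> W.vr" "x\<^sup>2 - c \<in> W.mi"
    have "(x\<^sup>2 + c) * (x\<^sup>2 - c) \<in> W.mi" using W.mi_closed(3)[OF W.vr_closed(3)[OF W.vr_power[OF x(1)] c(1)] x(2)] .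
    from W.mi_closed(2)[OF this c(2)] have "x ^ 4 - a \<in> W.mi" by (simp add: power2_eq_square power4_eq_xxxx algebra_simps)
    from F4[OF x(1) this] z(6) show False by simp
   qed (rule c(1))
   note cu = W.nonsq_unit[OF ns]
   have close: "c\<^sup>2 = a \<or> zval z (c\<^sup>2 - a) > 2 * zval z c" using c(2) cu by (auto simp: W.mi_def)
   have oddp: "odd (zval z \<pi>)" using odd e by simp
   from C1 obtain p0 p1 q0 q1 where p: "p0 \<in> L" "p1 \<in> L" "q0 \<in> L" "q1 \<in> L"
    "\<alpha> = (p0 + p1 * \<alpha>)\<^sup>2 - \<pi> * (q0 + q1 * \<alpha>)\<^sup>2" unfolding b by blast
   show False
   proof (rule W.split_case[OF two' iL i(2) aL(1) a(2) piL _ _ close _ p])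
    show "c \<in> L" "c ~= 0" using cu by auto
    fix h P Q assume h: "h \<in> L" "h ~= 0" "h = c \<or> zval z (h - c) > zval z c" "P \<in> L" "Q \<in> L" "h = P\<^sup>2 - \<pi> * Q\<^sup>2"
    show False using W.ramified_no[OF ns piL unif(2) oddp h(3,1,2,4,5,6)] .
   qed
  qed
qed

end

section \<open>Norm tori of biquadratic algebras\<close>

text \<open>
  The independence of characters (Dedekind, Artin), for functions that are multiplicative on a set
  closed under multiplication.
\<close>
lemma character_independence:
  fixes ch :: "'q \<Rightarrow> 't \<Rightarrow> 'a::field"
  assumes fin: "finite S" and cl: "!!x y. x \<in> G ==> y \<in> G ==> mul x y \<in> G"
   and hom: "!!q x y. q \<in> S ==> x \<in> G ==> y \<in> G ==> ch q (mul x y) = ch q x * ch q y"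
   and sep: "!!q q'. q \<in> S ==> q' \<in> S ==> q ~= q' ==> \<exists>x\<in>G. ch q x ~= ch q' x"
   and nz: "!!q. q \<in> S ==> \<exists>x\<in>G. ch q x ~= 0"
   and zero: "!!x. x \<in> G ==> (\<Sum>q\<in>S. c q * ch q x) = 0"
  shows "\<forall>q\<in>S. c q = 0"
  using fin hom sep nz zero
proof (induction S arbitrary: c)
  case (insert q0 S)
  have 1: "c q = 0" if q: "q \<in> S" for q
  proof -
   have "q ~= q0" using q insert.hyps by blast
   then obtain x0 where x0: "x0 \<in> G" "ch q x0 ~= ch q0 x0" using insert.prems(2)[of q q0] q by blast
   have "\<forall>q\<in>S. c q * (ch q x0 - ch q0 x0) = 0"
   proof (rule insert.IH)
    show "(\<Sum>q\<in>S. c q * (ch q x0 - ch q0 x0) * ch q x) = 0" if x: "x \<in> G" for x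
    proof -
     have "(\<Sum>q\<in>insert q0 S. c q * ch q (mul x0 x)) = 0" using insert.prems(4)[OF cl[OF x0(1) x]] .
     then have a: "c q0 * (ch q0 x0 * ch q0 x) + (\<Sum>q\<in>S. c q * (ch q x0 * ch q x)) = 0"
      using insert.hyps insert.prems(1)[OF _ x0(1) x] by simp
     have b: "ch q0 x0 * (c q0 * ch q0 x + (\<Sum>q\<in>S. c q * ch q x)) = 0"
      using insert.prems(4)[OF x] insert.hyps by simp
     have "(\<Sum>q\<in>S. c q * (ch q x0 - ch q0 x0) * ch q x) = (\<Sum>q\<in>S. c q * (ch q x0 * ch q x)) - ch q0 x0 * (\<Sum>q\<in>S. c q * ch q x)"
      by (simp add: sum_distrib_left sum_subtractf algebra_simps)
     also have "... = (c q0 * (ch q0 x0 * ch q0 x) + (\<Sum>q\<in>S. c q * (ch q x0 * ch q x)))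
       - ch q0 x0 * (c q0 * ch q0 x + (\<Sum>q\<in>S. c q * ch q x))" by (simp add: algebra_simps)
     finally show ?thesis unfolding a b by simp
    qed
   qed (use insert.prems in blast)+
   with q x0(2) show ?thesis by auto
  qed
  obtain x where x: "x \<in> G" "ch q0 x ~= 0" using insert.prems(3) by blast
  have "c q0 * ch q0 x = 0" using insert.prems(4)[OF x(1)] insert.hyps 1 by simp
  with x 1 show ?case by auto
qed simp

lemma kronecker_sum:
  "finite A ==> m \<in> A ==> (\<Sum>k\<in>A. (if m = k then 1 else 0) * f k) = (f m :: 'a::field)"
  by (simp add: mult_delta_left)

text \<open>
  For bits, `sg a b` is `(-1) ^ (a b)`; the arguments are read modulo 2.
\<close>
definition sg :: "nat \<Rightarrow> nat \<Rightarrow> 'a::field" where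
  "sg a b = (if odd a & odd b then - 1 else 1)"

text \<open>
  A block diagonal matrix with three blocks, each half of the character table of a group of order
  4. An index `4 B + k` stands for the element or character `k` of block `B`; the two bits of `k`
  belong to the signs on `s B` and `r B`.
\<close>
definition hm :: "nat \<Rightarrow> nat \<Rightarrow> 'a::field" where
  "hm i m = (if i div 4 = m div 4 then sg i m * sg (i div 2) (m div 2) / 2 else 0)"

text \<open>
  The sum in the group of order 4, that is, the exclusive or of the two low bits, within the block
  of `i`.
\<close>
definition xo :: "nat \<Rightarrow> nat \<Rightarrow> nat" where
  "xo i j = 4 * (i div 4) + 2 * ((i div 2 + j div 2) mod 2) + (i + j) mod 2"

lemma xo_props: "xo i j div 4 = i div 4" "odd (xo i j) \<longleftrightarrow> odd i ~= odd j" "odd (xo i j div 2) \<longleftrightarrow> odd (i div 2) ~= odd (j div 2)"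
proof -
  define p q where "p = (i div 2 + j div 2) mod 2" and "q = (i + j) mod 2"
  have pq: "p < 2" "q < 2" by (simp_all add: p_def q_def)
  have x: "xo i j = 4 * (i div 4) + (2 * p + q)" unfolding xo_def p_def q_def by simp
  show "xo i j div 4 = i div 4" using pq unfolding x by simp
  have "odd (xo i j) \<longleftrightarrow> odd q" unfolding x by simp
  then show "odd (xo i j) \<longleftrightarrow> odd i ~= odd j" unfolding q_def by simp
  have "xo i j = 2 * (2 * (i div 4) + p) + q" unfolding x by simp
  then have "xo i j div 2 = 2 * (i div 4) + p" using pq(2) by simp
  then have "odd (xo i j div 2) \<longleftrightarrow> odd p" by simp
  then show "odd (xo i j div 2) \<longleftrightarrow> odd (i div 2) ~= odd (j div 2)" unfolding p_def by simp
qed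

lemma xo_less: "i < 12 ==> xo i j < 12"
  using xo_props(1)[of i j] div_less_iff_less_mult[of 4 "xo i j" 3] div_less_iff_less_mult[of 4 i 3] by simp

lemma hm_commute: "hm i m = (hm m i :: 'a::field)"
  by (auto simp: hm_def sg_def)

lemma hm_xo:
  assumes "(2::'a::field) ~= 0" "i div 4 = j div 4"
  shows "2 * hm m i * hm m j = (hm m (xo i j) :: 'a)"
  using assms(1) unfolding hm_def sg_def xo_props using assms(2) by auto

lemma set12: "{..<12::nat} = {0,1,2,3,4,5,6,7,8,9,10,11}"
  by code_simp

lemma hm_orth:
  assumes two: "(2::'a::field) ~= 0" and "i < 12" "j < 12"
  shows "(\<Sum>m<12. hm i m * hm m j) = (if i = j then 1 else 0 :: 'a)"
proof -
  have 4: "(4::'a) ~= 0" using two mult_eq_0_iff[of "2::'a" 2] by simp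
  have "i \<in> {..<12}" "j \<in> {..<12}" using assms by auto
  then have "i \<in> {0,1,2,3,4,5,6,7,8,9,10,11}" "j \<in> {0,1,2,3,4,5,6,7,8,9,10,11}" unfolding set12 by simp_all
  then show ?thesis
   unfolding set12 by (elim insertE emptyE; simp add: hm_def sg_def 4 field_simps)
qed

locale biquad =
  fixes K :: "'a::alg_closed_field set" and r s :: "nat \<Rightarrow> 'a"
  assumes K: "subf K" and two: "(2::'a) ~= 0"
   and rs: "B < 3 ==> r B ~= 0 & s B ~= 0 & (r B)\<^sup>2 \<in> K & (s B)\<^sup>2 \<in> K"
begin

text \<open>
  The basis `1, s, r, r s` of the biquadratic algebra of each block.
\<close>
definition e :: "nat \<Rightarrow> 'a" where
  "e i = (if odd i then s (i div 4) else 1) * (if odd (i div 2) then r (i div 4) else 1)"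

lemma e_nz: "i < 12 ==> e i ~= 0"
  using rs[of "i div 4"] unfolding e_def by auto

lemma kappa: "i < 12 ==> i div 4 = j div 4 ==> e (xo i j) * e j / e i \<in> K"
proof -
  assume i: "i < 12" and ij: "i div 4 = j div 4"
  define fr fs where "fr k = (if odd (k div 2) then r (k div 4) else 1)" and "fs k = (if odd k then s (k div 4) else 1)" for k
  have B: "r (i div 4) * r (i div 4) \<in> K" "s (i div 4) * s (i div 4) \<in> K" "r (i div 4) ~= 0" "s (i div 4) ~= 0"
   using rs[of "i div 4"] i by (auto simp: power2_eq_square)
  have "fr (xo i j) * fr j / fr i \<in> K" "fs (xo i j) * fs j / fs i \<in> K"
   unfolding fr_def fs_def xo_props ij[symmetric] using B by (auto simp: subf_closed(2)[OF K])
  then have "(fs (xo i j) * fs j / fs i) * (fr (xo i j) * fr j / fr i) \<in> K" by (intro subf_closed(4)[OF K])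
  then show ?thesis unfolding e_def fr_def fs_def by (simp add: mult_ac)
qed

text \<open>
  Multiplication by the element of the product of the three biquadratic algebras that has
  conjugates `y m`, as a matrix with respect to the basis `e`. These matrices are simultaneously
  diagonalized by the characters.
\<close>
definition tm :: "(nat \<Rightarrow> 'a) \<Rightarrow> 'a mat" where
  "tm y = Matrix.mat 12 12 (\<lambda>(i, j). (\<Sum>m<12. hm i m * y m * hm m j) * e j / e i)"

text \<open>
  The eigenvalues of `tm y`, as linear functions of the entries.
\<close>
definition chi :: "nat \<Rightarrow> 'a mat \<Rightarrow> 'a" where
  "chi m A = (\<Sum>i<12. 2 * hm m i * e i * A $$ (i, 4 * (m div 4)))"

text \<open>
  The conjugates `2 l` and `2 l + 1` differ by the sign on `s`, so that their product is the norm
  to `K(r)`.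
\<close>
definition adm :: "(nat \<Rightarrow> 'a) set" where
  "adm = {y. \<forall>l<6. y (2 * l) * y (2 * l + 1) = 1}"

definition TT :: "'a mat set" where "TT = tm ` adm"

lemma tm_carrier [simp]: "tm y \<in> carrier_mat 12 12" "dim_row (tm y) = 12" "dim_col (tm y) = 12"
  by (auto simp: tm_def)

lemma tm_cong: "(!!m. m < 12 ==> y m = y' m) ==> tm y = tm y'"
  unfolding tm_def by (intro cong_mat) (auto intro!: sum.cong)

lemma tm_one: "tm (\<lambda>_. 1) = 1\<^sub>m 12"
  unfolding tm_def by (rule eq_matI) (auto simp: hm_orth[OF two] e_nz)

lemma tm_mult: "tm y * tm y' = tm (\<lambda>m. y m * y' m)"
proof (rule eq_matI)
  fix i j assume "i < dim_row (tm (\<lambda>m. y m * y' m))" "j < dim_col (tm (\<lambda>m. y m * y' m))"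
  then have ij: "i < 12" "j < 12" by simp_all
  have "(tm y * tm y') $$ (i, j) = (\<Sum>k<12. tm y $$ (i, k) * tm y' $$ (k, j))"
   using ij by (simp add: scalar_prod_def atLeast0LessThan)
  also have "... = (\<Sum>k<12. \<Sum>m<12. \<Sum>m'<12. (hm m k * hm k m') * (hm i m * y m * y' m' * hm m' j * e j / e i))"
  proof (rule sum.cong[OF refl])
   fix k :: nat assume "k \<in> {..<12}"
   then have k: "k < 12" by simp
   have cancel: "(a * e k / e i) * (b * e j / e k) = (e j / e i) * (a * b)" for a b using e_nz[OF k] by simp
   have "tm y $$ (i, k) * tm y' $$ (k, j) = (e j / e i) * ((\<Sum>m<12. hm i m * y m * hm m k) * (\<Sum>m'<12. hm k m' * y' m' * hm m' j))"
    unfolding tm_def using ij k cancel by simp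
   also have "... = (\<Sum>m<12. \<Sum>m'<12. (hm m k * hm k m') * (hm i m * y m * y' m' * hm m' j * e j / e i))"
    unfolding sum_product unfolding sum_distrib_left by (intro sum.cong refl) (simp add: mult_ac)
   finally show "tm y $$ (i, k) * tm y' $$ (k, j) = (\<Sum>m<12. \<Sum>m'<12. (hm m k * hm k m') * (hm i m * y m * y' m' * hm m' j * e j / e i))" .
  qed
  also have "... = (\<Sum>m<12. \<Sum>m'<12. \<Sum>k<12. (hm m k * hm k m') * (hm i m * y m * y' m' * hm m' j * e j / e i))"
   by (subst sum.swap, rule sum.cong, simp, subst sum.swap, simp)
  also have "... = (\<Sum>m<12. \<Sum>m'<12. (if m = m' then 1 else 0) * (hm i m * y m * y' m' * hm m' j * e j / e i))"
   by (intro sum.cong refl) (subst sum_distrib_right[symmetric], subst hm_orth[OF two], auto)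
  also have "... = (\<Sum>m<12. hm i m * y m * y' m * hm m j * e j / e i)"
   by (intro sum.cong refl kronecker_sum) auto
  also have "... = tm (\<lambda>m. y m * y' m) $$ (i, j)"
   unfolding tm_def using ij by (simp add: sum_distrib_right sum_divide_distrib mult.assoc)
  finally show "(tm y * tm y') $$ (i, j) = tm (\<lambda>m. y m * y' m) $$ (i, j)" .
qed simp_all

lemma hm_base: "m < 12 ==> hm m (4 * (m' div 4)) = (if m div 4 = m' div 4 then 1 / 2 else 0 :: 'a)"
  by (auto simp: hm_def sg_def)

lemma chi_tm:
  assumes m: "m < 12"
  shows "chi m (tm y) = y m"
proof -
  have m4: "4 * (m div 4) < 12" using m div_less_iff_less_mult[of 4 m 3] by simp
  have e4: "e (4 * (m div 4)) = 1" unfolding e_def by simp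
  have "chi m (tm y) = (\<Sum>i<12. \<Sum>k<12. (hm m i * hm i k) * (2 * y k * hm k (4 * (m div 4))))"
   unfolding chi_def
  proof (rule sum.cong[OF refl])
   fix i :: nat assume "i \<in> {..<12}"
   then have i: "i < 12" by simp
   have cancel: "2 * hm m i * e i * (a * 1 / e i) = 2 * hm m i * a" for a using e_nz[OF i] by simp
   have "2 * hm m i * e i * tm y $$ (i, 4 * (m div 4)) = 2 * hm m i * (\<Sum>k<12. hm i k * y k * hm k (4 * (m div 4)))"
    unfolding tm_def using i m4 cancel e4 by simp
   also have "... = (\<Sum>k<12. (hm m i * hm i k) * (2 * y k * hm k (4 * (m div 4))))"
    unfolding sum_distrib_left by (intro sum.cong refl) (simp add: mult_ac)
   finally show "2 * hm m i * e i * tm y $$ (i, 4 * (m div 4)) = (\<Sum>k<12. (hm m i * hm i k) * (2 * y k * hm k (4 * (m div 4))))" .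
  qed
  also have "... = (\<Sum>k<12. (\<Sum>i<12. hm m i * hm i k) * (2 * y k * hm k (4 * (m div 4))))"
   by (subst sum.swap) (simp add: sum_distrib_right)
  also have "... = (\<Sum>k<12. (if m = k then 2 * y k * hm k (4 * (m div 4)) else 0))"
   using m by (intro sum.cong) (auto simp: hm_orth[OF two])
  also have "... = y m" using m two by (simp add: hm_base)
  finally show ?thesis .
qed

lemma tm_eq_iff: "tm y = tm y' \<longleftrightarrow> (\<forall>m<12. y m = y' m)"
  using chi_tm tm_cong by metis

lemma tm_inverse: "(!!m. m < 12 ==> y m ~= 0) ==> tm y * tm (\<lambda>m. inverse (y m)) = 1\<^sub>m 12"
  unfolding tm_mult tm_one[symmetric] by (rule tm_cong) simp

lemma GL_simps: "x \<otimes>\<^bsub>GL N\<^esub> y = x * y" "\<one>\<^bsub>GL N\<^esub> = 1\<^sub>m N"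
  "carrier (GL N) = {A \<in> carrier_mat N N. \<exists>B\<in>carrier_mat N N. A * B = 1\<^sub>m N & B * A = 1\<^sub>m N}"
  by (auto simp: GL_def units_of_def Units_def ring_mat_simps)

lemma GL_group: "group (GL N :: 'a mat monoid)"
  unfolding GL_def by (rule monoid.units_group[OF ring.is_monoid[OF ring_mat]])

lemma GL_inv: "A \<in> carrier (GL N) ==> B \<in> carrier_mat N N ==> A * B = 1\<^sub>m N ==> B * A = 1\<^sub>m N ==> inv\<^bsub>GL N\<^esub> (A :: 'a mat) = B"
  by (rule group.inv_equality[OF GL_group]) (auto simp: GL_simps)

lemma tm_GL: "(!!m. m < 12 ==> y m ~= 0) ==> tm y \<in> carrier (GL 12)"
  using tm_inverse[of y] tm_inverse[of "\<lambda>m. inverse (y m)"] unfolding GL_simps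
  by (auto intro!: bexI[of _ "tm (\<lambda>m. inverse (y m))"])

lemma tm_inv: "(!!m. m < 12 ==> y m ~= 0) ==> inv\<^bsub>GL 12\<^esub> (tm y) = tm (\<lambda>m. inverse (y m))"
  using tm_inverse[of y] tm_inverse[of "\<lambda>m. inverse (y m)"] by (intro GL_inv tm_GL) auto

lemma adm_nz: "y \<in> adm ==> m < 12 ==> y m ~= 0"
proof -
  assume y: "y \<in> adm" and m: "m < 12"
  have "y (2 * (m div 2)) * y (2 * (m div 2) + 1) = 1" using y m unfolding adm_def by auto
  then have "y (2 * (m div 2)) ~= 0" "y (2 * (m div 2) + 1) ~= 0" by auto
  moreover have "m = 2 * (m div 2) \<or> m = 2 * (m div 2) + 1" by (cases "even m") auto
  ultimately show ?thesis by metis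
qed

lemma adm_closed: "y \<in> adm ==> y' \<in> adm ==> (\<lambda>m. y m * y' m) \<in> adm" "y \<in> adm ==> (\<lambda>m. inverse (y m)) \<in> adm" "(\<lambda>_. 1) \<in> adm"
proof -
  show "(\<lambda>m. y m * y' m) \<in> adm" if "y \<in> adm" "y' \<in> adm"
  proof -
   have "y (2 * l) * y' (2 * l) * (y (2 * l + 1) * y' (2 * l + 1)) = 1" if l: "l < 6" for l
   proof -
    have 1: "y (2 * l) * y (2 * l + 1) = 1" "y' (2 * l) * y' (2 * l + 1) = 1"
     using \<open>y \<in> adm\<close> \<open>y' \<in> adm\<close> l unfolding adm_def by blast+
    have "y (2 * l) * y' (2 * l) * (y (2 * l + 1) * y' (2 * l + 1)) = (y (2 * l) * y (2 * l + 1)) * (y' (2 * l) * y' (2 * l + 1))"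
     by (simp only: mult_ac)
    also have "... = 1" unfolding 1 by simp
    finally show ?thesis .
   qed
   then show ?thesis unfolding adm_def by blast
  qed
  show "(\<lambda>m. inverse (y m)) \<in> adm" if "y \<in> adm"
   using that unfolding adm_def by (simp flip: inverse_mult_distrib)
qed (simp add: adm_def)

lemma TT_subgroup: "subgroup TT (GL 12)"
proof (rule group.subgroupI[OF GL_group])
  show "TT \<subseteq> carrier (GL 12)" unfolding TT_def using tm_GL adm_nz by auto
  show "TT ~= {}" unfolding TT_def using adm_closed(3) by blast
  show "inv\<^bsub>GL 12\<^esub> A \<in> TT" if "A \<in> TT" for A
   using that tm_inv adm_nz adm_closed(2) unfolding TT_def by auto
  show "A \<otimes>\<^bsub>GL 12\<^esub> A' \<in> TT" if "A \<in> TT" "A' \<in> TT" for A A'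
   using that adm_closed(1) unfolding TT_def GL_simps by (auto simp: tm_mult)
qed

text \<open>
  The linear equations over `K` that say that a matrix is a multiplication matrix: its entries are
  determined by the column of the image of 1.
\<close>
definition lin :: "nat \<Rightarrow> nat \<Rightarrow> 'a mat \<Rightarrow> 'a" where
  "lin i j A = A $$ (i, j) - (if i div 4 = j div 4 then e (xo i j) * e j / e i * A $$ (xo i j, 4 * (i div 4)) else 0)"

definition xc :: "nat \<Rightarrow> nat \<Rightarrow> 'a mat \<Rightarrow> 'a" where "xc B k A = A $$ (4 * B + k, 4 * B)"

text \<open>
  The norm equation has coefficients in `K(r)`; `nrm` and `nrm'` are its components with respect
  to the basis `1, r`.
\<close>
definition nrm :: "nat \<Rightarrow> 'a mat \<Rightarrow> 'a" where
  "nrm B A = xc B 0 A * xc B 0 A + (r B)\<^sup>2 * xc B 2 A * xc B 2 A - (s B)\<^sup>2 * xc B 1 A * xc B 1 A - (r B)\<^sup>2 * (s B)\<^sup>2 * xc B 3 A * xc B 3 A - 1"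

definition nrm' :: "nat \<Rightarrow> 'a mat \<Rightarrow> 'a" where
  "nrm' B A = 2 * (xc B 0 A * xc B 2 A) - 2 * (s B)\<^sup>2 * xc B 1 A * xc B 3 A"

lemma block4: "B < 3 ==> k < 4 ==> 4 * B + k < (12::nat)" by simp

lemma chi_explicit:
  assumes B: "B < 3" and k: "k < 4"
  shows "chi (4 * B + k) A = xc B 0 A + sg k 1 * s B * xc B 1 A + sg (k div 2) 1 * r B * xc B 2 A + sg k 1 * sg (k div 2) 1 * s B * r B * xc B 3 A"
proof -
  have inj: "inj_on ((+) (4 * B)) {..<4}" by simp
  have sub: "(+) (4 * B) ` {..<4} \<subseteq> {..<12}" using B by auto
  have kb: "(4 * B + k) div 4 = B" using k by simp
  have "chi (4 * B + k) A = (\<Sum>i\<in>(+) (4 * B) ` {..<4}. 2 * hm (4 * B + k) i * e i * A $$ (i, 4 * B))"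
   unfolding chi_def kb
  proof (rule sum.mono_neutral_right[OF _ sub], simp, intro ballI)
   fix i :: nat assume i: "i \<in> {..<12} - (+) (4 * B) ` {..<4}"
   have "B ~= i div 4"
   proof
    assume "B = i div 4"
    then have "i = 4 * B + i mod 4" by simp
    moreover have "i mod 4 \<in> {..<4}" by simp
    ultimately have "i \<in> (+) (4 * B) ` {..<4}" by blast
    with i show False by blast
   qed
   then show "2 * hm (4 * B + k) i * e i * A $$ (i, 4 * B) = 0" unfolding hm_def kb by simp
  qed
  also have "... = (\<Sum>i<4. 2 * hm (4 * B + k) (4 * B + i) * e (4 * B + i) * A $$ (4 * B + i, 4 * B))"
   by (simp add: sum.reindex[OF inj])
  also have "{..<4::nat} = {0, 1, 2, 3}" by auto
  finally have "chi (4 * B + k) A = (\<Sum>i\<in>{0,1,2,3}. 2 * hm (4 * B + k) (4 * B + i) * e (4 * B + i) * A $$ (4 * B + i, 4 * B))" .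
  moreover have "(4 * B + i) div 2 = 2 * B + i div 2" for i :: nat by simp
  moreover have "Suc (4 * B) div 4 = B" "Suc (Suc (4 * B)) div 4 = B" "(4 * B + 3) div 4 = B"
   by (rule div_nat_eqI; simp)+
  moreover have "Suc (4 * B) div 2 = 2 * B" "Suc (Suc (4 * B)) div 2 = 2 * B + 1" "(4 * B + 3) div 2 = 2 * B + 1"
   by (rule div_nat_eqI; simp)+
  ultimately show ?thesis using two unfolding hm_def e_def xc_def sg_def by (auto simp: kb)
qed

lemma chi_products:
  assumes B: "B < 3"
  shows "chi (4 * B) A * chi (4 * B + 1) A - 1 = nrm B A + r B * nrm' B A"
   and "chi (4 * B + 2) A * chi (4 * B + 3) A - 1 = nrm B A - r B * nrm' B A"
proof -
  have c: "chi (4 * B) A = xc B 0 A + s B * xc B 1 A + r B * xc B 2 A + s B * r B * xc B 3 A"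
   "chi (4 * B + 1) A = xc B 0 A - s B * xc B 1 A + r B * xc B 2 A - s B * r B * xc B 3 A"
   "chi (4 * B + 2) A = xc B 0 A + s B * xc B 1 A - r B * xc B 2 A - s B * r B * xc B 3 A"
   "chi (4 * B + 3) A = xc B 0 A - s B * xc B 1 A - r B * xc B 2 A + s B * r B * xc B 3 A"
   using chi_explicit[OF B, of 0 A] chi_explicit[OF B, of 1 A] chi_explicit[OF B, of 2 A] chi_explicit[OF B, of 3 A]
   by (simp_all add: sg_def)
  show "chi (4 * B) A * chi (4 * B + 1) A - 1 = nrm B A + r B * nrm' B A"
   "chi (4 * B + 2) A * chi (4 * B + 3) A - 1 = nrm B A - r B * nrm' B A"
   unfolding c nrm_def nrm'_def by (simp_all add: power2_eq_square algebra_simps)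
qed

text \<open>
  The linear equations compare a matrix with the multiplication matrix that has the same first
  column in each block.
\<close>
lemma lin_eq:
  assumes ij: "i < 12" "j < 12"
  shows "lin i j A = A $$ (i, j) - tm (\<lambda>m. chi m A) $$ (i, j)"
proof -
  have t: "tm (\<lambda>m. chi m A) $$ (i, j) = (\<Sum>m<12. hm i m * chi m A * hm m j) * e j / e i"
   using ij unfolding tm_def by simp
  show ?thesis
  proof (cases "i div 4 = j div 4")
   case False
   then have "hm i m * chi m A * hm m j = 0" for m by (auto simp: hm_def)
   then have "(\<Sum>m<12. hm i m * chi m A * hm m j) = 0" by (intro sum.neutral) blast
   then show ?thesis using False unfolding t lin_def by simp
  next
   case True
   have "(\<Sum>m<12. hm i m * chi m A * hm m j) = (\<Sum>m<12. \<Sum>k<12. (hm k m * hm m (xo i j)) * (e k * A $$ (k, 4 * (i div 4))))"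
   proof (intro sum.cong refl)
    fix m :: nat
    have "hm i m * chi m A * hm m j = (2 * hm m i * hm m j) * (\<Sum>k<12. hm m k * e k * A $$ (k, 4 * (m div 4)))"
     unfolding chi_def hm_commute[of i m] by (simp add: sum_distrib_left algebra_simps)
    also have "... = hm m (xo i j) * (\<Sum>k<12. hm m k * e k * A $$ (k, 4 * (i div 4)))"
     unfolding hm_xo[OF two True] by (cases "m div 4 = i div 4") (auto simp: hm_def xo_props)
    also have "... = (\<Sum>k<12. (hm k m * hm m (xo i j)) * (e k * A $$ (k, 4 * (i div 4))))"
     unfolding sum_distrib_left by (intro sum.cong refl) (simp add: hm_commute[of m] algebra_simps)
    finally show "hm i m * chi m A * hm m j = ..." .
   qed
   also have "... = (\<Sum>k<12. (\<Sum>m<12. hm k m * hm m (xo i j)) * (e k * A $$ (k, 4 * (i div 4))))"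
    by (subst sum.swap) (simp add: sum_distrib_right)
   also have "... = (\<Sum>k<12. if k = xo i j then e k * A $$ (k, 4 * (i div 4)) else 0)"
    by (intro sum.cong refl) (simp add: hm_orth[OF two] xo_less[OF ij(1)])
   also have "... = e (xo i j) * A $$ (xo i j, 4 * (i div 4))" using xo_less[OF ij(1)] by simp
   finally show ?thesis unfolding t using True unfolding lin_def by simp
  qed
qed

lemma tm_chi:
  assumes A: "A \<in> carrier_mat 12 12" and l: "!!i j. i < 12 ==> j < 12 ==> lin i j A = 0"
  shows "A = tm (\<lambda>m. chi m A)"
proof (rule eq_matI)
  fix i j assume "i < dim_row (tm (\<lambda>m. chi m A))" "j < dim_col (tm (\<lambda>m. chi m A))"
  then have ij: "i < 12" "j < 12" by simp_all
  with l[OF ij] lin_eq[OF ij, of A] show "A $$ (i, j) = tm (\<lambda>m. chi m A) $$ (i, j)" by simp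
qed (use A in auto)

lemma lin_tm: "i < 12 ==> j < 12 ==> lin i j (tm y) = 0"
proof -
  assume ij: "i < 12" "j < 12"
  have "tm (\<lambda>m. chi m (tm y)) = tm y" by (rule tm_cong) (rule chi_tm)
  then show ?thesis using lin_eq[OF ij, of "tm y"] by simp
qed

lemma adm_pairs: "y \<in> adm \<longleftrightarrow> (\<forall>B<3. y (4 * B) * y (4 * B + 1) = 1 & y (4 * B + 2) * y (4 * B + 3) = 1)"
proof
  assume "y \<in> adm"
  then have a: "!!l. l < 6 ==> y (2 * l) * y (2 * l + 1) = 1" unfolding adm_def by blast
  show "\<forall>B<3. y (4 * B) * y (4 * B + 1) = 1 & y (4 * B + 2) * y (4 * B + 3) = 1"
   using a[of "2 * _"] a[of "2 * _ + 1"] by (auto simp: algebra_simps numeral_eq_Suc)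
next
  assume a: "\<forall>B<3. y (4 * B) * y (4 * B + 1) = 1 & y (4 * B + 2) * y (4 * B + 3) = 1"
  have "y (2 * l) * y (2 * l + 1) = 1" if l: "l < 6" for l
  proof (cases "even l")
   case True
   then obtain B where "l = 2 * B" by (elim evenE)
   with a l show ?thesis by auto
  next
   case False
   then obtain B where "l = 2 * B + 1" by (elim oddE)
   with a l show ?thesis by (auto simp: algebra_simps numeral_eq_Suc)
  qed
  then show "y \<in> adm" unfolding adm_def by blast
qed

lemma TT_iff: "A \<in> TT \<longleftrightarrow> A \<in> carrier_mat 12 12 & (\<forall>i<12. \<forall>j<12. lin i j A = 0) & (\<forall>B<3. nrm B A = 0 & nrm' B A = 0)"
proof
  assume "A \<in> TT"
  then obtain y where y: "y \<in> adm" "A = tm y" unfolding TT_def by blast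
  have "nrm B A = 0 & nrm' B A = 0" if B: "B < 3" for B
  proof -
   have "chi (4 * B) A * chi (4 * B + 1) A = 1" "chi (4 * B + 2) A * chi (4 * B + 3) A = 1"
    using y(1)[unfolded adm_pairs] B block4[OF B] unfolding y(2) by (simp_all add: chi_tm)
   with chi_products[OF B, of A] have n: "nrm B A + r B * nrm' B A = 0" "nrm B A - r B * nrm' B A = 0" by simp_all
   have "2 * (nrm B A) = (nrm B A + r B * nrm' B A) + (nrm B A - r B * nrm' B A)" by simp
   then have "nrm B A = 0" unfolding n using two by simp
   with n(1) rs[OF B] show ?thesis by simp
  qed
  with y lin_tm show "A \<in> carrier_mat 12 12 & (\<forall>i<12. \<forall>j<12. lin i j A = 0) & (\<forall>B<3. nrm B A = 0 & nrm' B A = 0)" by simp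
next
  assume a: "A \<in> carrier_mat 12 12 & (\<forall>i<12. \<forall>j<12. lin i j A = 0) & (\<forall>B<3. nrm B A = 0 & nrm' B A = 0)"
  then have "A = tm (\<lambda>m. chi m A)" by (intro tm_chi) auto
  moreover have "(\<lambda>m. chi m A) \<in> adm" unfolding adm_pairs using chi_products[of _ A] a by auto
  ultimately show "A \<in> TT" unfolding TT_def by blast
qed

end

section \<open>The norm torus is a torus over the base field\<close>

lemma sum_lessThan_add: "(\<Sum>i<n + m. f i) = (\<Sum>i<n. f i) + (\<Sum>i<m. f (n + i :: nat) :: 'a::comm_monoid_add)"
  by (induction m) (auto simp: add.assoc)

lemma prod_pairs: "(\<Prod>m<2 * n. f m) = (\<Prod>l<n. f (2 * l) * f (2 * l + 1 :: nat) :: 'a::comm_monoid_mult)"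
  by (induction n) (auto simp: mult.assoc)

text \<open>
  The ideal generated by the vanishing polynomials with coefficients in `K`.
\<close>
definition kgen :: "'a::field set \<Rightarrow> nat \<Rightarrow> 'a mat set \<Rightarrow> ('a mat \<Rightarrow> 'a) set" where
  "kgen K N T = {f. \<exists>n g h. (\<forall>i<n. g i \<in> entry_polys UNIV N & h i \<in> vanishing K N T) &
    f = (\<lambda>A. \<Sum>i<n::nat. g i A * h i A)}"

lemma ep_sum: "0 \<in> F ==> (!!i. i \<in> I ==> f i \<in> entry_polys F N) ==> (\<lambda>A. \<Sum>i\<in>I. f i A) \<in> entry_polys F N"
  by (induction I rule: infinite_finite_induct) (auto intro: entry_polys.intros)

lemma ep_prod: "1 \<in> F ==> (!!i. i \<in> I ==> f i \<in> entry_polys F N) ==> (\<lambda>A. \<Prod>i\<in>I. f i A) \<in> entry_polys F N"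
  by (induction I rule: infinite_finite_induct) (auto intro: entry_polys.intros)

lemma ep_power: "1 \<in> F ==> f \<in> entry_polys F N ==> (\<lambda>A. f A ^ k) \<in> entry_polys F N"
  by (induction k) (auto intro: entry_polys.intros)

lemma ep_diff:
  assumes "- 1 \<in> F" "f \<in> entry_polys F N" "g \<in> entry_polys F N"
  shows "(\<lambda>A. f A - g A) \<in> entry_polys F N"
proof -
  have "(\<lambda>A. f A + (\<lambda>_. - 1) A * g A) \<in> entry_polys F N"
   using assms by (intro entry_polys.add entry_polys.mult entry_polys.const)
  then show ?thesis by simp
qed

lemma kgen_add: assumes "f \<in> kgen K N T" "f' \<in> kgen K N T" shows "(\<lambda>A. f A + f' A) \<in> kgen K N T"
proof -
  obtain n g h where f: "\<forall>i<n::nat. g i \<in> entry_polys UNIV N & h i \<in> vanishing K N T" "f = (\<lambda>A. \<Sum>i<n. g i A * h i A)"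
   using assms(1) unfolding kgen_def by (elim CollectE exE conjE) ((rule that; assumption)?)
  obtain n' g' h' where f': "\<forall>i<n'::nat. g' i \<in> entry_polys UNIV N & h' i \<in> vanishing K N T" "f' = (\<lambda>A. \<Sum>i<n'. g' i A * h' i A)"
   using assms(2) unfolding kgen_def by (elim CollectE exE conjE) ((rule that; assumption)?)
  let ?g = "\<lambda>i. if i < n then g i else g' (i - n)" and ?h = "\<lambda>i. if i < n then h i else h' (i - n)"
  have "(\<lambda>A. f A + f' A) = (\<lambda>A. \<Sum>i<n + n'. ?g i A * ?h i A)"
   unfolding sum_lessThan_add f(2) f'(2) by simp
  moreover have "\<forall>i<n + n'. ?g i \<in> entry_polys UNIV N & ?h i \<in> vanishing K N T"
   using f(1) f'(1) by auto
  ultimately show ?thesis unfolding kgen_def by (intro CollectI exI[of _ "n + n'"] exI[of _ ?g] exI[of _ ?h] conjI)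
qed

lemma kgen_mult: assumes "f \<in> kgen K N T" "p \<in> entry_polys UNIV N" shows "(\<lambda>A. p A * f A) \<in> kgen K N T"
proof -
  obtain n g h where f: "\<forall>i<n::nat. g i \<in> entry_polys UNIV N & h i \<in> vanishing K N T" "f = (\<lambda>A. \<Sum>i<n. g i A * h i A)"
   using assms(1) unfolding kgen_def by (elim CollectE exE conjE) ((rule that; assumption)?)
  have "(\<lambda>A. p A * f A) = (\<lambda>A. \<Sum>i<n. (\<lambda>A. p A * g i A) A * h i A)"
   unfolding f(2) by (simp add: sum_distrib_left mult.assoc)
  moreover have "\<forall>i<n. (\<lambda>A. p A * g i A) \<in> entry_polys UNIV N & h i \<in> vanishing K N T"
   using f(1) assms(2) entry_polys.mult by blast
  ultimately show ?thesis unfolding kgen_def by (intro CollectI exI[of _ n] exI[of _ "\<lambda>i A. p A * g i A"] exI[of _ h] conjI)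
qed

lemma kgen_vanishing: "h \<in> vanishing K N T ==> h \<in> kgen K N T"
  unfolding kgen_def by (intro CollectI exI[of _ 1] exI[of _ "\<lambda>_ _. 1"] exI[of _ "\<lambda>_. h"]) (auto intro: entry_polys.const)

lemma kgen_0: "(\<lambda>_. 0) \<in> kgen K N T"
  unfolding kgen_def by (intro CollectI exI[of _ 0]) auto

lemma kgen_zero_on: "f \<in> kgen K N T ==> A \<in> T ==> f A = 0"
  unfolding kgen_def vanishing_def by auto

text \<open>
  Congruence modulo that ideal.
\<close>
definition cg :: "'a::field set \<Rightarrow> nat \<Rightarrow> 'a mat set \<Rightarrow> ('a mat \<Rightarrow> 'a) \<Rightarrow> ('a mat \<Rightarrow> 'a) \<Rightarrow> bool" where
  "cg K N T f g \<longleftrightarrow> (\<lambda>A. f A - g A) \<in> kgen K N T"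

lemma cg_refl: "cg K N T f f" unfolding cg_def using kgen_0 by simp

lemma cg_trans: "cg K N T f g ==> cg K N T g h ==> cg K N T f h"
  unfolding cg_def using kgen_add[of "\<lambda>A. f A - g A" K N T "\<lambda>A. g A - h A"] by simp

lemma cg_add: "cg K N T f f' ==> cg K N T g g' ==> cg K N T (\<lambda>A. f A + g A) (\<lambda>A. f' A + g' A)"
  unfolding cg_def using kgen_add[of "\<lambda>A. f A - f' A" K N T "\<lambda>A. g A - g' A"] by (simp add: algebra_simps)

lemma cg_mult:
  assumes "cg K N T f f'" "cg K N T g g'" "f \<in> entry_polys UNIV N" "g' \<in> entry_polys UNIV N"
  shows "cg K N T (\<lambda>A. f A * g A) (\<lambda>A. f' A * g' A)"
proof -
  have "(\<lambda>A. f A * (g A - g' A) + g' A * (f A - f' A)) \<in> kgen K N T"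
   using assms unfolding cg_def by (intro kgen_add kgen_mult[of "\<lambda>A. g A - g' A"] kgen_mult[of "\<lambda>A. f A - f' A"])
  then show ?thesis unfolding cg_def by (simp add: algebra_simps)
qed

lemma cg_prod:
  assumes "!!i. i \<in> I ==> cg K N T (f i) (g i)" "!!i. i \<in> I ==> f i \<in> entry_polys UNIV N" "!!i. i \<in> I ==> g i \<in> entry_polys UNIV N"
  shows "cg K N T (\<lambda>A. \<Prod>i\<in>I. f i A) (\<lambda>A. \<Prod>i\<in>I. g i A)"
  using assms
proof (induction I rule: infinite_finite_induct)
  case (insert i I)
  have "cg K N T (\<lambda>A. f i A * (\<Prod>i\<in>I. f i A)) (\<lambda>A. g i A * (\<Prod>i\<in>I. g i A))"
   using insert by (intro cg_mult ep_prod) auto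
  then show ?case using insert.hyps by simp
qed (auto intro: cg_refl)

context biquad
begin

abbreviation "EP \<equiv> entry_polys UNIV 12 :: ('a mat \<Rightarrow> 'a) set"
abbreviation "cong \<equiv> cg K 12 TT"

lemma chi_EP: "m < 12 ==> chi m \<in> EP"
proof -
  assume m: "m < 12"
  have m4: "4 * (m div 4) < 12" using m div_less_iff_less_mult[of 4 m 3] by simp
  have "(\<lambda>A. \<Sum>i<12. (\<lambda>_. 2 * hm m i * e i) A * A $$ (i, 4 * (m div 4))) \<in> EP"
   using m4 by (intro ep_sum entry_polys.mult entry_polys.const entry_polys.entry) auto
  then show ?thesis unfolding chi_def[abs_def] by simp
qed

lemma lin_vanishing: "i < 12 ==> j < 12 ==> lin i j \<in> vanishing K 12 TT"
proof -
  assume ij: "i < 12" "j < 12"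
  have x4: "4 * (i div 4) < 12" using ij div_less_iff_less_mult[of 4 i 3] by simp
  have "lin i j \<in> entry_polys K 12"
  proof (cases "i div 4 = j div 4")
   case True
   have "(\<lambda>A. A $$ (i, j) - (\<lambda>_. e (xo i j) * e j / e i) A * A $$ (xo i j, 4 * (i div 4))) \<in> entry_polys K 12"
    using ij x4 xo_less[OF ij(1)] kappa[OF ij(1) True] subf_closed(2,5)[OF K]
    by (intro ep_diff entry_polys.mult entry_polys.const entry_polys.entry) auto
   then show ?thesis using True unfolding lin_def[abs_def] by simp
  next
   case False
   then show ?thesis using ij entry_polys.entry[of i 12 j K] unfolding lin_def[abs_def] by simp
  qed
  then show ?thesis unfolding vanishing_def using ij TT_iff by blast
qed

lemma nrm_vanishing:
  assumes B: "B < 3"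
  shows "nrm B \<in> vanishing K 12 TT" "nrm' B \<in> vanishing K 12 TT"
proof -
  have x: "xc B k \<in> entry_polys K 12" if "k < 4" for k
   using B that entry_polys.entry[of "4 * B + k" 12 "4 * B" K] unfolding xc_def[abs_def] by simp
  note c = subf_closed[OF K]
  have d: "(r B)\<^sup>2 \<in> K" "(s B)\<^sup>2 \<in> K" using rs[OF B] by auto
  have xx: "xc B 0 \<in> entry_polys K 12" "xc B 1 \<in> entry_polys K 12" "xc B 2 \<in> entry_polys K 12" "xc B 3 \<in> entry_polys K 12"
   using x by simp_all
  have "nrm B \<in> entry_polys K 12" unfolding nrm_def[abs_def] using d
   by (intro ep_diff entry_polys.add entry_polys.mult entry_polys.const c(1-5) d xx c(11))
  moreover have "nrm' B \<in> entry_polys K 12" unfolding nrm'_def[abs_def] using d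
   by (intro ep_diff entry_polys.add entry_polys.mult entry_polys.const c(1-5) d xx c(11))
  ultimately show "nrm B \<in> vanishing K 12 TT" "nrm' B \<in> vanishing K 12 TT"
   unfolding vanishing_def using TT_iff B by blast+
qed

lemma chi_pair_cong: "l < 6 ==> cong (\<lambda>A. chi (2 * l) A * chi (2 * l + 1) A) (\<lambda>_. 1)"
proof -
  assume l: "l < 6"
  define B where "B = l div 2"
  have B: "B < 3" using l div_less_iff_less_mult[of 2 l 3] unfolding B_def by simp
  have c1: "(\<lambda>A. nrm B A + (\<lambda>_. q) A * nrm' B A) \<in> kgen K 12 TT" for q
   by (intro kgen_add kgen_mult kgen_vanishing nrm_vanishing[OF B] entry_polys.const UNIV_I)
  show ?thesis
  proof (cases "even l")
   case True
   then have "2 * l = 4 * B" unfolding B_def by auto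
   then show ?thesis unfolding cg_def using chi_products(1)[OF B] c1[of "r B"] by simp
  next
   case False
   then obtain t where "l = 2 * t + 1" by (elim oddE)
   then have e1: "2 * l = 4 * B + 2" and e2: "2 * l + 1 = 4 * B + 3" unfolding B_def by auto
   show ?thesis unfolding cg_def e2 unfolding e1 chi_products(2)[OF B] using c1[of "- r B"] by simp
  qed
qed

definition mon :: "(nat \<Rightarrow> nat) \<Rightarrow> 'a mat \<Rightarrow> 'a" where "mon p A = (\<Prod>m<12. chi m A ^ p m)"

text \<open>
  Exponents of monomials in which no two eigenvalues with product 1 occur together.
\<close>
definition reduced :: "(nat \<Rightarrow> nat) set" where
  "reduced = {q. (\<forall>l<6. q (2 * l) = 0 \<or> q (2 * l + 1) = 0) & (\<forall>m\<ge>12. q m = 0)}"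

definition red :: "(nat \<Rightarrow> nat) \<Rightarrow> nat \<Rightarrow> nat" where
  "red p m = (if m \<ge> 12 then 0 else if even m then p m - p (m + 1) else p m - p (m - 1))"

lemma red_reduced: "red p \<in> reduced" by (auto simp: reduced_def red_def)

lemma mon_EP: "mon p \<in> EP"
  unfolding mon_def[abs_def] using chi_EP by (intro ep_prod ep_power) auto

lemma mon_pairs: "mon p A = (\<Prod>l<6. chi (2 * l) A ^ p (2 * l) * chi (2 * l + 1) A ^ p (2 * l + 1))"
  using prod_pairs[of "\<lambda>m. chi m A ^ p m" 6] unfolding mon_def by simp

lemma mon_red: "cong (mon p) (mon (red p))"
proof -
  have "cong (\<lambda>A. chi (2 * l) A ^ a * chi (2 * l + 1) A ^ b) (\<lambda>A. chi (2 * l) A ^ (a - b) * chi (2 * l + 1) A ^ (b - a))"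
   if l: "l < 6" for l a b
  proof -
   have EP: "chi (2 * l) \<in> EP" "chi (2 * l + 1) \<in> EP" using chi_EP l by auto
   have pw: "cong (\<lambda>A. (chi (2 * l) A * chi (2 * l + 1) A) ^ k) (\<lambda>_. 1)" for k
   proof (induction k)
    case (Suc k)
    have "cong (\<lambda>A. (chi (2 * l) A * chi (2 * l + 1) A) * (chi (2 * l) A * chi (2 * l + 1) A) ^ k) (\<lambda>A. 1 * 1)"
     by (rule cg_mult[OF chi_pair_cong[OF l] Suc]) (intro entry_polys.mult entry_polys.const EP UNIV_I)+
    then show ?case by simp
   qed (simp add: cg_refl)
   define k where "k = min a b"
   have ab: "a = k + (a - b)" "b = k + (b - a)" unfolding k_def by auto
   have "cong (\<lambda>A. (chi (2 * l) A * chi (2 * l + 1) A) ^ k * (chi (2 * l) A ^ (a - b) * chi (2 * l + 1) A ^ (b - a)))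
     (\<lambda>A. 1 * (chi (2 * l) A ^ (a - b) * chi (2 * l + 1) A ^ (b - a)))"
    by (rule cg_mult[OF pw cg_refl]) (intro entry_polys.mult ep_power entry_polys.const EP UNIV_I)+
   moreover have "(\<lambda>A. (chi (2 * l) A * chi (2 * l + 1) A) ^ k * (chi (2 * l) A ^ (a - b) * chi (2 * l + 1) A ^ (b - a)))
     = (\<lambda>A. chi (2 * l) A ^ a * chi (2 * l + 1) A ^ b)"
    by (subst (3) ab(1), subst (4) ab(2)) (simp add: power_add power_mult_distrib mult_ac)
   ultimately show ?thesis by simp
  qed
  from this[of _ "p (2 * _)" "p (2 * _ + 1)"]
  have "cong (\<lambda>A. \<Prod>l<6. chi (2 * l) A ^ p (2 * l) * chi (2 * l + 1) A ^ p (2 * l + 1))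
   (\<lambda>A. \<Prod>l<6. chi (2 * l) A ^ (p (2 * l) - p (2 * l + 1)) * chi (2 * l + 1) A ^ (p (2 * l + 1) - p (2 * l)))"
   by (intro cg_prod) (auto intro!: entry_polys.mult ep_power chi_EP)
  moreover have "(\<lambda>A. \<Prod>l<6. chi (2 * l) A ^ (p (2 * l) - p (2 * l + 1)) * chi (2 * l + 1) A ^ (p (2 * l + 1) - p (2 * l))) = mon (red p)"
   unfolding mon_pairs[abs_def] by (intro ext prod.cong) (auto simp: red_def)
  ultimately show ?thesis unfolding mon_pairs[abs_def] by simp
qed

definition spn :: "('a mat \<Rightarrow> 'a) set" where
  "spn = {f. \<exists>S c. finite S & S \<subseteq> reduced & cong f (\<lambda>A. \<Sum>q\<in>S. c q * mon q A)}"

lemma spn_cong: "cong f g ==> g \<in> spn ==> f \<in> spn"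
  unfolding spn_def by (elim CollectE exE conjE, intro CollectI exI conjI) (auto intro: cg_trans)

lemma spn_mon: "(\<lambda>A. c * mon p A) \<in> spn"
proof -
  have "cong (\<lambda>A. (\<lambda>_. c) A * mon p A) (\<lambda>A. (\<lambda>_. c) A * mon (red p) A)"
   by (intro cg_mult cg_refl mon_red mon_EP entry_polys.const UNIV_I)
  then show ?thesis unfolding spn_def using red_reduced[of p]
   by (intro CollectI exI[of _ "{red p}"] exI[of _ "\<lambda>_. c"]) simp
qed

lemma spn_add:
  assumes "f \<in> spn" "g \<in> spn"
  shows "(\<lambda>A. f A + g A) \<in> spn"
proof -
  obtain S c where f: "finite S" "S \<subseteq> reduced" "cong f (\<lambda>A. \<Sum>q\<in>S. c q * mon q A)" using assms(1) unfolding spn_def by (elim CollectE exE conjE) ((rule that; assumption)?)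
  obtain S' c' where g: "finite S'" "S' \<subseteq> reduced" "cong g (\<lambda>A. \<Sum>q\<in>S'. c' q * mon q A)" using assms(2) unfolding spn_def by (elim CollectE exE conjE) ((rule that; assumption)?)
  define d where "d q = (if q \<in> S then c q else 0) + (if q \<in> S' then c' q else 0)" for q
  have "(\<Sum>q\<in>S. c q * mon q A) + (\<Sum>q\<in>S'. c' q * mon q A) = (\<Sum>q\<in>S \<union> S'. d q * mon q A)" for A
  proof -
   have "(\<Sum>q\<in>S. c q * mon q A) = (\<Sum>q\<in>S \<union> S'. (if q \<in> S then c q else 0) * mon q A)"
    using f(1) g(1) by (intro sum.mono_neutral_cong_left) auto
   moreover have "(\<Sum>q\<in>S'. c' q * mon q A) = (\<Sum>q\<in>S \<union> S'. (if q \<in> S' then c' q else 0) * mon q A)"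
    using f(1) g(1) by (intro sum.mono_neutral_cong_left) auto
   ultimately show ?thesis unfolding d_def by (simp add: distrib_right sum.distrib)
  qed
  with cg_add[OF f(3) g(3)] have "cong (\<lambda>A. f A + g A) (\<lambda>A. \<Sum>q\<in>S \<union> S'. d q * mon q A)" by simp
  then show ?thesis unfolding spn_def using f g by (intro CollectI exI[of _ "S \<union> S'"] exI[of _ d]) simp
qed

lemma spn_0: "(\<lambda>_. 0) \<in> spn"
  unfolding spn_def by (intro CollectI exI[of _ "{}"]) (simp add: cg_refl)

lemma spn_sum: "(!!i. i \<in> I ==> f i \<in> spn) ==> (\<lambda>A. \<Sum>i\<in>I. f i A) \<in> spn"
  by (induction I rule: infinite_finite_induct) (auto intro: spn_0 spn_add)

lemma mon_mult: "mon p A * mon q A = mon (\<lambda>m. p m + q m) A"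
  unfolding mon_def by (simp add: prod.distrib power_add)

lemma spn_mult:
  assumes "f \<in> spn" "g \<in> spn" "f \<in> EP"
  shows "(\<lambda>A. f A * g A) \<in> spn"
proof -
  obtain S c where f: "cong f (\<lambda>A. \<Sum>q\<in>S. c q * mon q A)" using assms(1) unfolding spn_def by (elim CollectE exE conjE) ((rule that; assumption)?)
  obtain S' c' where g: "cong g (\<lambda>A. \<Sum>q\<in>S'. c' q * mon q A)" using assms(2) unfolding spn_def by (elim CollectE exE conjE) ((rule that; assumption)?)
  have EP': "(\<lambda>A. \<Sum>q\<in>S'. c' q * mon q A) \<in> EP"
   by (intro ep_sum entry_polys.mult[OF entry_polys.const mon_EP]) auto
  have "(\<lambda>A. \<Sum>q\<in>S. \<Sum>q'\<in>S'. (c q * c' q') * mon (\<lambda>m. q m + q' m) A) \<in> spn"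
   by (intro spn_sum spn_mon)
  moreover have "(\<lambda>A. \<Sum>q\<in>S. \<Sum>q'\<in>S'. (c q * c' q') * mon (\<lambda>m. q m + q' m) A)
    = (\<lambda>A. (\<Sum>q\<in>S. c q * mon q A) * (\<Sum>q\<in>S'. c' q * mon q A))"
   unfolding sum_product mon_mult[symmetric] by (simp add: mult_ac)
  ultimately show ?thesis using spn_cong[OF cg_mult[OF f g assms(3) EP']] by simp
qed

lemma EP_spn: "f \<in> EP ==> f \<in> spn"
proof (induction rule: entry_polys.induct)
  case (const c)
  have "(\<lambda>A. c * mon (\<lambda>_. 0) A) \<in> spn" by (rule spn_mon)
  then show ?case unfolding mon_def by simp
next
  case (entry i j)
  have chi: "chi m A = mon (\<lambda>k. if k = m then 1 else 0) A" if "m < 12" for m A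
  proof -
   have "mon (\<lambda>k. if k = m then 1 else 0) A = (\<Prod>k<12. if k = m then chi k A else 1)"
    unfolding mon_def by (intro prod.cong) auto
   with that show ?thesis by simp
  qed
  have "(\<lambda>A. A $$ (i, j) - tm (\<lambda>m. chi m A) $$ (i, j)) \<in> kgen K 12 TT"
   using kgen_vanishing[OF lin_vanishing[OF entry]] ext[of "lin i j", OF lin_eq[OF entry]] by simp
  then have 1: "cong (\<lambda>A. A $$ (i, j)) (\<lambda>A. tm (\<lambda>m. chi m A) $$ (i, j))" unfolding cg_def .
  have "(\<lambda>A. \<Sum>m\<in>{..<12}. (hm i m * hm m j * e j / e i) * mon (\<lambda>k. if k = m then 1 else 0) A) \<in> spn"
   by (intro spn_sum spn_mon)
  moreover have "(\<lambda>A. \<Sum>m\<in>{..<12}. (hm i m * hm m j * e j / e i) * mon (\<lambda>k. if k = m then 1 else 0) A) = (\<lambda>A. tm (\<lambda>m. chi m A) $$ (i, j))"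
  proof
   fix A
   have "(\<Sum>m\<in>{..<12}. (hm i m * hm m j * e j / e i) * mon (\<lambda>k. if k = m then 1 else 0) A) = (\<Sum>m<12. hm i m * chi m A * hm m j * e j / e i)"
    by (intro sum.cong refl) (simp add: chi mult_ac)
   then show "(\<Sum>m\<in>{..<12}. (hm i m * hm m j * e j / e i) * mon (\<lambda>k. if k = m then 1 else 0) A) = tm (\<lambda>m. chi m A) $$ (i, j)"
    unfolding tm_def using entry by (simp add: sum_distrib_right sum_divide_distrib)
  qed
  ultimately show ?case using spn_cong[OF 1] by simp
next
  case (add f g)
  then show ?case by (intro spn_add)
next
  case (mult f g)
  then show ?case by (intro spn_mult)
qed

lemma mon_tm: "mon q (tm y) = (\<Prod>m<12. y m ^ q m)"
  unfolding mon_def by (intro prod.cong) (auto simp: chi_tm)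

text \<open>
  Some `\<tau>` has `\<tau> ^ a ~= \<tau> ^ b`, for otherwise the polynomial `t (t ^ a - t ^
  b) + 1` would have no root.
\<close>
lemma mon_separated:
  assumes "p \<in> reduced" "q \<in> reduced" "p ~= q"
  shows "\<exists>y\<in>adm. (\<Prod>m<12. y m ^ p m) ~= (\<Prod>m<12. y m ^ q m)"
proof -
  obtain m where m: "p m ~= q m" using assms(3) by blast
  then have m12: "m < 12" using assms(1,2) unfolding reduced_def by (cases "m < 12") auto
  define l where "l = m div 2"
  have l: "l < 6" "m = 2 * l \<or> m = 2 * l + 1" using m12 unfolding l_def by auto
  define a b where "a = p (2 * l) + q (2 * l + 1)" and "b = q (2 * l) + p (2 * l + 1)"
  have "p (2 * l) = 0 \<or> p (2 * l + 1) = 0" "q (2 * l) = 0 \<or> q (2 * l + 1) = 0" using assms(1,2) l(1) unfolding reduced_def by auto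
  with m l(2) have ab: "a ~= b" unfolding a_def b_def by (elim disjE) auto
  define P :: "'a poly" where "P = [:0, 1:] * (Polynomial.monom 1 a - Polynomial.monom 1 b) + 1"
  have "Polynomial.coeff P (Suc a) ~= 0" unfolding P_def using ab by (simp add: coeff_pCons Polynomial.coeff_monom)
  then have "Polynomial.degree P > 0" by (metis Zero_not_Suc bot_nat_0.not_eq_extremum le_degree le_0_eq)
  then obtain \<tau> where "poly P \<tau> = 0" using alg_closed_root by blast
  then have \<tau>: "\<tau> * (\<tau> ^ a - \<tau> ^ b) = - 1" unfolding P_def by (simp add: poly_monom eq_neg_iff_add_eq_0)
  then have \<tau>0: "\<tau> ~= 0" "\<tau> ^ a ~= \<tau> ^ b" by auto
  define y where "y k = (if k = 2 * l then \<tau> else if k = 2 * l + 1 then inverse \<tau> else 1)" for k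
  have yad: "y \<in> adm" unfolding adm_def y_def using \<tau>0 by auto
  have val: "(\<Prod>m<12. y m ^ w m) = \<tau> ^ w (2 * l) * inverse \<tau> ^ w (2 * l + 1)" for w :: "nat \<Rightarrow> nat"
  proof -
   have "(\<Prod>m<12. y m ^ w m) = (\<Prod>t<6. y (2 * t) ^ w (2 * t) * y (2 * t + 1) ^ w (2 * t + 1))"
    using prod_pairs[of "\<lambda>m. y m ^ w m" 6] by simp
   also have "... = (\<Prod>t<6. if t = l then \<tau> ^ w (2 * l) * inverse \<tau> ^ w (2 * l + 1) else 1)"
   proof (intro prod.cong refl)
    fix t :: nat
    have "2 * t + 1 ~= 2 * l" by presburger
    then show "y (2 * t) ^ w (2 * t) * y (2 * t + 1) ^ w (2 * t + 1) = (if t = l then \<tau> ^ w (2 * l) * inverse \<tau> ^ w (2 * l + 1) else 1)"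
     unfolding y_def by auto
   qed
   also have "... = \<tau> ^ w (2 * l) * inverse \<tau> ^ w (2 * l + 1)" using l(1) by simp
   finally show ?thesis .
  qed
  have neq: "\<tau> ^ p (2 * l) * inverse \<tau> ^ p (2 * l + 1) ~= \<tau> ^ q (2 * l) * inverse \<tau> ^ q (2 * l + 1)"
  proof
   assume "\<tau> ^ p (2 * l) * inverse \<tau> ^ p (2 * l + 1) = \<tau> ^ q (2 * l) * inverse \<tau> ^ q (2 * l + 1)"
   then have "\<tau> ^ p (2 * l) / \<tau> ^ p (2 * l + 1) = \<tau> ^ q (2 * l) / \<tau> ^ q (2 * l + 1)" by (simp add: divide_inverse power_inverse)
   then have "\<tau> ^ a = \<tau> ^ b" using \<tau>0(1) unfolding a_def b_def power_add by (simp add: frac_eq_eq)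
   with \<tau>0(2) show False ..
  qed
  show ?thesis using neq yad unfolding val[of p, symmetric] val[of q, symmetric] by blast
qed

text \<open>
  Modulo the ideal generated over `K`, every polynomial is a linear combination of reduced
  monomials in the eigenvalues. On the torus these are distinct characters, hence independent; so
  a vanishing polynomial is congruent to 0.
\<close>
theorem TT_defined_over: "defined_over K 12 TT"
  unfolding defined_over_def
proof
  fix f assume f: "f \<in> vanishing UNIV 12 TT"
  then have fE: "f \<in> EP" and f0: "!!A. A \<in> TT ==> f A = 0" by (auto simp: vanishing_def)
  obtain S c where S: "finite S" "S \<subseteq> reduced" "cong f (\<lambda>A. \<Sum>q\<in>S. c q * mon q A)"
   using EP_spn[OF fE] unfolding spn_def by (elim CollectE exE conjE) ((rule that; assumption)?)
  have zero: "(\<Sum>q\<in>S. c q * (\<Prod>m<12. y m ^ q m)) = 0" if y: "y \<in> adm" for y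
  proof -
   have T: "tm y \<in> TT" using y unfolding TT_def by blast
   from kgen_zero_on[OF S(3)[unfolded cg_def] T] f0[OF T] show ?thesis by (simp add: mon_tm)
  qed
  have "\<forall>q\<in>S. c q = 0"
  proof (rule character_independence[OF S(1), where G = adm and mul = "\<lambda>x y m. x m * y m" and ch = "\<lambda>q y. \<Prod>m<12. y m ^ q m"])
   show "\<exists>y\<in>adm. (\<Prod>m<12. y m ^ q m) ~= 0" for q using adm_closed(3) by (intro bexI[of _ "\<lambda>_. 1"]) auto
   show "\<exists>y\<in>adm. (\<Prod>m<12. y m ^ q m) ~= (\<Prod>m<12. y m ^ q' m)" if "q \<in> S" "q' \<in> S" "q ~= q'" for q q'
    using mon_separated that S(2) by blast
  qed (auto simp: adm_closed(1) zero power_mult_distrib prod.distrib)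
  then have "f \<in> kgen K 12 TT" using S(3) unfolding cg_def by simp
  then show "\<exists>n g h. (\<forall>i<n::nat. g i \<in> entry_polys UNIV 12 & h i \<in> vanishing K 12 TT) & f = (\<lambda>A. \<Sum>i<n. g i A * h i A)"
   unfolding kgen_def by (elim CollectE)
qed

lemma TT_closed: "zariski_closed 12 TT"
  unfolding zariski_closed_def
proof
  show "TT \<subseteq> {A \<in> carrier (GL 12). \<forall>f\<in>vanishing UNIV 12 TT. f A = 0}"
   using subgroup.subset[OF TT_subgroup] unfolding vanishing_def by blast
  have mono: "entry_polys K N \<subseteq> entry_polys UNIV N" for N
  proof
   fix f assume "f \<in> entry_polys K N" then show "f \<in> entry_polys UNIV N"
    by induction (auto intro: entry_polys.intros)
  qed
  then have v: "vanishing K 12 TT \<subseteq> vanishing UNIV 12 TT" unfolding vanishing_def by blast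
  show "{A \<in> carrier (GL 12). \<forall>f\<in>vanishing UNIV 12 TT. f A = 0} \<subseteq> TT"
  proof
   fix A assume "A \<in> {A \<in> carrier (GL 12). \<forall>f\<in>vanishing UNIV 12 TT. f A = 0}"
   then have "A \<in> carrier_mat 12 12" "!!f. f \<in> vanishing K 12 TT ==> f A = 0" using v by (auto simp: GL_simps)
   then show "A \<in> TT" unfolding TT_iff using lin_vanishing nrm_vanishing by blast
  qed
qed

lemma diag_group_diag: "B \<in> diag_group 6 ==> B = mat_diag 6 (\<lambda>l. B $$ (l, l)) & (\<forall>l<6. B $$ (l, l) ~= 0) & B \<in> carrier_mat 6 6"
  for B :: "'a mat"
proof -
  assume "B \<in> diag_group 6"
  then obtain C where B: "B \<in> carrier_mat 6 6" "C \<in> carrier_mat 6 6" "B * C = 1\<^sub>m 6" and d: "diagonal_mat B"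
   unfolding diag_group_def GL_simps by (elim CollectE conjE bexE) ((rule that; assumption)?)
  have B0: "B $$ (i, j) = 0" if "i < 6" "j < 6" "i ~= j" for i j using d B(1) that unfolding diagonal_mat_def by auto
  have e: "B = mat_diag 6 (\<lambda>l. B $$ (l, l))" unfolding mat_diag_def using B(1) B0 by (intro eq_matI) auto
  have "B $$ (l, l) ~= 0" if l: "l < 6" for l
  proof
   assume z: "B $$ (l, l) = 0"
   have "(B * C) $$ (l, l) = (\<Sum>k<6. B $$ (l, k) * C $$ (k, l))"
    using B(1,2) l by (simp add: scalar_prod_def atLeast0LessThan)
   also have "... = 0" using B0[OF l] z by (intro sum.neutral ballI) (metis lessThan_iff mult_zero_left)
   finally show False using B(3) l by simp
  qed
  with e B show ?thesis by blast
qed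

lemma mat_diag_in: "(!!l. l < 6 ==> t l ~= 0) ==> mat_diag 6 t \<in> diag_group 6" for t :: "nat \<Rightarrow> 'a"
proof -
  assume t: "!!l. l < 6 ==> t l ~= 0"
  have "mat_diag 6 (\<lambda>l. t l * inverse (t l)) = 1\<^sub>m 6" using t by (intro eq_matI) (auto simp: mat_diag_def)
  then have "mat_diag 6 t * mat_diag 6 (\<lambda>l. inverse (t l)) = 1\<^sub>m 6" "mat_diag 6 (\<lambda>l. inverse (t l)) * mat_diag 6 t = 1\<^sub>m 6"
   by (simp_all add: mult.commute)
  then show ?thesis unfolding diag_group_def GL_simps
   by (auto simp: diagonal_mat_def mat_diag_def intro!: bexI[of _ "mat_diag 6 (\<lambda>l. inverse (t l))"])
qed

text \<open>
  One eigenvalue from each pair gives coordinates on the torus.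
\<close>
definition toD :: "'a mat \<Rightarrow> 'a mat" where "toD A = mat_diag 6 (\<lambda>l. chi (2 * l) A)"
definition ofD :: "'a mat \<Rightarrow> 'a mat" where
  "ofD B = tm (\<lambda>m. if even m then B $$ (m div 2, m div 2) else inverse (B $$ (m div 2, m div 2)))"

theorem TT_torus: "torus K 6 12 TT"
proof -
  have GLT: "monoid.mult (GL N\<lparr>carrier := T'\<rparr>) = ((*) :: 'a mat \<Rightarrow> _)" for N T' using GL_simps(1)[of N] by (auto simp: fun_eq_iff)
  have toD_tm: "toD (tm y) = mat_diag 6 (\<lambda>l. y (2 * l))" for y
   unfolding toD_def mat_diag_def by (intro cong_mat) (auto simp: chi_tm)
  have ofD_cong: "ofD (mat_diag 6 t) = tm (\<lambda>m. if even m then t (m div 2) else inverse (t (m div 2)))" for t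
   unfolding ofD_def by (rule tm_cong) (auto simp: mat_diag_def)
  have "alg_group_hom 12 TT 6 (diag_group 6) toD"
   unfolding alg_group_hom_def
  proof (intro conjI allI impI)
   show "toD \<in> hom (GL 12\<lparr>carrier := TT\<rparr>) (GL 6\<lparr>carrier := diag_group 6\<rparr>)"
   proof (rule homI)
    fix A assume "A \<in> carrier (GL 12\<lparr>carrier := TT\<rparr>)"
    then obtain y where y: "y \<in> adm" "A = tm y" unfolding TT_def by auto
    show "toD A \<in> carrier (GL 6\<lparr>carrier := diag_group 6\<rparr>)" unfolding y(2) toD_tm
     using adm_nz[OF y(1)] by (simp add: mat_diag_in)
    fix A' assume "A' \<in> carrier (GL 12\<lparr>carrier := TT\<rparr>)"
    then obtain y' where y': "y' \<in> adm" "A' = tm y'" unfolding TT_def by auto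
    show "toD (A \<otimes>\<^bsub>GL 12\<lparr>carrier := TT\<rparr>\<^esub> A') = toD A \<otimes>\<^bsub>GL 6\<lparr>carrier := diag_group 6\<rparr>\<^esub> toD A'"
     unfolding GLT y y' tm_mult toD_tm by simp
   qed
   fix i j :: nat assume ij: "i < 6" "j < 6"
   show "regular_on 12 TT (\<lambda>A. toD A $$ (i, j))"
   proof (cases "i = j")
    case True
    then show ?thesis unfolding regular_on_def using ij chi_EP[of "2 * i"]
     by (intro bexI[of _ "chi (2 * i)"] exI[of _ 0]) (auto simp: toD_def mat_diag_def)
   next
    case False
    then show ?thesis unfolding regular_on_def using ij
     by (intro bexI[of _ "\<lambda>_. 0"] exI[of _ 0]) (auto simp: toD_def mat_diag_def intro: entry_polys.const)
   qed
  qed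
  moreover have "alg_group_hom 6 (diag_group 6) 12 TT ofD"
   unfolding alg_group_hom_def
  proof (intro conjI allI impI)
   show "ofD \<in> hom (GL 6\<lparr>carrier := diag_group 6\<rparr>) (GL 12\<lparr>carrier := TT\<rparr>)"
   proof (rule homI)
    fix B :: "'a mat" assume "B \<in> carrier (GL 6\<lparr>carrier := diag_group 6\<rparr>)"
    then have B: "B = mat_diag 6 (\<lambda>l. B $$ (l, l))" "\<forall>l<6. B $$ (l, l) ~= 0" using diag_group_diag by auto
    show "ofD B \<in> carrier (GL 12\<lparr>carrier := TT\<rparr>)"
     unfolding ofD_def TT_def adm_def using B(2) by auto
    fix B' :: "'a mat" assume "B' \<in> carrier (GL 6\<lparr>carrier := diag_group 6\<rparr>)"
    then have B': "B' = mat_diag 6 (\<lambda>l. B' $$ (l, l))" using diag_group_diag by auto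
    have "B * B' = mat_diag 6 (\<lambda>l. B $$ (l, l) * B' $$ (l, l))" by (subst B(1), subst B') simp
    then have "ofD (B * B') = tm (\<lambda>m. (if even m then B $$ (m div 2, m div 2) else inverse (B $$ (m div 2, m div 2))) *
     (if even m then B' $$ (m div 2, m div 2) else inverse (B' $$ (m div 2, m div 2))))"
     by (simp only: ofD_cong) (rule tm_cong, simp)
    then show "ofD (B \<otimes>\<^bsub>GL 6\<lparr>carrier := diag_group 6\<rparr>\<^esub> B') = ofD B \<otimes>\<^bsub>GL 12\<lparr>carrier := TT\<rparr>\<^esub> ofD B'"
     unfolding GLT by (simp only: ofD_def tm_mult)
   qed
   fix i j :: nat assume ij: "i < 12" "j < 12"
   define D where "D B = (\<Prod>l<6. B $$ (l, l))" for B :: "'a mat"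
   define p where "p B = (\<Sum>m<12. (\<lambda>_. hm i m * hm m j * e j / e i) B *
     (if even m then B $$ (m div 2, m div 2) * D B else (\<Prod>l\<in>{..<6} - {m div 2}. B $$ (l, l))))" for B :: "'a mat"
   have "p \<in> entry_polys UNIV 6"
    unfolding p_def[abs_def]
   proof (intro ep_sum entry_polys.mult entry_polys.const UNIV_I)
    fix m :: nat assume "m \<in> {..<12}"
    then have m: "m div 2 < 6" by simp
    show "(\<lambda>B. if even m then B $$ (m div 2, m div 2) * D B else \<Prod>l\<in>{..<6} - {m div 2}. B $$ (l, l)) \<in> entry_polys UNIV 6"
     unfolding D_def using m
     by (cases "even m") (auto intro!: entry_polys.mult ep_prod entry_polys.entry)
   qed
   moreover have "\<forall>B\<in>diag_group 6. ofD B $$ (i, j) = p B / det B ^ 1"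
   proof
    fix B :: "'a mat" assume B: "B \<in> diag_group 6"
    note d = diag_group_diag[OF B]
    have "upper_triangular B" unfolding upper_triangular_def
    proof (intro allI impI)
     fix i j assume "i < dim_row B" "j < i"
     then have "i < 6" "j < 6" "i ~= j" using d by auto
     then show "B $$ (i, j) = 0" using arg_cong[OF d[THEN conjunct1], of "\<lambda>M. M $$ (i, j)"] by (simp add: mat_diag_def)
    qed
    then have "det B = prod_list (diag_mat B)" using det_upper_triangular d by blast
    also have "... = D B" unfolding D_def diag_mat_def using d by (auto simp: prod.distinct_set_conv_list[symmetric] atLeast0LessThan)
    finally have det: "det B = D B" .
    have D0: "D B ~= 0" unfolding D_def using d by auto
    have t: "(if even m then B $$ (m div 2, m div 2) * D B else (\<Prod>l\<in>{..<6} - {m div 2}. B $$ (l, l))) / D B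
      = (if even m then B $$ (m div 2, m div 2) else inverse (B $$ (m div 2, m div 2)))" if "m < 12" for m
    proof (cases "even m")
     case False
     have "D B = B $$ (m div 2, m div 2) * (\<Prod>l\<in>{..<6} - {m div 2}. B $$ (l, l))"
      unfolding D_def using that by (intro prod.remove) auto
     with False D0 show ?thesis by (auto simp: field_simps)
    qed (use D0 in simp)
    have "p B / D B = (\<Sum>m<12. hm i m * hm m j * e j / e i * ((if even m then B $$ (m div 2, m div 2) * D B else (\<Prod>l\<in>{..<6} - {m div 2}. B $$ (l, l))) / D B))"
     unfolding p_def by (simp only: sum_divide_distrib times_divide_eq_right)
    also have "... = (\<Sum>m<12. hm i m * hm m j * e j / e i * (if even m then B $$ (m div 2, m div 2) else inverse (B $$ (m div 2, m div 2))))"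
     using t by (intro sum.cong) auto
    also have "... = ofD B $$ (i, j)"
    proof -
     have "ofD B $$ (i, j) = (\<Sum>m<12. hm i m * (if even m then B $$ (m div 2, m div 2) else inverse (B $$ (m div 2, m div 2))) * hm m j) * e j / e i"
      unfolding ofD_def tm_def using ij by simp
     also have "... = (\<Sum>m<12. hm i m * hm m j * e j / e i * (if even m then B $$ (m div 2, m div 2) else inverse (B $$ (m div 2, m div 2))))"
      unfolding sum_distrib_right sum_divide_distrib by (intro sum.cong refl) (simp only: mult_ac times_divide_eq_left times_divide_eq_right)
     finally show ?thesis ..
    qed
    finally show "ofD B $$ (i, j) = p B / det B ^ 1" unfolding det by simp
   qed
   ultimately show "regular_on 6 (diag_group 6) (\<lambda>B. ofD B $$ (i, j))" unfolding regular_on_def by blast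
  qed
  moreover have "ofD (toD A) = A" if A: "A \<in> TT" for A
  proof -
   obtain y where y: "y \<in> adm" "A = tm y" using A unfolding TT_def by auto
   show ?thesis unfolding y(2) toD_tm ofD_cong
   proof (rule tm_cong)
    fix m :: nat assume m: "m < 12"
    show "(if even m then y (2 * (m div 2)) else inverse (y (2 * (m div 2)))) = y m"
    proof (cases "even m")
     case False
     then have e: "2 * (m div 2) + 1 = m" by simp
     have "m div 2 < 6" using m by simp
     then have "y (2 * (m div 2)) * y (2 * (m div 2) + 1) = 1" using y(1) unfolding adm_def by blast
     then have "inverse (y (2 * (m div 2))) = y (2 * (m div 2) + 1)" by (rule inverse_unique)
     with False e show ?thesis by simp
    qed simp
   qed
  qed
  moreover have "toD (ofD B) = B" if B: "B \<in> diag_group 6" for B :: "'a mat"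
  proof -
   have "toD (ofD B) = mat_diag 6 (\<lambda>l. B $$ (l, l))" unfolding ofD_def toD_tm by simp
   with diag_group_diag[OF B] show ?thesis by simp
  qed
  ultimately have "alg_group_isomorphic 12 TT 6 (diag_group 6)" unfolding alg_group_isomorphic_def by blast
  then show ?thesis unfolding torus_def linear_algebraic_group_def using TT_subgroup TT_closed TT_defined_over by blast
qed

end

section \<open>Absolute Galois groups\<close>

lemma FF_combine:
  "length Ks = length Us ==> ring.combine FF Ks Us = (\<Sum>i<length Us. Ks ! i * (Us ! i :: 'a::field))"
  by (induction Ks Us rule: list_induct2) (simp_all add: FF.combine.simps sum.lessThan_Suc_shift del: sum.lessThan_Suc)

lemma FF_Span:
  assumes "subf (F :: 'a::field set)"
  shows "ring.Span FF F Us = {\<Sum>i<length Us. c i * Us ! i | c. \<forall>i<length Us. c i \<in> F}"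
proof -
  have F: "subfield F FF" using assms subfield_FF_iff by blast
  have 1: "ring.Span FF F Us = {ring.combine FF Ks Us | Ks. length Ks = length Us & set Ks \<subseteq> F}"
   using FF.Span_eq_combine_set_length_version[OF F, of Us] by auto
  show ?thesis unfolding 1
  proof (intro equalityI subsetI)
   fix x assume "x \<in> {ring.combine FF Ks Us | Ks. length Ks = length Us & set Ks \<subseteq> F}"
   then obtain Ks where k: "length Ks = length Us" "set Ks \<subseteq> F" "x = ring.combine FF Ks Us" by (elim CollectE exE conjE) ((rule that; assumption)?)
   have "\<forall>i<length Us. Ks ! i \<in> F" using k(1,2) nth_mem by fastforce
   then show "x \<in> {\<Sum>i<length Us. c i * Us ! i | c. \<forall>i<length Us. c i \<in> F}"
    unfolding k(3) FF_combine[OF k(1)] by (intro CollectI exI[of _ "\<lambda>i. Ks ! i"] conjI refl)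
  next
   fix x assume "x \<in> {\<Sum>i<length Us. c i * Us ! i | c. \<forall>i<length Us. c i \<in> F}"
   then obtain c where c: "x = (\<Sum>i<length Us. c i * Us ! i)" "\<forall>i<length Us. c i \<in> F" by (elim CollectE exE conjE) ((rule that; assumption)?)
   have l: "length (map c [0..<length Us]) = length Us" by simp
   have "x = ring.combine FF (map c [0..<length Us]) Us" unfolding FF_combine[OF l] c(1) by simp
   moreover have "set (map c [0..<length Us]) \<subseteq> F" using c(2) by auto
   ultimately show "x \<in> {ring.combine FF Ks Us | Ks. length Ks = length Us & set Ks \<subseteq> F}"
    using l by (intro CollectI exI[of _ "map c [0..<length Us]"] conjI)
  qed
qed

text \<open>
  The polynomial `t^2 - d^2` is separable because the characteristic is not 2.
\<close>
lemma sqrt_sep_closure: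
  assumes F: "subf F" and two: "(2::'a::field) ~= 0" and d: "d\<^sup>2 \<in> F"
  shows "d \<in> sep_closure (F :: 'a set)"
proof (cases "d = 0")
  case True then show ?thesis using sep_closure_incl[OF F] subf_closed(1)[OF F] by blast
next
  case False
  have "d ~= - d" using False two by (metis eq_neg_iff_add_eq_0 mult_2 mult_eq_0_iff)
  then have "(\<Prod>v\<in>{d, - d}. [:- v, 1:]) = [:- (d\<^sup>2), 0, 1:]" by (simp add: power2_eq_square)
  moreover have "rsquarefree (\<Prod>v\<in>{d, - d}. [:- v, 1:])" by (rule rsquarefree_prod_roots) simp
  ultimately have "rsquarefree [:- (d\<^sup>2), 0, 1:]" by simp
  moreover have "[:- (d\<^sup>2), 0, 1:] \<in> polys F"
   unfolding polys_pCons_iff using d by (simp add: subf_closed[OF F] polys_closed[OF F])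
  moreover have "poly [:- (d\<^sup>2), 0, 1:] d = 0" by (simp add: power2_eq_square)
  ultimately show ?thesis unfolding sep_closure_iff by blast
qed

text \<open>
  The homomorphism permutes the finite set of roots of each separable polynomial over `F`, being
  injective. It may be defined on a larger field `E`; this covers the restriction of automorphisms
  to a smaller separable closure.
\<close>
lemma permutes_sep_closure:
  fixes F :: "'a::field set"
  assumes E: "subf E" "rhom E f" and FE: "sep_closure F \<subseteq> E" and F: "subf F" and fxd: "\<forall>c\<in>F. f c = c"
  shows "bij_betw f (sep_closure F) (sep_closure F)"
proof -
  have FE': "F \<subseteq> E" using sep_closure_incl[OF F] FE by blast
  have root: "poly p (f x) = 0" if p: "p \<in> polys F" and x: "x \<in> E" "poly p x = 0" for p x
  proof -
   have pE: "p \<in> polys E" using p polys_mono[OF FE'] by blast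
   have "map_poly f p = p"
    using p fxd rhom_simps(1)[OF E] by (intro poly_eqI) (simp add: coeff_map_poly polys_def)
   then show ?thesis using poly_map_poly_on[OF E pE x(1)] x(2) rhom_simps(1)[OF E] by simp
  qed
  have inj: "inj_on f (sep_closure F)" using rhom_inj[OF E] FE by (intro inj_onI) blast
  have "f ` sep_closure F = sep_closure F"
  proof (intro equalityI subsetI)
   fix y assume "y \<in> f ` sep_closure F"
   then obtain x where x: "x \<in> sep_closure F" "y = f x" by (elim imageE) ((rule that; assumption)?)
   then obtain p where p: "p \<in> polys F" "rsquarefree p" "poly p x = 0" unfolding sep_closure_iff by (elim bexE conjE) ((rule that; assumption)?)
   have "x \<in> E" using x(1) FE by blast
   with p root have "poly p y = 0" unfolding x(2) by blast
   with p show "y \<in> sep_closure F" unfolding sep_closure_iff by blast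
  next
   fix y assume y: "y \<in> sep_closure F"
   then obtain p where p: "p \<in> polys F" "rsquarefree p" "poly p y = 0" unfolding sep_closure_iff by (elim bexE conjE) ((rule that; assumption)?)
   define Z where "Z = {x. poly p x = 0}"
   have ZS: "Z \<subseteq> sep_closure F" unfolding Z_def using p(1,2) by (auto simp: sep_closure_iff)
   have "p ~= 0" using p(2) by (auto simp: rsquarefree_def)
   then have fin: "finite Z" unfolding Z_def by (rule poly_roots_finite)
   have "f ` Z \<subseteq> Z"
   proof (rule image_subsetI)
    fix x assume x: "x \<in> Z"
    then have "x \<in> E" using ZS FE by blast
    with x show "f x \<in> Z" unfolding Z_def using root[OF p(1)] by simp
   qed
   then have "f ` Z = Z" using inj_on_subset[OF inj ZS] endo_inj_surj[OF fin] by blast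
   moreover have "y \<in> Z" using p(3) unfolding Z_def by simp
   ultimately have "y \<in> f ` Z" by simp
   then show "y \<in> f ` sep_closure F" using ZS by (rule rev_subsetD[OF _ image_mono])
  qed
  with inj show ?thesis unfolding bij_betw_def by simp
qed

lemma restrict_abs_Gal:
  fixes F :: "'a::alg_closed_field set"
  assumes E: "subf E" "rhom E f" and FE: "sep_closure F \<subseteq> E" and F: "acl F" and fxd: "\<forall>c\<in>F. f c = c"
  shows "restrict f (sep_closure F) \<in> abs_Gal F"
proof -
  have sF: "subf F" using F unfolding acl_def by simp
  note S = sep_closure_subf[OF F]
  have b: "bij_betw f (sep_closure F) (sep_closure F)" by (rule permutes_sep_closure[OF E FE sF fxd])
  have "restrict f (sep_closure F) \<in> Bij (sep_closure F)"
   unfolding Bij_def using b by (simp cong: bij_betw_cong)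
  moreover have "f (x + y) = f x + f y & f (x * y) = f x * f y" if "x \<in> sep_closure F" "y \<in> sep_closure F" for x y
   using that FE rhom_simps(3,4)[OF E] by blast
  moreover have "c \<in> sep_closure F" if "c \<in> F" for c using that sep_closure_incl[OF sF] by blast
  ultimately show ?thesis unfolding abs_Gal_def using fxd subf_closed(3,4)[OF S] by simp
qed

lemma abs_Gal_props:
  fixes F :: "'a::alg_closed_field set"
  assumes F: "acl F" and s: "\<sigma> \<in> abs_Gal F"
  shows "rhom (sep_closure F) \<sigma>" "!!x. x \<in> sep_closure F ==> \<sigma> x \<in> sep_closure F" "!!x. x \<in> F ==> \<sigma> x = x"
   "\<sigma> \<in> extensional (sep_closure F)"
proof -
  have F': "subf F" using F unfolding acl_def by simp
  have b: "bij_betw \<sigma> (sep_closure F) (sep_closure F)" and e: "\<sigma> \<in> extensional (sep_closure F)"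
   using s unfolding abs_Gal_def Bij_def by auto
  show "!!x. x \<in> F ==> \<sigma> x = x" using s unfolding abs_Gal_def by blast
  then show "rhom (sep_closure F) \<sigma>" using s subf_closed(1,2)[OF F'] unfolding rhom_def abs_Gal_def by blast
  show "!!x. x \<in> sep_closure F ==> \<sigma> x \<in> sep_closure F" using b bij_betwE by blast
  show "\<sigma> \<in> extensional (sep_closure F)" by (rule e)
qed

lemma compose_abs_Gal:
  fixes F :: "'a::alg_closed_field set"
  assumes F: "acl F" and s: "\<sigma> \<in> abs_Gal F" and t: "\<tau> \<in> abs_Gal F"
  shows "compose (sep_closure F) \<sigma> \<tau> \<in> abs_Gal F"
proof -
  have F': "subf F" using F unfolding acl_def by simp
  note S = sep_closure_subf[OF F] and ps = abs_Gal_props[OF F s] and pt = abs_Gal_props[OF F t]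
  have "compose (sep_closure F) \<sigma> \<tau> \<in> Bij (sep_closure F)"
   using s t unfolding abs_Gal_def by (intro compose_Bij) auto
  moreover have "c \<in> sep_closure F" if "c \<in> F" for c using that sep_closure_incl[OF F'] by blast
  ultimately show ?thesis unfolding abs_Gal_def
   using rhom_simps(3,4)[OF S ps(1)] rhom_simps(3,4)[OF S pt(1)] ps(2,3) pt(2,3) subf_closed(3,4)[OF S]
   by (simp add: compose_def)
qed

lemma fixed_abs_Gal:
  fixes F :: "'a::alg_closed_field set"
  assumes F: "acl F" and z: "z \<in> sep_closure F" "\<forall>\<sigma>\<in>abs_Gal F. \<sigma> z = z"
  shows "z \<in> F"
proof (rule fixed_sep_closure[OF F z(1)])
  fix \<sigma> assume "\<sigma> \<in> auts F"
  then have "restrict \<sigma> (sep_closure F) \<in> abs_Gal F"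
   unfolding auts_def using F by (intro restrict_abs_Gal[OF subf_UNIV]) auto
  then have "restrict \<sigma> (sep_closure F) z = z" using z(2) by blast
  then show "\<sigma> z = z" using z(1) by simp
qed

text \<open>
  If `\<sigma>0` changes the sign of `d`, then `z + \<sigma>0 z` and `(z - \<sigma>0 z) d` are
  fixed by the whole group.
\<close>
lemma fixed_quadratic:
  fixes F :: "'a::alg_closed_field set"
  assumes F: "acl F" and two: "(2::'a) ~= 0" and d: "d\<^sup>2 \<in> F"
   and z: "z \<in> sep_closure F" "\<forall>\<sigma>\<in>abs_Gal F. \<sigma> d = d --> \<sigma> z = z"
  shows "\<exists>p\<in>F. \<exists>q\<in>F. z = p + q * d"
proof (cases "\<forall>\<sigma>\<in>abs_Gal F. \<sigma> d = d")
  case True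
  then have "z \<in> F" using z by (intro fixed_abs_Gal[OF F]) auto
  moreover have "0 \<in> F" using F subf_closed(1) unfolding acl_def by blast
  ultimately show ?thesis by (intro bexI[of _ z] bexI[of _ 0]) auto
next
  case False
  then obtain \<sigma>0 where s0: "\<sigma>0 \<in> abs_Gal F" "\<sigma>0 d ~= d" by blast
  have F': "subf F" using F unfolding acl_def by simp
  note S = sep_closure_subf[OF F]
  have dS: "d \<in> sep_closure F" by (rule sqrt_sep_closure[OF F' two d])
  have pm: "\<sigma> d = d \<or> \<sigma> d = - d" if "\<sigma> \<in> abs_Gal F" for \<sigma>
  proof -
   note p = abs_Gal_props[OF F that]
   have "(\<sigma> d)\<^sup>2 = \<sigma> (d\<^sup>2)" using rhom_power[OF S p(1) dS] by simp
   also have "... = d\<^sup>2" using p(3) d by blast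
   finally show ?thesis by (simp add: power2_eq_iff)
  qed
  have neg: "\<sigma> (- d) = - \<sigma> d" if "\<sigma> \<in> abs_Gal F" for \<sigma> by (rule rhom_minus[OF S abs_Gal_props(1)[OF F that] dS])
  have comp: "\<sigma> (\<tau> z) = z" if "\<sigma> \<in> abs_Gal F" "\<tau> \<in> abs_Gal F" "\<sigma> (\<tau> d) = d" for \<sigma> \<tau>
   using z compose_abs_Gal[OF F that(1,2)] that(3) dS by (auto simp: compose_def)
  have d0: "d ~= 0" using s0 abs_Gal_props(3)[OF F s0(1), of 0] subf_closed(1)[OF F'] by blast
  have sd: "\<sigma>0 d = - d" using pm s0 by blast
  have s0z: "\<sigma>0 z \<in> sep_closure F" by (rule abs_Gal_props(2)[OF F s0(1) z(1)])
  have move: "\<sigma> z = \<sigma>0 z" if s: "\<sigma> \<in> abs_Gal F" "\<sigma> d = - d" for \<sigma>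
  proof (rule rhom_inj[OF S abs_Gal_props(1)[OF F s0(1)]])
   show "\<sigma>0 (\<sigma> z) = \<sigma>0 (\<sigma>0 z)"
    using comp[OF s0(1) s(1)] comp[OF s0(1) s0(1)] s sd neg[OF s0(1)] by simp
  qed (use abs_Gal_props(2)[OF F s(1) z(1)] s0z in auto)
  have act: "(\<sigma> d = d & \<sigma> z = z & \<sigma> (\<sigma>0 z) = \<sigma>0 z) \<or> (\<sigma> d = - d & \<sigma> z = \<sigma>0 z & \<sigma> (\<sigma>0 z) = z)"
   if s: "\<sigma> \<in> abs_Gal F" for \<sigma>
  proof (cases "\<sigma> d = d")
   case True
   have "compose (sep_closure F) \<sigma> \<sigma>0 z = \<sigma>0 z"
    using True dS neg[OF s] sd by (intro move compose_abs_Gal[OF F s s0(1)]) (simp add: compose_def)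
   then have "\<sigma> (\<sigma>0 z) = \<sigma>0 z" using z(1) by (simp add: compose_def)
   with True z(2) s show ?thesis by blast
  next
   case False
   then have m: "\<sigma> d = - d" using pm[OF s] by blast
   moreover have "\<sigma> (\<sigma>0 z) = z" using m sd neg[OF s] by (intro comp[OF s s0(1)]) simp
   ultimately show ?thesis using move[OF s] by blast
  qed
  have a: "z + \<sigma>0 z \<in> F"
  proof (rule fixed_abs_Gal[OF F])
   show "z + \<sigma>0 z \<in> sep_closure F" by (rule subf_closed(3)[OF S z(1) s0z])
   show "\<forall>\<sigma>\<in>abs_Gal F. \<sigma> (z + \<sigma>0 z) = z + \<sigma>0 z"
   proof
    fix \<sigma> assume s: "\<sigma> \<in> abs_Gal F"
    show "\<sigma> (z + \<sigma>0 z) = z + \<sigma>0 z"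
     using act[OF s] rhom_simps(3)[OF S abs_Gal_props(1)[OF F s] z(1) s0z] by auto
   qed
  qed
  have b: "(z - \<sigma>0 z) * d \<in> F"
  proof (rule fixed_abs_Gal[OF F])
   have zz: "z - \<sigma>0 z \<in> sep_closure F" by (rule subf_closed(7)[OF S z(1) s0z])
   then show "(z - \<sigma>0 z) * d \<in> sep_closure F" by (rule subf_closed(4)[OF S _ dS])
   show "\<forall>\<sigma>\<in>abs_Gal F. \<sigma> ((z - \<sigma>0 z) * d) = (z - \<sigma>0 z) * d"
   proof
    fix \<sigma> assume s: "\<sigma> \<in> abs_Gal F"
    have "\<sigma> ((z - \<sigma>0 z) * d) = (\<sigma> z - \<sigma> (\<sigma>0 z)) * \<sigma> d"
     using rhom_simps(4)[OF S abs_Gal_props(1)[OF F s] zz dS] rhom_diff[OF S abs_Gal_props(1)[OF F s] z(1) s0z] by simp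
    then show "\<sigma> ((z - \<sigma>0 z) * d) = (z - \<sigma>0 z) * d" using act[OF s] by (auto simp: algebra_simps)
   qed
  qed
  note c = subf_closed[OF F']
  have "(z + \<sigma>0 z) / 2 \<in> F" "(z - \<sigma>0 z) * d / (2 * d\<^sup>2) \<in> F"
   using a b d c(11)[of "num.Bit0 num.One"] by (auto intro!: c(8) c(4))
  moreover have "z = (z + \<sigma>0 z) / 2 + ((z - \<sigma>0 z) * d / (2 * d\<^sup>2)) * d"
  proof -
   have e1: "((z - \<sigma>0 z) * d / (2 * d\<^sup>2)) * d = (z - \<sigma>0 z) / 2" using d0 by (simp add: power2_eq_square)
   have e2: "(z + \<sigma>0 z) / 2 + (z - \<sigma>0 z) / 2 = (2 * z) / 2" by (simp add: add_divide_distrib[symmetric])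
   show ?thesis unfolding e1 e2 using two by simp
  qed
  ultimately show ?thesis by blast
qed

lemma finite_ext_base:
  assumes "subf (F :: 'a::field set)"
  shows "finite_ext F F" "ring.dim FF F F = 1"
proof -
  have F: "subfield F FF" using assms subfield_FF_iff by blast
  have d: "ring.dimension FF 1 F F" by (rule FF.dimension_one[OF F])
  show "finite_ext F F" unfolding finite_ext_def ring.finite_dimension_def[OF FF.ring_axioms] using F d by blast
  show "ring.dim FF F F = 1" using FF.dimI[OF F d] unfolding over_def .
qed

text \<open>
  A finite extension is spanned by finitely many elements, and conversely finitely many separable
  elements generate a finite separable extension. Finite sets of elements have the advantage that
  two of them are easily united.
\<close>
lemma krull_continuous_iff:
  fixes F :: "'a::alg_closed_field set"
  assumes F: "acl F"
  shows "krull_continuous F c \<longleftrightarrow> (\<forall>\<sigma>\<in>abs_Gal F. \<exists>xs. set xs \<subseteq> sep_closure F &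
    (\<forall>\<tau>\<in>abs_Gal F. (\<forall>x\<in>set xs. \<tau> x = \<sigma> x) --> c \<tau> = c \<sigma>))"
proof -
  have F': "subf F" using F unfolding acl_def by simp
  have FF: "subfield F FF" using F' subfield_FF_iff by blast
  note S = sep_closure_subf[OF F]
  have FS: "F \<subseteq> sep_closure F" by (rule sep_closure_incl[OF F'])
  have 1: "\<exists>M. finite_ext F M & M \<subseteq> sep_closure F & set xs \<subseteq> M" if xs: "set xs \<subseteq> sep_closure F" for xs
  proof -
   have alg: "!!x. x \<in> set xs ==> (ring.algebraic FF over F) x"
    unfolding algebraic_FF_iff[OF F'] using F unfolding acl_def by blast
   interpret D: domain "FF :: 'a ring" by (rule FF_domain)
   define M where "M = ring.finite_extension FF F xs"
   have "subfield M FF" unfolding M_def by (rule D.finite_extension_is_subfield[OF FF]) (use alg in auto)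
   moreover have "ring.finite_dimension FF F M" unfolding M_def by (rule D.finite_extension_finite_dimension(1)[OF FF _ alg]) auto
   moreover have "F \<subseteq> M" unfolding M_def by (rule FF.finite_extension_incl[OF subfieldE(3)[OF FF]]) auto
   moreover have "set xs \<subseteq> M" unfolding M_def by (rule D.finite_extension_mem[OF subfieldE(1)[OF FF]]) auto
   moreover have "M \<subseteq> sep_closure F" unfolding M_def
    by (rule FF.finite_extension_subring_incl[OF _ FS xs]) (use S subfield_FF_iff subfieldE(1) in blast)
   ultimately show ?thesis unfolding finite_ext_def using FF by blast
  qed
  have 2: "\<exists>xs. set xs \<subseteq> M & (\<forall>\<sigma>\<in>abs_Gal F. \<forall>\<tau>\<in>abs_Gal F. (\<forall>x\<in>set xs. \<tau> x = \<sigma> x) --> (\<forall>x\<in>M. \<tau> x = \<sigma> x))"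
   if M: "finite_ext F M" "M \<subseteq> sep_closure F" for M
  proof -
   have "ring.finite_dimension FF F M" using M(1) unfolding finite_ext_def by blast
   then obtain Us where Us: "set Us \<subseteq> M" "ring.Span FF F Us = M"
    using FF.exists_base[OF FF] unfolding ring.finite_dimension_def[OF FF.ring_axioms]
    using FF.Span_base_incl[OF FF] by (metis FF_simps(1) subset_UNIV)
   have "\<tau> x = \<sigma> x" if st: "\<sigma> \<in> abs_Gal F" "\<tau> \<in> abs_Gal F" "\<forall>x\<in>set Us. \<tau> x = \<sigma> x" and x: "x \<in> M" for \<sigma> \<tau> x
   proof -
    obtain k where k: "x = (\<Sum>i<length Us. k i * Us ! i)" "\<forall>i<length Us. k i \<in> F"
     using x unfolding Us(2)[symmetric] FF_Span[OF F'] by (elim CollectE exE conjE) ((rule that; assumption)?)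
    have U: "Us ! i \<in> set Us" "Us ! i \<in> sep_closure F" "k i \<in> sep_closure F" if "i < length Us" for i
     using that k(2) FS Us(1) M(2) nth_mem[OF that] by blast+
    have "\<rho> x = (\<Sum>i<length Us. k i * \<rho> (Us ! i))" if r: "\<rho> \<in> abs_Gal F" for \<rho>
    proof -
     note p = abs_Gal_props[OF F r]
     have "\<rho> x = (\<Sum>i<length Us. \<rho> (k i * Us ! i))" unfolding k(1)
      by (rule rhom_sum[OF S p(1)]) (use U in \<open>auto intro!: subf_closed(4)[OF S]\<close>)
     also have "... = (\<Sum>i<length Us. k i * \<rho> (Us ! i))"
      using U rhom_simps(4)[OF S p(1)] p(3) k(2) by (intro sum.cong refl) simp
     finally show ?thesis .
    qed
    then have e: "\<tau> x = (\<Sum>i<length Us. k i * \<tau> (Us ! i))" "\<sigma> x = (\<Sum>i<length Us. k i * \<sigma> (Us ! i))" using st(1,2) by auto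
    show ?thesis unfolding e
    proof (intro sum.cong refl)
     fix i assume "i \<in> {..<length Us}"
     then have "Us ! i \<in> set Us" by simp
     then show "k i * \<tau> (Us ! i) = k i * \<sigma> (Us ! i)" using st(3) by simp
    qed
   qed
   with Us(1) show ?thesis by blast
  qed
  show ?thesis unfolding krull_continuous_def
  proof (intro iffI ballI)
   fix \<sigma> assume s: "\<sigma> \<in> abs_Gal F"
   assume "\<forall>\<sigma>\<in>abs_Gal F. \<exists>M. finite_ext F M & M \<subseteq> sep_closure F & (\<forall>\<tau>\<in>abs_Gal F. (\<forall>x\<in>M. \<tau> x = \<sigma> x) --> c \<tau> = c \<sigma>)"
   then obtain M where M: "finite_ext F M" "M \<subseteq> sep_closure F" "\<forall>\<tau>\<in>abs_Gal F. (\<forall>x\<in>M. \<tau> x = \<sigma> x) --> c \<tau> = c \<sigma>" using s by blast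
   obtain xs where xs: "set xs \<subseteq> M" "\<forall>\<sigma>\<in>abs_Gal F. \<forall>\<tau>\<in>abs_Gal F. (\<forall>x\<in>set xs. \<tau> x = \<sigma> x) --> (\<forall>x\<in>M. \<tau> x = \<sigma> x)"
    using 2[OF M(1,2)] by blast
   have "c \<tau> = c \<sigma>" if "\<tau> \<in> abs_Gal F" "\<forall>x\<in>set xs. \<tau> x = \<sigma> x" for \<tau>
   proof -
    have "\<forall>x\<in>M. \<tau> x = \<sigma> x" using xs(2) s that by blast
    with M(3) that(1) show ?thesis by blast
   qed
   then show "\<exists>xs. set xs \<subseteq> sep_closure F & (\<forall>\<tau>\<in>abs_Gal F. (\<forall>x\<in>set xs. \<tau> x = \<sigma> x) --> c \<tau> = c \<sigma>)"
    using xs(1) M(2) by (intro exI[of _ xs]) auto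
  next
   fix \<sigma> assume s: "\<sigma> \<in> abs_Gal F"
   assume "\<forall>\<sigma>\<in>abs_Gal F. \<exists>xs. set xs \<subseteq> sep_closure F & (\<forall>\<tau>\<in>abs_Gal F. (\<forall>x\<in>set xs. \<tau> x = \<sigma> x) --> c \<tau> = c \<sigma>)"
   then obtain xs where xs: "set xs \<subseteq> sep_closure F" "\<forall>\<tau>\<in>abs_Gal F. (\<forall>x\<in>set xs. \<tau> x = \<sigma> x) --> c \<tau> = c \<sigma>" using s by blast
   obtain M where M: "finite_ext F M" "M \<subseteq> sep_closure F" "set xs \<subseteq> M" using 1[OF xs(1)] by blast
   have "c \<tau> = c \<sigma>" if t: "\<tau> \<in> abs_Gal F" "\<forall>x\<in>M. \<tau> x = \<sigma> x" for \<tau>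
   proof -
    have "\<forall>x\<in>set xs. \<tau> x = \<sigma> x" using t(2) M(3) by blast
    with xs(2) t(1) show ?thesis by blast
   qed
   then show "\<exists>M. finite_ext F M & M \<subseteq> sep_closure F & (\<forall>\<tau>\<in>abs_Gal F. (\<forall>x\<in>M. \<tau> x = \<sigma> x) --> c \<tau> = c \<sigma>)"
    using M(1,2) by (intro exI[of _ M]) blast
  qed
qed

section \<open>The cohomology class\<close>

lemma xo_eqI: "m div 4 = k div 4 ==> odd m = odd k ==> odd (m div 2) = odd (k div 2) ==> m = (k::nat)"
proof -
  assume a: "m div 4 = k div 4" and b: "odd m = odd k" "odd (m div 2) = odd (k div 2)"
  have "m div 2 div 2 = k div 2 div 2" using a by (simp add: div_mult2_eq[symmetric])
  moreover have "m div 2 mod 2 = k div 2 mod 2" using b(2) by (simp add: mod2_eq_if)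
  ultimately have "m div 2 = k div 2" by (metis mult_div_mod_eq)
  moreover have "m mod 2 = k mod 2" using b(1) by (simp add: mod2_eq_if)
  ultimately show "m = k" by (metis mult_div_mod_eq)
qed

lemma xo_xo: "xo (xo m c) c = m" "xo (xo m c) d = xo (xo m d) c"
  by (rule xo_eqI; auto simp: xo_props)+

lemma xo_even: "even m ==> xo m 1 = m + 1"
  by (rule xo_eqI) (auto simp: xo_props elim!: evenE)

lemma hm_xo_sign: "hm i (xo m c) = sg i c * sg (i div 2) (c div 2) * (hm i m :: 'a::field)"
  unfolding hm_def sg_def xo_props by auto

context biquad
begin

lemma adm_iff: "y \<in> adm \<longleftrightarrow> (\<forall>m<12. y m * y (xo m 1) = 1)"
proof
  assume y: "y \<in> adm"
  show "\<forall>m<12. y m * y (xo m 1) = 1"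
  proof (intro allI impI)
   fix m :: nat assume m: "m < 12"
   then have l: "y (2 * (m div 2)) * y (2 * (m div 2) + 1) = 1" using y unfolding adm_def by auto
   show "y m * y (xo m 1) = 1"
   proof (cases "even m")
    case True
    then have "2 * (m div 2) = m" by simp
    with l xo_even[OF True] show ?thesis by simp
   next
    case False
    then obtain k where k: "m = 2 * k + 1" by (elim oddE)
    then have "xo m 1 = 2 * k" using xo_even[of "2 * k"] xo_xo(1)[of "2 * k" 1] by simp
    with l k show ?thesis by (simp add: mult.commute)
   qed
  qed
next
  assume a: "\<forall>m<12. y m * y (xo m 1) = 1"
  have "y (2 * l) * y (2 * l + 1) = 1" if "l < 6" for l using a[rule_format, of "2 * l"] that xo_even[of "2 * l"] by simp
  then show "y \<in> adm" unfolding adm_def by blast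
qed

text \<open>
  The two bits record whether `\<sigma>` changes the signs of `s B` and `r B`.
\<close>
definition code :: "('a \<Rightarrow> 'a) \<Rightarrow> nat \<Rightarrow> nat" where
  "code \<sigma> B = (if \<sigma> (s B) = s B then 0 else 1) + (if \<sigma> (r B) = r B then 0 else 2)"

text \<open>
  The permutation of the conjugates by `\<sigma>`.
\<close>
definition tau :: "('a \<Rightarrow> 'a) \<Rightarrow> nat \<Rightarrow> nat" where
  "tau \<sigma> m = xo m (code \<sigma> (m div 4))"

lemma code_odd: "odd (code \<sigma> B) \<longleftrightarrow> \<sigma> (s B) ~= s B" "odd (code \<sigma> B div 2) \<longleftrightarrow> \<sigma> (r B) ~= r B"
  unfolding code_def by auto

lemma tau_props: "m < 12 ==> tau \<sigma> m < 12" "tau \<sigma> m div 4 = m div 4" "tau \<sigma> (tau \<sigma> m) = m"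
   "tau \<sigma> (xo m 1) = xo (tau \<sigma> m) 1" "odd (tau \<sigma> m div 2) \<longleftrightarrow> odd (m div 2) ~= (\<sigma> (r (m div 4)) ~= r (m div 4))"
   "odd (tau \<sigma> m) \<longleftrightarrow> odd m ~= (\<sigma> (s (m div 4)) ~= s (m div 4))"
  unfolding tau_def by (auto simp: xo_less xo_props code_odd xo_xo(1)) (rule xo_xo(2))

end

locale galois_biquad = biquad +
  assumes acl: "acl K"
begin

abbreviation "S \<equiv> sep_closure K"
abbreviation "G \<equiv> abs_Gal K"

lemma S: "subf S" by (rule sep_closure_subf[OF acl])
lemma KS: "K \<subseteq> S" by (rule sep_closure_incl[OF K])
lemma rsS: "B < 3 ==> r B \<in> S & s B \<in> S"
  using rs[of B] sqrt_sep_closure[OF K two] by blast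

lemma gal_sqrt:
  assumes "\<sigma> \<in> G" "d \<in> S" "d\<^sup>2 \<in> K"
  shows "\<sigma> d = (if \<sigma> d = d then d else - d)"
proof -
  note p = abs_Gal_props[OF acl assms(1)]
  have "(\<sigma> d)\<^sup>2 = d\<^sup>2" using rhom_power[OF S p(1) assms(2), of 2] p(3)[OF assms(3)] by simp
  then show ?thesis by (auto simp: power2_eq_iff)
qed

lemma gal_e:
  assumes s: "\<sigma> \<in> G" and i: "i < 12"
  shows "\<sigma> (e i) = sg i (code \<sigma> (i div 4)) * sg (i div 2) (code \<sigma> (i div 4) div 2) * e i" "e i \<in> S"
proof -
  note p = abs_Gal_props[OF acl s]
  define B where "B = i div 4"
  have B: "B < 3" using i unfolding B_def by simp
  have one: "1 \<in> S" "\<sigma> 1 = 1" using subf_closed(2)[OF S] rhom_simps(2)[OF S p(1)] by auto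
  have a: "(if odd i then s B else 1) \<in> S" "(if odd (i div 2) then r B else 1) \<in> S" using rsS[OF B] one by auto
  then show "e i \<in> S" unfolding e_def B_def[symmetric] by (rule subf_closed(4)[OF S])
  have "\<sigma> (e i) = \<sigma> (if odd i then s B else 1) * \<sigma> (if odd (i div 2) then r B else 1)"
   unfolding e_def B_def[symmetric] by (rule rhom_simps(4)[OF S p(1) a])
  moreover have "\<sigma> (if odd i then s B else 1) = sg i (code \<sigma> B) * (if odd i then s B else 1)"
   using gal_sqrt[OF s, of "s B"] rsS[OF B] rs[OF B] one unfolding sg_def code_odd by auto
  moreover have "\<sigma> (if odd (i div 2) then r B else 1) = sg (i div 2) (code \<sigma> B div 2) * (if odd (i div 2) then r B else 1)"
   using gal_sqrt[OF s, of "r B"] rsS[OF B] rs[OF B] one unfolding sg_def code_odd by auto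
  ultimately show "\<sigma> (e i) = sg i (code \<sigma> (i div 4)) * sg (i div 2) (code \<sigma> (i div 4) div 2) * e i"
   unfolding e_def B_def[symmetric] by (simp add: mult_ac)
qed

text \<open>
  Separable points of the product of the biquadratic algebras, invertible but of arbitrary norm.
  The class is the coboundary of such a point.
\<close>
definition nz :: "(nat \<Rightarrow> 'a) set" where
  "nz = {y. \<forall>m<12. y m \<in> S & y m ~= 0}"

text \<open>
  The Galois action on the points in terms of the eigenvalues.
\<close>
definition act :: "('a \<Rightarrow> 'a) \<Rightarrow> (nat \<Rightarrow> 'a) \<Rightarrow> nat \<Rightarrow> 'a" where
  "act \<sigma> y m = \<sigma> (y (tau \<sigma> m))"

lemma hmS: "hm i m \<in> S" "hm i m \<in> K"
proof -
  show "hm i m \<in> K" unfolding hm_def sg_def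
   by (simp add: subf_closed(1,2,4,5,8,11)[OF K])
  then show "hm i m \<in> S" using KS by blast
qed

text \<open>
  The sign changes of the basis `e` under `\<sigma>` are values of characters; multiplying the
  character table by them permutes its columns by `tau \<sigma>`.
\<close>
lemma map_tm:
  assumes s: "\<sigma> \<in> G" and y: "\<forall>m<12. y m \<in> S"
  shows "map_mat \<sigma> (tm y) = tm (act \<sigma> y)"
proof (rule eq_matI)
  fix i j assume "i < dim_row (tm (act \<sigma> y))" "j < dim_col (tm (act \<sigma> y))"
  then have ij: "i < 12" "j < 12" by simp_all
  note p = abs_Gal_props[OF acl s]
  note rh = rhom_simps[OF S p(1)]
  define eps where "eps i = (sg i (code \<sigma> (i div 4)) * sg (i div 2) (code \<sigma> (i div 4) div 2) :: 'a)" for i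
  have eps: "eps i * eps i = 1" "eps i ~= 0" "inverse (eps i) = eps i" for i unfolding eps_def sg_def by auto
  have ht: "hm k (tau \<sigma> m) = eps k * hm k m" for k m
  proof (cases "k div 4 = m div 4")
   case True then show ?thesis unfolding tau_def eps_def hm_xo_sign by simp
  next
   case False then show ?thesis unfolding hm_def tau_props(2) by simp
  qed
  have t: "hm i m * y m * hm m j \<in> S" if "m < 12" for m using y that hmS(1) by (intro subf_closed(4)[OF S]) auto
  then have tS: "(\<Sum>m<12. hm i m * y m * hm m j) \<in> S" by (intro subf_closed(12)[OF S]) auto
  have "map_mat \<sigma> (tm y) $$ (i, j) = \<sigma> ((\<Sum>m<12. hm i m * y m * hm m j) * e j / e i)"
   unfolding tm_def using ij by simp
  also have "... = \<sigma> (\<Sum>m<12. hm i m * y m * hm m j) * \<sigma> (e j) / \<sigma> (e i)"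
   using tS gal_e(2)[OF s] ij rh(4) rhom_divide[OF S p(1)] subf_closed(4)[OF S] by simp
  also have "\<sigma> (\<Sum>m<12. hm i m * y m * hm m j) = (\<Sum>m<12. \<sigma> (hm i m * y m * hm m j))"
   by (rule rhom_sum[OF S p(1)]) (use t in auto)
  also have "... = (\<Sum>m<12. hm i m * \<sigma> (y m) * hm m j)"
  proof (intro sum.cong refl)
   fix m :: nat assume "m \<in> {..<12}"
   then have ym: "y m \<in> S" using y by blast
   show "\<sigma> (hm i m * y m * hm m j) = hm i m * \<sigma> (y m) * hm m j"
    unfolding rh(4)[OF subf_closed(4)[OF S hmS(1) ym] hmS(1)] rh(4)[OF hmS(1) ym] p(3)[OF hmS(2)] ..
  qed
  also have "... * \<sigma> (e j) / \<sigma> (e i) = (\<Sum>m<12. (eps i * hm i m) * \<sigma> (y m) * (eps j * hm j m)) * e j / e i"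
   unfolding gal_e(1)[OF s ij(1)] gal_e(1)[OF s ij(2)] eps_def[symmetric] sum_distrib_right sum_divide_distrib
   using e_nz[OF ij(1)] eps(2)[of i] eps(3)[of i] eps(1)[of i]
   by (intro sum.cong refl) (simp add: hm_commute[of j] field_simps)
  also have "(\<Sum>m<12. (eps i * hm i m) * \<sigma> (y m) * (eps j * hm j m)) = (\<Sum>m<12. hm i (tau \<sigma> m) * \<sigma> (y m) * hm j (tau \<sigma> m))"
   unfolding ht ..
  also have "... = (\<Sum>m<12. hm i m * \<sigma> (y (tau \<sigma> m)) * hm j m)"
   by (rule sum.reindex_bij_witness[of _ "tau \<sigma>" "tau \<sigma>"]) (auto simp: tau_props)
  also have "... = (\<Sum>m<12. hm i m * act \<sigma> y m * hm m j)" unfolding act_def hm_commute[of j] ..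
  finally show "map_mat \<sigma> (tm y) $$ (i, j) = tm (act \<sigma> y) $$ (i, j)" unfolding tm_def using ij by simp
qed simp_all

lemma tmS: "\<forall>m<12. y m \<in> S ==> i < 12 ==> j < 12 ==> tm y $$ (i, j) \<in> S"
  using hmS(1) rsS unfolding tm_def
  by (auto simp: e_def intro!: subf_closed(4,8,12)[OF S] subf_closed(2)[OF S])

lemma chiS:
  assumes "\<forall>i<12. \<forall>j<12. A $$ (i, j) \<in> S" "m < 12"
  shows "chi m A \<in> S"
proof -
  have "4 * (m div 4) < 12" using assms(2) div_less_iff_less_mult[of 4 m 3] by simp
  then have "2 * hm m i * e i * A $$ (i, 4 * (m div 4)) \<in> S" if "i < 12" for i
   using assms(1) that hmS(1) rsS[of "i div 4"] subf_closed(2)[OF S] subf_closed(11)[OF S] unfolding e_def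
   by (intro subf_closed(4)[OF S]) auto
  then show ?thesis unfolding chi_def by (intro subf_closed(12)[OF S]) auto
qed

lemma points_iff: "A \<in> points TT S \<longleftrightarrow> (\<exists>y\<in>adm \<inter> nz. A = tm y)"
proof
  assume A: "A \<in> points TT S"
  then obtain y where y: "y \<in> adm" "A = tm y" unfolding points_def TT_def by auto
  have "\<forall>i<12. \<forall>j<12. A $$ (i, j) \<in> S" using A y(2) unfolding points_def by simp
  then have "y m \<in> S" if "m < 12" for m using chiS[of A m] that unfolding y(2) chi_tm[OF that] by blast
  then have "y \<in> nz" unfolding nz_def using adm_nz[OF y(1)] by blast
  with y show "\<exists>y\<in>adm \<inter> nz. A = tm y" by blast
next
  assume "\<exists>y\<in>adm \<inter> nz. A = tm y"
  then obtain y where "y \<in> adm" "y \<in> nz" "A = tm y" by blast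
  then show "A \<in> points TT S" unfolding points_def TT_def nz_def using tmS by auto
qed

lemma nz_closed: "y \<in> nz ==> y' \<in> nz ==> (\<lambda>m. y m * y' m) \<in> nz" "y \<in> nz ==> (\<lambda>m. inverse (y m)) \<in> nz" "(\<lambda>_. 1) \<in> nz"
  unfolding nz_def using subf_closed(2,4,6)[OF S] by auto

lemma act_nz: "\<sigma> \<in> G ==> y \<in> nz ==> act \<sigma> y \<in> nz"
proof -
  assume s: "\<sigma> \<in> G" and y: "y \<in> nz"
  note p = abs_Gal_props[OF acl s]
  have "act \<sigma> y m \<in> S & act \<sigma> y m ~= 0" if "m < 12" for m
  proof -
   have t: "y (tau \<sigma> m) \<in> S" "y (tau \<sigma> m) ~= 0" using y tau_props(1)[OF that] unfolding nz_def by auto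
   then show ?thesis unfolding act_def using p(2) rhom_eq_0_iff[OF S p(1)] by blast
  qed
  then show "act \<sigma> y \<in> nz" unfolding nz_def by blast
qed

lemma act_adm: "\<sigma> \<in> G ==> y \<in> adm ==> y \<in> nz ==> act \<sigma> y \<in> adm"
proof -
  assume s: "\<sigma> \<in> G" and y: "y \<in> adm" "y \<in> nz"
  note p = abs_Gal_props[OF acl s]
  have "act \<sigma> y m * act \<sigma> y (xo m 1) = 1" if m: "m < 12" for m
  proof -
   have "y (tau \<sigma> m) \<in> S" "y (xo (tau \<sigma> m) 1) \<in> S" using y(2) tau_props(1)[OF m] xo_less unfolding nz_def by auto
   then have "act \<sigma> y m * act \<sigma> y (xo m 1) = \<sigma> (y (tau \<sigma> m) * y (xo (tau \<sigma> m) 1))"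
    unfolding act_def tau_props(4) using rhom_simps(4)[OF S p(1)] by simp
   also have "... = \<sigma> 1" using y(1) tau_props(1)[OF m] unfolding adm_iff by simp
   finally show ?thesis using rhom_simps(2)[OF S p(1)] by simp
  qed
  then show "act \<sigma> y \<in> adm" unfolding adm_iff by blast
qed

lemma act_mult:
  assumes "\<sigma> \<in> G" "y \<in> nz" "y' \<in> nz" "m < 12"
  shows "act \<sigma> (\<lambda>m. y m * y' m) m = act \<sigma> y m * act \<sigma> y' m" "act \<sigma> (\<lambda>m. inverse (y m)) m = inverse (act \<sigma> y m)"
proof -
  note p = abs_Gal_props[OF acl assms(1)]
  have "y (tau \<sigma> m) \<in> S" "y' (tau \<sigma> m) \<in> S" using assms tau_props(1) unfolding nz_def by auto
  then show "act \<sigma> (\<lambda>m. y m * y' m) m = act \<sigma> y m * act \<sigma> y' m" "act \<sigma> (\<lambda>m. inverse (y m)) m = inverse (act \<sigma> y m)"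
   unfolding act_def using rhom_simps(4)[OF S p(1)] rhom_inverse[OF S p(1)] by auto
qed

lemma map_compose:
  assumes "\<sigma> \<in> G" "\<tau> \<in> G" "y \<in> nz"
  shows "map_mat (compose S \<sigma> \<tau>) (tm y) = map_mat \<sigma> (map_mat \<tau> (tm y))"
  using assms(3) tmS unfolding nz_def by (intro eq_matI) (auto simp: compose_def)

text \<open>
  The cocycle `y\<inverse> \<sigma>(y)`.
\<close>
definition cob :: "(nat \<Rightarrow> 'a) \<Rightarrow> ('a \<Rightarrow> 'a) \<Rightarrow> 'a mat" where
  "cob y = (\<lambda>\<sigma>\<in>G. tm (\<lambda>m. inverse (y m) * act \<sigma> y m))"

lemma Z1_iff:
  "c \<in> carrier (Z1 K 12 TT) \<longleftrightarrow> c \<in> extensional G & (\<forall>\<sigma>\<in>G. c \<sigma> \<in> points TT S) & krull_continuous K c &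
   (\<forall>\<sigma>\<in>G. \<forall>\<tau>\<in>G. c (compose S \<sigma> \<tau>) = c \<sigma> * map_mat \<sigma> (c \<tau>))"
  unfolding Z1_def by (auto simp: PiE_def)

lemma Z1_simps: "c \<otimes>\<^bsub>Z1 K 12 TT\<^esub> d = (\<lambda>\<sigma>\<in>G. c \<sigma> * d \<sigma>)" "\<one>\<^bsub>Z1 K 12 TT\<^esub> = (\<lambda>\<sigma>\<in>G. 1\<^sub>m 12)"
  unfolding Z1_def by simp_all

text \<open>
  It suffices that the norm of `y` is fixed by the Galois group: `y` itself need not lie on the
  torus.
\<close>
lemma cob_Z1:
  assumes y: "y \<in> nz" and P: "\<forall>\<sigma>\<in>G. (\<lambda>m. inverse (y m) * act \<sigma> y m) \<in> adm"
  shows "cob y \<in> carrier (Z1 K 12 TT)"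
  unfolding Z1_iff
proof (intro conjI ballI)
  show "cob y \<in> extensional G" unfolding cob_def by simp
  show "cob y \<sigma> \<in> points TT S" if "\<sigma> \<in> G" for \<sigma>
   using that P nz_closed(1)[OF nz_closed(2)[OF y] act_nz[OF that y]] unfolding cob_def points_iff by auto
  show "krull_continuous K (cob y)"
   unfolding krull_continuous_iff[OF acl]
  proof
   fix \<sigma> assume s: "\<sigma> \<in> G"
   define xs where "xs = map y [0..<12] @ map r [0..<3] @ map s [0..<3]"
   have xs: "set xs \<subseteq> S" unfolding xs_def using y rsS unfolding nz_def by auto
   have "cob y \<tau> = cob y \<sigma>" if t: "\<tau> \<in> G" "\<forall>x\<in>set xs. \<tau> x = \<sigma> x" for \<tau>
   proof -
    have yy: "!!m. m < 12 ==> \<tau> (y m) = \<sigma> (y m)" and "!!B. B < 3 ==> \<tau> (r B) = \<sigma> (r B) & \<tau> (s B) = \<sigma> (s B)"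
     using t(2) unfolding xs_def by auto
    then have "tau \<tau> m = tau \<sigma> m" if "m < 12" for m using that unfolding tau_def code_def by simp
    then show ?thesis using s t(1) yy tau_props(1) unfolding cob_def by (auto intro!: tm_cong simp: act_def)
   qed
   with xs show "\<exists>xs. set xs \<subseteq> S & (\<forall>\<tau>\<in>G. (\<forall>x\<in>set xs. \<tau> x = \<sigma> x) --> cob y \<tau> = cob y \<sigma>)" by blast
  qed
  fix \<sigma> \<tau> assume st: "\<sigma> \<in> G" "\<tau> \<in> G"
  have c: "compose S \<sigma> \<tau> \<in> G" by (rule compose_abs_Gal[OF acl st])
  have yS: "\<forall>m<12. y m \<in> S" "\<forall>m<12. act \<tau> y m \<in> S" using y act_nz[OF st(2) y] unfolding nz_def by auto
  have "tm (act (compose S \<sigma> \<tau>) y) = tm (act \<sigma> (act \<tau> y))"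
   using map_compose[OF st y] unfolding map_tm[OF c yS(1)] map_tm[OF st(2) yS(1)] map_tm[OF st(1) yS(2)] .
  then have a: "act (compose S \<sigma> \<tau>) y m = act \<sigma> (act \<tau> y) m" if "m < 12" for m using that unfolding tm_eq_iff by blast
  have n: "(\<lambda>m. inverse (y m)) \<in> nz" "act \<tau> y \<in> nz" "act \<sigma> y \<in> nz" using nz_closed(2)[OF y] act_nz st y by auto
  have cS: "\<forall>m<12. inverse (y m) * act \<tau> y m \<in> S" using nz_closed(1)[OF n(1,2)] unfolding nz_def by blast
  have "cob y \<sigma> * map_mat \<sigma> (cob y \<tau>) = tm (\<lambda>m. (inverse (y m) * act \<sigma> y m) * act \<sigma> (\<lambda>m. inverse (y m) * act \<tau> y m) m)"
   unfolding cob_def using st by (simp add: map_tm[OF st(1) cS] tm_mult)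
  also have "... = tm (\<lambda>m. inverse (y m) * act (compose S \<sigma> \<tau>) y m)"
  proof (rule tm_cong)
   fix m :: nat assume m: "m < 12"
   have "act \<sigma> y m ~= 0" using n(3) m unfolding nz_def by blast
   then show "(inverse (y m) * act \<sigma> y m) * act \<sigma> (\<lambda>m. inverse (y m) * act \<tau> y m) m = inverse (y m) * act (compose S \<sigma> \<tau>) y m"
    unfolding act_mult(1)[OF st(1) n(1,2) m] act_mult(2)[OF st(1) y y m] a[OF m] by simp
  qed
  finally show "cob y (compose S \<sigma> \<tau>) = cob y \<sigma> * map_mat \<sigma> (cob y \<tau>)" unfolding cob_def using c by simp
qed

lemma cob_mult: "y \<in> nz ==> y' \<in> nz ==> cob y \<otimes>\<^bsub>Z1 K 12 TT\<^esub> cob y' = cob (\<lambda>m. y m * y' m)"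
  unfolding Z1_simps cob_def
  by (intro restrict_ext) (auto simp: tm_mult act_mult(1) intro!: tm_cong)

lemma cob_one: "(!!\<sigma> m. \<sigma> \<in> G ==> m < 12 ==> act \<sigma> y m = y m) ==> y \<in> nz ==> cob y = \<one>\<^bsub>Z1 K 12 TT\<^esub>"
  unfolding Z1_simps cob_def tm_one[symmetric] nz_def by (intro restrict_ext tm_cong) auto

lemma act_one: "\<sigma> \<in> G ==> act \<sigma> (\<lambda>_. 1) m = 1"
  unfolding act_def using rhom_simps(2)[OF S abs_Gal_props(1)[OF acl]] by blast

lemma B1_eq: "B1 K 12 TT = cob ` (adm \<inter> nz)"
proof -
  have 1: "(\<lambda>\<sigma>\<in>G. inv\<^bsub>GL 12\<^esub> (tm y) * map_mat \<sigma> (tm y)) = cob y" if "y \<in> nz" for y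
   unfolding cob_def
  proof (rule restrict_ext)
   fix \<sigma> assume s: "\<sigma> \<in> G"
   have y: "\<forall>m<12. y m \<in> S" "!!m. m < 12 ==> y m ~= 0" using that unfolding nz_def by auto
   have i: "inv\<^bsub>GL 12\<^esub> (tm y) = tm (\<lambda>m. inverse (y m))" by (rule tm_inv) (rule y(2))
   show "inv\<^bsub>GL 12\<^esub> (tm y) * map_mat \<sigma> (tm y) = tm (\<lambda>m. inverse (y m) * act \<sigma> y m)"
    unfolding map_tm[OF s y(1)] i tm_mult ..
  qed
  show ?thesis unfolding B1_def
  proof (intro equalityI subsetI)
   fix c assume "c \<in> {(\<lambda>\<sigma>\<in>G. inv\<^bsub>GL 12\<^esub> a * map_mat \<sigma> a) | a. a \<in> points TT S}"
   then obtain a where a: "c = (\<lambda>\<sigma>\<in>G. inv\<^bsub>GL 12\<^esub> a * map_mat \<sigma> a)" "a \<in> points TT S" by (elim CollectE exE conjE) ((rule that; assumption)?)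
   obtain y where y: "y \<in> adm \<inter> nz" "a = tm y" using a(2) unfolding points_iff by (elim bexE) ((rule that; assumption)?)
   have "c = cob y" unfolding a(1) y(2) using 1 y(1) by blast
   then show "c \<in> cob ` (adm \<inter> nz)" using y(1) by (rule image_eqI)
  next
   fix c assume "c \<in> cob ` (adm \<inter> nz)"
   then obtain y where y: "c = cob y" "y \<in> adm \<inter> nz" by (elim imageE) ((rule that; assumption)?)
   have "tm y \<in> points TT S" unfolding points_iff using y(2) by blast
   moreover have "c = (\<lambda>\<sigma>\<in>G. inv\<^bsub>GL 12\<^esub> (tm y) * map_mat \<sigma> (tm y))" unfolding y(1) using 1 y(2) by simp
   ultimately show "c \<in> {(\<lambda>\<sigma>\<in>G. inv\<^bsub>GL 12\<^esub> a * map_mat \<sigma> a) | a. a \<in> points TT S}" by (intro CollectI exI[of _ "tm y"] conjI)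
  qed
qed

lemma Z1_comm_group: "comm_group (Z1 K 12 TT)"
proof (rule comm_groupI)
  let ?Z = "Z1 K 12 TT"
  have val: "\<exists>y\<in>adm \<inter> nz. c \<sigma> = tm y" if "c \<in> carrier ?Z" "\<sigma> \<in> G" for c \<sigma>
   using that unfolding Z1_iff points_iff by blast
  have cc: "c (compose S \<sigma> \<tau>) = c \<sigma> * map_mat \<sigma> (c \<tau>)" if "c \<in> carrier ?Z" "\<sigma> \<in> G" "\<tau> \<in> G" for c \<sigma> \<tau>
   using that unfolding Z1_iff by blast
  have kr: "\<exists>xs. set xs \<subseteq> S & (\<forall>\<tau>\<in>G. (\<forall>x\<in>set xs. \<tau> x = \<sigma> x) --> c \<tau> = c \<sigma>)" if "c \<in> carrier ?Z" "\<sigma> \<in> G" for c \<sigma>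
   using that unfolding Z1_iff krull_continuous_iff[OF acl] by blast
  note comp = compose_abs_Gal[OF acl]
  show "c \<otimes>\<^bsub>?Z\<^esub> d \<in> carrier ?Z" if c: "c \<in> carrier ?Z" and d: "d \<in> carrier ?Z" for c d
   unfolding Z1_iff Z1_simps
  proof (intro conjI ballI)
   fix \<sigma> assume s: "\<sigma> \<in> G"
   obtain y y' where y: "y \<in> adm \<inter> nz" "c \<sigma> = tm y" "y' \<in> adm \<inter> nz" "d \<sigma> = tm y'" using val[OF c s] val[OF d s] by blast
   have "(\<lambda>m. y m * y' m) \<in> adm \<inter> nz" using y(1,3) adm_closed(1) nz_closed(1) by auto
   with s y(2,4) show "(\<lambda>\<sigma>\<in>G. c \<sigma> * d \<sigma>) \<sigma> \<in> points TT S" unfolding points_iff by (auto simp: tm_mult)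
   fix \<tau> assume t: "\<tau> \<in> G"
   obtain w w' where w: "w \<in> adm \<inter> nz" "c \<tau> = tm w" "w' \<in> adm \<inter> nz" "d \<tau> = tm w'" using val[OF c t] val[OF d t] by blast
   have n: "w \<in> nz" "w' \<in> nz" using w by auto
   have wS: "\<forall>m<12. w m \<in> S" "\<forall>m<12. w' m \<in> S" "\<forall>m<12. w m * w' m \<in> S"
    using n nz_closed(1)[OF n] unfolding nz_def by auto
   have "c \<sigma> * map_mat \<sigma> (c \<tau>) * (d \<sigma> * map_mat \<sigma> (d \<tau>)) = c \<sigma> * d \<sigma> * map_mat \<sigma> (c \<tau> * d \<tau>)"
    unfolding y(2,4) w(2,4) tm_mult map_tm[OF s wS(1)] map_tm[OF s wS(2)] map_tm[OF s wS(3)]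
    by (rule tm_cong) (simp only: act_mult(1)[OF s n], simp only: mult_ac)
   then show "(\<lambda>\<sigma>\<in>G. c \<sigma> * d \<sigma>) (compose S \<sigma> \<tau>) = (\<lambda>\<sigma>\<in>G. c \<sigma> * d \<sigma>) \<sigma> * map_mat \<sigma> ((\<lambda>\<sigma>\<in>G. c \<sigma> * d \<sigma>) \<tau>)"
    using s t comp[OF s t] cc[OF c s t] cc[OF d s t] by simp
  next
   show "krull_continuous K (\<lambda>\<sigma>\<in>G. c \<sigma> * d \<sigma>)" unfolding krull_continuous_iff[OF acl]
   proof
    fix \<sigma> assume s: "\<sigma> \<in> G"
    obtain xs where xs: "set xs \<subseteq> S" "\<forall>\<tau>\<in>G. (\<forall>x\<in>set xs. \<tau> x = \<sigma> x) --> c \<tau> = c \<sigma>" using kr[OF c s] by blast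
    obtain ys where ys: "set ys \<subseteq> S" "\<forall>\<tau>\<in>G. (\<forall>x\<in>set ys. \<tau> x = \<sigma> x) --> d \<tau> = d \<sigma>" using kr[OF d s] by blast
    show "\<exists>xs. set xs \<subseteq> S & (\<forall>\<tau>\<in>G. (\<forall>x\<in>set xs. \<tau> x = \<sigma> x) --> (\<lambda>\<sigma>\<in>G. c \<sigma> * d \<sigma>) \<tau> = (\<lambda>\<sigma>\<in>G. c \<sigma> * d \<sigma>) \<sigma>)"
    proof (intro exI[of _ "xs @ ys"] conjI ballI impI)
     show "set (xs @ ys) \<subseteq> S" using xs(1) ys(1) by simp
     fix \<tau> assume t: "\<tau> \<in> G" "\<forall>x\<in>set (xs @ ys). \<tau> x = \<sigma> x"
     have "c \<tau> = c \<sigma>" using xs(2)[rule_format, OF t(1)] t(2) by simp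
     moreover have "d \<tau> = d \<sigma>" using ys(2)[rule_format, OF t(1)] t(2) by simp
     ultimately show "(\<lambda>\<sigma>\<in>G. c \<sigma> * d \<sigma>) \<tau> = (\<lambda>\<sigma>\<in>G. c \<sigma> * d \<sigma>) \<sigma>" using s t(1) by simp
    qed
   qed
  qed simp
  show "\<one>\<^bsub>?Z\<^esub> \<in> carrier ?Z"
  proof -
   have "cob (\<lambda>_. 1) = \<one>\<^bsub>?Z\<^esub>" by (rule cob_one[OF act_one nz_closed(3)])
   moreover have "cob (\<lambda>_. 1) \<in> carrier ?Z"
    by (rule cob_Z1[OF nz_closed(3)]) (simp add: act_one adm_closed(3))
   ultimately show ?thesis by simp
  qed
  fix c assume c: "c \<in> carrier ?Z"
  then have ce: "c \<in> extensional G" unfolding Z1_iff by blast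
  show "\<one>\<^bsub>?Z\<^esub> \<otimes>\<^bsub>?Z\<^esub> c = c" unfolding Z1_simps
  proof (rule extensionalityI[OF _ ce])
   fix \<sigma> assume s: "\<sigma> \<in> G"
   obtain y where y: "c \<sigma> = tm y" using val[OF c s] by blast
   have "1\<^sub>m 12 * c \<sigma> = c \<sigma>" unfolding y by (rule left_mult_one_mat[OF tm_carrier(1)])
   then show "(\<lambda>\<sigma>\<in>G. (\<lambda>\<sigma>\<in>G. 1\<^sub>m 12) \<sigma> * c \<sigma>) \<sigma> = c \<sigma>" using s by simp
  qed simp
  show "\<exists>d\<in>carrier ?Z. d \<otimes>\<^bsub>?Z\<^esub> c = \<one>\<^bsub>?Z\<^esub>"
  proof (intro bexI[of _ "\<lambda>\<sigma>\<in>G. tm (\<lambda>m. inverse (chi m (c \<sigma>)))"])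
   have ch: "(\<lambda>m. chi m (c \<sigma>)) \<in> nz" "(\<lambda>m. chi m (c \<sigma>)) \<in> adm" "c \<sigma> = tm (\<lambda>m. chi m (c \<sigma>))" if s: "\<sigma> \<in> G" for \<sigma>
   proof -
    obtain y where y: "y \<in> adm" "y \<in> nz" "c \<sigma> = tm y" using val[OF c s] by blast
    have e: "!!m. m < 12 ==> chi m (c \<sigma>) = y m" unfolding y(3) by (rule chi_tm)
    show "(\<lambda>m. chi m (c \<sigma>)) \<in> nz" using y(2) e unfolding nz_def by simp
    show "(\<lambda>m. chi m (c \<sigma>)) \<in> adm" using y(1) e xo_less unfolding adm_iff by simp
    show "c \<sigma> = tm (\<lambda>m. chi m (c \<sigma>))" unfolding y(3) by (rule tm_cong) (simp add: chi_tm)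
   qed
   show "(\<lambda>\<sigma>\<in>G. tm (\<lambda>m. inverse (chi m (c \<sigma>)))) \<otimes>\<^bsub>?Z\<^esub> c = \<one>\<^bsub>?Z\<^esub>" unfolding Z1_simps
   proof (rule restrict_ext)
    fix \<sigma> assume s: "\<sigma> \<in> G"
    have "tm (\<lambda>m. inverse (chi m (c \<sigma>))) * tm (\<lambda>m. chi m (c \<sigma>)) = 1\<^sub>m 12"
     unfolding tm_mult tm_one[symmetric] using ch(1)[OF s] unfolding nz_def by (intro tm_cong) auto
    then show "(\<lambda>\<sigma>\<in>G. tm (\<lambda>m. inverse (chi m (c \<sigma>)))) \<sigma> * c \<sigma> = 1\<^sub>m 12" using s ch(3)[OF s] by simp
   qed
   show "(\<lambda>\<sigma>\<in>G. tm (\<lambda>m. inverse (chi m (c \<sigma>)))) \<in> carrier ?Z" unfolding Z1_iff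
   proof (intro conjI ballI)
    fix \<sigma> assume s: "\<sigma> \<in> G"
    show "(\<lambda>\<sigma>\<in>G. tm (\<lambda>m. inverse (chi m (c \<sigma>)))) \<sigma> \<in> points TT S"
     using s adm_closed(2)[OF ch(2)[OF s]] nz_closed(2)[OF ch(1)[OF s]] unfolding points_iff by auto
    fix \<tau> assume t: "\<tau> \<in> G"
    have nS: "\<forall>m<12. chi m (c \<tau>) \<in> S" "\<forall>m<12. inverse (chi m (c \<tau>)) \<in> S"
     using ch(1)[OF t] nz_closed(2)[OF ch(1)[OF t]] unfolding nz_def by auto
    have "tm (\<lambda>m. chi m (c (compose S \<sigma> \<tau>))) = tm (\<lambda>m. chi m (c \<sigma>) * act \<sigma> (\<lambda>m. chi m (c \<tau>)) m)"
     using cc[OF c s t] ch(3)[OF s] ch(3)[OF t] ch(3)[OF comp[OF s t]] map_tm[OF s nS(1)] tm_mult by metis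
    then have "!!m. m < 12 ==> chi m (c (compose S \<sigma> \<tau>)) = chi m (c \<sigma>) * act \<sigma> (\<lambda>m. chi m (c \<tau>)) m" unfolding tm_eq_iff by blast
    then have "tm (\<lambda>m. inverse (chi m (c (compose S \<sigma> \<tau>)))) = tm (\<lambda>m. inverse (chi m (c \<sigma>))) * map_mat \<sigma> (tm (\<lambda>m. inverse (chi m (c \<tau>))))"
     unfolding map_tm[OF s nS(2)] tm_mult by (intro tm_cong) (simp add: act_mult(2)[OF s ch(1)[OF t] ch(1)[OF t]])
    then show "(\<lambda>\<sigma>\<in>G. tm (\<lambda>m. inverse (chi m (c \<sigma>)))) (compose S \<sigma> \<tau>)
      = (\<lambda>\<sigma>\<in>G. tm (\<lambda>m. inverse (chi m (c \<sigma>)))) \<sigma> * map_mat \<sigma> ((\<lambda>\<sigma>\<in>G. tm (\<lambda>m. inverse (chi m (c \<sigma>)))) \<tau>)"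
     using s t comp[OF s t] by simp
   next
    show "krull_continuous K (\<lambda>\<sigma>\<in>G. tm (\<lambda>m. inverse (chi m (c \<sigma>))))" unfolding krull_continuous_iff[OF acl]
    proof
     fix \<sigma> assume s: "\<sigma> \<in> G"
     obtain xs where xs: "set xs \<subseteq> S" "\<forall>\<tau>\<in>G. (\<forall>x\<in>set xs. \<tau> x = \<sigma> x) --> c \<tau> = c \<sigma>" using kr[OF c s] by blast
     show "\<exists>xs. set xs \<subseteq> S & (\<forall>\<tau>\<in>G. (\<forall>x\<in>set xs. \<tau> x = \<sigma> x) -->
       (\<lambda>\<sigma>\<in>G. tm (\<lambda>m. inverse (chi m (c \<sigma>)))) \<tau> = (\<lambda>\<sigma>\<in>G. tm (\<lambda>m. inverse (chi m (c \<sigma>)))) \<sigma>)"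
     proof (intro exI[of _ xs] conjI ballI impI)
      show "set xs \<subseteq> S" by (rule xs(1))
      fix \<tau> assume t: "\<tau> \<in> G" "\<forall>x\<in>set xs. \<tau> x = \<sigma> x"
      have "c \<tau> = c \<sigma>" using xs(2)[rule_format, OF t(1)] t(2) by simp
      then show "(\<lambda>\<sigma>\<in>G. tm (\<lambda>m. inverse (chi m (c \<sigma>)))) \<tau> = (\<lambda>\<sigma>\<in>G. tm (\<lambda>m. inverse (chi m (c \<sigma>)))) \<sigma>"
       using s t(1) by simp
     qed
    qed
   qed simp
  qed
  fix d assume d: "d \<in> carrier ?Z"
  show "c \<otimes>\<^bsub>?Z\<^esub> d = d \<otimes>\<^bsub>?Z\<^esub> c" unfolding Z1_simps
  proof (rule restrict_ext)
   fix \<sigma> assume s: "\<sigma> \<in> G"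
   obtain y y' where y: "c \<sigma> = tm y" "d \<sigma> = tm y'" using val[OF c s] val[OF d s] by blast
   show "c \<sigma> * d \<sigma> = d \<sigma> * c \<sigma>" unfolding y tm_mult by (simp add: mult.commute)
  qed
  fix f assume f: "f \<in> carrier ?Z"
  show "c \<otimes>\<^bsub>?Z\<^esub> d \<otimes>\<^bsub>?Z\<^esub> f = c \<otimes>\<^bsub>?Z\<^esub> (d \<otimes>\<^bsub>?Z\<^esub> f)" unfolding Z1_simps
  proof (rule restrict_ext)
   fix \<sigma> assume s: "\<sigma> \<in> G"
   obtain y y' y'' where y: "c \<sigma> = tm y" "d \<sigma> = tm y'" "f \<sigma> = tm y''" using val[OF c s] val[OF d s] val[OF f s] by blast
   show "(\<lambda>\<sigma>\<in>G. c \<sigma> * d \<sigma>) \<sigma> * f \<sigma> = c \<sigma> * (\<lambda>\<sigma>\<in>G. d \<sigma> * f \<sigma>) \<sigma>" using s unfolding y by (simp add: y tm_mult mult.assoc)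
  qed
qed

lemma adm_quot: "\<sigma> \<in> G ==> y \<in> adm ==> y \<in> nz ==> (\<lambda>m. inverse (y m) * act \<sigma> y m) \<in> adm"
  using adm_closed(1)[OF adm_closed(2) act_adm] by blast

lemma B1_subgroup: "subgroup (B1 K 12 TT) (Z1 K 12 TT)"
proof -
  interpret Z: comm_group "Z1 K 12 TT" by (rule Z1_comm_group)
  have sub: "B1 K 12 TT \<subseteq> carrier (Z1 K 12 TT)" unfolding B1_eq using cob_Z1 adm_quot by blast
  have inB: "cob y \<in> B1 K 12 TT" if "y \<in> adm" "y \<in> nz" for y unfolding B1_eq using that by blast
  show ?thesis
  proof (rule Z.subgroupI[OF sub])
   show "B1 K 12 TT ~= {}" using inB[OF adm_closed(3) nz_closed(3)] by blast
   fix c assume c: "c \<in> B1 K 12 TT"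
   then obtain y where y: "c = cob y" "y \<in> adm" "y \<in> nz" unfolding B1_eq by blast
   have iy: "(\<lambda>m. inverse (y m)) \<in> adm" "(\<lambda>m. inverse (y m)) \<in> nz" using adm_closed(2) nz_closed(2) y by auto
   have n1: "(\<lambda>m. inverse (y m) * y m) \<in> nz" by (rule nz_closed(1)[OF iy(2) y(3)])
   have one: "inverse (y m) * y m = 1" if "m < 12" for m using that y(3) unfolding nz_def by simp
   have "cob (\<lambda>m. inverse (y m)) \<otimes>\<^bsub>Z1 K 12 TT\<^esub> c = cob (\<lambda>m. inverse (y m) * y m)"
    unfolding y(1) by (rule cob_mult[OF iy(2) y(3)])
   also have "... = \<one>\<^bsub>Z1 K 12 TT\<^esub>"
   proof (rule cob_one[OF _ n1])
    fix \<sigma> m assume s: "\<sigma> \<in> G" and m: "m < (12::nat)"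
    show "act \<sigma> (\<lambda>m. inverse (y m) * y m) m = inverse (y m) * y m"
     using act_one[OF s, of m] one[OF m] one[OF tau_props(1)[OF m, of \<sigma>]] unfolding act_def by simp
   qed
   finally have "inv\<^bsub>Z1 K 12 TT\<^esub> c = cob (\<lambda>m. inverse (y m))"
    using sub inB[OF iy] c by (intro Z.inv_equality) auto
   then show "inv\<^bsub>Z1 K 12 TT\<^esub> c \<in> B1 K 12 TT" using inB[OF iy] by simp
   fix d assume "d \<in> B1 K 12 TT"
   then obtain y' where y': "d = cob y'" "y' \<in> adm" "y' \<in> nz" unfolding B1_eq by blast
   show "c \<otimes>\<^bsub>Z1 K 12 TT\<^esub> d \<in> B1 K 12 TT"
    unfolding y(1) y'(1) cob_mult[OF y(3) y'(3)] by (rule inB[OF adm_closed(1)[OF y(2) y'(2)] nz_closed(1)[OF y(3) y'(3)]])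
  qed
qed

lemma B1_normal: "B1 K 12 TT \<lhd> Z1 K 12 TT"
proof -
  interpret Z: comm_group "Z1 K 12 TT" by (rule Z1_comm_group)
  show ?thesis using Z.normal_iff_subgroup B1_subgroup by blast
qed

text \<open>
  The element `r` of each block, `zr`, has conjugates `r, r, -r, -r`. An element of norm `r` is
  `zz`, with conjugates `r, 1, -r, 1`, and `ww` is the element `zz^2 / zr` of norm 1.
\<close>
definition zr :: "nat \<Rightarrow> 'a" where "zr m = (if odd (m div 2) then - r (m div 4) else r (m div 4))"
definition zz :: "nat \<Rightarrow> 'a" where "zz m = (if odd m then 1 else zr m)"
definition ww :: "nat \<Rightarrow> 'a" where "ww m = (if odd m then inverse (zr m) else zr m)"

lemma zr_nz: "zr \<in> nz"
proof -
  have "r (m div 4) \<in> S & r (m div 4) ~= 0" if "m < 12" for m using rsS[of "m div 4"] rs[of "m div 4"] that by simp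
  then show ?thesis unfolding nz_def zr_def using subf_closed(5)[OF S] by auto
qed

lemma zz_nz: "zz \<in> nz" and ww_nz: "ww \<in> nz"
  using zr_nz subf_closed(2,6)[OF S] unfolding nz_def zz_def ww_def by auto

lemma zr_xo: "zr (xo m 1) = zr m"
  unfolding zr_def xo_props by simp

lemma zz_xo: "zz m * zz (xo m 1) = zr m"
  unfolding zz_def zr_xo xo_props by auto

lemma ww_adm: "ww \<in> adm"
  using zr_nz unfolding adm_iff ww_def zr_xo xo_props nz_def by auto

lemma zr_act:
  assumes s: "\<sigma> \<in> G" and m: "m < 12"
  shows "act \<sigma> zr m = zr m"
proof -
  define B where "B = m div 4"
  have B: "B < 3" using m unfolding B_def by simp
  note p = abs_Gal_props[OF acl s]
  have "\<sigma> (r B) = (if \<sigma> (r B) = r B then r B else - r B)" using gal_sqrt[OF s] rsS[OF B] rs[OF B] by blast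
  moreover have "\<sigma> (- r B) = - \<sigma> (r B)" using rhom_minus[OF S p(1)] rsS[OF B] by blast
  ultimately show ?thesis unfolding act_def zr_def tau_props B_def[symmetric] by (auto split: if_splits)
qed

lemma zz_cocycle: "cob zz \<in> carrier (Z1 K 12 TT)"
proof (rule cob_Z1[OF zz_nz], intro ballI)
  fix \<sigma> assume s: "\<sigma> \<in> G"
  show "(\<lambda>m. inverse (zz m) * act \<sigma> zz m) \<in> adm" unfolding adm_iff
  proof (intro allI impI)
   fix m :: nat assume m: "m < 12"
   note p = abs_Gal_props[OF acl s]
   have t: "tau \<sigma> m < 12" by (rule tau_props(1)[OF m])
   have zS: "zz (tau \<sigma> m) \<in> S" "zz (xo (tau \<sigma> m) 1) \<in> S" using zz_nz t xo_less[OF t] unfolding nz_def by auto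
   have "inverse (zz m) * act \<sigma> zz m * (inverse (zz (xo m 1)) * act \<sigma> zz (xo m 1))
     = inverse (zz m * zz (xo m 1)) * (\<sigma> (zz (tau \<sigma> m)) * \<sigma> (zz (xo (tau \<sigma> m) 1)))"
    unfolding act_def tau_props(4) by (simp add: mult_ac)
   also have "... = inverse (zr m) * act \<sigma> zr m"
    unfolding rhom_simps(4)[OF S p(1) zS, symmetric] zz_xo act_def ..
   also have "... = 1" unfolding zr_act[OF s m] using zr_nz m unfolding nz_def by simp
   finally show "inverse (zz m) * act \<sigma> zz m * (inverse (zz (xo m 1)) * act \<sigma> zz (xo m 1)) = 1" .
  qed
qed

text \<open>
  As `zr` is fixed by the Galois group, the square of the cocycle of `zz` is the coboundary of
  `ww`.
\<close>
lemma zz_square: "cob zz \<otimes>\<^bsub>Z1 K 12 TT\<^esub> cob zz \<in> B1 K 12 TT"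
proof -
  interpret Z: comm_group "Z1 K 12 TT" by (rule Z1_comm_group)
  have wB: "cob ww \<in> B1 K 12 TT" unfolding B1_eq using ww_adm ww_nz by blast
  have e: "zz m * zz m = ww m * zr m" if "m < 12" for m
   using zr_nz that unfolding zz_def ww_def nz_def by simp
  have "cob zz \<otimes>\<^bsub>Z1 K 12 TT\<^esub> cob zz = cob (\<lambda>m. zz m * zz m)" by (rule cob_mult[OF zz_nz zz_nz])
  also have "... = cob (\<lambda>m. ww m * zr m)"
   unfolding cob_def by (intro restrict_ext tm_cong) (simp add: e act_def tau_props(1))
  also have "... = cob ww \<otimes>\<^bsub>Z1 K 12 TT\<^esub> cob zr" by (rule cob_mult[OF ww_nz zr_nz, symmetric])
  also have "cob zr = \<one>\<^bsub>Z1 K 12 TT\<^esub>" by (rule cob_one[OF zr_act zr_nz])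
  also have "cob ww \<otimes>\<^bsub>Z1 K 12 TT\<^esub> \<one>\<^bsub>Z1 K 12 TT\<^esub> = cob ww"
   using wB subgroup.subset[OF B1_subgroup] by (intro Z.r_one) blast
  finally show ?thesis using wB by simp
qed

text \<open>
  The quotient `u = zz / y` is an element of norm `r` that is fixed by the Galois group. Its
  conjugates `a`, `b` in the block are exchanged by changing the sign of `s`, so that `p = (a + b)
  / 2` and `q = (a - b) / (2 s)` depend on `r` only.
\<close>
lemma norm_equation:
  assumes y: "y \<in> adm" "y \<in> nz" and fixd: "!!\<sigma> m. \<sigma> \<in> G ==> m < 12 ==> act \<sigma> (\<lambda>m. zz m / y m) m = zz m / y m"
   and B: "B < 3"
  shows "\<exists>p0\<in>K. \<exists>p1\<in>K. \<exists>q0\<in>K. \<exists>q1\<in>K. r B = (p0 + p1 * r B)\<^sup>2 - (s B)\<^sup>2 * (q0 + q1 * r B)\<^sup>2"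
proof -
  define u where "u m = zz m / y m" for m
  define a b where "a = u (4 * B)" and "b = u (4 * B + 1)"
  have m: "4 * B < 12" "4 * B + 1 < 12" using B by auto
  have uS: "a \<in> S" "b \<in> S" using zz_nz y(2) m unfolding a_def b_def u_def nz_def by (auto intro!: subf_closed(8)[OF S])
  have x1: "xo (4 * B) 1 = 4 * B + 1" by (rule xo_even) simp
  have ab: "a * b = r B"
  proof -
   have "a * b = (zz (4 * B) * zz (xo (4 * B) 1)) / (y (4 * B) * y (xo (4 * B) 1))" unfolding a_def b_def u_def x1 by simp
   also have "... = zr (4 * B) / 1" using y(1) m(1) unfolding zz_xo adm_iff by simp
   finally show ?thesis unfolding zr_def by simp
  qed
  have s0: "s B ~= 0" "(s B)\<^sup>2 \<in> K" "(r B)\<^sup>2 \<in> K" "s B \<in> S" using rs[OF B] rsS[OF B] by auto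
  have act: "(\<sigma> (s B) = s B & \<sigma> a = a & \<sigma> b = b) \<or> (\<sigma> (s B) = - s B & \<sigma> a = b & \<sigma> b = a)"
   if s: "\<sigma> \<in> G" and r: "\<sigma> (r B) = r B" for \<sigma>
  proof -
   have f: "\<sigma> (u (tau \<sigma> (4 * B))) = a" "\<sigma> (u (tau \<sigma> (4 * B + 1))) = b"
    using fixd[OF s m(1)] fixd[OF s m(2)] unfolding act_def u_def a_def b_def by auto
   have d4: "(4 * B + 1) div 4 = B" by (rule div_nat_eqI) simp_all
   show ?thesis
   proof (cases "\<sigma> (s B) = s B")
    case True
    then have c: "code \<sigma> B = 0" unfolding code_def using r by simp
    have "xo k 0 = k" for k by (rule xo_eqI) (auto simp: xo_props)
    with f True show ?thesis unfolding tau_def a_def b_def by (simp add: c d4[simplified])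
   next
    case False
    then have c: "code \<sigma> B = 1" unfolding code_def using r by simp
    have "xo (4 * B + 1) 1 = 4 * B" using xo_xo(1)[of "4 * B" 1] unfolding x1 .
    then have "tau \<sigma> (4 * B) = 4 * B + 1" "tau \<sigma> (4 * B + 1) = 4 * B" unfolding tau_def d4 by (simp_all add: c x1[simplified])
    moreover have "\<sigma> (s B) = - s B" using False gal_sqrt[OF s s0(4,2)] by simp
    ultimately show ?thesis using f unfolding a_def b_def by simp
   qed
  qed
  have two': "2 \<in> S" "!!\<sigma>. \<sigma> \<in> G ==> \<sigma> 2 = 2"
   using subf_closed(11)[OF S, of "num.Bit0 num.One"] abs_Gal_props(3)[OF acl] subf_closed(11)[OF K, of "num.Bit0 num.One"] by auto
  define p q where "p = (a + b) / 2" and "q = (a - b) / (2 * s B)"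
  have pqS: "p \<in> S" "q \<in> S" unfolding p_def q_def using uS two' s0(4)
   by (auto intro!: subf_closed(3,4,7,8)[OF S])
  have pq: "\<forall>\<sigma>\<in>G. \<sigma> (r B) = r B --> \<sigma> p = p" "\<forall>\<sigma>\<in>G. \<sigma> (r B) = r B --> \<sigma> q = q"
  proof -
   have *: "\<sigma> p = p & \<sigma> q = q" if s: "\<sigma> \<in> G" and r: "\<sigma> (r B) = r B" for \<sigma>
   proof -
    note rh = rhom_simps[OF S abs_Gal_props(1)[OF acl s]] rhom_divide[OF S abs_Gal_props(1)[OF acl s]]
     rhom_diff[OF S abs_Gal_props(1)[OF acl s]]
    have "\<sigma> p = (\<sigma> a + \<sigma> b) / 2" unfolding p_def by (simp only: rh(5)[OF subf_closed(3)[OF S uS] two'(1)] rh(3)[OF uS] two'(2)[OF s])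
    moreover have "\<sigma> q = (\<sigma> a - \<sigma> b) / (2 * \<sigma> (s B))"
     unfolding q_def by (simp only: rh(5)[OF subf_closed(7)[OF S uS] subf_closed(4)[OF S two'(1) s0(4)]]
       rh(6)[OF uS] rh(4)[OF two'(1) s0(4)] two'(2)[OF s])
    moreover have "(b - a) / (2 * - s B) = (a - b) / (2 * s B)"
     by (metis minus_diff_eq minus_divide_divide mult_minus_right)
    ultimately show ?thesis using act[OF s r] unfolding p_def q_def by (auto simp: add.commute)
   qed
   then show "\<forall>\<sigma>\<in>G. \<sigma> (r B) = r B --> \<sigma> p = p" "\<forall>\<sigma>\<in>G. \<sigma> (r B) = r B --> \<sigma> q = q" by blast+
  qed
  obtain p0 p1 where p01: "p0 \<in> K" "p1 \<in> K" "p = p0 + p1 * r B" using fixed_quadratic[OF acl two s0(3) pqS(1) pq(1)] by blast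
  obtain q0 q1 where q01: "q0 \<in> K" "q1 \<in> K" "q = q0 + q1 * r B" using fixed_quadratic[OF acl two s0(3) pqS(2) pq(2)] by blast
  have "r B = p\<^sup>2 - (s B)\<^sup>2 * q\<^sup>2"
  proof -
   have sq: "s B * q = (a - b) / 2" unfolding q_def using s0(1) by simp
   have "p\<^sup>2 - (s B)\<^sup>2 * q\<^sup>2 = p\<^sup>2 - (s B * q)\<^sup>2" by (simp add: power_mult_distrib)
   also have "... = ((a + b)\<^sup>2 - (a - b)\<^sup>2) / (2 * 2)" unfolding sq p_def by (simp only: power2_eq_square times_divide_times_eq) (simp only: diff_divide_distrib)
   also have "(a + b)\<^sup>2 - (a - b)\<^sup>2 = (2 * 2) * (a * b)" by (simp add: power2_eq_square algebra_simps)
   also have "... / (2 * 2) = a * b" using two mult_eq_0_iff[of "2::'a" 2] by simp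
   finally show ?thesis using ab by simp
  qed
  with p01 q01 show ?thesis by blast
qed

end

text \<open>
  Over `L` the cocycle of `zz` is also the coboundary of a point `y` of the torus.
\<close>
lemma (in galois_biquad) split_norm_equation:
  assumes L: "finite_ext K L" and sp: "splits K L 12 TT (B1 K 12 TT #>\<^bsub>Z1 K 12 TT\<^esub> cob zz)" and B: "B < 3"
  shows "\<exists>p0\<in>L. \<exists>p1\<in>L. \<exists>q0\<in>L. \<exists>q1\<in>L. r B = (p0 + p1 * r B)\<^sup>2 - (s B)\<^sup>2 * (q0 + q1 * r B)\<^sup>2"
proof -
  have KL: "K \<subseteq> L" and Lf: "subf L" using L unfolding finite_ext_def subfield_FF_iff by auto
  have aL: "acl L" by (rule acl_mono[OF acl KL Lf])
  interpret L: galois_biquad L r s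
   by unfold_locales (use Lf two rs KL aL in auto)
  interpret Z: comm_group "Z1 K 12 TT" by (rule Z1_comm_group)
  have SL: "S \<subseteq> L.S" by (rule sep_closure_mono[OF KL])
  have res: "restrict \<sigma> S \<in> G" if "\<sigma> \<in> L.G" for \<sigma>
   using abs_Gal_props[OF aL that] KL by (intro restrict_abs_Gal[OF L.S _ SL acl]) auto
  have self: "cob zz \<in> B1 K 12 TT #>\<^bsub>Z1 K 12 TT\<^esub> cob zz" by (rule Z.rcos_self[OF zz_cocycle B1_subgroup])
  have oneB: "\<one>\<^bsub>Z1 L 12 TT\<^esub> \<in> B1 L 12 TT" by (rule subgroup.one_closed[OF L.B1_subgroup])
  define c where "c = res_cocycle K L (cob zz)"
  have c: "c \<sigma> = tm (\<lambda>m. inverse (zz m) * L.act \<sigma> zz m)" if s: "\<sigma> \<in> L.G" for \<sigma>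
  proof -
   have "c \<sigma> = tm (\<lambda>m. inverse (zz m) * act (restrict \<sigma> S) zz m)"
    unfolding c_def res_cocycle_def using s by (simp add: cob_def res)
   also have "... = tm (\<lambda>m. inverse (zz m) * L.act \<sigma> zz m)"
   proof (rule tm_cong)
    fix m :: nat assume m: "m < 12"
    have "tau (restrict \<sigma> S) m = tau \<sigma> m" unfolding tau_def code_def using rsS[of "m div 4"] m by simp
    moreover have "zz (tau \<sigma> m) \<in> S" using zz_nz tau_props(1)[OF m] unfolding nz_def by blast
    ultimately show "inverse (zz m) * act (restrict \<sigma> S) zz m = inverse (zz m) * L.act \<sigma> zz m"
     unfolding act_def L.act_def by simp
   qed
   finally show ?thesis .
  qed
  have "\<one>\<^bsub>Z1 L 12 TT\<^esub> \<otimes>\<^bsub>Z1 L 12 TT\<^esub> c = c"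
   unfolding L.Z1_simps
  proof (rule extensionalityI)
   show "c \<in> extensional L.G" unfolding c_def res_cocycle_def by simp
   fix \<sigma> assume s: "\<sigma> \<in> L.G"
   have "1\<^sub>m 12 * c \<sigma> = c \<sigma>" unfolding c[OF s] by (rule left_mult_one_mat[OF tm_carrier(1)])
   then show "(\<lambda>\<sigma>\<in>L.G. (\<lambda>\<sigma>\<in>L.G. 1\<^sub>m 12) \<sigma> * c \<sigma>) \<sigma> = c \<sigma>" using s by simp
  qed simp
  then have "c \<in> B1 L 12 TT #>\<^bsub>Z1 L 12 TT\<^esub> c" unfolding r_coset_def using oneB by force
  then have "c \<in> res_H1 K L 12 TT (B1 K 12 TT #>\<^bsub>Z1 K 12 TT\<^esub> cob zz)" unfolding res_H1_def c_def using self by blast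
  also have "... = B1 L 12 TT" using sp unfolding splits_def H1_def by simp
  finally obtain y where y: "c = L.cob y" "y \<in> adm" "y \<in> L.nz" unfolding L.B1_eq by blast
  have z: "zz \<in> L.nz" using zz_nz SL unfolding nz_def L.nz_def by blast
  have iy: "(\<lambda>m. inverse (y m)) \<in> L.nz" by (rule L.nz_closed(2)[OF y(3)])
  show ?thesis
  proof (rule L.norm_equation[OF y(2,3) _ B])
   fix \<sigma> m assume s: "\<sigma> \<in> L.G" and m: "m < (12::nat)"
   have "tm (\<lambda>m. inverse (zz m) * L.act \<sigma> zz m) = tm (\<lambda>m. inverse (y m) * L.act \<sigma> y m)"
    using c[OF s] s unfolding y(1) L.cob_def by simp
   then have e: "inverse (zz m) * L.act \<sigma> zz m = inverse (y m) * L.act \<sigma> y m" unfolding tm_eq_iff using m by blast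
   have nz: "zz m ~= 0" "y m ~= 0" "L.act \<sigma> y m ~= 0"
    using z y(3) m L.act_nz[OF s y(3)] unfolding L.nz_def by auto
   have "L.act \<sigma> (\<lambda>m. zz m / y m) m = L.act \<sigma> zz m * inverse (L.act \<sigma> y m)"
    unfolding divide_inverse L.act_mult(1)[OF s z iy m] L.act_mult(2)[OF s y(3) y(3) m] ..
   also have "... = zz m / y m" using e nz by (simp add: field_simps)
   finally show "L.act \<sigma> (\<lambda>m. zz m / y m) m = zz m / y m" .
  qed
qed

text \<open>
  The class is not trivial, since `K` would split it although 4 does not divide the degree 1.
\<close>
theorem (in galois_biquad) class_with_period_2:
  assumes ind: "!!L. finite_ext K L ==>
    (\<forall>B<3. \<exists>p0\<in>L. \<exists>p1\<in>L. \<exists>q0\<in>L. \<exists>q1\<in>L. r B = (p0 + p1 * r B)\<^sup>2 - (s B)\<^sup>2 * (q0 + q1 * r B)\<^sup>2) ==>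
    4 dvd ring.dim FF K L"
  shows "\<exists>\<xi>. \<xi> \<in> carrier (H1 K 12 TT) & period K 12 TT \<xi> = 2 & 4 dvd cohom_index K 12 TT \<xi>"
proof -
  interpret Z: comm_group "Z1 K 12 TT" by (rule Z1_comm_group)
  interpret N: normal "B1 K 12 TT" "Z1 K 12 TT" by (rule B1_normal)
  interpret H: group "H1 K 12 TT" unfolding H1_def by (rule N.factorgroup_is_group)
  define \<xi> where "\<xi> = B1 K 12 TT #>\<^bsub>Z1 K 12 TT\<^esub> cob zz"
  have car: "\<xi> \<in> carrier (H1 K 12 TT)" unfolding H1_def carrier_FactGroup \<xi>_def using zz_cocycle by blast
  have split4: "4 dvd ring.dim FF K L" if "finite_ext K L" "splits K L 12 TT \<xi>" for L
   using ind[OF that(1)] split_norm_equation[OF that(1) that(2)[unfolded \<xi>_def]] by blast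
  have one: "\<one>\<^bsub>H1 K 12 TT\<^esub> = B1 K 12 TT" unfolding H1_def by simp
  have sq: "\<xi> \<otimes>\<^bsub>H1 K 12 TT\<^esub> \<xi> = \<one>\<^bsub>H1 K 12 TT\<^esub>"
  proof -
   have "\<xi> \<otimes>\<^bsub>H1 K 12 TT\<^esub> \<xi> = B1 K 12 TT #>\<^bsub>Z1 K 12 TT\<^esub> (cob zz \<otimes>\<^bsub>Z1 K 12 TT\<^esub> cob zz)"
    unfolding \<xi>_def H1_def using N.rcos_sum[OF zz_cocycle zz_cocycle] by simp
   also have "... = B1 K 12 TT"
    by (rule Z.coset_join2[OF _ B1_subgroup zz_square]) (intro Z.m_closed zz_cocycle)
   finally show ?thesis using one by simp
  qed
  have ne: "\<xi> ~= \<one>\<^bsub>H1 K 12 TT\<^esub>"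
  proof
   assume x1: "\<xi> = \<one>\<^bsub>H1 K 12 TT\<^esub>"
   have "B1 K 12 TT #>\<^bsub>Z1 K 12 TT\<^esub> res_cocycle K K c = B1 K 12 TT" if c: "c \<in> B1 K 12 TT" for c
   proof -
    have cZ: "c \<in> carrier (Z1 K 12 TT)" using c N.subset by blast
    then have ce: "c \<in> extensional G" unfolding Z1_iff by blast
    have "restrict \<sigma> S = \<sigma>" if "\<sigma> \<in> G" for \<sigma> using abs_Gal_props(4)[OF acl that] by (rule extensional_restrict)
    then have "res_cocycle K K c = restrict c G" unfolding res_cocycle_def by (intro restrict_ext) simp
    also have "... = c" using ce by (rule extensional_restrict)
    finally show ?thesis using Z.coset_join2[OF cZ B1_subgroup c] by simp
   qed
   then have "res_H1 K K 12 TT \<xi> = B1 K 12 TT"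
    unfolding res_H1_def x1 one using N.one_closed by blast
   then have "splits K K 12 TT \<xi>" unfolding splits_def one .
   with split4[OF finite_ext_base(1)[OF K]] have "4 dvd ring.dim FF K K" .
   then show False unfolding finite_ext_base(2)[OF K] by simp
  qed
  define P where "P = {n::nat. 0 < n & \<xi> [^]\<^bsub>H1 K 12 TT\<^esub> n = \<one>\<^bsub>H1 K 12 TT\<^esub>}"
  have p2: "\<xi> [^]\<^bsub>H1 K 12 TT\<^esub> (2::nat) = \<one>\<^bsub>H1 K 12 TT\<^esub>" using sq car by (simp add: numeral_2_eq_2)
  have "2 dvd n" if "n \<in> P" for n
  proof (rule ccontr)
   assume "\<not> 2 dvd n"
   then obtain k where k: "n = 2 * k + 1" by (elim oddE)
   have "\<xi> [^]\<^bsub>H1 K 12 TT\<^esub> n = (\<xi> [^]\<^bsub>H1 K 12 TT\<^esub> (2::nat)) [^]\<^bsub>H1 K 12 TT\<^esub> k \<otimes>\<^bsub>H1 K 12 TT\<^esub> \<xi>"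
    unfolding k H.nat_pow_pow[OF car] by simp
   also have "... = \<xi>" unfolding p2 using car by simp
   finally show False using that ne unfolding P_def by simp
  qed
  then have "2 dvd Gcd P" by (intro Gcd_greatest)
  moreover have "Gcd P dvd 2" using p2 unfolding P_def by (intro Gcd_dvd) simp
  ultimately have "period K 12 TT \<xi> = 2" unfolding period_def P_def[symmetric] by (rule dvd_antisym[OF _ _, rotated])
  moreover have "4 dvd cohom_index K 12 TT \<xi>" unfolding cohom_index_def
   using split4 by (intro Gcd_greatest) blast
  ultimately show ?thesis using car by blast
qed

section \<open>Valuations of local and global fields\<close>

lemma dvf_ext_of_finite_ext:
  assumes d: "dvf K v \<pi> R" and L: "finite_ext K L"
  shows "\<exists>u. dvf_ext K v \<pi> R L (ring.dim FF K L) u"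
proof -
  have K: "subfield K FF" and Lf: "subfield L FF" and KL: "K \<subseteq> L" and fd: "ring.finite_dimension FF K L"
   using L unfolding finite_ext_def by auto
  have sK: "subf K" and sL: "subf L" using K Lf subfield_FF_iff by auto
  have "ring.dimension FF (ring.dim FF K L) K L" using FF.finite_dimensionE[OF K fd] unfolding over_def .
  then obtain Vs where Vs: "ring.independent FF K Vs" "length Vs = ring.dim FF K L" "ring.Span FF K Vs = L"
   using FF.exists_base[OF K] by blast
  have LS: "L = {\<Sum>i<length Vs. c i * Vs ! i | c. \<forall>i<length Vs. c i \<in> K}" using FF_Span[OF sK, of Vs] Vs(3) by simp
  have "dvf_ext K v \<pi> R L (ring.dim FF K L) (\<lambda>i. Vs ! i)"
   unfolding dvf_ext_def dvf_ext_axioms_def Vs(2)[symmetric]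
  proof (intro conjI allI impI)
   show "dvf K v \<pi> R" by (rule d)
   show "subf L" by (rule sL)
   show "K \<subseteq> L" by (rule KL)
   show "alg_over K x" if "x \<in> L" for x
    using FF.finite_dimension_imp_algebraic[OF K subfieldE(1)[OF Lf] fd that] unfolding algebraic_FF_iff[OF sK] .
   show "Vs ! i \<in> L" if "i < length Vs" for i
    using FF.Span_base_incl[OF K, of Vs] nth_mem[OF that] unfolding Vs(3) by auto
   show "\<exists>c. (\<forall>i<length Vs. c i \<in> K) & x = (\<Sum>i<length Vs. c i * Vs ! i)" if "x \<in> L" for x
    using that unfolding LS by auto
   fix c i assume c: "\<forall>i. i < length Vs --> c i \<in> K" and s: "(\<Sum>i<length Vs. c i * Vs ! i) = 0" and i: "i < length Vs"
   define Ks where "Ks = map c [0..<length Vs]"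
   have l: "length Ks = length Vs" "set Ks \<subseteq> K" using c unfolding Ks_def by auto
   have "ring.combine FF Ks Vs = (\<Sum>i<length Vs. c i * Vs ! i)" unfolding FF_combine[OF l(1)] unfolding Ks_def by simp
   then have "ring.combine FF Ks Vs = \<zero>\<^bsub>FF\<^esub>" using s by simp
   from FF.independent_imp_trivial_combine[OF K Vs(1) l(2) this] have "set Ks \<subseteq> {0}" using l(1) by simp
   then show "c i = 0" using i unfolding Ks_def by (auto simp: image_subset_iff)
  qed
  then show ?thesis by blast
qed

text \<open>
  The order of divisibility by `p` on the fraction field of a ring `D` in which every nonzero
  element is a power of `p` times an element prime to `p`, and whose quotient by `p` is a finite
  field.
\<close>
lemma dvf_of_prime_element:
  fixes D :: "'a::field set"
  assumes D: "0 \<in> D" "1 \<in> D" "\<forall>x\<in>D. \<forall>y\<in>D. x + y \<in> D & x * y \<in> D & x - y \<in> D"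
   and p: "p \<in> D" "p ~= 0" and one: "1 ~: (*) p ` D"
   and dec: "\<forall>x\<in>D. x ~= 0 --> (\<exists>k::nat. \<exists>u\<in>D. u ~: (*) p ` D & x = p ^ k * u)"
   and inv: "\<forall>u\<in>D. u ~: (*) p ` D --> (\<exists>w\<in>D. u * w - 1 \<in> (*) p ` D)"
   and R: "finite R" "R \<subseteq> D" "\<forall>x\<in>D. \<exists>!r\<in>R. x - r \<in> (*) p ` D"
  shows "\<exists>v. dvf {x / y | x y. x \<in> D & y \<in> D & y ~= 0} v p R & (\<forall>u\<in>D. u ~: (*) p ` D --> v u = 0)"
proof -
  define I where "I = (*) p ` D"
  define U where "U = D - I"
  define P where "P = {x / y | x y. x \<in> D & y \<in> D & y ~= 0}"
  have Dc: "x + y \<in> D" "x * y \<in> D" "x - y \<in> D" if "x \<in> D" "y \<in> D" for x y using D(3) that by auto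
  have Dn: "- x \<in> D" if "x \<in> D" for x using Dc(3)[OF D(1) that] by simp
  have Dpow: "x ^ k \<in> D" if "x \<in> D" for x and k :: nat by (induction k) (use that D(2) Dc in auto)
  have II: "p * x \<in> I" if "x \<in> D" for x unfolding I_def using that by (rule imageI)
  have IE: "\<exists>y\<in>D. x = p * y" if "x \<in> I" for x using that unfolding I_def by (elim imageE) blast
  have ID: "x \<in> D" if "x \<in> I" for x using IE[OF that] Dc(2)[OF p(1)] by blast
  have Id: "x - y \<in> I" if xy: "x \<in> I" "y \<in> I" for x y
  proof -
   obtain a b where "a \<in> D" "x = p * a" "b \<in> D" "y = p * b" using IE[OF xy(1)] IE[OF xy(2)] by blast
   then show ?thesis using II[OF Dc(3)[of a b]] by (simp add: right_diff_distrib)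
  qed
  have Im: "x * y \<in> I" if xy: "x \<in> I" "y \<in> D" for x y
  proof -
   obtain a where "a \<in> D" "x = p * a" using IE[OF xy(1)] by blast
   then show ?thesis using II[OF Dc(2)[of a y]] xy(2) by (simp add: mult.assoc)
  qed
  have UD: "u \<in> D" "u ~= 0" if "u \<in> U" for u using that II[OF D(1)] unfolding U_def by auto
  have prime: "y \<in> I" if uy: "u \<in> U" "y \<in> D" "u * y \<in> I" for u y
  proof -
   obtain w where w: "w \<in> D" "u * w - 1 \<in> I" using inv uy(1) unfolding U_def I_def by blast
   have "(u * y) * w - (u * w - 1) * y \<in> I" by (intro Id Im w uy)
   then show ?thesis by (simp add: algebra_simps)
  qed
  have U1: "1 \<in> U" using one D(2) unfolding U_def I_def by blast
  have Um: "u * w \<in> U" if "u \<in> U" "w \<in> U" for u w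
   using prime[OF that(1), of w] that Dc(2) unfolding U_def by blast
  have dec': "\<exists>k. \<exists>u\<in>U. x = p ^ k * u" if "x \<in> D" "x ~= 0" for x
   using dec that unfolding U_def I_def by blast
  have uniq': False if k: "k < l" and u: "u \<in> U" "u' \<in> U" "w \<in> U" "w' \<in> U" and e: "p powi k * u / w = p powi l * u' / w'" for k l u u' w w'
  proof -
   define d where "d = nat (l - k) - 1"
   have "l = k + (1 + int d)" using k unfolding d_def by simp
   then have l: "p powi l = p powi k * (p * p ^ d)" using p(2) by (simp add: power_int_add)
   have nzs: "w ~= 0" "w' ~= 0" "p powi k ~= 0" using UD u p(2) by auto
   have "p powi k * (u * w') = p powi k * (p * (p ^ d * (u' * w)))"
    using e nzs(1,2) unfolding l by (simp add: field_simps)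
   then have "u * w' = p * (p ^ d * (u' * w))" by (simp only: mult_left_cancel[OF nzs(3)])
   moreover have "p * (p ^ d * (u' * w)) \<in> I" using u UD by (intro II Dc(2) Dpow p(1)) auto
   ultimately show False using Um[OF u(1,4)] unfolding U_def by simp
  qed
  define v where "v x = (THE k. \<exists>u\<in>U. \<exists>w\<in>U. x = p powi k * u / w)" for x
  have vI: "v (p powi k * u / w) = k" if "u \<in> U" "w \<in> U" for k u w
   unfolding v_def
  proof (rule the_equality)
   fix l assume "\<exists>u'\<in>U. \<exists>w'\<in>U. p powi k * u / w = p powi l * u' / w'"
   then obtain u' w' where e: "u' \<in> U" "w' \<in> U" "p powi k * u / w = p powi l * u' / w'" by blast
   have "\<not> k < l" using uniq'[OF _ that(1) e(1) that(2) e(2,3)] by blast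
   moreover have "\<not> l < k" using uniq'[OF _ e(1) that(1) e(2) that(2) e(3)[symmetric]] by blast
   ultimately show "l = k" by simp
  qed (use that in blast)
  have PE: "\<exists>k. \<exists>u\<in>U. \<exists>w\<in>U. x = p powi k * u / w" if x: "x \<in> P" "x ~= 0" for x
  proof -
   obtain a b where ab: "a \<in> D" "b \<in> D" "b ~= 0" "x = a / b" using x(1) unfolding P_def by blast
   then have "a ~= 0" using x(2) by auto
   obtain k u where k: "u \<in> U" "a = p ^ k * u" using dec'[OF ab(1) \<open>a ~= 0\<close>] by blast
   obtain l w where l: "w \<in> U" "b = p ^ l * w" using dec'[OF ab(2,3)] by blast
   have "x = p powi (int k - int l) * u / w" unfolding ab(4) k(2) l(2) using p(2) by (simp add: power_int_diff)
   with k(1) l(1) show ?thesis by blast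
  qed
  have vD: "v (p ^ k * u / w) = int k" if "u \<in> U" "w \<in> U" for k u w using vI[OF that, of "int k"] by simp
  have PD: "x / y \<in> P" if "x \<in> D" "y \<in> D" "y ~= 0" for x y unfolding P_def using that by blast
  have DP: "x \<in> P" if "x \<in> D" for x using PD[OF that D(2)] by simp
  have sP: "subf P"
   unfolding subf_def
  proof (intro conjI ballI)
   show "0 \<in> P" "1 \<in> P" using DP D(1,2) by auto
   fix x assume "x \<in> P"
   then obtain a b where ab: "a \<in> D" "b \<in> D" "b ~= 0" "x = a / b" unfolding P_def by blast
   show "- x \<in> P" using PD[OF Dn[OF ab(1)] ab(2,3)] ab(4) by simp
   show "inverse x \<in> P"
   proof (cases "a = 0")
    case True then show ?thesis using ab(4) DP[OF D(1)] by simp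
   next
    case False then show ?thesis using PD[OF ab(2,1)] ab(4) by simp
   qed
   fix y assume "y \<in> P"
   then obtain c d where cd: "c \<in> D" "d \<in> D" "d ~= 0" "y = c / d" unfolding P_def by blast
   have "x + y = (a * d + c * b) / (b * d)" unfolding ab(4) cd(4) using ab(3) cd(3) by (simp add: add_frac_eq)
   then show "x + y \<in> P" using PD[of "a * d + c * b" "b * d"] Dc ab cd by simp
   have "x * y = (a * c) / (b * d)" unfolding ab(4) cd(4) by simp
   then show "x * y \<in> P" using PD[of "a * c" "b * d"] Dc ab cd by simp
  qed
  have add: "k \<le> v (p powi k * u / w + p powi l * u' / w')"
   if kl: "k \<le> l" and u: "u \<in> U" "w \<in> U" "u' \<in> U" "w' \<in> U" and nz: "p powi k * u / w + p powi l * u' / w' ~= 0" for k l u w u' w'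
  proof -
   define d where "d = u * w' + p ^ nat (l - k) * (u' * w)"
   have "l = k + int (nat (l - k))" using kl by simp
   then have pl: "p powi l = p powi k * p ^ nat (l - k)" using p(2) by (metis power_int_add power_int_of_nat)
   have ww: "w ~= 0" "w' ~= 0" using u UD by auto
   have e: "p powi k * u / w + p powi l * u' / w' = p powi k * d / (w * w')"
    unfolding pl d_def using ww by (simp add: add_frac_eq algebra_simps)
   have "d \<in> D" unfolding d_def using u UD by (intro Dc(1,2) Dpow p(1)) auto
   moreover have "d ~= 0" using nz unfolding e by auto
   ultimately obtain m u'' where m: "u'' \<in> U" "d = p ^ m * u''" using dec' by blast
   have e2: "p powi k * d / (w * w') = p powi (k + int m) * u'' / (w * w')" unfolding m(2) using p(2) by (simp add: power_int_add)
   have "v (p powi k * d / (w * w')) = k + int m" unfolding e2 by (rule vI[OF m(1) Um[OF u(2,4)]])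
   then show ?thesis unfolding e by simp
  qed
  define M where "M = {p * d / w | d w. d \<in> D & w \<in> U}"
  have M_iff: "x \<in> M \<longleftrightarrow> x = 0 \<or> 1 \<le> v x" if x: "x \<in> P" for x
  proof
   assume "x \<in> M"
   then obtain d w where dw: "d \<in> D" "w \<in> U" "x = p * d / w" unfolding M_def by blast
   show "x = 0 \<or> 1 \<le> v x"
   proof (cases "d = 0")
    case False
    then obtain m u where m: "u \<in> U" "d = p ^ m * u" using dec' dw(1) by blast
    have e: "x = p ^ Suc m * u / w" unfolding dw(3) m(2) by simp
    have "v x = int (Suc m)" unfolding e by (rule vD[OF m(1) dw(2)])
    then show ?thesis by simp
   qed (simp add: dw(3))
  next
   assume a: "x = 0 \<or> 1 \<le> v x"
   show "x \<in> M"
   proof (cases "x = 0")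
    case True
    then show ?thesis unfolding M_def using D(1) U1 by (intro CollectI exI[of _ 0] exI[of _ 1]) simp
   next
    case False
    obtain k u w where k: "u \<in> U" "w \<in> U" "x = p powi k * u / w" using PE[OF x False] by blast
    then have "1 \<le> k" using a False vI by auto
    then have "k = int (Suc (nat (k - 1)))" by simp
    then have "p powi k = p * p ^ nat (k - 1)" by (metis power_int_of_nat power_Suc)
    then have "x = p * (p ^ nat (k - 1) * u) / w" unfolding k(3) by (simp add: mult.assoc)
    moreover have "p ^ nat (k - 1) * u \<in> D" using k(1) UD by (intro Dc(2) Dpow p(1)) auto
    ultimately show ?thesis unfolding M_def using k(2) by blast
   qed
  qed
  have Md: "x - y \<in> M" if "x \<in> M" "y \<in> M" for x y
  proof -
   obtain d w d' w' where e: "d \<in> D" "w \<in> U" "x = p * d / w" "d' \<in> D" "w' \<in> U" "y = p * d' / w'" using \<open>x \<in> M\<close> \<open>y \<in> M\<close> unfolding M_def by blast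
   have "x - y = p * (d * w' - d' * w) / (w * w')" unfolding e(3,6) using UD e(2,5) by (simp add: diff_frac_eq algebra_simps)
   moreover have "d * w' - d' * w \<in> D" using e UD by (intro Dc) auto
   ultimately show ?thesis unfolding M_def using Um[OF e(2,5)] by blast
  qed
  have MD: "x \<in> I" if xM: "x \<in> M" and xD: "x \<in> D" for x
  proof -
   obtain d w where e: "d \<in> D" "w \<in> U" "x = p * d / w" using xM unfolding M_def by blast
   then have "w * x = p * d" using UD by simp
   then show ?thesis using prime[OF e(2) xD] II[OF e(1)] by simp
  qed
  have "dvf P v p R"
  proof
   show "subf P" by (rule sP)
   show "v (x * y) = v x + v y" if x: "x \<in> P" "x ~= 0" and y: "y \<in> P" "y ~= 0" for x y
   proof -
    obtain k u w where k: "u \<in> U" "w \<in> U" "x = p powi k * u / w" using PE[OF x] by blast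
    obtain l u' w' where l: "u' \<in> U" "w' \<in> U" "y = p powi l * u' / w'" using PE[OF y] by blast
    have e: "x * y = p powi (k + l) * (u * u') / (w * w')" unfolding k(3) l(3) using p(2) by (simp add: power_int_add)
    have "v (x * y) = k + l" unfolding e by (rule vI[OF Um[OF k(1) l(1)] Um[OF k(2) l(2)]])
    moreover have "v x = k" "v y = l" unfolding k(3) l(3) by (rule vI[OF k(1,2)], rule vI[OF l(1,2)])
    ultimately show ?thesis by simp
   qed
   show "min (v x) (v y) \<le> v (x + y)" if x: "x \<in> P" "x ~= 0" and y: "y \<in> P" "y ~= 0" and xy: "x + y ~= 0" for x y
   proof -
    obtain k u w where k: "u \<in> U" "w \<in> U" "x = p powi k * u / w" using PE[OF x] by blast
    obtain l u' w' where l: "u' \<in> U" "w' \<in> U" "y = p powi l * u' / w'" using PE[OF y] by blast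
    have vv: "v x = k" "v y = l" using vI[OF k(1,2)] vI[OF l(1,2)] k(3) l(3) by auto
    show ?thesis
    proof (cases "k \<le> l")
     case True
     have "k \<le> v (x + y)" unfolding k(3) l(3) by (rule add[OF True k(1,2) l(1,2) xy[unfolded k(3) l(3)]])
     then show ?thesis using vv True by simp
    next
     case False
     then have lk: "l \<le> k" by simp
     have yx: "y + x ~= 0" using xy by (simp add: add.commute)
     have "l \<le> v (y + x)" unfolding k(3) l(3) by (rule add[OF lk l(1,2) k(1,2) yx[unfolded k(3) l(3)]])
     then show ?thesis using vv lk by (simp add: add.commute)
    qed
   qed
   show "p \<in> P" "p ~= 0" using DP p by auto
   show "v p = 1" using vD[OF U1 U1, of 1] by simp
   show "finite R" by (rule R(1))
   show "r \<in> P & (r = 0 \<or> 0 \<le> v r)" if "r \<in> R" for r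
   proof -
    have r: "r \<in> D" using that R(2) by blast
    have "0 \<le> v r" if "r ~= 0"
    proof -
     obtain k u where "u \<in> U" "r = p ^ k * u" using dec'[OF r \<open>r ~= 0\<close>] by blast
     then show ?thesis using vD[OF _ U1, of u k] by simp
    qed
    with DP[OF r] show ?thesis by blast
   qed
   show "\<exists>!r\<in>R. x - r = 0 \<or> 1 \<le> v (x - r)" if x: "x \<in> P" "x = 0 \<or> 0 \<le> v x" for x
   proof -
    have xr: "(x - r = 0 \<or> 1 \<le> v (x - r)) \<longleftrightarrow> x - r \<in> M" if "r \<in> R" for r
     using M_iff[of "x - r"] subf_closed(7)[OF sP x(1)] DP R(2) that by auto
    have "\<exists>d\<in>D. \<exists>w\<in>U. x = d / w"
    proof (cases "x = 0")
     case True then show ?thesis using D(1) U1 by (intro bexI[of _ 0] bexI[of _ 1]) auto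
    next
     case False
     obtain k u w where k: "u \<in> U" "w \<in> U" "x = p powi k * u / w" using PE[OF x(1) False] by blast
     then have "0 \<le> k" using x(2) False vI by auto
     then have "p powi k = p ^ nat k" by (metis nat_0_le power_int_of_nat)
     then have "x = (p ^ nat k * u) / w" using k(3) by simp
     moreover have "p ^ nat k * u \<in> D" using k(1) UD by (intro Dc(2) Dpow p(1)) auto
     ultimately show ?thesis using k(2) by blast
    qed
    then obtain d w where d: "d \<in> D" "w \<in> U" "x = d / w" by blast
    obtain w' where w': "w' \<in> D" "w * w' - 1 \<in> I" using inv d(2) unfolding U_def I_def by blast
    obtain r where r: "r \<in> R" "d * w' - r \<in> I" using R(3) Dc(2)[OF d(1) w'(1)] unfolding I_def by blast
    have rD: "r \<in> D" "w \<in> D" "w ~= 0" using r(1) R(2) d(2) UD by auto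
    have "(d * w' - r) * w - (w * w' - 1) * d \<in> I" by (intro Id Im r(2) w'(2) rD d(1))
    moreover have "(d * w' - r) * w - (w * w' - 1) * d = d - r * w" by (simp add: algebra_simps)
    ultimately obtain f where f: "f \<in> D" "d - r * w = p * f" using IE by metis
    have "x - r = (d - r * w) / w" unfolding d(3) using rD(3) by (simp add: diff_divide_distrib)
    then have xrM: "x - r \<in> M" unfolding f(2) M_def using f(1) d(2) by blast
    show ?thesis
    proof (rule ex1I[of _ r])
     show "r \<in> R & (x - r = 0 \<or> 1 \<le> v (x - r))" using xr[OF r(1)] xrM r(1) by blast
     fix r' assume r': "r' \<in> R & (x - r' = 0 \<or> 1 \<le> v (x - r'))"
     then have "x - r' \<in> M" using xr by blast
     from Md[OF this xrM] have "r - r' \<in> M" by simp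
     moreover have "r - r' \<in> D" using r' R(2) rD(1) by (intro Dc(3)) auto
     ultimately have "r - r' \<in> I" by (rule MD)
     moreover have "r - r \<in> I" using II[OF D(1)] by simp
     ultimately show "r' = r" using R(3) rD(1) r(1) r' unfolding I_def by blast
    qed
   qed
  qed
  moreover have "v u = 0" if "u \<in> D" "u ~: (*) p ` D" for u
  proof -
   have "u \<in> U" using that unfolding U_def I_def by blast
   then show ?thesis using vD[OF _ U1, of u 0] by simp
  qed
  ultimately show ?thesis unfolding P_def by blast
qed

text \<open>
  Any prime divisor of `\<pi>` among the integral elements of `K` gives an extension of the
  valuation.
\<close>
lemma extend_valuation:
  fixes K :: "'a::field set"
  assumes d: "dvf P v \<pi> R" and v2: "v 2 = 0" "(2::'a) ~= 0" and K: "finite_ext P K"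
  shows "\<exists>w \<rho> S. dvf K w \<rho> S & (2::'a) ~: dvf.mi K w"
proof -
  obtain u where "dvf_ext P v \<pi> R K (ring.dim FF P K) u" using dvf_ext_of_finite_ext[OF d K] by blast
  then interpret dvf_ext P v \<pi> R K "ring.dim FF P K" u .
  have "\<pi> \<in> ic" by (rule ic_closed(3)[OF unif_vr])
  then obtain z where z: "prime_ic z" "\<pi> / z \<in> ic" using prime_divisor[OF _ unif(2) pi_not_unit] by blast
  obtain S where S: "dvf K (zval z) z S" "!!x. x \<in> P ==> x ~= 0 ==> zval z x = zval z \<pi> * v x"
   using prime_valuation[OF z] by metis
  have "2 \<in> P" using subf_closed(11)[OF local.K, of "num.Bit0 num.One"] by simp
  then have "zval z 2 = 0" using S(2) v2 by simp
  then have "(2::'a) ~: dvf.mi K (zval z)" unfolding dvf.mi_def[OF S(1)] using v2(2) by simp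
  with S(1) show ?thesis by blast
qed

lemma generate_field_subf: "subf (generate_field FF (H :: 'a::field set))"
proof -
  let ?G = "generate_field FF H"
  have one: "1 \<in> ?G" using generate_field.one[of FF H] by simp
  have neg: "- x \<in> ?G" if "x \<in> ?G" for x using generate_field.a_inv[OF that] by simp
  have add: "x + y \<in> ?G" if "x \<in> ?G" "y \<in> ?G" for x y using generate_field.eng_add[OF that] by simp
  have zero: "0 \<in> ?G" using add[OF one neg[OF one]] by simp
  have inv: "inverse x \<in> ?G" if "x \<in> ?G" for x
   using generate_field.m_inv[OF that] zero by (cases "x = 0") auto
  have mult: "x * y \<in> ?G" if "x \<in> ?G" "y \<in> ?G" for x y using generate_field.eng_mult[OF that] by simp
  show ?thesis unfolding subf_def by (intro conjI ballI zero one neg add inv mult)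
qed

lemma generate_field_min:
  assumes "subf (F :: 'a::field set)" "H \<subseteq> F"
  shows "generate_field FF H \<subseteq> F"
proof
  fix x assume "x \<in> generate_field FF H"
  then show "x \<in> F"
  proof (induction rule: generate_field.induct)
   case (m_inv h)
   then show ?case using subf_closed(6)[OF assms(1)] by simp
  qed (use assms(2) subf_closed[OF assms(1)] in auto)
qed

lemma of_int_in_subf: "subf F ==> (of_int n :: 'a::field) \<in> F"
  proof -
  assume F: "subf F"
  show "(of_int n :: 'a) \<in> F"
  proof (cases n rule: int_cases2)
   case (nonneg m)
   then show ?thesis using subf_of_nat[OF F, of m] by simp
  next
   case (nonpos m)
   then show ?thesis using subf_closed(5)[OF F subf_of_nat[OF F, of m]] by simp
  qed
qed

text \<open>
  The prime 3 is the smallest one with odd residue characteristic.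
\<close>
lemma number_field_valuation:
  assumes K: "number_field (K :: 'a::field set)"
  shows "\<exists>w \<rho> S. dvf K w \<rho> S & (2::'a) ~: dvf.mi K w"
proof -
  have ch: "CHAR('a) = 0" and fe: "finite_ext (generate_field FF {}) K" using K unfolding number_field_def by auto
  have inj: "(of_int a :: 'a) = of_int b \<longleftrightarrow> a = b" for a b
   using of_int_eq_0_iff_char_dvd[where 'a = 'a, of "a - b"] ch by simp
  define D where "D = range (of_int :: int \<Rightarrow> 'a)"
  have I: "of_int a \<in> (*) 3 ` D \<longleftrightarrow> 3 dvd a" for a
  proof
   assume "of_int a \<in> (*) (3::'a) ` D"
   then obtain b where "(of_int a :: 'a) = 3 * of_int b" unfolding D_def by auto
   then have "(of_int a :: 'a) = of_int (3 * b)" by simp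
   then show "3 dvd a" unfolding inj by simp
  next
   assume "3 dvd a"
   then obtain b where "a = 3 * b" by (elim dvdE)
   then have "(of_int a :: 'a) = 3 * of_int b" by simp
   then show "of_int a \<in> (*) (3::'a) ` D" unfolding D_def by (intro image_eqI[of _ _ "of_int b"]) auto
  qed
  have mem: "of_int a \<in> D" for a unfolding D_def by blast
  have DE: "\<exists>a. x = of_int a" if "x \<in> D" for x using that unfolding D_def by blast
  have three: "(3::'a) = of_int 3" by simp
  have "\<exists>v. dvf {x / y | x y. x \<in> D & y \<in> D & y ~= 0} v 3 (of_int ` {0..<3}) & (\<forall>u\<in>D. u ~: (*) 3 ` D --> v u = 0)"
  proof (rule dvf_of_prime_element)
   show "0 \<in> D" "1 \<in> D" "3 \<in> D" using mem[of 0] mem[of 1] mem[of 3] by simp_all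
   show "\<forall>x\<in>D. \<forall>y\<in>D. x + y \<in> D & x * y \<in> D & x - y \<in> D"
    unfolding D_def by (auto simp flip: of_int_add of_int_mult of_int_diff)
   show "(3::'a) ~= 0" using inj[of 3 0] by simp
   show "1 ~: (*) 3 ` D" using I[of 1] by simp
   show "\<forall>x\<in>D. x ~= 0 --> (\<exists>k::nat. \<exists>u\<in>D. u ~: (*) 3 ` D & x = 3 ^ k * u)"
   proof (intro ballI impI)
    fix x assume "x \<in> D" "x ~= 0"
    then obtain a where a: "x = of_int a" "a ~= 0" using DE by fastforce
    obtain b where b: "a = 3 ^ multiplicity 3 a * b" "\<not> 3 dvd b"
     using multiplicity_decompose'[of a 3] a(2) by auto
    have "x = 3 ^ multiplicity 3 a * of_int b" unfolding a(1) by (subst b(1)) simp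
    with b(2) mem[of b] I[of b] show "\<exists>k::nat. \<exists>u\<in>D. u ~: (*) 3 ` D & x = 3 ^ k * u" by blast
   qed
   show "\<forall>u\<in>D. u ~: (*) 3 ` D --> (\<exists>w\<in>D. u * w - 1 \<in> (*) 3 ` D)"
   proof (intro ballI impI)
    fix u assume u: "u \<in> D" "u ~: (*) 3 ` D"
    obtain a where a: "u = of_int a" using DE u(1) by blast
    then have na: "\<not> 3 dvd a" using u(2) I by blast
    then have "a mod 3 = 1 \<or> a mod 3 = 2" by presburger
    moreover have "(a * a) mod 3 = ((a mod 3) * (a mod 3)) mod 3" by (simp add: mod_mult_eq)
    ultimately have "(a * a) mod 3 = 1" by auto
    then have "3 dvd a * a - 1" by presburger
    then have "of_int (a * a - 1) \<in> (*) (3::'a) ` D" using I by blast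
    then show "\<exists>w\<in>D. u * w - 1 \<in> (*) 3 ` D" using mem[of a] unfolding a by (intro bexI[of _ "of_int a"]) simp_all
   qed
   show "finite (of_int ` {0..<3::int} :: 'a set)" by simp
   show "of_int ` {0..<3} \<subseteq> D" using mem by blast
   show "\<forall>x\<in>D. \<exists>!r\<in>of_int ` {0..<3}. x - r \<in> (*) 3 ` D"
   proof
    fix x assume "x \<in> D"
    then obtain a where a: "x = of_int a" using DE by blast
    show "\<exists>!r\<in>of_int ` {0..<3}. x - r \<in> (*) 3 ` D"
    proof (rule ex1I[of _ "of_int (a mod 3)"])
     have "of_int (a - a mod 3) \<in> (*) (3::'a) ` D" unfolding I by (simp add: mod_eq_dvd_iff[symmetric])
     then show "of_int (a mod 3) \<in> of_int ` {0..<3} & x - of_int (a mod 3) \<in> (*) 3 ` D" unfolding a by simp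
     fix r assume r: "r \<in> of_int ` {0..<3} & x - r \<in> (*) 3 ` D"
     obtain b where b: "r = of_int b" "0 \<le> b" "b < 3" using conjunct1[OF r] by auto
     note m = conjunct2[OF r]
     have "of_int (a - b) \<in> (*) (3::'a) ` D" using m unfolding a b(1) by simp
     then have "3 dvd a - b" using I by blast
     with b(2,3) have "b = a mod 3" by presburger
     then show "r = of_int (a mod 3)" using b(1) by simp
    qed
   qed
  qed
  then obtain v where v: "dvf {x / y | x y. x \<in> D & y \<in> D & y ~= 0} v 3 (of_int ` {0..<3})" "\<forall>u\<in>D. u ~: (*) 3 ` D --> v u = 0" by blast
  let ?P = "{x / y | x y. x \<in> D & y \<in> D & y ~= 0}"
  have "generate_field FF {} = ?P"
  proof
   show "generate_field FF {} \<subseteq> ?P" by (rule generate_field_min[OF dvf.K[OF v(1)]]) simp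
   have "D \<subseteq> generate_field FF {}" unfolding D_def using of_int_in_subf[OF generate_field_subf] by blast
   then show "?P \<subseteq> generate_field FF {}" using subf_closed(8)[OF generate_field_subf[of "{}"]] by blast
  qed
  moreover have "v 2 = 0" using v(2) mem[of 2] I[of 2] by simp
  moreover have "(2::'a) ~= 0" using inj[of 2 0] by simp
  ultimately show ?thesis using extend_valuation[OF v(1)] fe by simp
qed

lemma two_nonzero: "CHAR('a::field) ~= 2 ==> (2::'a) ~= 0"
proof
  assume c: "CHAR('a) ~= 2" and "(2::'a) = 0"
  then have "of_nat 2 = (0::'a)" by simp
  then have "CHAR('a) dvd 2" unfolding of_nat_eq_0_iff_char_dvd .
  moreover from this have "CHAR('a) \<le> 2" by (rule dvd_imp_le) simp
  moreover have "CHAR('a) ~= 1" by simp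
  ultimately show False using c by (cases "CHAR('a) = 0") auto
qed

text \<open>
  Multiplication by a nonzero element of the finite image of the integers is injective, hence
  surjective.
\<close>
lemma prime_field_finite:
  assumes ch: "CHAR('a::field) > 0"
  shows "generate_field FF {} = range (of_int :: int \<Rightarrow> 'a)" "finite (range (of_int :: int \<Rightarrow> 'a))"
proof -
  let ?F = "range (of_int :: int \<Rightarrow> 'a)" and ?p = "int CHAR('a)"
  have "of_int a = (of_int (a mod ?p) :: 'a)" for a
  proof -
   have "(of_int (?p * (a div ?p) + a mod ?p) :: 'a) = of_int (a mod ?p)" unfolding of_int_add of_int_mult by simp
   then show ?thesis by simp
  qed
  moreover have "a mod ?p \<in> {0..<?p}" for a using ch by simp
  ultimately have "?F \<subseteq> of_int ` {0..<?p}" by (metis image_subsetI image_eqI)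
  then show fin: "finite ?F" by (rule finite_subset) simp
  have "inverse x \<in> ?F" if x: "x \<in> ?F" for x
  proof (cases "x = 0")
   case True then show ?thesis by (intro range_eqI[of _ _ 0]) simp
  next
   case False
   obtain a where a: "x = of_int a" using x by blast
   have "(*) x ` ?F \<subseteq> ?F"
   proof (rule image_subsetI)
    fix y assume "y \<in> ?F"
    then obtain b where "y = of_int b" by blast
    then show "x * y \<in> ?F" unfolding a by (intro range_eqI[of _ _ "a * b"]) simp
   qed
   then have "(*) x ` ?F = ?F" using fin False by (intro endo_inj_surj) (auto intro: inj_onI)
   moreover have "1 \<in> ?F" by (intro range_eqI[of _ _ 1]) simp
   ultimately have "1 \<in> (*) x ` ?F" by simp
   then obtain y where "y \<in> ?F" "1 = x * y" by (rule imageE)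
   then show ?thesis using inverse_unique[of x y] by simp
  qed
  then have "subf ?F" unfolding subf_def
   by (auto simp flip: of_int_add of_int_mult of_int_minus intro: range_eqI[of _ _ 0] range_eqI[of _ _ 1])
  then have "generate_field FF {} \<subseteq> ?F" by (intro generate_field_min) auto
  moreover have "?F \<subseteq> generate_field FF {}" using of_int_in_subf[OF generate_field_subf] by blast
  ultimately show "generate_field FF {} = ?F" by blast
qed

text \<open>
  Here `D` is the polynomial ring in `t` over the prime field. The uniqueness of coefficients,
  which makes `t` prime, is the transcendence of `t`.
\<close>
lemma function_field_valuation:
  assumes K: "global_function_field (K :: 'a::field set)" and ch2: "CHAR('a) ~= 2"
  shows "\<exists>w \<rho> S. dvf K w \<rho> S & (2::'a) ~: dvf.mi K w"
proof -
  obtain t where ch: "CHAR('a) > 0" and tr: "ring.transcendental FF (generate_field FF {}) t" and fe: "finite_ext (generate_field FF {t}) K"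
   using K unfolding global_function_field_def by blast
  define F where "F = generate_field FF ({} :: 'a set)"
  have F: "subf F" unfolding F_def by (rule generate_field_subf)
  have finF: "finite F" unfolding F_def using prime_field_finite[OF ch] by simp
  have "\<not> alg_over F t" unfolding algebraic_FF_iff[OF F, symmetric] over_def using tr unfolding F_def by simp
  then have t0: "h = 0" if "h \<in> polys F" "poly h t = 0" for h using that unfolding alg_over_def by blast
  note c = polys_closed[OF F] and sc = subf_closed[OF F]
  define D where "D = {poly h t | h. h \<in> polys F}"
  have DI: "poly h t \<in> D" if "h \<in> polys F" for h unfolding D_def using that by blast
  have DE: "\<exists>a q. a \<in> F & q \<in> polys F & x = a + t * poly q t" if xD: "x \<in> D" for x
  proof -
   obtain h where h: "h \<in> polys F" "x = poly h t" using xD unfolding D_def by blast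
   obtain a q where "h = pCons a q" by (rule pCons_cases)
   with h show ?thesis unfolding polys_pCons_iff by (intro exI[of _ a] exI[of _ q]) (simp add: polys_pCons_iff)
  qed
  have FD: "a \<in> D" if "a \<in> F" for a using DI[of "[:a:]"] that c(1) by (simp add: polys_pCons_iff)
  have II: "t * poly q t \<in> (*) t ` D" if "q \<in> polys F" for q using DI[OF that] by blast
  have I0: "a = 0" if a: "a \<in> F" "q \<in> polys F" and m: "a + t * poly q t \<in> (*) t ` D" for a q
  proof -
   obtain h where h: "h \<in> polys F" "a + t * poly q t = t * poly h t" using m unfolding D_def by blast
   have "pCons a (q - h) \<in> polys F" unfolding polys_pCons_iff using a c(4) h(1) by blast
   moreover have "poly (pCons a (q - h)) t = 0" using h(2) by (simp add: algebra_simps)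
   ultimately have "pCons a (q - h) = 0" by (rule t0)
   then show ?thesis by simp
  qed
  have two: "(2::'a) ~= 0" by (rule two_nonzero[OF ch2])
  have tn: "t ~= 0" using t0[of "[:0, 1:]"] sc(1,2) c(1) by (auto simp: polys_pCons_iff)
  have "\<exists>v. dvf {x / y | x y. x \<in> D & y \<in> D & y ~= 0} v t F & (\<forall>u\<in>D. u ~: (*) t ` D --> v u = 0)"
  proof (rule dvf_of_prime_element)
   show "0 \<in> D" "1 \<in> D" using FD sc(1,2) by auto
   show "t \<in> D" using DI[of "[:0, 1:]"] sc(1,2) c(1) by (simp add: polys_pCons_iff)
   show "t ~= 0" by (rule tn)
   show "\<forall>x\<in>D. \<forall>y\<in>D. x + y \<in> D & x * y \<in> D & x - y \<in> D"
   proof (intro ballI)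
    fix x y assume "x \<in> D" "y \<in> D"
    then obtain h k where "h \<in> polys F" "x = poly h t" "k \<in> polys F" "y = poly k t" unfolding D_def by blast
    then show "x + y \<in> D & x * y \<in> D & x - y \<in> D" using DI[of "h + k"] DI[of "h * k"] DI[of "h - k"] c by simp
   qed
   show "1 ~: (*) t ` D" using I0[OF sc(2) c(1)] by auto
   show "\<forall>x\<in>D. x ~= 0 --> (\<exists>k::nat. \<exists>u\<in>D. u ~: (*) t ` D & x = t ^ k * u)"
   proof (intro ballI impI)
    fix x assume "x \<in> D" "x ~= 0"
    then obtain h where h: "h \<in> polys F" "x = poly h t" unfolding D_def by blast
    then have h0: "h ~= 0" using \<open>x ~= 0\<close> by auto
    have "\<exists>k::nat. \<exists>u\<in>D. u ~: (*) t ` D & poly h t = t ^ k * u" using h(1) h0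
    proof (induction h)
     case (pCons a q)
     show ?case
     proof (cases "a = 0")
      case True
      with pCons have "q \<in> polys F" "q ~= 0" unfolding polys_pCons_iff by auto
      with pCons.IH obtain k u where "u \<in> D" "u ~: (*) t ` D" "poly q t = t ^ k * u" by blast
      with True show ?thesis by (intro exI[of _ "Suc k"] bexI[of _ u]) auto
     next
      case False
      have aq: "a \<in> F" "q \<in> polys F" using pCons.prems unfolding polys_pCons_iff by auto
      then have "a + t * poly q t ~: (*) t ` D" using I0 False by blast
      moreover have "a + t * poly q t \<in> D" using DI[OF pCons.prems(1)] by simp
      ultimately show ?thesis by (intro exI[of _ 0] bexI[of _ "a + t * poly q t"]) auto
     qed
    qed simp
    then show "\<exists>k::nat. \<exists>u\<in>D. u ~: (*) t ` D & x = t ^ k * u" using h(2) by simp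
   qed
   show "\<forall>u\<in>D. u ~: (*) t ` D --> (\<exists>w\<in>D. u * w - 1 \<in> (*) t ` D)"
   proof (intro ballI impI)
    fix u assume u: "u \<in> D" "u ~: (*) t ` D"
    obtain a q where a: "a \<in> F" "q \<in> polys F" "u = a + t * poly q t" using DE[OF u(1)] by blast
    have a0: "a ~= 0" using u(2) II[OF a(2)] a(3) by auto
    have "u * inverse a - 1 = t * poly (smult (inverse a) q) t" unfolding a(3) using a0 by (simp add: algebra_simps)
    then have "u * inverse a - 1 \<in> (*) t ` D" using II[OF c(7)[OF sc(6)[OF a(1)] a(2)]] by simp
    then show "\<exists>w\<in>D. u * w - 1 \<in> (*) t ` D" using FD[OF sc(6)[OF a(1)]] by blast
   qed
   show "finite F" by (rule finF)
   show "F \<subseteq> D" using FD by blast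
   show "\<forall>x\<in>D. \<exists>!r\<in>F. x - r \<in> (*) t ` D"
   proof
    fix x assume "x \<in> D"
    then obtain a q where a: "a \<in> F" "q \<in> polys F" "x = a + t * poly q t" using DE by blast
    show "\<exists>!r\<in>F. x - r \<in> (*) t ` D"
    proof (rule ex1I[of _ a])
     show "a \<in> F & x - a \<in> (*) t ` D" using a II[OF a(2)] by simp
     fix r assume r: "r \<in> F & x - r \<in> (*) t ` D"
     have e: "x - r = (a - r) + t * poly q t" unfolding a(3) by simp
     have "(a - r) + t * poly q t \<in> (*) t ` D" using r unfolding e by blast
     then have "a - r = 0" using I0[OF sc(7)[of a r] a(2)] a(1) r by blast
     then show "r = a" by simp
    qed
   qed
  qed
  then obtain v where v: "dvf {x / y | x y. x \<in> D & y \<in> D & y ~= 0} v t F" "\<forall>u\<in>D. u ~: (*) t ` D --> v u = 0" by blast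
  let ?P = "{x / y | x y. x \<in> D & y \<in> D & y ~= 0}"
  have "generate_field FF {t} = ?P"
  proof
   have "t \<in> D" using DI[of "[:0, 1:]"] sc(1,2) c(1) by (simp add: polys_pCons_iff)
   then have "t / 1 \<in> ?P" using FD[OF sc(2)] by (intro CollectI exI[of _ t] exI[of _ 1] conjI refl) simp_all
   then show "generate_field FF {t} \<subseteq> ?P" by (intro generate_field_min[OF dvf.K[OF v(1)]]) simp
   have G: "subf (generate_field FF {t})" by (rule generate_field_subf)
   have "F \<subseteq> generate_field FF {t}" unfolding F_def by (rule generate_field_min[OF G]) simp
   then have "polys F \<subseteq> polys (generate_field FF {t})" by (rule polys_mono)
   moreover have "t \<in> generate_field FF {t}" by (rule generate_field.incl) simp
   ultimately have "D \<subseteq> generate_field FF {t}" unfolding D_def using poly_in_subf[OF G] by blast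
   then show "?P \<subseteq> generate_field FF {t}" using subf_closed(8)[OF G] by blast
  qed
  moreover have "v 2 = 0"
  proof -
   have "(2::'a) \<in> F" using sc(11)[of "num.Bit0 num.One"] by simp
   then have "(2::'a) \<in> D" "(2::'a) ~: (*) t ` D" using FD I0[OF _ c(1), of 2] two by auto
   with v(2) show ?thesis by blast
  qed
  ultimately show ?thesis using extend_valuation[OF v(1)] fe two by simp
qed

text \<open>
  If 2 lies in the maximal ideal, then the residue field has characteristic 2: a multiple of its
  unit is 0 precisely if the multiplier is even.
\<close>
lemma local_field_valuation:
  fixes K :: "'a::field set"
  assumes K: "nonarch_local_field K v" and ch: "ring_char (residue_field K v) ~= 2"
  shows "\<exists>\<pi> R. dvf K v \<pi> R & (2::'a) ~: dvf.mi K v"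
proof -
  have sK: "subf K" and dv: "discrete_valuation K v" and fin: "finite (carrier (residue_field K v))"
   using K unfolding nonarch_local_field_def subfield_FF_iff by auto
  note c = subf_closed[OF sK]
  have onto: "v ` (K - {0}) = UNIV" and vm: "!!x y. x \<in> K - {0} ==> y \<in> K - {0} ==> v (x * y) = v x + v y"
   and va: "!!x y. x \<in> K - {0} ==> y \<in> K - {0} ==> x + y ~= 0 ==> min (v x) (v y) \<le> v (x + y)"
   using dv unfolding discrete_valuation_def by auto
  define A I where "A = {x\<in>K. x = 0 \<or> 0 \<le> v x}" and "I = val_ideal K v"
  have v1: "v 1 = 0" using vm[of 1 1] c(2) by simp
  have vn1: "v (- 1) = 0" using vm[of "- 1" "- 1"] c(2,5) v1 by simp
  have vn: "v (- x) = v x" if "x \<in> K - {0}" for x using vm[of "- 1" x] that c(2,5) vn1 by simp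
  have I0: "0 \<in> I" unfolding I_def val_ideal_def using c(1) by simp
  have In: "- x \<in> I" if "x \<in> I" for x
   using that vn[of x] c(5)[of x] unfolding I_def val_ideal_def by (cases "x = 0") auto
  have Ia: "x + y \<in> I" if "x \<in> I" "y \<in> I" for x y
  proof (cases "x = 0 \<or> y = 0 \<or> x + y = 0")
   case True then show ?thesis using that I0 by auto
  next
   case False
   then have "min (v x) (v y) \<le> v (x + y)" using that va[of x y] unfolding I_def val_ideal_def by auto
   then show ?thesis using that False c(3)[of x y] unfolding I_def val_ideal_def by auto
  qed
  have Is: "x - y \<in> I" if "x \<in> I" "y \<in> I" for x y using Ia[OF that(1) In[OF that(2)]] by simp
  have coset: "a_r_coset (val_ring K v) I x = {i + x | i. i \<in> I}" for x
   unfolding a_r_coset_def' val_ring_def by auto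
  have coset_iff: "z \<in> {i + x | i. i \<in> I} \<longleftrightarrow> z - x \<in> I" for x z
  proof
   assume "z \<in> {i + x | i. i \<in> I}" then show "z - x \<in> I" by auto
  next
   assume "z - x \<in> I" then show "z \<in> {i + x | i. i \<in> I}" by (intro CollectI exI[of _ "z - x"]) simp
  qed
  have carr: "carrier (residue_field K v) = (\<lambda>x. {z. z - x \<in> I}) ` A"
  proof -
   have "carrier (residue_field K v) = (\<Union>x\<in>A. {a_r_coset (val_ring K v) I x})"
    unfolding residue_field_def FactRing_def A_RCOSETS_def' I_def[symmetric] by (simp add: val_ring_def A_def)
   moreover have "a_r_coset (val_ring K v) I x = {z. z - x \<in> I}" for x unfolding coset using coset_iff by blast
   ultimately show ?thesis by auto
  qed
  define R where "R = (\<lambda>C. SOME x. x \<in> C) ` carrier (residue_field K v)"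
  have Rrep: "\<exists>r\<in>R. r - x \<in> I" if x: "x \<in> A" for x
  proof -
   have "(SOME z. z \<in> {z. z - x \<in> I}) \<in> R" unfolding R_def carr using x by (intro imageI)
   moreover have "(SOME z. z \<in> {z. z - x \<in> I}) \<in> {z. z - x \<in> I}" by (rule someI[of _ x]) (simp add: I0)
   ultimately show ?thesis by blast
  qed
  have Rform: "\<exists>x\<in>A. r - x \<in> I & r = (SOME z. z \<in> {z. z - x \<in> I})" if r: "r \<in> R" for r
  proof -
   obtain x where x: "x \<in> A" "r = (SOME z. z \<in> {z. z - x \<in> I})" using r unfolding R_def carr by blast
   have "r \<in> {z. z - x \<in> I}" unfolding x(2) by (rule someI[of _ x]) (simp add: I0)
   with x show ?thesis by blast
  qed
  have Runiq: "r = r'" if r: "r \<in> R" "r' \<in> R" and m: "x - r \<in> I" "x - r' \<in> I" for r r' x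
  proof -
   obtain y where y: "r - y \<in> I" "r = (SOME z. z \<in> {z. z - y \<in> I})" using Rform[OF r(1)] by blast
   obtain y' where y': "r' - y' \<in> I" "r' = (SOME z. z \<in> {z. z - y' \<in> I})" using Rform[OF r(2)] by blast
   have d: "y - y' \<in> I" using Is[OF Ia[OF Is[OF m(2,1)] y'(1)] y(1)] by simp
   have "{z. z - y \<in> I} = {z. z - y' \<in> I}"
   proof (intro equalityI subsetI CollectI; elim CollectE)
    fix z
    show "z - y \<in> I ==> z - y' \<in> I" using Ia[OF _ d, of "z - y"] by simp
    show "z - y' \<in> I ==> z - y \<in> I" using Is[OF _ d, of "z - y'"] by simp
   qed
   then show ?thesis unfolding y(2) y'(2) by simp
  qed
  have IK: "x \<in> I \<longleftrightarrow> x \<in> K & (x = 0 \<or> 1 \<le> v x)" for x unfolding I_def val_ideal_def by auto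
  have AI: "x + y \<in> A" if xy: "x \<in> A" "y \<in> I" for x y
  proof (cases "x = 0 \<or> y = 0 \<or> x + y = 0")
   case True then show ?thesis using xy c(1) unfolding A_def I_def val_ideal_def by auto
  next
   case False
   then have "min (v x) (v y) \<le> v (x + y)" using xy va[of x y] unfolding A_def I_def val_ideal_def by auto
   then show ?thesis using xy False c(3)[of x y] unfolding A_def I_def val_ideal_def by auto
  qed
  obtain \<pi> where pi: "\<pi> \<in> K - {0}" "v \<pi> = 1" using onto by (metis UNIV_I imageE)
  have d: "dvf K v \<pi> R"
  proof
   show "subf K" by (rule sK)
   show "v (x * y) = v x + v y" if "x \<in> K" "x ~= 0" "y \<in> K" "y ~= 0" for x y using that vm by simp
   show "min (v x) (v y) \<le> v (x + y)" if "x \<in> K" "x ~= 0" "y \<in> K" "y ~= 0" "x + y ~= 0" for x y using that va by simp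
   show "\<pi> \<in> K" "\<pi> ~= 0" "v \<pi> = 1" using pi by auto
   show "finite R" unfolding R_def using fin by simp
   show "r \<in> K & (r = 0 \<or> 0 \<le> v r)" if r: "r \<in> R" for r
   proof -
    obtain x where "x \<in> A" "r - x \<in> I" using Rform[OF r] by blast
    from AI[OF this] show ?thesis unfolding A_def by simp
   qed
   then have RK: "r \<in> K" if "r \<in> R" for r using that by blast
   show "\<exists>!r\<in>R. x - r = 0 \<or> 1 \<le> v (x - r)" if x: "x \<in> K" "x = 0 \<or> 0 \<le> v x" for x
   proof -
    have iff: "(x - r = 0 \<or> 1 \<le> v (x - r)) \<longleftrightarrow> x - r \<in> I" if "r \<in> R" for r
     unfolding IK using c(7)[OF x(1) RK[OF that]] by blast
    obtain r where r: "r \<in> R" "r - x \<in> I" using Rrep[of x] x unfolding A_def by blast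
    have xr: "x - r \<in> I" using In[OF r(2)] by simp
    show ?thesis
    proof (rule ex1I[of _ r])
     show "r \<in> R & (x - r = 0 \<or> 1 \<le> v (x - r))" using iff[OF r(1)] xr r(1) by blast
     fix r' assume r': "r' \<in> R & (x - r' = 0 \<or> 1 \<le> v (x - r'))"
     then have "x - r' \<in> I" using iff by blast
     then show "r' = r" using Runiq[of r' r x] r' r(1) xr by blast
    qed
   qed
  qed
  have "(2::'a) ~: I"
  proof
   assume two: "(2::'a) \<in> I"
   have one: "(1::'a) ~: I" unfolding IK using v1 by simp
   let ?Q = "residue_field K v"
   have add: "x \<oplus>\<^bsub>?Q\<^esub> y = {h + k | h k. h \<in> x & k \<in> y}" for x y
    unfolding residue_field_def FactRing_def by (auto simp: set_add_def' val_ring_def)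
   have zero: "\<zero>\<^bsub>?Q\<^esub> = I" unfolding residue_field_def FactRing_def I_def by simp
   have unit: "\<one>\<^bsub>?Q\<^esub> = {z. z - 1 \<in> I}"
   proof -
    have "\<one>\<^bsub>?Q\<^esub> = a_r_coset (val_ring K v) I 1" unfolding residue_field_def FactRing_def I_def by (simp add: val_ring_def)
    then show ?thesis unfolding coset using coset_iff by blast
   qed
   have mult: "[n] \<cdot>\<^bsub>?Q\<^esub> \<one>\<^bsub>?Q\<^esub> = {z. z - of_nat n \<in> I}" for n :: nat
   proof (induction n)
    case 0
    then show ?case by (simp add: add_pow_def nat_pow_def zero)
   next
    case (Suc n)
    have "[Suc n] \<cdot>\<^bsub>?Q\<^esub> \<one>\<^bsub>?Q\<^esub> = ([n] \<cdot>\<^bsub>?Q\<^esub> \<one>\<^bsub>?Q\<^esub>) \<oplus>\<^bsub>?Q\<^esub> \<one>\<^bsub>?Q\<^esub>" by (simp add: add_pow_def nat_pow_def)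
    also have "... = {h + k | h k. h - of_nat n \<in> I & k - 1 \<in> I}" unfolding Suc unfolding add unit by simp
    also have "... = {z. z - of_nat (Suc n) \<in> I}"
    proof (intro equalityI subsetI)
     fix z assume "z \<in> {h + k | h k. h - of_nat n \<in> I & k - (1::'a) \<in> I}"
     then obtain h k where hk: "z = h + k" "h - of_nat n \<in> I" "k - 1 \<in> I" by auto
     have e: "z - of_nat (Suc n) = (h - of_nat n) + (k - 1)" unfolding hk(1) by simp
     show "z \<in> {z. z - of_nat (Suc n) \<in> I}" unfolding mem_Collect_eq e by (rule Ia[OF hk(2,3)])
    next
     fix z :: 'a assume "z \<in> {z. z - of_nat (Suc n) \<in> I}"
     then have "(z - 1) - of_nat n \<in> I" by (simp add: algebra_simps)
     then show "z \<in> {h + k | h k. h - of_nat n \<in> I & k - (1::'a) \<in> I}"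
      using I0 by (intro CollectI exI[of _ "z - 1"] exI[of _ 1]) simp
    qed
    finally show ?case .
   qed
   have even: "of_nat (2 * k) \<in> I" for k
   proof (induction k)
    case (Suc k)
    then show ?case using Ia[OF two Suc] by (simp add: algebra_simps)
   qed (simp add: I0)
   have main: "[n] \<cdot>\<^bsub>?Q\<^esub> \<one>\<^bsub>?Q\<^esub> = \<zero>\<^bsub>?Q\<^esub> \<longleftrightarrow> 2 dvd n" for n :: nat
   proof -
    have "[n] \<cdot>\<^bsub>?Q\<^esub> \<one>\<^bsub>?Q\<^esub> = \<zero>\<^bsub>?Q\<^esub> \<longleftrightarrow> of_nat n \<in> I"
    proof
     assume "[n] \<cdot>\<^bsub>?Q\<^esub> \<one>\<^bsub>?Q\<^esub> = \<zero>\<^bsub>?Q\<^esub>"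
     then have "{z. z - of_nat n \<in> I} = I" unfolding mult zero .
     moreover have "of_nat n \<in> {z. z - of_nat n \<in> I}" using I0 by simp
     ultimately show "of_nat n \<in> I" by simp
    next
     assume n: "of_nat n \<in> I"
     have "z - of_nat n \<in> I \<longleftrightarrow> z \<in> I" for z using Is[OF _ n, of z] Ia[OF _ n, of "z - of_nat n"] by auto
     then show "[n] \<cdot>\<^bsub>?Q\<^esub> \<one>\<^bsub>?Q\<^esub> = \<zero>\<^bsub>?Q\<^esub>" unfolding mult zero by simp
    qed
    also have "... \<longleftrightarrow> 2 dvd n"
    proof
     assume n: "of_nat n \<in> I"
     show "2 dvd n"
     proof (rule ccontr)
      assume "\<not> 2 dvd n"
      then obtain k where "n = 2 * k + 1" by (elim oddE)
      then show False using Is[OF n even[of k]] one by simp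
     qed
    qed (use even in \<open>auto elim!: dvdE\<close>)
    finally show ?thesis .
   qed
   have "ring_char ?Q = 2" unfolding ring_char_def main
   proof (rule the_equality)
    fix p :: nat assume h: "\<forall>n::nat. (2 dvd n) = (p dvd n)"
    have "p dvd 2" "2 dvd p" using h[rule_format, of 2] h[rule_format, of p] by simp_all
    then show "p = 2" by (rule dvd_antisym)
   qed simp
   with ch show False by simp
  qed
  moreover have "dvf.mi K v = I" unfolding dvf.mi_def[OF d] using IK by blast
  ultimately show ?thesis using d by blast
qed

lemma sqrt_exists: "\<exists>y. y\<^sup>2 = (x :: 'a::alg_closed_field)"
  using alg_closed_root[of "[:- x, 0, 1:]"] by (auto simp: power2_eq_square)

theorem theorem1p10:
  fixes K :: "'a::alg_closed_field set"
  assumes "algebraic_closure (FF :: 'a ring) K"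
    and "(\<exists>v. nonarch_local_field K v \<and> ring_char (residue_field K v) \<noteq> 2) \<or>
         (global_field K \<and> CHAR('a) \<noteq> 2)"
    and "\<exists>i\<in>K. i ^ 2 = -1"
  shows "\<exists>N T \<xi>. torus K 6 N T \<and> \<xi> \<in> carrier (H1 K N T) \<and>
           period K N T \<xi> = 2 \<and> 4 dvd cohom_index K N T \<xi>"
proof -
  have "subfield K FF" using assms(1) unfolding algebraic_closure_def by blast
  then have sK: "subf K" using subfield_FF_iff by blast
  have acl: "acl K"
    unfolding acl_def algebraic_FF_iff[OF sK, symmetric] using sK algebraic_closure.algebraic_extension[OF assms(1)] by simp
  obtain v \<pi> R where dK: "dvf K v \<pi> R" and two_mi: "(2::'a) \<notin> dvf.mi K v"
    using assms(2) local_field_valuation number_field_valuation function_field_valuation unfolding global_field_def by metis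
  interpret dvf K v \<pi> R by (rule dK)
  obtain a where a: "nonsq a" using nonsq_exists[OF two_mi] by blast
  obtain i where i: "i \<in> K" "i\<^sup>2 = - 1" using assms(3) by blast
  obtain \<alpha> where al: "\<alpha>\<^sup>2 = a" using sqrt_exists by blast
  obtain \<beta> where be: "\<beta>\<^sup>2 = \<pi>" using sqrt_exists by blast
  have aK: "a \<in> K" using a vr_K unfolding nonsq_def by blast
  have a0: "\<alpha> \<noteq> 0" using a al vr_closed(1) mi_closed(1) unfolding nonsq_def by force
  have b0: "\<beta> \<noteq> 0" using be unif(2) by auto
  have t0: "(2::'a) \<noteq> 0" using two_mi mi_closed(1) by auto
  define r s where "r B = (if B = 0 then \<alpha> else if B = 1 then \<beta> else \<alpha> * \<beta>)"
    and "s B = (if B = 0 then \<beta> else \<alpha>)" for B :: nat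
  interpret galois_biquad K r s
  proof
    show "subf K" by (rule sK)
    show "(2::'a) \<noteq> 0" by (rule t0)
    show "acl K" by (rule acl)
    show "r B \<noteq> 0 \<and> s B \<noteq> 0 \<and> (r B)\<^sup>2 \<in> K \<and> (s B)\<^sup>2 \<in> K" for B
      unfolding r_def s_def using a0 b0 al be aK unif(1) subf_closed(4)[OF sK] by (simp add: power_mult_distrib)
  qed
  have "\<exists>\<xi>. \<xi> \<in> carrier (H1 K 12 TT) \<and> period K 12 TT \<xi> = 2 \<and> 4 dvd cohom_index K 12 TT \<xi>"
  proof (rule class_with_period_2)
    fix L assume L: "finite_ext K L"
      and eq: "\<forall>B<3. \<exists>p0\<in>L. \<exists>p1\<in>L. \<exists>q0\<in>L. \<exists>q1\<in>L. r B = (p0 + p1 * r B)\<^sup>2 - (s B)\<^sup>2 * (q0 + q1 * r B)\<^sup>2"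
    obtain u where "dvf_ext K v \<pi> R L (ring.dim FF K L) u" using dvf_ext_of_finite_ext[OF dK L] by blast
    then interpret L: dvf_ext K v \<pi> R L "ring.dim FF K L" u .
    have rs: "r 0 = \<alpha>" "s 0 = \<beta>" "r 1 = \<beta>" "s 1 = \<alpha>" "r 2 = \<alpha> * \<beta>" "s 2 = \<alpha>" by (simp_all add: r_def s_def)
    show "4 dvd ring.dim FF K L"
      by (rule L.splitting_degree[OF two_mi i a al be eq[rule_format, of 0, unfolded rs]
            eq[rule_format, of 1, unfolded rs] eq[rule_format, of 2, unfolded rs]]) simp_all
  qed
  then show ?thesis using TT_torus by blast
qed

end
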